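(* Let $(V,g)$ be an oriented Euclidean vector space of finite even dimension $2n$ (the phase space of a linear fermionic system). 1. The bundle of quantum Hilbert spaces $\mathcal H\to\mathcal J_g$, with the connection obtained by orthogonal projection of the trivial connection on $\mathcal J_g\times\mathcal H_0$, is projectively flat: its curvature is $\frac{\sigma_g}{2\sqrt{-1}}\,\mathrm{id}_{\mathcal H}$. 2. The bundle of quantum Hilbert spaces with metaplectic correction $\hat{\mathcal H}=\mathcal H\otimes\sqrt{\mathcal K^{-1}}\to\mathcal J_g$, with the tensor product connection, is flat.
   Context: Complex structures: $\mathcal J_g$ is the manifold of all $J\in\mathrm{End}(V)$ with $J^2=-1$, $g(J\cdot,J\cdot)=g$, and inducing the given orientation. For $J\in\mathcal J_g$, $V_J^{1,0}$ and $V_J^{0,1}$ are the $\pm\sqrt{-1}$-eigenspaces of $J$ in $V^{\mathbb C}$, and $P_J=\frac12(1-\sqrt{-1}J)$ is the projection onto $V_J^{1,0}$ along $V_J^{0,1}$. With $\delta$ the exterior differential on $\mathcal J_g$, define the 2-form $\sigma_g=-\sqrt{-1}\,\mathrm{tr}(P_J\,\delta P_J\wedge\delta P_J\,P_J)$ on $\mathcal J_g$ (it is a Kähler form). Hilbert spaces: $\nu\colon V\to V^*$ is $\nu(x)=g(x,\cdot)$, extended complex-linearly. $\mathcal H_0=\bigwedge^\bullet(V^{\mathbb C})^*$ with Hermitian inner product $\langle\psi,\psi'\rangle_0=\langle(\bar\psi\wedge\star_0\psi')^{(2n)},\epsilon_g\rangle$, where $(\cdot)^{(2n)}$ is the top-degree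 part, $\epsilon_g\in\bigwedge^{2n}V$ is the oriented unit volume element, and $\star_0$ is the (complex-linear) Hodge star of the metric $\frac12 g$. For $x\in V^{\mathbb C}$, $\nabla_x=\iota_x-\frac12\nu(x)\wedge\,\cdot$ acting on $\mathcal H_0$. For $J\in\mathcal J_g$, $\mathcal H_J=\{\psi\in\mathcal H_0:\nabla_x\psi=0\ \forall x\in V_J^{0,1}\}$. $\mathcal H\to\mathcal J_g$ is the vector bundle with fibre $\mathcal H_J$ over $J$, a sub-bundle of $\mathcal J_g\times\mathcal H_0$. Metaplectic correction: $\mathcal V\to\mathcal J_g$ is the bundle with fibre $V_J^{1,0}$, with the connection obtained from the trivial connection on $\mathcal J_g\times V^{\mathbb C}$ by the projection $P_J$. $\mathcal K^{-1}=\bigwedge^n\mathcal V$ has the induced connection. $\sqrt{\mathcal K^{-1}}\to\mathcal J_g$ is the line bundle (existing and unique up to isomorphism, since $c_1(\mathcal K)$ is even and $\mathcal J_g$ is simply connected) with $(\sqrt{\mathcal K^{-1}})^{\otimes2}=\mathcal K^{-1}$, with the connection whose tensor square is that of $\mathcal K^{-1}$. *)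

theory Defs
  imports "HOL-Analysis.Analysis" "HOL-Combinatorics.Permutations"
begin

section \<open>Bundles and connections over embedded submanifolds\<close>

text \<open>
  The base of a bundle is an embedded submanifold \<open>M\<close> of a finite-dimensional real normed space.
\<close>

primrec Ck_on :: "nat \<Rightarrow> ('a::real_normed_vector \<Rightarrow> 'b::real_normed_vector) \<Rightarrow> 'a set \<Rightarrow> bool" where
  "Ck_on 0 f W \<longleftrightarrow> continuous_on W f"
| "Ck_on (Suc k) f W \<longleftrightarrow>
     f differentiable_on W \<and> (\<forall>v. Ck_on k (\<lambda>x. frechet_derivative f (at x) v) W)"

text \<open>\<open>U\<close> is a relatively open subset of the submanifold: a map is smooth on \<open>U\<close> if it locally
  extends to a smooth map on an open subset of the ambient space.\<close>

definition smooth_in :: "'a set \<Rightarrow> ('a::real_normed_vector \<Rightarrow> 'b::real_normed_vector) \<Rightarrow> bool" where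
  "smooth_in U f \<longleftrightarrow> (\<forall>x\<in>U. \<exists>W F. open W \<and> x \<in> W \<and> (\<forall>k. Ck_on k F W) \<and> (\<forall>y\<in>W \<inter> U. F y = f y))"

definition tangent :: "'a set \<Rightarrow> 'a \<Rightarrow> 'a::real_normed_vector set" where
  "tangent M x = {A. \<exists>\<gamma>::real \<Rightarrow> 'a. (\<forall>t. \<gamma> t \<in> M) \<and> \<gamma> 0 = x \<and> (\<gamma> has_vector_derivative A) (at 0)}"

text \<open>The Frechet derivative within \<open>M\<close> is not unique, but its values on tangent vectors are, and
  it is only ever applied to those.\<close>

definition deriv_along ::
    "'a set \<Rightarrow> ('a \<Rightarrow> 'b::real_normed_vector) \<Rightarrow> 'a \<Rightarrow> 'a::real_normed_vector \<Rightarrow> 'b" where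
  "deriv_along M f x A = frechet_derivative f (at x within M) A"

definition vector_field :: "'a set \<Rightarrow> 'a set \<Rightarrow> ('a \<Rightarrow> 'a::real_normed_vector) \<Rightarrow> bool" where
  "vector_field M U X \<longleftrightarrow> (\<forall>x\<in>U. X x \<in> tangent M x) \<and> smooth_in U X"

definition lie_bracket ::
    "'a set \<Rightarrow> ('a \<Rightarrow> 'a) \<Rightarrow> ('a \<Rightarrow> 'a) \<Rightarrow> 'a \<Rightarrow> 'a::real_normed_vector" where
  "lie_bracket M X Y x = deriv_along M Y x (X x) - deriv_along M X x (Y x)"

text \<open>
  A bundle is a family \<open>E x\<close> of complex subspaces of a space of functions \<open>'i \<Rightarrow> complex\<close>, with
  pointwise operations, and its sections are differentiated pointwise. When the fibres lie in a fixed
  finite-dimensional space of functions this is the usual differentiation, since the point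
  evaluations span the dual of that space. An abstract vector bundle \<open>E\<close> is of this form with \<open>'i\<close>
  the set of global sections of its dual, \<open>e\<close> being sent to evaluation at \<open>e\<close>.
\<close>

definition local_section ::
    "'a::real_normed_vector set \<Rightarrow> ('a \<Rightarrow> ('i \<Rightarrow> complex) set) \<Rightarrow> ('a \<Rightarrow> 'i \<Rightarrow> complex) \<Rightarrow> bool" where
  "local_section U E s \<longleftrightarrow> (\<forall>x\<in>U. s x \<in> E x) \<and> (\<forall>i. smooth_in U (\<lambda>x. s x i))"

definition trivial_connection ::
    "'a set \<Rightarrow> 'a \<Rightarrow> 'a \<Rightarrow> ('a::real_normed_vector \<Rightarrow> 'i \<Rightarrow> complex) \<Rightarrow> 'i \<Rightarrow> complex" where
  "trivial_connection M x A s = (\<lambda>i. deriv_along M (\<lambda>y. s y i) x A)"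

text \<open>A connection is given by \<open>D x A s\<close>, the covariant derivative at \<open>x\<close> in the direction
  \<open>A \<in> tangent M x\<close> of a section \<open>s\<close> defined near \<open>x\<close>. The second conjunct says that only the germ
  of \<open>s\<close> at \<open>x\<close> matters.\<close>

definition connection ::
    "'a::real_normed_vector set \<Rightarrow> ('a \<Rightarrow> ('i \<Rightarrow> complex) set)
      \<Rightarrow> ('a \<Rightarrow> 'a \<Rightarrow> ('a \<Rightarrow> 'i \<Rightarrow> complex) \<Rightarrow> 'i \<Rightarrow> complex) \<Rightarrow> bool" where
  "connection M E D \<longleftrightarrow> (\<forall>U s. openin (top_of_set M) U \<and> local_section U E s \<longrightarrow>
     (\<forall>x\<in>U. \<forall>A\<in>tangent M x. D x A s \<in> E x) \<and>
     (\<forall>t. local_section U E t \<and> (\<forall>y\<in>U. s y = t y) \<longrightarrow>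
        (\<forall>x\<in>U. \<forall>A\<in>tangent M x. D x A s = D x A t)) \<and>
     (\<forall>X. vector_field M U X \<longrightarrow> local_section U E (\<lambda>x. D x (X x) s)) \<and>
     (\<forall>x\<in>U. \<forall>A\<in>tangent M x. \<forall>B\<in>tangent M x. \<forall>a b.
        D x (a *\<^sub>R A + b *\<^sub>R B) s = (\<lambda>i. of_real a * D x A s i + of_real b * D x B s i)) \<and>
     (\<forall>t. local_section U E t \<longrightarrow> (\<forall>x\<in>U. \<forall>A\<in>tangent M x.
        D x A (\<lambda>y i. s y i + t y i) = (\<lambda>i. D x A s i + D x A t i))) \<and>
     (\<forall>f::'a \<Rightarrow> complex. smooth_in U f \<longrightarrow> (\<forall>x\<in>U. \<forall>A\<in>tangent M x.
        D x A (\<lambda>y i. f y * s y i) = (\<lambda>i. deriv_along M f x A * s x i + f x * D x A s i))))"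

definition curvature ::
    "'a set \<Rightarrow> ('a \<Rightarrow> 'a \<Rightarrow> ('a \<Rightarrow> 'i \<Rightarrow> complex) \<Rightarrow> 'i \<Rightarrow> complex)
      \<Rightarrow> ('a \<Rightarrow> 'a) \<Rightarrow> ('a \<Rightarrow> 'a) \<Rightarrow> ('a \<Rightarrow> 'i \<Rightarrow> complex) \<Rightarrow> 'a::real_normed_vector \<Rightarrow> 'i \<Rightarrow> complex" where
  "curvature M D X Y s x = (\<lambda>i.
     D x (X x) (\<lambda>y. D y (Y y) s) i - D x (Y x) (\<lambda>y. D y (X y) s) i - D x (lie_bracket M X Y x) s i)"

text \<open>The curvature is \<open>\<omega> id\<close>. Where the fibres are nonzero, \<open>\<omega>\<close> is determined on tangent
  vectors by the curvature, hence it is a smooth 2-form there.\<close>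

definition scalar_curvature ::
    "'a::real_normed_vector set \<Rightarrow> ('a \<Rightarrow> ('i \<Rightarrow> complex) set)
      \<Rightarrow> ('a \<Rightarrow> 'a \<Rightarrow> ('a \<Rightarrow> 'i \<Rightarrow> complex) \<Rightarrow> 'i \<Rightarrow> complex) \<Rightarrow> ('a \<Rightarrow> 'a \<Rightarrow> 'a \<Rightarrow> complex) \<Rightarrow> bool" where
  "scalar_curvature M E D \<omega> \<longleftrightarrow> (\<forall>U X Y s.
     openin (top_of_set M) U \<and> vector_field M U X \<and> vector_field M U Y \<and> local_section U E s \<longrightarrow>
     (\<forall>x\<in>U. curvature M D X Y s x = (\<lambda>i. \<omega> x (X x) (Y x) * s x i)))"

definition projectively_flat ::
    "'a::real_normed_vector set \<Rightarrow> ('a \<Rightarrow> ('i \<Rightarrow> complex) set)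
      \<Rightarrow> ('a \<Rightarrow> 'a \<Rightarrow> ('a \<Rightarrow> 'i \<Rightarrow> complex) \<Rightarrow> 'i \<Rightarrow> complex) \<Rightarrow> bool" where
  "projectively_flat M E D \<longleftrightarrow> (\<exists>\<omega>. scalar_curvature M E D \<omega>)"

definition flat ::
    "'a::real_normed_vector set \<Rightarrow> ('a \<Rightarrow> ('i \<Rightarrow> complex) set)
      \<Rightarrow> ('a \<Rightarrow> 'a \<Rightarrow> ('a \<Rightarrow> 'i \<Rightarrow> complex) \<Rightarrow> 'i \<Rightarrow> complex) \<Rightarrow> bool" where
  "flat M E D \<longleftrightarrow> (\<forall>U X Y s.
     openin (top_of_set M) U \<and> vector_field M U X \<and> vector_field M U Y \<and> local_section U E s \<longrightarrow>
     (\<forall>x\<in>U. curvature M D X Y s x = (\<lambda>i. 0)))"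

definition line_bundle :: "'a::real_normed_vector set \<Rightarrow> ('a \<Rightarrow> ('i \<Rightarrow> complex) set) \<Rightarrow> bool" where
  "line_bundle M L \<longleftrightarrow> (\<forall>x\<in>M. \<exists>U l. openin (top_of_set M) U \<and> x \<in> U \<and> local_section U L l \<and>
     (\<forall>y\<in>U. l y \<noteq> (\<lambda>i. 0) \<and> L y = {\<lambda>i. c * l y i | c. True}))"

definition cspan :: "('i \<Rightarrow> complex) set \<Rightarrow> ('i \<Rightarrow> complex) set" where
  "cspan S = {\<lambda>i. \<Sum>k<N. c k * f k i | (N::nat) c f. \<forall>k<N. f k \<in> S}"

definition tensor :: "('i \<Rightarrow> complex) \<Rightarrow> ('j \<Rightarrow> complex) \<Rightarrow> 'i \<times> 'j \<Rightarrow> complex" (infixr "\<otimes>\<^sub>f" 70) where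
  "u \<otimes>\<^sub>f v = (\<lambda>(i, j). u i * v j)"

definition tensor_bundle ::
    "('a \<Rightarrow> ('i \<Rightarrow> complex) set) \<Rightarrow> ('a \<Rightarrow> ('j \<Rightarrow> complex) set) \<Rightarrow> 'a \<Rightarrow> ('i \<times> 'j \<Rightarrow> complex) set" where
  "tensor_bundle E F x = cspan {u \<otimes>\<^sub>f v | u v. u \<in> E x \<and> v \<in> F x}"

text \<open>A section of \<open>E \<otimes> F\<close> is near \<open>x\<close> a finite sum of products of sections, and the Leibniz
  rule then determines its covariant derivative.\<close>

definition tensor_connection ::
    "'a::real_normed_vector set
      \<Rightarrow> ('a \<Rightarrow> ('i \<Rightarrow> complex) set) \<Rightarrow> ('a \<Rightarrow> 'a \<Rightarrow> ('a \<Rightarrow> 'i \<Rightarrow> complex) \<Rightarrow> 'i \<Rightarrow> complex)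
      \<Rightarrow> ('a \<Rightarrow> ('j \<Rightarrow> complex) set) \<Rightarrow> ('a \<Rightarrow> 'a \<Rightarrow> ('a \<Rightarrow> 'j \<Rightarrow> complex) \<Rightarrow> 'j \<Rightarrow> complex)
      \<Rightarrow> 'a \<Rightarrow> 'a \<Rightarrow> ('a \<Rightarrow> 'i \<times> 'j \<Rightarrow> complex) \<Rightarrow> 'i \<times> 'j \<Rightarrow> complex" where
  "tensor_connection M E D\<^sub>E F D\<^sub>F x A r = (THE w. \<exists>U (N::nat) s t.
     openin (top_of_set M) U \<and> x \<in> U \<and>
     (\<forall>k<N. local_section U E (s k) \<and> local_section U F (t k)) \<and>
     (\<forall>y\<in>U. r y = (\<lambda>p. \<Sum>k<N. (s k y \<otimes>\<^sub>f t k y) p)) \<and>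
     w = (\<lambda>p. \<Sum>k<N. (D\<^sub>E x A (s k) \<otimes>\<^sub>f t k x) p + (s k x \<otimes>\<^sub>f D\<^sub>F x A (t k)) p))"

text \<open>\<open>\<Phi>\<close> is a smooth isomorphism of vector bundles that carries one connection to the other.\<close>

definition connection_iso ::
    "'a::real_normed_vector set
      \<Rightarrow> ('a \<Rightarrow> ('i \<Rightarrow> complex) set) \<Rightarrow> ('a \<Rightarrow> 'a \<Rightarrow> ('a \<Rightarrow> 'i \<Rightarrow> complex) \<Rightarrow> 'i \<Rightarrow> complex)
      \<Rightarrow> ('a \<Rightarrow> ('j \<Rightarrow> complex) set) \<Rightarrow> ('a \<Rightarrow> 'a \<Rightarrow> ('a \<Rightarrow> 'j \<Rightarrow> complex) \<Rightarrow> 'j \<Rightarrow> complex)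
      \<Rightarrow> ('a \<Rightarrow> ('i \<Rightarrow> complex) \<Rightarrow> 'j \<Rightarrow> complex) \<Rightarrow> bool" where
  "connection_iso M E D\<^sub>E F D\<^sub>F \<Phi> \<longleftrightarrow>
     (\<forall>x\<in>M. bij_betw (\<Phi> x) (E x) (F x) \<and>
        (\<forall>u\<in>E x. \<forall>v\<in>E x. \<forall>c. \<Phi> x (\<lambda>i. c * u i + v i) = (\<lambda>j. c * \<Phi> x u j + \<Phi> x v j))) \<and>
     (\<forall>U s. openin (top_of_set M) U \<and> local_section U E s \<longrightarrow>
        local_section U F (\<lambda>x. \<Phi> x (s x)) \<and>
        (\<forall>x\<in>U. \<forall>A\<in>tangent M x. D\<^sub>F x A (\<lambda>y. \<Phi> y (s y)) = \<Phi> x (D\<^sub>E x A s))) \<and>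
     (\<forall>U t. openin (top_of_set M) U \<and> local_section U F t \<longrightarrow>
        local_section U E (\<lambda>x. inv_into (E x) (\<Phi> x) (t x)))"

definition square_root_bundle ::
    "'a::real_normed_vector set
      \<Rightarrow> ('a \<Rightarrow> ('j \<Rightarrow> complex) set) \<Rightarrow> ('a \<Rightarrow> 'a \<Rightarrow> ('a \<Rightarrow> 'j \<Rightarrow> complex) \<Rightarrow> 'j \<Rightarrow> complex)
      \<Rightarrow> ('a \<Rightarrow> ('i \<Rightarrow> complex) set) \<Rightarrow> ('a \<Rightarrow> 'a \<Rightarrow> ('a \<Rightarrow> 'i \<Rightarrow> complex) \<Rightarrow> 'i \<Rightarrow> complex) \<Rightarrow> bool" where
  "square_root_bundle M K D\<^sub>K L D\<^sub>L \<longleftrightarrow> line_bundle M L \<and> connection M L D\<^sub>L \<and>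
     (\<exists>\<Phi>. connection_iso M (tensor_bundle L L) (tensor_connection M L D\<^sub>L L D\<^sub>L) K D\<^sub>K \<Phi>)"

section \<open>Complexification and exterior forms\<close>

text \<open>The pair \<open>(x, y)\<close> stands for \<open>x + \<i> y\<close>.\<close>

type_synonym 'v cvec = "'v \<times> 'v"

definition cscale :: "complex \<Rightarrow> 'v::real_vector cvec \<Rightarrow> 'v cvec" where
  "cscale c z = (Re c *\<^sub>R fst z - Im c *\<^sub>R snd z, Re c *\<^sub>R snd z + Im c *\<^sub>R fst z)"

definition of_vec :: "'v::real_vector \<Rightarrow> 'v cvec" where
  "of_vec x = (x, 0)"

definition cvec_cnj :: "'v::real_vector cvec \<Rightarrow> 'v cvec" where
  "cvec_cnj z = (fst z, - snd z)"

definition cmetric :: "'v::real_inner cvec \<Rightarrow> 'v cvec \<Rightarrow> complex" where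
  "cmetric z w = Complex (fst z \<bullet> fst w - snd z \<bullet> snd w) (fst z \<bullet> snd w + snd z \<bullet> fst w)"

definition capply :: "('v::real_normed_vector \<Rightarrow>\<^sub>L 'v) \<Rightarrow> 'v cvec \<Rightarrow> 'v cvec" where
  "capply T z = (blinfun_apply T (fst z), blinfun_apply T (snd z))"

definition ctrace :: "('v::euclidean_space cvec \<Rightarrow> 'v cvec) \<Rightarrow> complex" where
  "ctrace T = (\<Sum>b\<in>Basis. cmetric (of_vec b) (T (of_vec b)))"

text \<open>An inhomogeneous form is a function on lists of all lengths; its part of degree \<open>k\<close> is the
  restriction to the lists of length \<open>k\<close>.\<close>

type_synonym 'v form = "'v cvec list \<Rightarrow> complex"

definition ext_forms :: "'v::real_vector form set" where
  "ext_forms = {\<psi>.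
     (\<forall>xs i c x y. i < length xs \<longrightarrow> \<psi> (xs[i := cscale c x + y]) = c * \<psi> (xs[i := x]) + \<psi> (xs[i := y])) \<and>
     (\<forall>xs. \<not> distinct xs \<longrightarrow> \<psi> xs = 0)}"

text \<open>The sum is over shuffles, so that \<open>\<alpha>\<^sub>1 \<and> \<dots> \<and> \<alpha>\<^sub>k\<close> takes the value \<open>det (\<alpha>\<^sub>i x\<^sub>j)\<close>
  at \<open>x\<^sub>1, \<dots>, x\<^sub>k\<close>.\<close>

definition wedge :: "'v form \<Rightarrow> 'v form \<Rightarrow> 'v form" where
  "wedge \<alpha> \<beta> xs = (\<Sum>S\<in>Pow {..<length xs}.
     (-1) ^ card {(i, j). i < j \<and> j < length xs \<and> i \<notin> S \<and> j \<in> S} *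
     \<alpha> (nths xs S) * \<beta> (nths xs (- S)))"

definition interior :: "'v cvec \<Rightarrow> 'v form \<Rightarrow> 'v form" where
  "interior x \<psi> = (\<lambda>xs. \<psi> (x # xs))"

definition metric_form :: "'v::real_inner cvec \<Rightarrow> 'v form" where
  "metric_form x = (\<lambda>xs. case xs of [y] \<Rightarrow> cmetric x y | _ \<Rightarrow> 0)"

definition form_cnj :: "'v::real_vector form \<Rightarrow> 'v form" where
  "form_cnj \<psi> = (\<lambda>xs. cnj (\<psi> (map cvec_cnj xs)))"

text \<open>An orientation of the Euclidean space is given by its unit volume form (extended
  complex-multilinearly); an ordered basis is positive if the volume form is positive on it.\<close>

definition orthonormal_basis :: "'v::euclidean_space list \<Rightarrow> bool" where
  "orthonormal_basis es \<longleftrightarrow> length es = DIM('v) \<and>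
     (\<forall>i<length es. \<forall>j<length es. es ! i \<bullet> es ! j = (if i = j then 1 else 0))"

definition volume_form :: "'v::euclidean_space form \<Rightarrow> bool" where
  "volume_form vol \<longleftrightarrow> vol \<in> ext_forms \<and> (\<forall>xs. length xs \<noteq> DIM('v) \<longrightarrow> vol xs = 0) \<and>
     (\<forall>es. orthonormal_basis es \<longrightarrow> vol (map of_vec es) \<in> {1, -1})"

text \<open>
  Hodge star of the metric \<open>c g\<close>, for \<open>c > 0\<close>, in components: \<open>f\<close> runs over a basis that is
  orthonormal for \<open>c g\<close>, and \<open>\<star>\<phi>\<close> is the contraction of \<open>\<phi>\<close> with the first arguments of the volume
  form of \<open>c g\<close>. With this convention \<open>\<psi> \<and> \<star>\<phi>\<close> is the volume form of \<open>c g\<close> times the inner product of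
  \<open>\<psi>\<close> and \<open>\<phi>\<close> for \<open>c g\<close>.
\<close>

definition hodge :: "real \<Rightarrow> 'v::euclidean_space form \<Rightarrow> 'v form \<Rightarrow> 'v form" where
  "hodge c vol \<phi> = (\<lambda>ys.
     let k = DIM('v) - length ys;
         f = (\<lambda>b. of_vec (b /\<^sub>R sqrt c));
         vol\<^sub>c = (\<lambda>xs. of_real (sqrt c ^ DIM('v)) * vol xs)
     in (\<Sum>bs | set bs \<subseteq> Basis \<and> length bs = k. \<phi> (map f bs) * vol\<^sub>c (map f bs @ ys)) / fact k)"

text \<open>The pairing with the oriented unit volume element \<open>e\<^sub>1 \<and> \<dots> \<and> e\<^sub>2\<^sub>n\<close>
  is evaluation at \<open>e\<^sub>1, \<dots>, e\<^sub>2\<^sub>n\<close>.\<close>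

definition form_inner :: "'v::euclidean_space form \<Rightarrow> 'v form \<Rightarrow> 'v form \<Rightarrow> complex" where
  "form_inner vol \<psi> \<psi>' = wedge (form_cnj \<psi>) (hodge (1/2) vol \<psi>')
     (map of_vec (SOME es. orthonormal_basis es \<and> vol (map of_vec es) = 1))"

section \<open>Complex structures and quantum Hilbert spaces\<close>

text \<open>The orientation induced by \<open>J\<close> is that of the bases \<open>v\<^sub>1, J v\<^sub>1, \<dots>, v\<^sub>n, J v\<^sub>n\<close>.\<close>

definition complex_structures :: "'v::euclidean_space form \<Rightarrow> ('v \<Rightarrow>\<^sub>L 'v) set" where
  "complex_structures vol = {J.
     (\<forall>x. blinfun_apply J (blinfun_apply J x) = - x) \<and>
     (\<forall>x y. blinfun_apply J x \<bullet> blinfun_apply J y = x \<bullet> y) \<and>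
     (\<forall>vs. 2 * length vs = DIM('v) \<longrightarrow>
        (let bs = concat (map (\<lambda>v. [v, blinfun_apply J v]) vs)
         in distinct bs \<and> independent (set bs) \<longrightarrow> Re (vol (map of_vec bs)) > 0))}"

definition V10 :: "('v::euclidean_space \<Rightarrow>\<^sub>L 'v) \<Rightarrow> 'v cvec set" where
  "V10 J = {z. capply J z = cscale \<i> z}"

definition V01 :: "('v::euclidean_space \<Rightarrow>\<^sub>L 'v) \<Rightarrow> 'v cvec set" where
  "V01 J = {z. capply J z = cscale (- \<i>) z}"

definition proj10 :: "('v::euclidean_space \<Rightarrow>\<^sub>L 'v) \<Rightarrow> 'v cvec \<Rightarrow> 'v cvec" where
  "proj10 J z = cscale (1/2) (z - cscale \<i> (capply J z))"

definition dproj10 ::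
    "'v::euclidean_space form \<Rightarrow> ('v \<Rightarrow>\<^sub>L 'v) \<Rightarrow> ('v \<Rightarrow>\<^sub>L 'v) \<Rightarrow> 'v cvec \<Rightarrow> 'v cvec" where
  "dproj10 vol J A z = deriv_along (complex_structures vol) (\<lambda>J'. proj10 J' z) J A"

text \<open>\<open>(\<alpha> \<and> \<beta>)(A, B) = \<alpha>(A) \<beta>(B) - \<alpha>(B) \<beta>(A)\<close> for operator-valued 1-forms.\<close>

definition sigma_form ::
    "'v::euclidean_space form \<Rightarrow> ('v \<Rightarrow>\<^sub>L 'v) \<Rightarrow> ('v \<Rightarrow>\<^sub>L 'v) \<Rightarrow> ('v \<Rightarrow>\<^sub>L 'v) \<Rightarrow> complex" where
  "sigma_form vol J A B = - \<i> * ctrace (\<lambda>z.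
     proj10 J (dproj10 vol J A (dproj10 vol J B (proj10 J z))) -
     proj10 J (dproj10 vol J B (dproj10 vol J A (proj10 J z))))"

definition nabla :: "'v::euclidean_space cvec \<Rightarrow> 'v form \<Rightarrow> 'v form" where
  "nabla x \<psi> = (\<lambda>xs. interior x \<psi> xs - 1/2 * wedge (metric_form x) \<psi> xs)"

definition quantum_bundle :: "('v::euclidean_space \<Rightarrow>\<^sub>L 'v) \<Rightarrow> 'v form set" where
  "quantum_bundle J = {\<psi> \<in> ext_forms. \<forall>x\<in>V01 J. nabla x \<psi> = (\<lambda>xs. 0)}"

definition orthogonal_proj :: "'v::euclidean_space form \<Rightarrow> 'v form set \<Rightarrow> 'v form \<Rightarrow> 'v form" where
  "orthogonal_proj vol S \<psi> =
     (THE \<phi>. \<phi> \<in> S \<and> (\<forall>\<eta>\<in>S. form_inner vol \<eta> (\<lambda>xs. \<psi> xs - \<phi> xs) = 0))"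

definition quantum_connection ::
    "'v::euclidean_space form \<Rightarrow> ('v \<Rightarrow>\<^sub>L 'v) \<Rightarrow> ('v \<Rightarrow>\<^sub>L 'v) \<Rightarrow> (('v \<Rightarrow>\<^sub>L 'v) \<Rightarrow> 'v form) \<Rightarrow> 'v form" where
  "quantum_connection vol J A s =
     orthogonal_proj vol (quantum_bundle J) (trivial_connection (complex_structures vol) J A s)"

section \<open>Metaplectic correction\<close>

definition V10_section ::
    "('v::euclidean_space \<Rightarrow>\<^sub>L 'v) set \<Rightarrow> (('v \<Rightarrow>\<^sub>L 'v) \<Rightarrow> 'v cvec) \<Rightarrow> bool" where
  "V10_section U v \<longleftrightarrow> (\<forall>J\<in>U. v J \<in> V10 J) \<and> smooth_in U v"

definition V10_connection ::
    "'v::euclidean_space form \<Rightarrow> ('v \<Rightarrow>\<^sub>L 'v) \<Rightarrow> ('v \<Rightarrow>\<^sub>L 'v) \<Rightarrow> (('v \<Rightarrow>\<^sub>L 'v) \<Rightarrow> 'v cvec) \<Rightarrow> 'v cvec" where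
  "V10_connection vol J A v = proj10 J (deriv_along (complex_structures vol) v J A)"

text \<open>Exterior powers of the complexified space are realised as alternating functions of
  complex-linear functionals \<open>\<alpha>\<^sub>i\<close>: the value of \<open>v\<^sub>1 \<and> \<dots> \<and> v\<^sub>k\<close> is \<open>det (\<alpha>\<^sub>i v\<^sub>j)\<close>.\<close>

definition clinear_functional :: "('v::real_vector cvec \<Rightarrow> complex) \<Rightarrow> bool" where
  "clinear_functional \<alpha> \<longleftrightarrow> (\<forall>c x y. \<alpha> (cscale c x + y) = c * \<alpha> x + \<alpha> y)"

definition vec_wedge :: "'v::real_vector cvec list \<Rightarrow> ('v cvec \<Rightarrow> complex) list \<Rightarrow> complex" where
  "vec_wedge vs = (\<lambda>\<alpha>s.
     if length \<alpha>s = length vs \<and> (\<forall>\<alpha>\<in>set \<alpha>s. clinear_functional \<alpha>)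
     then \<Sum>p | p permutes {..<length vs}. of_int (sign p) * (\<Prod>i<length vs. (\<alpha>s ! i) (vs ! p i))
     else 0)"

definition anticanonical_bundle ::
    "nat \<Rightarrow> ('v::euclidean_space \<Rightarrow>\<^sub>L 'v) \<Rightarrow> (('v cvec \<Rightarrow> complex) list \<Rightarrow> complex) set" where
  "anticanonical_bundle n J = cspan {vec_wedge vs | vs. length vs = n \<and> set vs \<subseteq> V10 J}"

text \<open>The covariant derivative of a local sum of products of sections of the bundle of the \<open>V10 J\<close>
  is given by the Leibniz rule.\<close>

definition anticanonical_connection ::
    "'v::euclidean_space form \<Rightarrow> nat \<Rightarrow> ('v \<Rightarrow>\<^sub>L 'v) \<Rightarrow> ('v \<Rightarrow>\<^sub>L 'v)
      \<Rightarrow> (('v \<Rightarrow>\<^sub>L 'v) \<Rightarrow> ('v cvec \<Rightarrow> complex) list \<Rightarrow> complex) \<Rightarrow> ('v cvec \<Rightarrow> complex) list \<Rightarrow> complex" where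
  "anticanonical_connection vol n J A \<kappa> = (THE w. \<exists>U (N::nat) vs.
     openin (top_of_set (complex_structures vol)) U \<and> J \<in> U \<and>
     (\<forall>k<N. length (vs k) = n \<and> (\<forall>v\<in>set (vs k). V10_section U v)) \<and>
     (\<forall>J'\<in>U. \<kappa> J' = (\<lambda>\<alpha>s. \<Sum>k<N. vec_wedge (map (\<lambda>v. v J') (vs k)) \<alpha>s)) \<and>
     w = (\<lambda>\<alpha>s. \<Sum>k<N. \<Sum>i<n.
       vec_wedge ((map (\<lambda>v. v J) (vs k))[i := V10_connection vol J A (vs k ! i)]) \<alpha>s))"

end

theory Submission
  imports Defs
begin

text \<open>
  Tangent vectors \<open>A\<close> at \<open>J\<close> are the skew maps anticommuting with \<open>J\<close>, and \<open>\<delta>P(A) = - \<i>/2 A\<close>.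
  The operators \<open>\<nabla>\<^sub>x\<close> satisfy the Clifford relation \<open>\<nabla>\<^sub>x \<nabla>\<^sub>y + \<nabla>\<^sub>y \<nabla>\<^sub>x = - g(x, y)\<close> and have adjoint
  \<open>- \<nabla>\<^sub>z\<close>, where \<open>z\<close> is the conjugate of \<open>x\<close>. Hence the range of \<open>\<nabla>\<^sub>v\<close>, for \<open>v\<close> of type \<open>(1,0)\<close>, is
  orthogonal to the fibre over \<open>J\<close>, and differentiating \<open>\<nabla>\<^sub>z s = 0\<close> shows that the connection is
  \<open>D\<^sub>A s = d\<^sub>A s + \<i>/4 T\<^sub>A s\<close> with \<open>T\<^sub>A = \<Sum>\<^sub>b \<nabla>(P A b) \<nabla>(b)\<close> over an orthonormal basis. Modulo the
  orthogonal complement of the fibre, \<open>d\<^sub>X (T\<^sub>Y s)\<close> is \<open>\<i>/2 tr(Q X Y) s\<close>, where \<open>Q = 1 - P\<close>; so the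
  curvature is \<open>1/8 tr(P [X, Y])\<close>.

  Through the metric, elements of \<open>\<And>\<^sup>n V\<^sup>1\<^sup>0\<close> become \<open>n\<close>-forms \<open>\<psi>\<close> annihilated by contraction with
  vectors of type \<open>(1,0)\<close>, with connection \<open>d\<^sub>A \<psi> - \<i>/2 A\<cdot>\<psi>\<close>, where \<open>A\<cdot>\<close> is the derivation extending
  \<open>A\<close>. If \<open>D \<psi> = \<tau> \<psi>\<close>, differentiating once more gives \<open>d\<tau>(X, Y) \<psi> = 1/4 [X, Y]\<cdot>\<psi> = 1/4 tr(Q [X, Y]) \<psi>\<close>.
  The square root has half of this curvature, which cancels that of the quantum bundle.
\<close>

section \<open>Smooth functions and symmetry of second derivatives\<close>

text \<open>The connections are given by definite descriptions (\<open>orthogonal_proj\<close>,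
  \<open>tensor_connection\<close>, \<open>anticanonical_connection\<close>), so each has to be
  replaced by an explicit formula before it can be differentiated, and well-definedness amounts to
  uniqueness of the described value. For the quantum bundle the value is verified by membership and
  orthogonality, and the curvature is computed modulo the orthogonal complement, which absorbs most
  of the terms: a form lying both in the fibre and in the complement vanishes.

  The metric \<open>g/2\<close> in the inner product gives degree \<open>k\<close> the weight
  \<open>2 ^ k / k!\<close>, and this makes contraction adjoint to half of exterior multiplication,
  as the coefficient in \<open>nabla\<close> demands.

  Derivatives along the space of complex structures are computed from extensions to open sets and
  have a meaning on tangent vectors only. Hence Lie brackets must be shown to be tangent, and for
  this every skew operator anticommuting with \<open>J\<close> must be realised as the velocity of a
  curve.

  The square root bundle is known only through an isomorphism; its curvature is read off from a
  local frame.\<close>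

lemma Ck_on_subset: "Ck_on k f W \<Longrightarrow> V \<subseteq> W \<Longrightarrow> Ck_on k f V"
  by (induction k arbitrary: f) (auto intro: continuous_on_subset differentiable_on_subset)

lemma Ck_on_Suc_imp: "Ck_on (Suc k) f W \<Longrightarrow> Ck_on k f W"
  by (induction k arbitrary: f) (auto intro: differentiable_imp_continuous_on)

lemma Ck_on_SucD:
  assumes "open W" "Ck_on (Suc k) f W" "x \<in> W"
  shows "(f has_derivative frechet_derivative f (at x)) (at x)"
  using assms by (metis Ck_on.simps(2) differentiable_on_def at_within_open frechet_derivative_works)

text \<open>On an open set the derivative at a point depends only on values in the set, so the
  induction passes to directional derivatives.\<close>

lemma Ck_on_cong:
  assumes "open W"
  shows "(\<And>x. x \<in> W \<Longrightarrow> f x = g x) \<Longrightarrow> Ck_on k f W \<Longrightarrow> Ck_on k g W"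
proof (induction k arbitrary: f g)
  case 0
  then show ?case by (metis Ck_on.simps(1) continuous_on_cong)
next
  case (Suc k)
  have d: "(g has_derivative frechet_derivative f (at x)) (at x)" if "x \<in> W" for x
    using Ck_on_SucD[OF assms Suc.prems(2) that] Suc.prems(1) assms that
    by (metis has_derivative_transform_within_open)
  have "g differentiable_on W"
    using d by (auto simp: differentiable_on_def differentiable_def intro: has_derivative_at_withinI)
  moreover have "Ck_on k (\<lambda>x. frechet_derivative g (at x) v) W" for v
  proof (rule Suc.IH)
    show "frechet_derivative f (at x) v = frechet_derivative g (at x) v" if "x \<in> W" for x
      using frechet_derivative_at[OF d[OF that]] by simp
    show "Ck_on k (\<lambda>x. frechet_derivative f (at x) v) W" using Suc.prems(2) by simp
  qed
  ultimately show ?case by simp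
qed

text \<open>\<open>frechet_derivative\<close> is a choice; uniqueness of derivatives at interior
  points allows any explicit family \<open>f'\<close> in its place. The closure properties below
  rest on this rule.\<close>

lemma Ck_on_SucI:
  assumes "open W" "\<And>x. x \<in> W \<Longrightarrow> (f has_derivative f' x) (at x)" "\<And>v. Ck_on k (\<lambda>x. f' x v) W"
  shows "Ck_on (Suc k) f W"
proof -
  have "f differentiable_on W"
    using assms(2) by (auto simp: differentiable_on_def differentiable_def intro: has_derivative_at_withinI)
  moreover have "Ck_on k (\<lambda>x. frechet_derivative f (at x) v) W" for v
  proof (rule Ck_on_cong[OF assms(1) _ assms(3)[of v]])
    show "f' x v = frechet_derivative f (at x) v" if "x \<in> W" for x
      using frechet_derivative_at[OF assms(2)[OF that]] by simp
  qed
  ultimately show ?thesis by simp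
qed

lemma Ck_on_const: "Ck_on k (\<lambda>x. c) W"
  by (induction k arbitrary: c) (auto simp: differentiable_on_def)

lemma Ck_on_linear:
  assumes "open W" "bounded_linear h"
  shows "Ck_on k f W \<Longrightarrow> Ck_on k (\<lambda>x. h (f x)) W"
proof (induction k arbitrary: f)
  case 0
  then show ?case using assms(2) by (auto intro: bounded_linear.continuous_on)
next
  case (Suc k)
  show ?case
  proof (rule Ck_on_SucI[OF assms(1), where f' = "\<lambda>x v. h (frechet_derivative f (at x) v)"])
    fix x assume "x \<in> W"
    then show "((\<lambda>x. h (f x)) has_derivative (\<lambda>v. h (frechet_derivative f (at x) v))) (at x)"
      using Ck_on_SucD[OF assms(1) Suc.prems] bounded_linear.has_derivative[OF assms(2)] by blast
  qed (use Suc assms in auto)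
qed

lemma Ck_on_add:
  assumes "open W"
  shows "Ck_on k f W \<Longrightarrow> Ck_on k g W \<Longrightarrow> Ck_on k (\<lambda>x. f x + g x) W"
proof (induction k arbitrary: f g)
  case 0
  then show ?case by (auto intro: continuous_intros)
next
  case (Suc k)
  show ?case
  proof (rule Ck_on_SucI[OF assms(1),
        where f' = "\<lambda>x v. frechet_derivative f (at x) v + frechet_derivative g (at x) v"])
    fix x assume "x \<in> W"
    then show "((\<lambda>x. f x + g x) has_derivative
        (\<lambda>v. frechet_derivative f (at x) v + frechet_derivative g (at x) v)) (at x)"
      using Ck_on_SucD[OF assms(1)] Suc.prems has_derivative_add by blast
  qed (use Suc assms in auto)
qed

lemma Ck_on_bilinear:
  assumes "open W" "bounded_bilinear B"
  shows "Ck_on k f W \<Longrightarrow> Ck_on k g W \<Longrightarrow> Ck_on k (\<lambda>x. B (f x) (g x)) W"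
proof (induction k arbitrary: f g)
  case 0
  then show ?case using assms(2) by (simp add: bounded_bilinear.continuous_on)
next
  case (Suc k)
  show ?case
  proof (rule Ck_on_SucI[OF assms(1),
        where f' = "\<lambda>x v. B (f x) (frechet_derivative g (at x) v) + B (frechet_derivative f (at x) v) (g x)"])
    fix x assume "x \<in> W"
    then show "((\<lambda>x. B (f x) (g x)) has_derivative
        (\<lambda>v. B (f x) (frechet_derivative g (at x) v) + B (frechet_derivative f (at x) v) (g x))) (at x)"
      using bounded_bilinear.FDERIV[OF assms(2) Ck_on_SucD[OF assms(1) Suc.prems(1)] Ck_on_SucD[OF assms(1) Suc.prems(2)]]
      by simp
  next
    fix v
    show "Ck_on k (\<lambda>x. B (f x) (frechet_derivative g (at x) v) + B (frechet_derivative f (at x) v) (g x)) W"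
      using Suc.prems Ck_on_Suc_imp[OF Suc.prems(1)] Ck_on_Suc_imp[OF Suc.prems(2)]
      by (intro Ck_on_add[OF assms(1)] Suc.IH) simp_all
  qed
qed

text \<open>The derivative of the inverse contains the inverse again, but with one order of
  differentiability less to prove, so induction on the order closes.\<close>

lemma Ck_on_inverse:
  fixes f :: "'a::real_normed_vector \<Rightarrow> 'b::real_normed_field"
  assumes "open W" "\<And>x. x \<in> W \<Longrightarrow> f x \<noteq> 0"
  shows "Ck_on k f W \<Longrightarrow> Ck_on k (\<lambda>x. inverse (f x)) W"
proof (induction k)
  case 0
  then show ?case using assms(2) by (auto intro: continuous_on_inverse)
next
  case (Suc k)
  let ?f' = "\<lambda>x v. - (inverse (f x) * frechet_derivative f (at x) v * inverse (f x))"
  show ?case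
  proof (rule Ck_on_SucI[OF assms(1), where f' = ?f'])
    fix x assume "x \<in> W"
    then show "((\<lambda>x. inverse (f x)) has_derivative ?f' x) (at x)"
      using Deriv.has_derivative_inverse[OF assms(2) Ck_on_SucD[OF assms(1) Suc.prems]] by simp
  next
    fix v
    have i: "Ck_on k (\<lambda>x. inverse (f x)) W" by (rule Suc.IH[OF Ck_on_Suc_imp[OF Suc.prems]])
    have d: "Ck_on k (\<lambda>x. frechet_derivative f (at x) v) W" using Suc.prems by simp
    have m: "Ck_on k (\<lambda>x. inverse (f x) * frechet_derivative f (at x) v * inverse (f x)) W"
      by (intro Ck_on_bilinear[OF assms(1) bounded_bilinear_mult] i d)
    show "Ck_on k (\<lambda>x. ?f' x v) W"
      by (rule Ck_on_linear[OF assms(1) bounded_linear_minus[OF bounded_linear_ident] m])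
  qed
qed

lemma Ck_on_ident: "open W \<Longrightarrow> Ck_on k (\<lambda>x. x) W"
proof (cases k)
  case (Suc m)
  assume "open W"
  then show ?thesis unfolding Suc by (rule Ck_on_SucI[OF _ has_derivative_ident Ck_on_const])
qed simp

text \<open>Schwarz' theorem: applying the mean value theorem twice in either order to the mixed second
  difference gives two values of the mixed second derivatives near \<open>x\<close>.\<close>

lemma mixed_difference:
  fixes f :: "'a::real_normed_vector \<Rightarrow> real"
  assumes W: "open W" and f: "Ck_on 2 f W" and t: "0 < t"
    and seg: "\<And>a b. 0 \<le> a \<Longrightarrow> a \<le> t \<Longrightarrow> 0 \<le> b \<Longrightarrow> b \<le> t \<Longrightarrow> x + a *\<^sub>R v + b *\<^sub>R w \<in> W"
  shows "\<exists>a b. 0 < a \<and> a < t \<and> 0 < b \<and> b < t \<and>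
    f (x + t *\<^sub>R v + t *\<^sub>R w) - f (x + t *\<^sub>R v) - f (x + t *\<^sub>R w) + f x =
    t\<^sup>2 * frechet_derivative (\<lambda>y. frechet_derivative f (at y) v) (at (x + a *\<^sub>R v + b *\<^sub>R w)) w"
proof -
  let ?d = "\<lambda>y. frechet_derivative f (at y)"
  have S2: "Ck_on (Suc (Suc 0)) f W" using f by (simp add: numeral_2_eq_2)
  have d1: "(f has_derivative ?d y) (at y)" if "y \<in> W" for y
    using Ck_on_SucD[OF W S2 that] .
  have d2: "((\<lambda>y. ?d y v) has_derivative frechet_derivative (\<lambda>y. ?d y v) (at y)) (at y)" if "y \<in> W" for y
    using Ck_on_SucD[OF W _ that, of 0 "\<lambda>y. ?d y v"] S2 by simp
  \<comment> \<open>The mixed second difference is \<open>g t - g 0\<close>. The mean value theorem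
    in \<open>s\<close> turns it into a difference of derivatives in direction \<open>v\<close>, to
    which the theorem is applied a second time along \<open>w\<close>.\<close>
  define g where "g s = f (x + s *\<^sub>R v + t *\<^sub>R w) - f (x + s *\<^sub>R v)" for s
  have "\<exists>a::real. 0 < a \<and> a < t \<and> g t - g 0 = (t - 0) * (?d (x + a *\<^sub>R v + t *\<^sub>R w) v - ?d (x + a *\<^sub>R v) v)"
  proof (rule MVT2[OF t])
    fix s :: real assume s: "0 \<le> s" "s \<le> t"
    have W1: "x + s *\<^sub>R v + t *\<^sub>R w \<in> W" "x + s *\<^sub>R v \<in> W"
      using seg[of s t] seg[of s 0] s t by auto
    have a1: "((\<lambda>s. x + s *\<^sub>R v + t *\<^sub>R w) has_derivative (\<lambda>h. h *\<^sub>R v)) (at s)"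
      by (auto intro!: derivative_eq_intros)
    have a2: "((\<lambda>s. x + s *\<^sub>R v) has_derivative (\<lambda>h. h *\<^sub>R v)) (at s)"
      by (auto intro!: derivative_eq_intros)
    have "(g has_derivative (\<lambda>h. ?d (x + s *\<^sub>R v + t *\<^sub>R w) (h *\<^sub>R v) - ?d (x + s *\<^sub>R v) (h *\<^sub>R v))) (at s)"
      unfolding g_def
      using has_derivative_compose[OF a1 d1[OF W1(1)]] has_derivative_compose[OF a2 d1[OF W1(2)]]
      by (rule has_derivative_diff)
    moreover have "(\<lambda>h. ?d (x + s *\<^sub>R v + t *\<^sub>R w) (h *\<^sub>R v) - ?d (x + s *\<^sub>R v) (h *\<^sub>R v))
        = (*) (?d (x + s *\<^sub>R v + t *\<^sub>R w) v - ?d (x + s *\<^sub>R v) v)"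
      using d1[OF W1(1)] d1[OF W1(2)]
      by (auto simp: linear_cmul has_derivative_linear algebra_simps fun_eq_iff)
    ultimately show "(g has_real_derivative ?d (x + s *\<^sub>R v + t *\<^sub>R w) v - ?d (x + s *\<^sub>R v) v) (at s)"
      by (simp add: has_field_derivative_def)
  qed
  then obtain a where a: "0 < a" "a < t"
    "g t - g 0 = t * (?d (x + a *\<^sub>R v + t *\<^sub>R w) v - ?d (x + a *\<^sub>R v) v)" by auto
  have "\<exists>b::real. 0 < b \<and> b < t \<and> ?d (x + a *\<^sub>R v + t *\<^sub>R w) v - ?d (x + a *\<^sub>R v + 0 *\<^sub>R w) v
     = (t - 0) * frechet_derivative (\<lambda>y. ?d y v) (at (x + a *\<^sub>R v + b *\<^sub>R w)) w"
  proof (rule MVT2[OF t])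
    fix s :: real assume s: "0 \<le> s" "s \<le> t"
    have W1: "x + a *\<^sub>R v + s *\<^sub>R w \<in> W"
      using seg[of a s] s a by auto
    have a1: "((\<lambda>s. x + a *\<^sub>R v + s *\<^sub>R w) has_derivative (\<lambda>h. h *\<^sub>R w)) (at s)"
      by (auto intro!: derivative_eq_intros)
    have "((\<lambda>s. ?d (x + a *\<^sub>R v + s *\<^sub>R w) v) has_derivative
        (\<lambda>h. frechet_derivative (\<lambda>y. ?d y v) (at (x + a *\<^sub>R v + s *\<^sub>R w)) (h *\<^sub>R w))) (at s)"
      using has_derivative_compose[OF a1 d2[OF W1]] .
    moreover have "(\<lambda>h. frechet_derivative (\<lambda>y. ?d y v) (at (x + a *\<^sub>R v + s *\<^sub>R w)) (h *\<^sub>R w))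
       = (*) (frechet_derivative (\<lambda>y. ?d y v) (at (x + a *\<^sub>R v + s *\<^sub>R w)) w)"
      using d2[OF W1] by (auto simp: linear_cmul has_derivative_linear algebra_simps fun_eq_iff)
    ultimately show "((\<lambda>s. ?d (x + a *\<^sub>R v + s *\<^sub>R w) v) has_real_derivative
        frechet_derivative (\<lambda>y. ?d y v) (at (x + a *\<^sub>R v + s *\<^sub>R w)) w) (at s)"
      by (simp add: has_field_derivative_def)
  qed
  then obtain b where b: "0 < b" "b < t" "?d (x + a *\<^sub>R v + t *\<^sub>R w) v - ?d (x + a *\<^sub>R v) v
     = t * frechet_derivative (\<lambda>y. ?d y v) (at (x + a *\<^sub>R v + b *\<^sub>R w)) w" by auto
  show ?thesis
    using a b by (intro exI[of _ a] exI[of _ b]) (auto simp: g_def power2_eq_square algebra_simps)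
qed

lemma second_derivative_symmetric_real:
  fixes f :: "'a::real_normed_vector \<Rightarrow> real"
  assumes W: "open W" and f: "Ck_on 2 f W" and x: "x \<in> W"
  shows "frechet_derivative (\<lambda>y. frechet_derivative f (at y) v) (at x) w =
    frechet_derivative (\<lambda>y. frechet_derivative f (at y) w) (at x) v"
proof -
  let ?h = "\<lambda>v w y. frechet_derivative (\<lambda>y. frechet_derivative f (at y) v) (at y) w"
  have cont: "isCont (?h v w) x" for v w
    using f x W by (auto simp: numeral_2_eq_2 continuous_on_eq_continuous_at)
  have "\<bar>?h v w x - ?h w v x\<bar> \<le> e" if "e > 0" for e
  proof -
    obtain d1 where d1: "d1 > 0" "\<And>y. dist y x < d1 \<Longrightarrow> dist (?h v w y) (?h v w x) < e/2"
      using cont[of v w] \<open>e > 0\<close> unfolding continuous_at_eps_delta by (metis half_gt_zero)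
    obtain d2 where d2: "d2 > 0" "\<And>y. dist y x < d2 \<Longrightarrow> dist (?h w v y) (?h w v x) < e/2"
      using cont[of w v] \<open>e > 0\<close> unfolding continuous_at_eps_delta by (metis half_gt_zero)
    obtain d3 where d3: "d3 > 0" "ball x d3 \<subseteq> W"
      using W x open_contains_ball by blast
    define d where "d = min d1 (min d2 d3)"
    \<comment> \<open>Small enough for the parallelogram with corner \<open>x\<close> and sides
      \<open>t *\<^sub>R v\<close>, \<open>t *\<^sub>R w\<close> to stay within distance
      \<open>d\<close> of \<open>x\<close>; the summand 1 covers the case that both vectors
      vanish.\<close>
    define t where "t = d / (2 * (norm v + norm w + 1))"
    have d: "d > 0" using d1 d2 d3 by (auto simp: d_def)
    then have t: "t > 0" by (auto simp: t_def intro!: divide_pos_pos add_nonneg_pos)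
    have near: "dist (x + a *\<^sub>R v + b *\<^sub>R w) x < d" if "0 \<le> a" "a \<le> t" "0 \<le> b" "b \<le> t" for a b
    proof -
      have "dist (x + a *\<^sub>R v + b *\<^sub>R w) x = norm (a *\<^sub>R v + b *\<^sub>R w)" by (simp add: dist_norm)
      also have "\<dots> \<le> a * norm v + b * norm w"
        using norm_triangle_ineq[of "a *\<^sub>R v" "b *\<^sub>R w"] that by simp
      also have "\<dots> \<le> t * norm v + t * norm w"
        using that by (intro add_mono mult_right_mono) auto
      also have "\<dots> < 2 * (norm v + norm w + 1) * t"
      proof -
        have "0 < t * (norm v + norm w + 2)" using t by (intro mult_pos_pos add_nonneg_pos) auto
        then show ?thesis by (simp add: algebra_simps)
      qed
      also have "\<dots> = d"
      proof -
        have "0 < norm v + norm w + 1" by (simp add: add_nonneg_pos)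
        then show ?thesis by (simp add: t_def field_simps)
      qed
      finally show ?thesis .
    qed
    have inW: "x + a *\<^sub>R v + b *\<^sub>R w \<in> W" if "0 \<le> a" "a \<le> t" "0 \<le> b" "b \<le> t" for a b
      using near[OF that] d3 by (auto simp: d_def dist_commute subset_iff)
    have inW': "x + a *\<^sub>R w + b *\<^sub>R v \<in> W" if "0 \<le> a" "a \<le> t" "0 \<le> b" "b \<le> t" for a b
      using inW[OF that(3,4,1,2)] by (simp add: algebra_simps)
    obtain a b where ab: "0 < a" "a < t" "0 < b" "b < t"
      "f (x + t *\<^sub>R v + t *\<^sub>R w) - f (x + t *\<^sub>R v) - f (x + t *\<^sub>R w) + f x = t\<^sup>2 * ?h v w (x + a *\<^sub>R v + b *\<^sub>R w)"
      using mixed_difference[OF W f t inW] by auto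
    obtain a' b' where ab': "0 < a'" "a' < t" "0 < b'" "b' < t"
      "f (x + t *\<^sub>R w + t *\<^sub>R v) - f (x + t *\<^sub>R w) - f (x + t *\<^sub>R v) + f x = t\<^sup>2 * ?h w v (x + a' *\<^sub>R w + b' *\<^sub>R v)"
      using mixed_difference[OF W f t inW'] by auto
    \<comment> \<open>The second difference is symmetric in \<open>v\<close> and \<open>w\<close>,
      so the two mixed derivatives agree, though at different points near \<open>x\<close>;
      continuity transfers this to \<open>x\<close> up to \<open>e\<close>.\<close>
    have "t\<^sup>2 * ?h v w (x + a *\<^sub>R v + b *\<^sub>R w) = t\<^sup>2 * ?h w v (x + a' *\<^sub>R w + b' *\<^sub>R v)"
      using ab(5) ab'(5) by (simp add: algebra_simps)
    then have eq: "?h v w (x + a *\<^sub>R v + b *\<^sub>R w) = ?h w v (x + a' *\<^sub>R w + b' *\<^sub>R v)" using t by simp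
    have "dist (x + a *\<^sub>R v + b *\<^sub>R w) x < d1" "dist (x + a' *\<^sub>R w + b' *\<^sub>R v) x < d2"
      using near[of a b] near[of b' a'] ab ab' by (auto simp: d_def algebra_simps)
    then show ?thesis
      using d1(2)[of "x + a *\<^sub>R v + b *\<^sub>R w"] d2(2)[of "x + a' *\<^sub>R w + b' *\<^sub>R v"] eq
      unfolding dist_real_def by linarith
  qed
  then have "\<bar>?h v w x - ?h w v x\<bar> \<le> 0" by (rule field_le_epsilon) simp
  then show ?thesis by simp
qed

lemma second_derivative_symmetric:
  fixes f :: "'a::real_normed_vector \<Rightarrow> 'b::euclidean_space"
  assumes W: "open W" and f: "Ck_on 2 f W" and x: "x \<in> W"
  shows "frechet_derivative (\<lambda>y. frechet_derivative f (at y) v) (at x) w =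
    frechet_derivative (\<lambda>y. frechet_derivative f (at y) w) (at x) v"
proof (rule euclidean_eqI)
  fix b :: 'b assume "b \<in> Basis"
  let ?d = "\<lambda>y. frechet_derivative f (at y)"
  have S2: "Ck_on (Suc (Suc 0)) f W" using f by (simp add: numeral_2_eq_2)
  have d1: "(f has_derivative ?d y) (at y)" if "y \<in> W" for y
    using Ck_on_SucD[OF W S2 that] .
  have d2: "((\<lambda>y. ?d y v) has_derivative frechet_derivative (\<lambda>y. ?d y v) (at y)) (at y)" if "y \<in> W" for y v
    using Ck_on_SucD[OF W _ that, of 0 "\<lambda>y. ?d y v"] S2 by simp
  have g: "Ck_on 2 (\<lambda>y. f y \<bullet> b) W"
    using Ck_on_linear[OF W bounded_linear_inner_left f] .
  have e1: "frechet_derivative (\<lambda>y. f y \<bullet> b) (at y) = (\<lambda>v. ?d y v \<bullet> b)" if "y \<in> W" for y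
    using frechet_derivative_at[OF has_derivative_inner_left[OF d1[OF that]]] by metis
  have e2: "frechet_derivative (\<lambda>y. frechet_derivative (\<lambda>y. f y \<bullet> b) (at y) v) (at x) w
      = frechet_derivative (\<lambda>y. ?d y v) (at x) w \<bullet> b" for v w
  proof -
    have "((\<lambda>y. ?d y v \<bullet> b) has_derivative (\<lambda>w. frechet_derivative (\<lambda>y. ?d y v) (at x) w \<bullet> b)) (at x)"
      by (rule has_derivative_inner_left[OF d2[OF x]])
    then have "((\<lambda>y. frechet_derivative (\<lambda>y. f y \<bullet> b) (at y) v) has_derivative
        (\<lambda>w. frechet_derivative (\<lambda>y. ?d y v) (at x) w \<bullet> b)) (at x)"
      by (rule has_derivative_transform_within_open[OF _ W x]) (simp add: e1)
    then show ?thesis using frechet_derivative_at by metis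
  qed
  show "frechet_derivative (\<lambda>y. ?d y v) (at x) w \<bullet> b = frechet_derivative (\<lambda>y. ?d y w) (at x) v \<bullet> b"
    using second_derivative_symmetric_real[OF W g x, of v w] by (simp add: e2)
qed

section \<open>Differentiation along a submanifold\<close>

lemma Ck_on_sum:
  assumes "open W" "\<And>i. i \<in> I \<Longrightarrow> Ck_on k (f i) W"
  shows "Ck_on k (\<lambda>x. \<Sum>i\<in>I. f i x) W"
  using assms(2)
  by (induction I rule: infinite_finite_induct) (auto intro!: Ck_on_add[OF assms(1)] Ck_on_const)

section \<open>Local smooth extensions\<close>

definition Cinf_on :: "('a::real_normed_vector \<Rightarrow> 'b::real_normed_vector) \<Rightarrow> 'a set \<Rightarrow> bool" where
  "Cinf_on f W \<longleftrightarrow> (\<forall>k. Ck_on k f W)"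

lemma Cinf_on_subset: "Cinf_on f W \<Longrightarrow> V \<subseteq> W \<Longrightarrow> Cinf_on f V"
  by (auto simp: Cinf_on_def intro: Ck_on_subset)

lemma Cinf_on_derivative:
  assumes "open W" "Cinf_on f W" "x \<in> W"
  shows "(f has_derivative frechet_derivative f (at x)) (at x)"
  using assms Ck_on_SucD unfolding Cinf_on_def by blast

lemma Cinf_on_directional: "Cinf_on f W \<Longrightarrow> Cinf_on (\<lambda>x. frechet_derivative f (at x) v) W"
  unfolding Cinf_on_def by (metis Ck_on.simps(2))

lemma smooth_in_iff:
  "smooth_in U f \<longleftrightarrow> (\<forall>x\<in>U. \<exists>W F. open W \<and> x \<in> W \<and> Cinf_on F W \<and> (\<forall>y\<in>W \<inter> U. F y = f y))"
  by (simp add: smooth_in_def Cinf_on_def)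

text \<open>The extensions of \<open>f\<close> and \<open>g\<close> live on different neighbourhoods
  and are combined on the intersection. The bilinear, additive and linear cases below are
  instances.\<close>

lemma smooth_in_map2:
  fixes f :: "'a::real_normed_vector \<Rightarrow> 'b::real_normed_vector"
    and g :: "'a \<Rightarrow> 'c::real_normed_vector" and h :: "'b \<Rightarrow> 'c \<Rightarrow> 'd::real_normed_vector"
  assumes h: "\<And>(W::'a set) F G. open W \<Longrightarrow> Cinf_on F W \<Longrightarrow> Cinf_on G W \<Longrightarrow> Cinf_on (\<lambda>x. h (F x) (G x)) W"
    and f: "smooth_in U f" and g: "smooth_in U g"
  shows "smooth_in U (\<lambda>x. h (f x) (g x))"
  unfolding smooth_in_iff
proof
  fix x assume "x \<in> U"
  then obtain V F W G where *: "open V" "x \<in> V" "Cinf_on F V" "\<forall>y\<in>V \<inter> U. F y = f y"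
    "open W" "x \<in> W" "Cinf_on G W" "\<forall>y\<in>W \<inter> U. G y = g y"
    using f g unfolding smooth_in_iff by meson
  then have "Cinf_on (\<lambda>x. h (F x) (G x)) (V \<inter> W)"
    using h[of "V \<inter> W" F G] Cinf_on_subset[of F V "V \<inter> W"] Cinf_on_subset[of G W "V \<inter> W"] by blast
  with * show "\<exists>W Fa. open W \<and> x \<in> W \<and> Cinf_on Fa W \<and> (\<forall>y\<in>W \<inter> U. Fa y = h (f y) (g y))"
    by (intro exI[of _ "V \<inter> W"] exI[of _ "\<lambda>x. h (F x) (G x)"]) auto
qed

lemma smooth_in_bilinear:
  "bounded_bilinear B \<Longrightarrow> smooth_in U f \<Longrightarrow> smooth_in U g \<Longrightarrow> smooth_in U (\<lambda>x. B (f x) (g x))"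
  by (rule smooth_in_map2) (auto simp: Cinf_on_def intro: Ck_on_bilinear)

lemmas smooth_in_mult = smooth_in_bilinear[OF bounded_bilinear_mult]

lemma smooth_in_add: "smooth_in U f \<Longrightarrow> smooth_in U g \<Longrightarrow> smooth_in U (\<lambda>x. f x + g x)"
  by (rule smooth_in_map2) (auto simp: Cinf_on_def intro: Ck_on_add)

lemma smooth_in_linear: "bounded_linear h \<Longrightarrow> smooth_in U f \<Longrightarrow> smooth_in U (\<lambda>x. h (f x))"
  by (rule smooth_in_map2[where h = "\<lambda>a b. h a" and g = f]) (auto simp: Cinf_on_def intro: Ck_on_linear)

lemma smooth_in_const: "smooth_in U (\<lambda>x. c)"
  unfolding smooth_in_def using Ck_on_const by blast

lemma smooth_in_ident: "smooth_in U (\<lambda>x. x)"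
  unfolding smooth_in_def using Ck_on_ident[OF open_UNIV] by blast

lemma smooth_in_minus: "smooth_in U f \<Longrightarrow> smooth_in U (\<lambda>x. - f x)"
  by (rule smooth_in_linear[OF bounded_linear_minus[OF bounded_linear_ident]])

lemma smooth_in_diff: "smooth_in U f \<Longrightarrow> smooth_in U g \<Longrightarrow> smooth_in U (\<lambda>x. f x - g x)"
  using smooth_in_add[OF _ smooth_in_minus, of U f g] by simp

lemma smooth_in_sum: "(\<And>i. i \<in> I \<Longrightarrow> smooth_in U (f i)) \<Longrightarrow> smooth_in U (\<lambda>x. \<Sum>i\<in>I. f i x)"
  by (induction I rule: infinite_finite_induct) (auto intro!: smooth_in_add smooth_in_const)

lemma smooth_in_prod:
  fixes f :: "'i \<Rightarrow> 'a::real_normed_vector \<Rightarrow> complex"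
  shows "(\<And>i. i \<in> I \<Longrightarrow> smooth_in U (f i)) \<Longrightarrow> smooth_in U (\<lambda>x. \<Prod>i\<in>I. f i x)"
  by (induction I rule: infinite_finite_induct) (auto intro!: smooth_in_mult smooth_in_const)

lemma smooth_in_subset: "smooth_in U f \<Longrightarrow> V \<subseteq> U \<Longrightarrow> smooth_in V f"
  unfolding smooth_in_def by (meson IntD1 IntD2 IntI subsetD)

lemma smooth_in_cong: "(\<And>x. x \<in> U \<Longrightarrow> f x = g x) \<Longrightarrow> smooth_in U f \<longleftrightarrow> smooth_in U g"
  unfolding smooth_in_def by simp

lemma smooth_in_continuous_on: "smooth_in U f \<Longrightarrow> continuous_on U f"
  unfolding continuous_on_eq_continuous_within
proof
  fix x assume f: "smooth_in U f" and x: "x \<in> U"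
  obtain W F where W: "open W" "x \<in> W" "Cinf_on F W" "\<forall>y\<in>W \<inter> U. F y = f y"
    using f x unfolding smooth_in_iff by blast
  obtain d where d: "d > 0" "ball x d \<subseteq> W" using W open_contains_ball by blast
  have "continuous_on W F" using W(3) unfolding Cinf_on_def by (metis Ck_on.simps(1))
  then have "continuous (at x within U) F"
    using W continuous_on_eq_continuous_at continuous_at_imp_continuous_at_within by blast
  then show "continuous (at x within U) f"
    by (rule continuous_transform_within[OF _ d(1) x]) (use d W in \<open>auto simp: dist_commute subset_iff\<close>)
qed

lemma smooth_in_inverse:
  fixes f :: "'a::real_normed_vector \<Rightarrow> 'b::real_normed_field"
  assumes f: "smooth_in U f" and nz: "\<And>x. x \<in> U \<Longrightarrow> f x \<noteq> 0"
  shows "smooth_in U (\<lambda>x. inverse (f x))"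
  unfolding smooth_in_iff
proof
  fix x assume x: "x \<in> U"
  then obtain W F where W: "open W" "x \<in> W" "Cinf_on F W" "\<forall>y\<in>W \<inter> U. F y = f y"
    using f unfolding smooth_in_iff by blast
  \<comment> \<open>The extension may vanish off \<open>U\<close>, so the neighbourhood is cut down
    to the points where it does not.\<close>
  let ?V = "W \<inter> F -` (- {0})"
  have "open ?V"
    using W(1,3) by (intro continuous_open_preimage) (auto simp: Cinf_on_def dest: spec[of _ 0])
  moreover have "Cinf_on (\<lambda>y. inverse (F y)) ?V"
    using \<open>open ?V\<close> W(3) unfolding Cinf_on_def
    by (intro allI Ck_on_inverse) (auto intro: Ck_on_subset)
  ultimately show "\<exists>W Fa. open W \<and> x \<in> W \<and> Cinf_on Fa W \<and> (\<forall>y\<in>W \<inter> U. Fa y = inverse (f y))"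
    using W x nz by (intro exI[of _ ?V] exI[of _ "\<lambda>y. inverse (F y)"]) auto
qed

text \<open>The neighbourhood is shrunk until its points in \<open>M\<close> lie in
  \<open>U\<close>; a derivative within \<open>M\<close> then meets only points where the extension
  agrees with \<open>f\<close>.\<close>

lemma smooth_in_extend:
  assumes "openin (top_of_set M) U" "smooth_in U f" "x \<in> U"
  obtains W F where "open W" "x \<in> W" "M \<inter> W \<subseteq> U" "Cinf_on F W" "\<And>y. y \<in> M \<inter> W \<Longrightarrow> F y = f y"
proof -
  obtain T where T: "open T" "U = M \<inter> T" using assms(1) by (auto simp: openin_open)
  obtain W F where W: "open W" "x \<in> W" "Cinf_on F W" "\<forall>y\<in>W \<inter> U. F y = f y"
    using assms unfolding smooth_in_iff by blast
  show ?thesis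
    by (rule that[of "W \<inter> T" F]) (use W T assms(3) in \<open>auto intro: Cinf_on_subset\<close>)
qed

section \<open>Derivatives along tangent vectors\<close>

lemma extension_has_derivative:
  assumes "open W" "x \<in> M" "x \<in> W" "Cinf_on F W" "\<And>y. y \<in> M \<inter> W \<Longrightarrow> F y = f y"
  shows "(f has_derivative frechet_derivative F (at x)) (at x within M)"
proof -
  obtain d where d: "d > 0" "ball x d \<subseteq> W" using assms(1,3) open_contains_ball by blast
  have "(F has_derivative frechet_derivative F (at x)) (at x within M)"
    using Cinf_on_derivative[OF assms(1,4,3)] by (rule has_derivative_at_withinI)
  then show ?thesis
  proof (rule has_derivative_transform_within[OF _ d(1) assms(2)])
    fix y assume "y \<in> M" "dist y x < d"
    moreover from this have "y \<in> W" using d(2) by (auto simp: dist_commute subset_iff)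
    ultimately show "F y = f y" using assms(5) by blast
  qed
qed

lemma smooth_in_differentiable:
  assumes "openin (top_of_set M) U" "smooth_in U f" "x \<in> U"
  shows "f differentiable (at x within M)"
proof -
  obtain W F where "open W" "x \<in> W" "M \<inter> W \<subseteq> U" "Cinf_on F W" "\<And>y. y \<in> M \<inter> W \<Longrightarrow> F y = f y"
    using smooth_in_extend[OF assms] by metis
  moreover have "x \<in> M" using assms openin_imp_subset by blast
  ultimately show ?thesis using extension_has_derivative[of W x M F f] by (auto simp: differentiable_def)
qed

text \<open>Composing with a curve in \<open>M\<close> of velocity \<open>A\<close> gives a function
  of a real variable, whose derivative is unique; by the chain rule it is the value at
  \<open>A\<close> of any derivative of \<open>f\<close> within \<open>M\<close>, the chosen one
  included.\<close>

lemma deriv_along_eq: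
  assumes f: "(f has_derivative f') (at x within M)" and A: "A \<in> tangent M x"
  shows "deriv_along M f x A = f' A"
proof -
  obtain \<gamma> :: "real \<Rightarrow> 'a" where g: "\<And>t. \<gamma> t \<in> M" "\<gamma> 0 = x" "(\<gamma> has_vector_derivative A) (at 0)"
    using A by (auto simp: tangent_def)
  have "deriv_along M f x = frechet_derivative f (at x within M)"
    by (simp add: deriv_along_def fun_eq_iff)
  then have f2: "(f has_derivative deriv_along M f x) (at x within M)"
    using f by (metis differentiable_def frechet_derivative_works)
  have *: "((\<lambda>t. f (\<gamma> t)) has_derivative (\<lambda>h. D (h *\<^sub>R A))) (at 0)"
    if "(f has_derivative D) (at x within M)" for D
  proof -
    have "((\<lambda>t. f (\<gamma> t)) has_derivative (\<lambda>h. D (h *\<^sub>R A))) (at 0 within UNIV)"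
    proof (rule has_derivative_in_compose[where f = \<gamma> and g = f])
      show "(\<gamma> has_derivative (\<lambda>h. h *\<^sub>R A)) (at 0 within UNIV)"
        using g(3) by (simp add: has_vector_derivative_def)
      show "(f has_derivative D) (at (\<gamma> 0) within range \<gamma>)"
        using that g by (auto intro: has_derivative_subset)
    qed
    then show ?thesis by simp
  qed
  have "(\<lambda>h. f' (h *\<^sub>R A)) = (\<lambda>h. deriv_along M f x (h *\<^sub>R A))"
    using has_derivative_unique[OF *[OF f] *[OF f2]] .
  from fun_cong[OF this, of 1] show ?thesis by simp
qed

lemma deriv_along_works:
  "f differentiable (at x within M) \<Longrightarrow> (f has_derivative deriv_along M f x) (at x within M)"
proof -
  have "deriv_along M f x = frechet_derivative f (at x within M)"
    by (simp add: deriv_along_def fun_eq_iff)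
  then show "f differentiable (at x within M) \<Longrightarrow> (f has_derivative deriv_along M f x) (at x within M)"
    by (simp add: frechet_derivative_works)
qed

text \<open>The set of derivatives within \<open>M\<close> depends only on the germ of the function,
  so the choice operator selects the same one on both sides.\<close>

lemma deriv_along_cong:
  assumes "openin (top_of_set M) U" "x \<in> U" "\<And>y. y \<in> U \<Longrightarrow> f y = g y"
  shows "deriv_along M f x A = deriv_along M g x A"
proof -
  obtain T where T: "open T" "U = M \<inter> T" using assms(1) by (auto simp: openin_open)
  then obtain d where d: "d > 0" "ball x d \<subseteq> T" using assms(2) open_contains_ball by blast
  have *: "(g has_derivative f') (at x within M)"
    if "(f has_derivative f') (at x within M)" "\<And>y. y \<in> U \<Longrightarrow> f y = g y" for f g :: "'a \<Rightarrow> 'b" and f'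
    using that(1) d assms(2) that(2) T
    by (intro has_derivative_transform_within[of f f' x M d g]) (auto simp: dist_commute subset_iff)
  have "(f has_derivative f') (at x within M) \<longleftrightarrow> (g has_derivative f') (at x within M)" for f'
    using *[of f f' g] *[of g f' f] assms(3) by auto
  then show ?thesis by (simp add: deriv_along_def frechet_derivative_def)
qed

lemma deriv_along_const: "A \<in> tangent M x \<Longrightarrow> deriv_along M (\<lambda>y. c) x A = 0"
  by (rule deriv_along_eq) (auto intro: derivative_intros)

lemma deriv_along_add:
  "f differentiable (at x within M) \<Longrightarrow> g differentiable (at x within M) \<Longrightarrow> A \<in> tangent M x \<Longrightarrow>
    deriv_along M (\<lambda>y. f y + g y) x A = deriv_along M f x A + deriv_along M g x A"
  by (rule deriv_along_eq[OF has_derivative_add]) (auto intro: deriv_along_works)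

lemma deriv_along_bounded_linear:
  "bounded_linear h \<Longrightarrow> f differentiable (at x within M) \<Longrightarrow> A \<in> tangent M x \<Longrightarrow>
    deriv_along M (\<lambda>y. h (f y)) x A = h (deriv_along M f x A)"
  by (rule deriv_along_eq[OF bounded_linear.has_derivative]) (auto intro: deriv_along_works)

lemma deriv_along_bilinear:
  "bounded_bilinear B \<Longrightarrow> f differentiable (at x within M) \<Longrightarrow> g differentiable (at x within M) \<Longrightarrow>
    A \<in> tangent M x \<Longrightarrow>
    deriv_along M (\<lambda>y. B (f y) (g y)) x A = B (f x) (deriv_along M g x A) + B (deriv_along M f x A) (g x)"
  by (rule deriv_along_eq[OF bounded_bilinear.FDERIV]) (auto intro: deriv_along_works)

lemmas deriv_along_mult = deriv_along_bilinear[OF bounded_bilinear_mult]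

lemma deriv_along_sum:
  "(\<And>i. i \<in> I \<Longrightarrow> f i differentiable (at x within M)) \<Longrightarrow> A \<in> tangent M x \<Longrightarrow>
    deriv_along M (\<lambda>y. \<Sum>i\<in>I. f i y) x A = (\<Sum>i\<in>I. deriv_along M (f i) x A)"
  by (rule deriv_along_eq[OF has_derivative_sum]) (auto intro: deriv_along_works)

lemma deriv_along_linear:
  assumes "f differentiable (at x within M)"
  shows "deriv_along M f x (a *\<^sub>R A + b *\<^sub>R B) = a *\<^sub>R deriv_along M f x A + b *\<^sub>R deriv_along M f x B"
  using has_derivative_linear[OF deriv_along_works[OF assms]] by (simp add: linear_add linear_cmul)

section \<open>Vector fields on spaces of operators and Lie brackets\<close>

text \<open>Matrix units. Expanding in them turns a derivative in a variable direction into a finite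
  sum of derivatives in constant directions, which are the ones that \<open>Ck_on\<close>
  controls.\<close>

definition elementary_blinfun :: "'v::euclidean_space \<Rightarrow> 'w::euclidean_space \<Rightarrow> 'v \<Rightarrow>\<^sub>L 'w" where
  "elementary_blinfun b c = blinfun_scaleR_left c o\<^sub>L blinfun_inner_left b"

lemma blinfun_expand:
  "A = (\<Sum>b\<in>Basis. \<Sum>c\<in>Basis. (blinfun_apply A b \<bullet> c) *\<^sub>R elementary_blinfun b c)"
proof (rule blinfun_eqI)
  fix x
  have "blinfun_apply (\<Sum>b\<in>Basis. \<Sum>c\<in>Basis. (blinfun_apply A b \<bullet> c) *\<^sub>R elementary_blinfun b c) x
      = (\<Sum>b\<in>Basis. \<Sum>c\<in>Basis. (x \<bullet> b) *\<^sub>R (blinfun_apply A b \<bullet> c) *\<^sub>R c)"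
    by (simp add: blinfun.sum_left blinfun.scaleR_left elementary_blinfun_def blinfun_inner_left.rep_eq mult.commute)
  also have "\<dots> = (\<Sum>b\<in>Basis. (x \<bullet> b) *\<^sub>R blinfun_apply A b)"
    by (simp add: scaleR_right.sum[symmetric] euclidean_representation del: scaleR_scaleR)
  also have "\<dots> = blinfun_apply A (\<Sum>b\<in>Basis. (x \<bullet> b) *\<^sub>R b)"
    by (simp add: blinfun.sum_right blinfun.scaleR_right)
  also have "\<dots> = blinfun_apply A x" by (simp add: euclidean_representation)
  finally show "blinfun_apply A x =
    blinfun_apply (\<Sum>b\<in>Basis. \<Sum>c\<in>Basis. (blinfun_apply A b \<bullet> c) *\<^sub>R elementary_blinfun b c) x" ..
qed

lemma linear_blinfun_expand:
  assumes "linear f"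
  shows "f A = (\<Sum>b\<in>Basis. \<Sum>c\<in>Basis. (blinfun_apply A b \<bullet> c) *\<^sub>R f (elementary_blinfun b c))"
proof -
  have "f A = f (\<Sum>b\<in>Basis. \<Sum>c\<in>Basis. (blinfun_apply A b \<bullet> c) *\<^sub>R elementary_blinfun b c)"
    by (rule arg_cong[OF blinfun_expand])
  also have "\<dots> = (\<Sum>b\<in>Basis. \<Sum>c\<in>Basis. (blinfun_apply A b \<bullet> c) *\<^sub>R f (elementary_blinfun b c))"
    by (simp add: linear_sum[OF assms] linear_cmul[OF assms])
  finally show ?thesis .
qed

lemma Cinf_on_field:
  fixes F :: "('v::euclidean_space \<Rightarrow>\<^sub>L 'w::euclidean_space) \<Rightarrow> 'b::real_normed_vector"
  assumes W: "open W" and F: "Cinf_on F W" and X: "Cinf_on X W"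
  shows "Cinf_on (\<lambda>x. frechet_derivative F (at x) (X x)) W"
  unfolding Cinf_on_def
proof
  fix k
  show "Ck_on k (\<lambda>x. frechet_derivative F (at x) (X x)) W"
  proof (rule Ck_on_cong[OF W])
    show "(\<Sum>b\<in>Basis. \<Sum>c\<in>Basis. (blinfun_apply (X x) b \<bullet> c) *\<^sub>R
        frechet_derivative F (at x) (elementary_blinfun b c)) = frechet_derivative F (at x) (X x)"
      if "x \<in> W" for x
      by (rule linear_blinfun_expand[OF has_derivative_linear[OF Cinf_on_derivative[OF W F that]], symmetric])
    show "Ck_on k (\<lambda>x. \<Sum>b\<in>Basis. \<Sum>c\<in>Basis. (blinfun_apply (X x) b \<bullet> c) *\<^sub>R
        frechet_derivative F (at x) (elementary_blinfun b c)) W"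
    proof (intro Ck_on_sum[OF W] Ck_on_bilinear[OF W bounded_bilinear_scaleR])
      fix b :: 'v and c :: 'w
      show "Ck_on k (\<lambda>x. blinfun_apply (X x) b \<bullet> c) W"
        by (rule Ck_on_linear[OF W bounded_linear_blinfun_matrix]) (use X in \<open>simp add: Cinf_on_def\<close>)
      show "Ck_on k (\<lambda>x. frechet_derivative F (at x) (elementary_blinfun b c)) W"
        using Cinf_on_directional[OF F] by (simp add: Cinf_on_def)
    qed
  qed
qed

lemma frechet_derivative_field:
  fixes F :: "('v::euclidean_space \<Rightarrow>\<^sub>L 'w::euclidean_space) \<Rightarrow> 'b::euclidean_space"
  assumes W: "open W" "x \<in> W" and F: "Cinf_on F W" and X: "Cinf_on X W"
  shows "frechet_derivative (\<lambda>y. frechet_derivative F (at y) (X y)) (at x) v =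
    frechet_derivative (\<lambda>y. frechet_derivative F (at y) (X x)) (at x) v +
    frechet_derivative F (at x) (frechet_derivative X (at x) v)"
proof -
  let ?d = "\<lambda>y. frechet_derivative F (at y)"
  let ?E = "elementary_blinfun :: 'v \<Rightarrow> 'w \<Rightarrow> _"
  let ?D2 = "\<lambda>w. frechet_derivative (\<lambda>y. ?d y w) (at x)"
  have lin: "linear (?d y)" if "y \<in> W" for y
    using has_derivative_linear[OF Cinf_on_derivative[OF W(1) F that]] .
  have D2: "((\<lambda>y. ?d y w) has_derivative ?D2 w) (at x)" for w
    using Cinf_on_derivative[OF W(1) Cinf_on_directional[OF F] W(2)] .
  have F2: "Ck_on 2 F W" using F by (simp add: Cinf_on_def)
  have X': "((\<lambda>y. blinfun_apply (X y) b \<bullet> c) has_derivative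
      (\<lambda>v. blinfun_apply (frechet_derivative X (at x) v) b \<bullet> c)) (at x)" for b c
    using bounded_linear.has_derivative[OF bounded_linear_blinfun_matrix Cinf_on_derivative[OF W(1) X W(2)]] .
  have "((\<lambda>y. \<Sum>b\<in>Basis. \<Sum>c\<in>Basis. (blinfun_apply (X y) b \<bullet> c) *\<^sub>R ?d y (?E b c)) has_derivative
      (\<lambda>v. \<Sum>b\<in>Basis. \<Sum>c\<in>Basis. (blinfun_apply (X x) b \<bullet> c) *\<^sub>R ?D2 (?E b c) v
         + (blinfun_apply (frechet_derivative X (at x) v) b \<bullet> c) *\<^sub>R ?d x (?E b c))) (at x)"
    by (intro has_derivative_sum has_derivative_scaleR X' D2)
  then have "((\<lambda>y. ?d y (X y)) has_derivative
      (\<lambda>v. \<Sum>b\<in>Basis. \<Sum>c\<in>Basis. (blinfun_apply (X x) b \<bullet> c) *\<^sub>R ?D2 (?E b c) v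
         + (blinfun_apply (frechet_derivative X (at x) v) b \<bullet> c) *\<^sub>R ?d x (?E b c))) (at x)"
    by (rule has_derivative_transform_within_open[OF _ W])
      (simp add: linear_blinfun_expand[OF lin, symmetric])
  then have "frechet_derivative (\<lambda>y. ?d y (X y)) (at x) v =
     (\<Sum>b\<in>Basis. \<Sum>c\<in>Basis. (blinfun_apply (X x) b \<bullet> c) *\<^sub>R ?D2 (?E b c) v
         + (blinfun_apply (frechet_derivative X (at x) v) b \<bullet> c) *\<^sub>R ?d x (?E b c))"
    by (rule fun_cong[OF frechet_derivative_at[symmetric]])
  \<comment> \<open>Linearity of the second derivative is immediate in the outer direction, so
    symmetry moves the matrix units there before the expansion is collapsed.\<close>
  also have "\<dots> = (\<Sum>b\<in>Basis. \<Sum>c\<in>Basis. (blinfun_apply (X x) b \<bullet> c) *\<^sub>R ?D2 v (?E b c))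
      + (\<Sum>b\<in>Basis. \<Sum>c\<in>Basis. (blinfun_apply (frechet_derivative X (at x) v) b \<bullet> c) *\<^sub>R ?d x (?E b c))"
    by (simp add: sum.distrib second_derivative_symmetric[OF W(1) F2 W(2), of _ v])
  also have "\<dots> = ?D2 v (X x) + ?d x (frechet_derivative X (at x) v)"
    by (simp only: linear_blinfun_expand[OF has_derivative_linear[OF D2], symmetric]
        linear_blinfun_expand[OF lin[OF W(2)], symmetric])
  finally show ?thesis by (simp add: second_derivative_symmetric[OF W(1) F2 W(2), of "X x"])
qed

lemma smooth_in_deriv_along:
  fixes M :: "('v::euclidean_space \<Rightarrow>\<^sub>L 'w::euclidean_space) set" and f :: "_ \<Rightarrow> 'b::real_normed_vector"
  assumes U: "openin (top_of_set M) U" and f: "smooth_in U f" and X: "vector_field M U X"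
  shows "smooth_in U (\<lambda>y. deriv_along M f y (X y))"
  unfolding smooth_in_iff
proof
  fix x assume x: "x \<in> U"
  obtain W F where W: "open W" "x \<in> W" "M \<inter> W \<subseteq> U" "Cinf_on F W" "\<And>y. y \<in> M \<inter> W \<Longrightarrow> F y = f y"
    using smooth_in_extend[OF U f x] by metis
  obtain V Y where V: "open V" "x \<in> V" "M \<inter> V \<subseteq> U" "Cinf_on Y V" "\<And>y. y \<in> M \<inter> V \<Longrightarrow> Y y = X y"
    using smooth_in_extend[OF U _ x, of X] X unfolding vector_field_def by metis
  have UM: "U \<subseteq> M" using openin_imp_subset[OF U] .
  have o: "open (W \<inter> V)" using W V by auto
  have "frechet_derivative F (at y) (Y y) = deriv_along M f y (X y)" if "y \<in> W \<inter> V \<inter> U" for y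
  proof -
    have "(f has_derivative frechet_derivative F (at y)) (at y within M)"
      by (rule extension_has_derivative[of W]) (use W that UM in auto)
    moreover have "X y \<in> tangent M y" using X that by (auto simp: vector_field_def)
    moreover have "Y y = X y" using V(5) that UM by auto
    ultimately show ?thesis using deriv_along_eq[of f _ y M] by simp
  qed
  moreover have "Cinf_on (\<lambda>y. frechet_derivative F (at y) (Y y)) (W \<inter> V)"
    by (rule Cinf_on_field[OF o]) (use W V in \<open>auto intro: Cinf_on_subset\<close>)
  ultimately show "\<exists>W F. open W \<and> x \<in> W \<and> Cinf_on F W \<and> (\<forall>y\<in>W \<inter> U. F y = deriv_along M f y (X y))"
    using W V o by (intro exI[of _ "W \<inter> V"] exI[of _ "\<lambda>y. frechet_derivative F (at y) (Y y)"]) auto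
qed

text \<open>For extensions, each iterated derivative is a second derivative with both fields frozen
  at \<open>x\<close>, plus a first derivative along the derivative of a field. The former cancel by
  symmetry and the latter form the bracket. Tangency \<open>br\<close> allows the result to be read
  as a derivative along \<open>M\<close>.\<close>

lemma deriv_along_lie_bracket:
  fixes M :: "('v::euclidean_space \<Rightarrow>\<^sub>L 'v) set" and f :: "_ \<Rightarrow> 'b::euclidean_space"
  assumes U: "openin (top_of_set M) U" and f: "smooth_in U f"
    and X: "vector_field M U X" and Y: "vector_field M U Y" and x: "x \<in> U"
    and br: "lie_bracket M X Y x \<in> tangent M x"
  shows "deriv_along M (\<lambda>y. deriv_along M f y (Y y)) x (X x) -
    deriv_along M (\<lambda>y. deriv_along M f y (X y)) x (Y x) = deriv_along M f x (lie_bracket M X Y x)"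
proof -
  obtain W1 F where W1: "open W1" "x \<in> W1" "M \<inter> W1 \<subseteq> U" "Cinf_on F W1" "\<And>y. y \<in> M \<inter> W1 \<Longrightarrow> F y = f y"
    using smooth_in_extend[OF U f x] by metis
  obtain W2 X' where W2: "open W2" "x \<in> W2" "M \<inter> W2 \<subseteq> U" "Cinf_on X' W2" "\<And>y. y \<in> M \<inter> W2 \<Longrightarrow> X' y = X y"
    using smooth_in_extend[OF U _ x, of X] X unfolding vector_field_def by metis
  obtain W3 Y' where W3: "open W3" "x \<in> W3" "M \<inter> W3 \<subseteq> U" "Cinf_on Y' W3" "\<And>y. y \<in> M \<inter> W3 \<Longrightarrow> Y' y = Y y"
    using smooth_in_extend[OF U _ x, of Y] Y unfolding vector_field_def by metis
  define W where "W = W1 \<inter> W2 \<inter> W3"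
  have W: "open W" "x \<in> W" "M \<inter> W \<subseteq> U" "Cinf_on F W" "Cinf_on X' W" "Cinf_on Y' W"
    and ext: "\<And>y. y \<in> M \<inter> W \<Longrightarrow> F y = f y" "\<And>y. y \<in> M \<inter> W \<Longrightarrow> X' y = X y" "\<And>y. y \<in> M \<inter> W \<Longrightarrow> Y' y = Y y"
    using W1 W2 W3 by (auto simp: W_def intro: Cinf_on_subset)
  have UM: "U \<subseteq> M" using openin_imp_subset[OF U] .
  then have xM: "x \<in> M" using x by auto
  have d1: "frechet_derivative F (at y) (Z' y) = deriv_along M f y (Z y)"
    if "y \<in> M \<inter> W" "vector_field M U Z" "\<And>y. y \<in> M \<inter> W \<Longrightarrow> Z' y = Z y" for y Z Z'
  proof -
    have "(f has_derivative frechet_derivative F (at y)) (at y within M)"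
      by (rule extension_has_derivative[of W]) (use W ext that in auto)
    moreover have "Z y \<in> tangent M y" using that W by (auto simp: vector_field_def)
    ultimately show ?thesis using deriv_along_eq that by metis
  qed
  have tX: "X x \<in> tangent M x" and tY: "Y x \<in> tangent M x" using X Y x by (auto simp: vector_field_def)
  have d2: "deriv_along M (\<lambda>y. deriv_along M f y (Z y)) x A =
      frechet_derivative (\<lambda>y. frechet_derivative F (at y) (Z x)) (at x) A +
      frechet_derivative F (at x) (deriv_along M Z x A)"
    if A: "A \<in> tangent M x" and Z: "vector_field M U Z" "\<And>y. y \<in> M \<inter> W \<Longrightarrow> Z' y = Z y" "Cinf_on Z' W" for A Z Z'
  proof -
    have "((\<lambda>y. deriv_along M f y (Z y)) has_derivative
        frechet_derivative (\<lambda>y. frechet_derivative F (at y) (Z' y)) (at x)) (at x within M)"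
      by (rule extension_has_derivative[of W]) (use W xM d1[OF _ Z(1,2)] Cinf_on_field[OF W(1,4) Z(3)] in auto)
    from deriv_along_eq[OF this A]
    have "deriv_along M (\<lambda>y. deriv_along M f y (Z y)) x A =
      frechet_derivative (\<lambda>y. frechet_derivative F (at y) (Z' x)) (at x) A +
      frechet_derivative F (at x) (frechet_derivative Z' (at x) A)"
      by (simp only: frechet_derivative_field[OF W(1,2,4) Z(3)])
    moreover have "(Z has_derivative frechet_derivative Z' (at x)) (at x within M)"
      by (rule extension_has_derivative[of W]) (use W xM Z in auto)
    then have "deriv_along M Z x A = frechet_derivative Z' (at x) A" by (rule deriv_along_eq[OF _ A])
    moreover have "Z' x = Z x" using Z W xM by auto
    ultimately show ?thesis by simp
  qed
  have F2: "Ck_on 2 F W" using W by (simp add: Cinf_on_def)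
  have lin: "linear (frechet_derivative F (at x))"
    using has_derivative_linear[OF Cinf_on_derivative[OF W(1,4,2)]] .
  have "(f has_derivative frechet_derivative F (at x)) (at x within M)"
    by (rule extension_has_derivative[of W]) (use W ext xM in auto)
  then have "deriv_along M f x (lie_bracket M X Y x) = frechet_derivative F (at x) (lie_bracket M X Y x)"
    using br by (rule deriv_along_eq)
  moreover have "frechet_derivative (\<lambda>y. frechet_derivative F (at y) (Y x)) (at x) (X x) =
      frechet_derivative (\<lambda>y. frechet_derivative F (at y) (X x)) (at x) (Y x)"
    by (rule second_derivative_symmetric[OF W(1) F2 W(2)])
  ultimately show ?thesis
    using d2[OF tX Y ext(3) W(6)] d2[OF tY X ext(2) W(5)] linear_diff[OF lin]
    by (simp add: lie_bracket_def)
qed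

section \<open>Exterior forms and the Clifford relation\<close>

lemma cscale_simps [simp]:
  "cscale 1 x = x" "cscale 0 x = 0" "cscale c 0 = 0"
  "cscale c (x + y) = cscale c x + cscale c y" "cscale (c + d) x = cscale c x + cscale d x"
  "cscale c (x - y) = cscale c x - cscale c y" "cscale (c - d) x = cscale c x - cscale d x"
  "cscale c (- x) = - cscale c x" "cscale (- c) x = - cscale c x"
  "cscale c (cscale d x) = cscale (c * d) x"
  by (auto simp: cscale_def prod_eq_iff algebra_simps)

lemma cmetric_simps [simp]:
  "cmetric z (x + y) = cmetric z x + cmetric z y" "cmetric (x + y) z = cmetric x z + cmetric y z"
  "cmetric z (cscale c x) = c * cmetric z x" "cmetric (cscale c x) z = c * cmetric x z"
  "cmetric z (- x) = - cmetric z x" "cmetric (- x) z = - cmetric x z"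
  "cmetric z (x - y) = cmetric z x - cmetric z y" "cmetric (x - y) z = cmetric x z - cmetric y z"
  "cmetric z 0 = 0" "cmetric 0 z = 0"
  by (auto simp: cmetric_def cscale_def complex_eq_iff algebra_simps inner_simps)

lemma cmetric_sym: "cmetric x y = cmetric y x"
  by (auto simp: cmetric_def complex_eq_iff inner_commute)

lemma cmetric_of_vec: "cmetric (of_vec x) (of_vec y) = of_real (x \<bullet> y)"
  by (simp add: cmetric_def of_vec_def complex_eq_iff)

lemma cvec_expand:
  "z = (\<Sum>b\<in>Basis. cscale (cmetric (of_vec b) z) (of_vec b))" for z :: "'v::euclidean_space cvec"
proof -
  have "(\<Sum>b\<in>Basis. cscale (cmetric (of_vec b) z) (of_vec b)) =
      ((\<Sum>b\<in>Basis. (fst z \<bullet> b) *\<^sub>R b), (\<Sum>b\<in>Basis. (snd z \<bullet> b) *\<^sub>R b))"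
    by (simp add: prod_eq_iff fst_sum snd_sum cscale_def cmetric_def of_vec_def inner_commute)
  then show ?thesis by (simp add: euclidean_representation)
qed

lemma clinear_functional_zero: "clinear_functional f \<Longrightarrow> f 0 = 0"
  unfolding clinear_functional_def by (metis add_0 add_cancel_right_left cscale_simps(3) mult_1)

lemma clinear_functional_sum:
  "clinear_functional f \<Longrightarrow> f (\<Sum>i\<in>I. cscale (c i) (x i)) = (\<Sum>i\<in>I. c i * f (x i))"
proof (induction I rule: infinite_finite_induct)
  case (insert i I)
  then show ?case by (simp add: clinear_functional_def del: split_paired_All)
qed (simp_all add: clinear_functional_zero)

lemma clinear_functional_expand:
  "clinear_functional f \<Longrightarrow> f z = (\<Sum>b\<in>Basis. cmetric (of_vec b) z * f (of_vec b))"
  for z :: "'v::euclidean_space cvec"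
  using clinear_functional_sum[of f "\<lambda>b. cmetric (of_vec b) z" of_vec Basis] cvec_expand[of z] by simp

lemma clinear_functional_cmetric: "clinear_functional (cmetric z)"
  by (simp add: clinear_functional_def)

text \<open>Nondegeneracy of the bilinear metric. This identification of functionals with vectors
  later turns exterior products of vectors into forms.\<close>

lemma clinear_functional_eq_cmetric:
  fixes f :: "'v::euclidean_space cvec \<Rightarrow> complex"
  assumes "clinear_functional f"
  obtains z where "f = cmetric z"
proof
  show "f = cmetric (\<Sum>b\<in>Basis. cscale (f (of_vec b)) (of_vec b))"
  proof
    fix x :: "'v cvec"
    have "clinear_functional (\<lambda>z. cmetric z x)" by (simp add: clinear_functional_def)
    from clinear_functional_sum[OF this, of "\<lambda>b. f (of_vec b)" of_vec Basis]
    show "f x = cmetric (\<Sum>b\<in>Basis. cscale (f (of_vec b)) (of_vec b)) x"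
      using clinear_functional_expand[OF assms, of x] by (simp add: mult.commute)
  qed
qed

definition multilinear :: "'v::real_vector form \<Rightarrow> bool" where
  "multilinear \<psi> \<longleftrightarrow> (\<forall>xs i c x y. i < length xs \<longrightarrow>
     \<psi> (xs[i := cscale c x + y]) = c * \<psi> (xs[i := x]) + \<psi> (xs[i := y]))"

lemma ext_forms_iff: "\<psi> \<in> ext_forms \<longleftrightarrow> multilinear \<psi> \<and> (\<forall>xs. \<not> distinct xs \<longrightarrow> \<psi> xs = 0)"
  by (simp add: ext_forms_def multilinear_def)

lemma multilinear_Cons:
  "multilinear \<psi> \<Longrightarrow> \<psi> ((cscale c x + y) # xs) = c * \<psi> (x # xs) + \<psi> (y # xs)"
  unfolding multilinear_def by (metis length_Cons list_update_code(2) zero_less_Suc)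

lemma multilinear_interior: "multilinear \<psi> \<Longrightarrow> multilinear (interior x \<psi>)"
  unfolding multilinear_def interior_def by (metis Suc_less_eq length_Cons list_update_code(3))

lemma interior_ext_forms: "\<psi> \<in> ext_forms \<Longrightarrow> interior x \<psi> \<in> ext_forms"
  unfolding ext_forms_iff by (metis multilinear_interior distinct.simps(2) interior_def)

lemma ext_forms_Cons:
  assumes "\<psi> \<in> ext_forms"
  shows "\<psi> ((cscale c x + y) # xs) = c * \<psi> (x # xs) + \<psi> (y # xs)"
    and "\<psi> ((x + y) # xs) = \<psi> (x # xs) + \<psi> (y # xs)"
    and "\<psi> (cscale c x # xs) = c * \<psi> (x # xs)"
    and "\<psi> (0 # xs) = 0"
proof -
  have m: "multilinear \<psi>" using assms by (simp add: ext_forms_iff)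
  show "\<psi> ((cscale c x + y) # xs) = c * \<psi> (x # xs) + \<psi> (y # xs)" by (rule multilinear_Cons[OF m])
  show "\<psi> ((x + y) # xs) = \<psi> (x # xs) + \<psi> (y # xs)" using multilinear_Cons[OF m, of 1 x y] by simp
  show z: "\<psi> (0 # xs) = 0" using multilinear_Cons[OF m, of 1 0 0] by simp
  show "\<psi> (cscale c x # xs) = c * \<psi> (x # xs)" using multilinear_Cons[OF m, of c x 0] z by simp
qed

lemma ext_forms_Cons_functional: "\<psi> \<in> ext_forms \<Longrightarrow> clinear_functional (\<lambda>x. \<psi> (x # xs))"
  unfolding clinear_functional_def using ext_forms_Cons(1) by blast

lemma ext_forms_linear_comb:
  "\<psi> \<in> ext_forms \<Longrightarrow> \<phi> \<in> ext_forms \<Longrightarrow> (\<lambda>xs. a * \<psi> xs + b * \<phi> xs) \<in> ext_forms"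
  unfolding ext_forms_def by (simp add: algebra_simps)

lemma ext_forms_scale: "\<psi> \<in> ext_forms \<Longrightarrow> (\<lambda>xs. a * \<psi> xs) \<in> ext_forms"
  using ext_forms_linear_comb[of \<psi> \<psi> a 0] by simp

lemma ext_forms_add: "\<psi> \<in> ext_forms \<Longrightarrow> \<phi> \<in> ext_forms \<Longrightarrow> (\<lambda>xs. \<psi> xs + \<phi> xs) \<in> ext_forms"
  using ext_forms_linear_comb[of \<psi> \<phi> 1 1] by simp

lemma ext_forms_zero: "(\<lambda>xs. 0) \<in> ext_forms"
  unfolding ext_forms_def by simp

lemma ext_forms_sum: "(\<And>i. i \<in> I \<Longrightarrow> \<psi> i \<in> ext_forms) \<Longrightarrow> (\<lambda>xs. \<Sum>i\<in>I. \<psi> i xs) \<in> ext_forms"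
  by (induction I rule: infinite_finite_induct) (auto intro: ext_forms_add ext_forms_zero)

lemma ext_forms_swap:
  assumes "\<psi> \<in> ext_forms"
  shows "\<psi> (x # y # zs) = - \<psi> (y # x # zs)"
proof -
  have a: "\<psi> (w # w # zs) = 0" for w using assms by (auto simp: ext_forms_iff)
  have "\<psi> ((x + y) # (x + y) # zs) = \<psi> (x # (x + y) # zs) + \<psi> (y # (x + y) # zs)"
    by (rule ext_forms_Cons(2)[OF assms])
  moreover have "\<psi> (w # (x + y) # zs) = \<psi> (w # x # zs) + \<psi> (w # y # zs)" for w
    using ext_forms_Cons(2)[OF interior_ext_forms[OF assms, of w]] by (simp add: interior_def)
  ultimately show ?thesis using a by (simp add: add_eq_0_iff2 add.commute)
qed

lemma ext_forms_move:
  "\<psi> \<in> ext_forms \<Longrightarrow> \<psi> (us @ x # vs) = (-1) ^ length us * \<psi> (x # us @ vs)"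
proof (induction us arbitrary: \<psi>)
  case (Cons u us)
  from Cons.IH[OF interior_ext_forms[OF Cons.prems, of u]] ext_forms_swap[OF Cons.prems, of u x "us @ vs"]
  show ?case by (simp add: interior_def)
qed simp

text \<open>The first argument is fixed at an element of \<open>E\<close>, the induction treats the
  others, and \<open>span\<close> releases the first. Stating the spanning property through
  functionals serves the standard basis, orthonormal bases and arbitrary real bases alike.\<close>

lemma multilinear_eqI_spanning:
  fixes f g :: "'v::euclidean_space form"
  assumes span: "\<And>f g z. clinear_functional f \<Longrightarrow> clinear_functional g \<Longrightarrow> (\<And>e. e \<in> E \<Longrightarrow> f e = g e) \<Longrightarrow> f z = g z"
    and "\<And>bs. length bs = k \<Longrightarrow> set bs \<subseteq> E \<Longrightarrow> f bs = g bs"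
    and "multilinear f" "multilinear g" "length xs = k"
  shows "f xs = g xs"
  using assms(2-)
proof (induction k arbitrary: f g xs)
  case (Suc k)
  then obtain x ys where xs: "xs = x # ys" "length ys = k" by (metis length_Suc_conv)
  have fn: "clinear_functional (\<lambda>x. h (x # ys))" if "multilinear h" for h
    unfolding clinear_functional_def using multilinear_Cons[OF that] by blast
  have "f (e # ys) = g (e # ys)" if "e \<in> E" for e
  proof -
    have "interior e f ys = interior e g ys"
    proof (rule Suc.IH)
      fix bs assume "length bs = k" "set bs \<subseteq> E"
      then show "interior e f bs = interior e g bs"
        using Suc.prems(1)[of "e # bs"] that by (simp add: interior_def)
    qed (use Suc.prems xs in \<open>auto intro: multilinear_interior\<close>)
    then show ?thesis by (simp add: interior_def)
  qed
  then show ?case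
    unfolding xs by (rule span[OF fn[OF Suc.prems(2)] fn[OF Suc.prems(3)]])
qed simp

lemma multilinear_eqI:
  fixes f g :: "'v::euclidean_space form"
  assumes eq: "\<And>bs. length bs = k \<Longrightarrow> set bs \<subseteq> Basis \<Longrightarrow> f (map of_vec bs) = g (map of_vec bs)"
    and "multilinear f" "multilinear g" "length xs = k"
  shows "f xs = g xs"
proof (rule multilinear_eqI_spanning[where E = "of_vec ` Basis" and k = k])
  fix h h' :: "'v cvec \<Rightarrow> complex" and z
  assume "clinear_functional h" "clinear_functional h'" "\<And>e. e \<in> of_vec ` Basis \<Longrightarrow> h e = h' e"
  then show "h z = h' z"
    using clinear_functional_expand[of h z] clinear_functional_expand[of h' z] by simp
next
  fix bs :: "'v cvec list" assume "length bs = k" "set bs \<subseteq> of_vec ` Basis"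
  moreover from this have "bs = map of_vec (map fst bs)"
    by (auto intro!: map_idI[symmetric] simp: of_vec_def)
  moreover have "set (map fst bs) \<subseteq> Basis" using calculation(2) by (auto simp: of_vec_def)
  ultimately show "f bs = g bs" using eq[of "map fst bs"] by (metis length_map)
qed (use assms in auto)

text \<open>A list of basis vectors longer than the dimension has a repetition. Forms are functions
  on lists of all lengths, so this bounds the degrees that occur.\<close>

lemma ext_forms_above_top:
  fixes \<psi> :: "'v::euclidean_space form"
  assumes "\<psi> \<in> ext_forms" "DIM('v) < length xs"
  shows "\<psi> xs = 0"
proof (rule multilinear_eqI[where g = "\<lambda>xs. 0" and k = "length xs"])
  fix bs :: "'v list" assume bs: "length bs = length xs" "set bs \<subseteq> Basis"
  have "\<not> distinct bs"
    using bs assms(2) card_mono[OF finite_Basis bs(2)] distinct_card[of bs] by auto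
  then have "\<not> distinct (map of_vec bs :: 'v cvec list)" by (simp add: distinct_map)
  then show "\<psi> (map of_vec bs) = 0" using assms(1) by (auto simp: ext_forms_iff)
qed (use assms in \<open>auto simp: ext_forms_iff multilinear_def\<close>)

section \<open>The shuffle product by recursion on the arguments\<close>

lemma wedge_Nil: "wedge \<alpha> \<beta> [] = \<alpha> [] * \<beta> []"
  by (simp add: wedge_def)

text \<open>Separates the shuffles that give the first argument to the first factor from those that
  give it to the second.\<close>

lemma sum_Pow_lessThan_Suc:
  "(\<Sum>S\<in>Pow {..<Suc n}. f S) = (\<Sum>T\<in>Pow {..<n}. f (insert 0 (Suc ` T))) + (\<Sum>T\<in>Pow {..<n}. f (Suc ` T))"
  for f :: "nat set \<Rightarrow> 'a::comm_monoid_add"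
proof -
  let ?A = "(\<lambda>T. insert 0 (Suc ` T)) ` Pow {..<n}" and ?B = "(\<lambda>T. Suc ` T) ` Pow {..<n}"
  have inj: "inj_on (\<lambda>T. Suc ` T) X" "inj_on (\<lambda>T. insert 0 (Suc ` T)) X" for X
    by (auto simp: inj_on_def)
  have dj: "?A \<inter> ?B = {}"
    by (metis (no_types, lifting) disjoint_iff imageE insertI1 nat.distinct(1))
  have "Pow {..<Suc n} = ?A \<union> ?B"
  proof (intro equalityI subsetI)
    fix S assume S: "S \<in> Pow {..<Suc n}"
    define T where "T = {j. Suc j \<in> S}"
    have T: "T \<in> Pow {..<n}" using S by (auto simp: T_def)
    have "S = (if 0 \<in> S then insert 0 (Suc ` T) else Suc ` T)"
      by (auto simp: T_def image_iff) (metis not0_implies_Suc)+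
    then show "S \<in> ?A \<union> ?B" using T by (metis UnI1 UnI2 image_eqI)
  qed auto
  then show ?thesis
    by (simp add: sum.union_disjoint[OF _ _ dj] sum.reindex[OF inj(1)] sum.reindex[OF inj(2)])
qed

definition inversions :: "nat \<Rightarrow> nat set \<Rightarrow> nat" where
  "inversions m S = card {(i, j). i < j \<and> j < m \<and> i \<notin> S \<and> j \<in> S}"

lemma inversions_insert_0: "inversions (Suc n) (insert 0 (Suc ` T)) = inversions n T"
proof -
  have "{(i, j). i < j \<and> j < Suc n \<and> i \<notin> insert 0 (Suc ` T) \<and> j \<in> insert 0 (Suc ` T)}
     = (\<lambda>(i, j). (Suc i, Suc j)) ` {(i, j). i < j \<and> j < n \<and> i \<notin> T \<and> j \<in> T}"
  proof (intro equalityI subsetI)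
    fix p assume p: "p \<in> {(i, j). i < j \<and> j < Suc n \<and> i \<notin> insert 0 (Suc ` T) \<and> j \<in> insert 0 (Suc ` T)}"
    then obtain i j where ij: "p = (Suc i, Suc j)" by (cases p; cases "fst p"; cases "snd p") auto
    with p show "p \<in> (\<lambda>(i, j). (Suc i, Suc j)) ` {(i, j). i < j \<and> j < n \<and> i \<notin> T \<and> j \<in> T}" by auto
  qed auto
  then show ?thesis unfolding inversions_def by (simp add: card_image inj_on_def)
qed

text \<open>Position 0 belongs to the second factor and precedes all of \<open>T\<close>, which adds
  one inversion for each element of \<open>T\<close>.\<close>

lemma inversions_Suc_image:
  assumes T: "T \<subseteq> {..<n}"
  shows "inversions (Suc n) (Suc ` T) = card T + inversions n T"
proof -
  have fin: "finite {(i, j). i < j \<and> j < n \<and> i \<notin> T \<and> j \<in> T}"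
    by (rule finite_subset[of _ "{..<n} \<times> {..<n}"]) auto
  have eq: "{(i, j). i < j \<and> j < Suc n \<and> i \<notin> Suc ` T \<and> j \<in> Suc ` T}
     = (\<lambda>j. (0, Suc j)) ` T \<union> (\<lambda>(i, j). (Suc i, Suc j)) ` {(i, j). i < j \<and> j < n \<and> i \<notin> T \<and> j \<in> T}"
    (is "?L = ?R")
  proof (intro equalityI subsetI)
    fix p assume p: "p \<in> ?L"
    then obtain i j where ij: "p = (i, Suc j)" by (cases p; cases "snd p") auto
    with p show "p \<in> ?R" by (cases i) auto
  qed (use T in auto)
  have "card ((\<lambda>j. (0::nat, Suc j)) ` T) = card T" by (simp add: card_image inj_on_def)
  moreover have "card ((\<lambda>(i, j). (Suc i, Suc j)) ` {(i, j). i < j \<and> j < n \<and> i \<notin> T \<and> j \<in> T}) = inversions n T"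
    unfolding inversions_def by (simp add: card_image inj_on_def)
  ultimately show ?thesis
    unfolding inversions_def eq using fin T finite_subset[OF T]
    by (subst card_Un_disjoint) (auto simp: inversions_def)
qed

text \<open>Contraction is a graded derivation: the new inversions counted by the size of the first
  block become the sign \<open>(-1) ^ length ys\<close> on the first factor. Most identities below
  follow from this recursion rather than from shuffle sums.\<close>

lemma wedge_Cons:
  "wedge \<alpha> \<beta> (x # xs) = wedge (interior x \<alpha>) \<beta> xs +
     wedge (\<lambda>ys. (-1) ^ length ys * \<alpha> ys) (interior x \<beta>) xs"
proof -
  let ?n = "length xs"
  let ?I = inversions
  have sh: "{j. Suc j \<in> insert 0 (Suc ` T)} = T" "{j. Suc j \<in> Suc ` T} = T"
    "{j. Suc j \<notin> insert 0 (Suc ` T)} = - T" "{j. Suc j \<notin> Suc ` T} = - T" for T by auto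
  have len: "length (nths xs T) = card T" if "T \<subseteq> {..<?n}" for T
    using that by (auto simp: length_nths intro!: arg_cong[of _ _ card])
  have "wedge \<alpha> \<beta> (x # xs) = (\<Sum>S\<in>Pow {..<Suc ?n}. (-1) ^ ?I (Suc ?n) S * \<alpha> (nths (x # xs) S) * \<beta> (nths (x # xs) (- S)))"
    by (simp add: wedge_def inversions_def)
  also have "\<dots> = (\<Sum>T\<in>Pow {..<?n}. (-1) ^ ?I ?n T * interior x \<alpha> (nths xs T) * \<beta> (nths xs (- T))) +
     (\<Sum>T\<in>Pow {..<?n}. (-1) ^ ?I ?n T * ((-1) ^ length (nths xs T) * \<alpha> (nths xs T)) * interior x \<beta> (nths xs (- T)))"
    unfolding sum_Pow_lessThan_Suc
    by (intro arg_cong2[where f = "(+)"] sum.cong)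
      (auto simp: nths_Cons sh inversions_insert_0 inversions_Suc_image len interior_def power_add mult_ac)
  finally show ?thesis by (simp add: wedge_def inversions_def)
qed

lemma wedge_linear_left:
  "wedge (\<lambda>xs. a * \<alpha> xs + b * \<alpha>' xs) \<beta> xs = a * wedge \<alpha> \<beta> xs + b * wedge \<alpha>' \<beta> xs"
  unfolding wedge_def by (simp add: sum_distrib_left sum.distrib[symmetric] algebra_simps)

lemma wedge_linear_right:
  "wedge \<alpha> (\<lambda>xs. a * \<beta> xs + b * \<beta>' xs) xs = a * wedge \<alpha> \<beta> xs + b * wedge \<alpha> \<beta>' xs"
  unfolding wedge_def by (simp add: sum_distrib_left sum.distrib[symmetric] algebra_simps)

lemma wedge_zero_left: "wedge (\<lambda>xs. 0) \<beta> xs = 0"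
  by (simp add: wedge_def)

lemma wedge_scalar: "wedge (\<lambda>xs. case xs of [] \<Rightarrow> c | _ \<Rightarrow> 0) \<beta> xs = c * \<beta> xs"
proof (induction xs arbitrary: \<beta>)
  case (Cons x xs)
  have 1: "interior x (\<lambda>xs. case xs of [] \<Rightarrow> c | _ \<Rightarrow> 0) = (\<lambda>xs. 0)"
    and 2: "(\<lambda>ys. (-1) ^ length ys * (case ys of [] \<Rightarrow> c | _ \<Rightarrow> 0)) = (\<lambda>xs. case xs of [] \<Rightarrow> c | _ \<Rightarrow> 0)"
    by (auto simp: interior_def fun_eq_iff split: list.split)
  show ?case unfolding wedge_Cons 1 2 wedge_zero_left Cons by (simp add: interior_def)
qed (simp add: wedge_Nil)

abbreviation ewedge :: "'v::real_inner cvec \<Rightarrow> 'v form \<Rightarrow> 'v form" where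
  "ewedge v \<equiv> wedge (metric_form v)"

lemma ewedge_Nil [simp]: "ewedge v \<psi> [] = 0"
  by (simp add: wedge_Nil metric_form_def)

lemma ewedge_Cons: "ewedge v \<psi> (x # xs) = cmetric v x * \<psi> xs - ewedge v (interior x \<psi>) xs"
proof -
  have "interior x (metric_form v) = (\<lambda>xs. case xs of [] \<Rightarrow> cmetric v x | _ \<Rightarrow> 0)"
    and "(\<lambda>ys. (-1) ^ length ys * metric_form v ys) = (\<lambda>ys. (-1) * metric_form v ys + 0 * metric_form v ys)"
    by (auto simp: interior_def metric_form_def fun_eq_iff split: list.split)
  then show ?thesis by (simp only: wedge_Cons wedge_scalar wedge_linear_left) simp
qed

lemma interior_ewedge: "interior x (ewedge v \<psi>) = (\<lambda>xs. cmetric v x * \<psi> xs - ewedge v (interior x \<psi>) xs)"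
  by (simp add: interior_def[of x "ewedge v \<psi>"] ewedge_Cons)

lemma ewedge_linear_vec:
  "ewedge (cscale c x + y) \<psi> xs = c * ewedge x \<psi> xs + ewedge y \<psi> xs"
proof -
  have "metric_form (cscale c x + y) = (\<lambda>xs. c * metric_form x xs + 1 * metric_form y xs)"
    by (auto simp: metric_form_def fun_eq_iff split: list.split)
  then have "wedge (metric_form (cscale c x + y)) \<psi> xs = wedge (\<lambda>xs. c * metric_form x xs + 1 * metric_form y xs) \<psi> xs"
    by (rule arg_cong)
  also have "\<dots> = c * ewedge x \<psi> xs + ewedge y \<psi> xs"
    unfolding wedge_linear_left by (simp only: mult_1)
  finally show ?thesis .
qed

lemma ewedge_zero: "ewedge v (\<lambda>xs. 0) xs = 0"
  by (simp add: wedge_def)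

lemma ewedge_ext_forms:
  fixes v :: "'v::real_inner cvec"
  assumes \<psi>: "\<psi> \<in> ext_forms"
  shows "ewedge v \<psi> \<in> ext_forms"
proof -
  have ml: "multilinear \<psi> \<Longrightarrow> i < length xs \<Longrightarrow>
      ewedge v \<psi> (xs[i := cscale c x + y]) = c * ewedge v \<psi> (xs[i := x]) + ewedge v \<psi> (xs[i := y])"
    for \<psi> xs i c x y
  proof (induction xs arbitrary: \<psi> i)
    case (Cons z zs)
    have int: "interior (cscale c x + y) \<psi> = (\<lambda>xs. c * interior x \<psi> xs + 1 * interior y \<psi> xs)"
      using Cons.prems(1) by (auto simp: interior_def multilinear_Cons)
    show ?case
    proof (cases i)
      case 0
      have "ewedge v (interior (cscale c x + y) \<psi>) zs = c * ewedge v (interior x \<psi>) zs + ewedge v (interior y \<psi>) zs"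
        unfolding int wedge_linear_right by simp
      then show ?thesis by (simp add: 0 ewedge_Cons algebra_simps)
    next
      case (Suc j)
      have "\<psi> (zs[j := cscale c x + y]) = c * \<psi> (zs[j := x]) + \<psi> (zs[j := y])"
        using Cons.prems Suc unfolding multilinear_def by (metis Suc_less_eq length_Cons list_update_code(3) list.size(4) add_Suc_right multilinear_interior multilinear_def interior_def)
      then show ?thesis
        using Cons.IH[OF multilinear_interior[OF Cons.prems(1), of z], of j] Cons.prems(2)
        by (simp add: Suc ewedge_Cons algebra_simps)
    qed
  qed simp
  \<comment> \<open>If a form vanishes on every list containing \<open>z\<close>, then only the term
    in which \<open>v\<close> is paired with this occurrence of \<open>z\<close> survives, with the
    sign of its position.\<close>
  have kill: "(\<And>ys. z \<in> set ys \<Longrightarrow> \<phi> ys = 0) \<Longrightarrow>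
      ewedge v \<phi> (us @ z # vs) = (-1) ^ length us * cmetric v z * \<phi> (us @ vs)" for \<phi> us z vs
  proof (induction us arbitrary: \<phi>)
    case Nil
    then have "interior z \<phi> = (\<lambda>xs. 0)" by (auto simp: interior_def)
    then show ?case by (simp add: ewedge_Cons ewedge_zero)
  next
    case (Cons u us)
    then have "ewedge v (interior u \<phi>) (us @ z # vs) = (-1) ^ length us * cmetric v z * interior u \<phi> (us @ vs)"
      by (intro Cons.IH) (auto simp: interior_def)
    then show ?case using Cons.prems by (simp add: ewedge_Cons) (simp add: interior_def)
  qed
  have alt: "\<psi> \<in> ext_forms \<Longrightarrow> \<not> distinct xs \<Longrightarrow> ewedge v \<psi> xs = 0" for xs \<psi>
  proof (induction xs arbitrary: \<psi>)
    case (Cons z zs)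
    show ?case
    proof (cases "distinct zs")
      case False
      then show ?thesis
        using Cons.IH[OF interior_ext_forms[OF Cons.prems(1), of z]] Cons.prems(1)
        by (simp add: ewedge_Cons ext_forms_iff)
    next
      case True
      \<comment> \<open>The head is repeated in the tail. Contraction with \<open>z\<close>
        satisfies the hypothesis of \<open>kill\<close>, and the surviving term cancels the term
        \<open>cmetric v z * \<psi> zs\<close> of the recursion.\<close>
      then obtain us vs where zs: "zs = us @ z # vs" using Cons.prems(2) by (auto dest: split_list)
      have "ewedge v (interior z \<psi>) (us @ z # vs) = (-1) ^ length us * cmetric v z * interior z \<psi> (us @ vs)"
        using Cons.prems(1) by (intro kill) (auto simp: ext_forms_iff interior_def)
      also have "\<dots> = cmetric v z * \<psi> zs"
        using ext_forms_move[OF Cons.prems(1), of us z vs] by (simp add: zs interior_def)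
      finally show ?thesis by (simp add: ewedge_Cons zs)
    qed
  qed simp
  show ?thesis using ml alt \<psi> unfolding ext_forms_iff multilinear_def by blast
qed

lemma ewedge_anticommute: "ewedge u (ewedge v \<psi>) xs + ewedge v (ewedge u \<psi>) xs = 0"
proof (induction xs arbitrary: \<psi>)
  case (Cons x xs)
  have *: "ewedge u (interior x (ewedge v \<psi>)) xs = cmetric v x * ewedge u \<psi> xs - ewedge u (ewedge v (interior x \<psi>)) xs" for u v
    using wedge_linear_right[of "metric_form u" "cmetric v x" \<psi> "-1" "ewedge v (interior x \<psi>)" xs]
    by (simp add: interior_ewedge)
  have "ewedge u (ewedge v \<psi>) (x # xs) + ewedge v (ewedge u \<psi>) (x # xs) =
      ewedge u (ewedge v (interior x \<psi>)) xs + ewedge v (ewedge u (interior x \<psi>)) xs"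
    by (simp add: ewedge_Cons[of _ "ewedge _ _"] *)
  then show ?case using Cons[of "interior x \<psi>"] by simp
qed simp

section \<open>The operators \<open>nabla\<close>\<close>

lemma nabla_linear_vec:
  "\<psi> \<in> ext_forms \<Longrightarrow> nabla (cscale c x + y) \<psi> xs = c * nabla x \<psi> xs + nabla y \<psi> xs"
  unfolding nabla_def interior_def ewedge_linear_vec ext_forms_Cons(1) by (simp add: algebra_simps)

lemma nabla_functional: "\<psi> \<in> ext_forms \<Longrightarrow> clinear_functional (\<lambda>x. nabla x \<psi> xs)"
  unfolding clinear_functional_def using nabla_linear_vec by blast

lemma nabla_linear:
  "nabla x (\<lambda>xs. a * \<psi> xs + b * \<phi> xs) xs = a * nabla x \<psi> xs + b * nabla x \<phi> xs"
  by (simp add: nabla_def interior_def wedge_linear_right algebra_simps)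

lemma nabla_zero [simp]: "nabla x (\<lambda>xs. 0) = (\<lambda>xs. 0)"
  using nabla_linear[of x 0 "\<lambda>xs. 0" 0 "\<lambda>xs. 0"] by auto

lemma nabla_scale: "nabla x (\<lambda>xs. a * \<psi> xs) xs = a * nabla x \<psi> xs"
  using nabla_linear[of x a \<psi> 0 \<psi>] by simp

lemma nabla_add: "nabla x (\<lambda>xs. \<psi> xs + \<phi> xs) xs = nabla x \<psi> xs + nabla x \<phi> xs"
  using nabla_linear[of x 1 \<psi> 1 \<phi>] by simp

lemma nabla_sum: "nabla x (\<lambda>xs. \<Sum>i\<in>I. \<psi> i xs) xs = (\<Sum>i\<in>I. nabla x (\<psi> i) xs)"
  by (induction I arbitrary: xs rule: infinite_finite_induct) (auto simp: nabla_add)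

lemma nabla_ext_forms: "\<psi> \<in> ext_forms \<Longrightarrow> nabla x \<psi> \<in> ext_forms"
  using ext_forms_linear_comb[OF interior_ext_forms[of \<psi> x] ewedge_ext_forms[of \<psi> x], of 1 "-1/2"]
  by (simp add: nabla_def[abs_def] diff_conv_add_uminus del: add_uminus_conv_diff)

text \<open>Contractions anticommute with each other, and so do exterior multiplications; each of
  the two mixed anticommutators contributes minus half of the metric.\<close>

lemma nabla_anticommute:
  assumes "\<psi> \<in> ext_forms"
  shows "nabla x (nabla y \<psi>) xs + nabla y (nabla x \<psi>) xs = - cmetric x y * \<psi> xs"
proof -
  have n: "nabla y \<psi> = (\<lambda>xs. 1 * interior y \<psi> xs + (-1/2) * ewedge y \<psi> xs)" for y
    by (simp add: nabla_def[abs_def])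
  have nn: "nabla x (nabla y \<psi>) xs = \<psi> (y # x # xs) - 1/2 * (cmetric x y * \<psi> xs - ewedge y (interior x \<psi>) xs)
      - 1/2 * ewedge x (interior y \<psi>) xs + 1/4 * ewedge x (ewedge y \<psi>) xs" for x y
    unfolding n[of y] nabla_linear
    unfolding nabla_def interior_ewedge cmetric_sym[of x y]
    by (simp add: interior_def[of x "\<lambda>xs. \<psi> (y # xs)"] interior_def[of y \<psi>] algebra_simps)
  have "nabla x (nabla y \<psi>) xs + nabla y (nabla x \<psi>) xs =
      (\<psi> (y # x # xs) + \<psi> (x # y # xs)) - cmetric x y * \<psi> xs
      + 1/4 * (ewedge x (ewedge y \<psi>) xs + ewedge y (ewedge x \<psi>) xs)"
    unfolding nn cmetric_sym[of y x] by (simp add: algebra_simps)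
  then show ?thesis
    using ext_forms_swap[OF assms, of x y xs] ewedge_anticommute[of x y \<psi> xs] by simp
qed

section \<open>A bilinear pairing of forms\<close>

lemma form_cnj_ext_forms:
  assumes "\<psi> \<in> ext_forms"
  shows "form_cnj \<psi> \<in> ext_forms"
proof -
  have *: "cvec_cnj (cscale c x + y) = cscale (cnj c) (cvec_cnj x) + cvec_cnj y" for c and x y :: "'a cvec"
    by (simp add: cvec_cnj_def cscale_def prod_eq_iff)
  have "inj (cvec_cnj :: 'a cvec \<Rightarrow> _)" by (auto simp: inj_def cvec_cnj_def prod_eq_iff)
  then have "distinct (map cvec_cnj xs) \<longleftrightarrow> distinct xs" for xs :: "'a cvec list"
    using inj_on_subset[of cvec_cnj UNIV "set xs"] by (simp add: distinct_map)
  moreover have "multilinear (form_cnj \<psi>)"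
    unfolding multilinear_def
  proof (intro allI impI)
    fix xs :: "'a cvec list" and i c x y
    assume i: "i < length xs"
    have "\<psi> ((map cvec_cnj xs)[i := cscale (cnj c) (cvec_cnj x) + cvec_cnj y]) =
        cnj c * \<psi> ((map cvec_cnj xs)[i := cvec_cnj x]) + \<psi> ((map cvec_cnj xs)[i := cvec_cnj y])"
      using assms i unfolding ext_forms_iff multilinear_def by (simp del: split_paired_All)
    then show "form_cnj \<psi> (xs[i := cscale c x + y]) = c * form_cnj \<psi> (xs[i := x]) + form_cnj \<psi> (xs[i := y])"
      unfolding form_cnj_def map_update * by simp
  qed
  ultimately show ?thesis
    using assms by (simp add: ext_forms_iff) (simp add: form_cnj_def)
qed

lemma cvec_cnj_simps [simp]:
  "cvec_cnj (cvec_cnj x) = x" "cvec_cnj (of_vec u) = of_vec u"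
  by (simp_all add: cvec_cnj_def of_vec_def)

lemma interior_form_cnj: "interior x (form_cnj \<psi>) = form_cnj (interior (cvec_cnj x) \<psi>)"
  by (simp add: interior_def form_cnj_def)

lemma cmetric_cnj: "cmetric (cvec_cnj x) (cvec_cnj y) = cnj (cmetric x y)"
  by (simp add: cmetric_def cvec_cnj_def complex_eq_iff inner_simps)

lemma ewedge_form_cnj: "ewedge v (form_cnj \<psi>) xs = cnj (ewedge (cvec_cnj v) \<psi> (map cvec_cnj xs))"
proof (induction xs arbitrary: \<psi>)
  case (Cons x xs)
  have "cmetric v x = cnj (cmetric (cvec_cnj v) (cvec_cnj x))" by (simp add: cmetric_cnj)
  then show ?case
    by (simp add: ewedge_Cons interior_form_cnj Cons) (simp add: form_cnj_def)
qed simp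

lemma nabla_form_cnj: "nabla v (form_cnj \<psi>) = form_cnj (nabla (cvec_cnj v) \<psi>)"
  by (rule ext) (simp add: nabla_def ewedge_form_cnj form_cnj_def[of "nabla _ _"] interior_form_cnj,
      simp add: form_cnj_def)

text \<open>Bilinear rather than Hermitian: conjugation is inserted separately by
  \<open>form_cnj\<close>, so transposes can be computed for complex vectors without conjugates. All
  lists of basis vectors are summed, which on \<open>k\<close>-forms gives \<open>k!\<close> times
  the sum over increasing lists.\<close>

primrec pair :: "nat \<Rightarrow> 'v::euclidean_space form \<Rightarrow> 'v form \<Rightarrow> complex" where
  "pair 0 \<psi> \<phi> = \<psi> [] * \<phi> []"
| "pair (Suc k) \<psi> \<phi> = (\<Sum>b\<in>Basis. pair k (interior (of_vec b) \<psi>) (interior (of_vec b) \<phi>))"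

lemma pair_eq_sum:
  "pair k \<psi> \<phi> = (\<Sum>bs | set bs \<subseteq> Basis \<and> length bs = k. \<psi> (map of_vec bs) * \<phi> (map of_vec bs))"
proof (induction k arbitrary: \<psi> \<phi>)
  case 0
  have "{bs. set bs \<subseteq> (Basis::'a set) \<and> length bs = 0} = {[]}" by auto
  then show ?case by simp
next
  case (Suc k)
  let ?L = "{bs. set bs \<subseteq> (Basis::'a set) \<and> length bs = k}"
  let ?h = "\<lambda>bs. \<psi> (map of_vec bs) * \<phi> (map of_vec bs)"
  have "pair (Suc k) \<psi> \<phi> = (\<Sum>b\<in>Basis. \<Sum>bs\<in>?L. ?h (b # bs))"
    by (simp add: Suc) (simp add: interior_def)
  also have "\<dots> = (\<Sum>(b, bs)\<in>Basis \<times> ?L. ?h (b # bs))" by (rule sum.cartesian_product)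
  also have "\<dots> = (\<Sum>bs\<in>(\<lambda>(b, bs). b # bs) ` (Basis \<times> ?L). ?h bs)"
    by (subst sum.reindex) (auto simp: inj_on_def intro!: sum.cong)
  also have "(\<lambda>(b, bs). b # bs) ` (Basis \<times> ?L) = {bs. set bs \<subseteq> (Basis::'a set) \<and> length bs = Suc k}"
    by (auto simp: length_Suc_conv image_iff)
  finally show ?case .
qed

lemma pair_linear_left:
  "pair k (\<lambda>xs. a * \<psi> xs + b * \<psi>' xs) \<phi> = a * pair k \<psi> \<phi> + b * pair k \<psi>' \<phi>"
  unfolding pair_eq_sum by (simp add: sum_distrib_left sum.distrib[symmetric] algebra_simps)

lemma pair_linear_right:
  "pair k \<psi> (\<lambda>xs. a * \<phi> xs + b * \<phi>' xs) = a * pair k \<psi> \<phi> + b * pair k \<psi> \<phi>'"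
  unfolding pair_eq_sum by (simp add: sum_distrib_left sum.distrib[symmetric] algebra_simps)

lemma pair_commute: "pair k \<psi> \<phi> = pair k \<phi> \<psi>"
  unfolding pair_eq_sum by (simp add: mult.commute)

lemma pair_zero_right: "pair k \<psi> (\<lambda>xs. 0) = 0"
  unfolding pair_eq_sum by simp

lemma pair_sum_right: "pair k \<psi> (\<lambda>xs. \<Sum>i\<in>I. \<phi> i xs) = (\<Sum>i\<in>I. pair k \<psi> (\<phi> i))"
  unfolding pair_eq_sum by (simp add: sum_distrib_left) (rule sum.swap)

lemma pair_uminus_right: "pair k \<psi> (\<lambda>xs. - \<phi> xs) = - pair k \<psi> \<phi>"
  unfolding pair_eq_sum by (simp add: sum_negf)

lemma pair_interior_expand:
  assumes "\<phi> \<in> ext_forms"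
  shows "pair k \<psi> (interior v \<phi>) = (\<Sum>b\<in>Basis. cmetric (of_vec b) v * pair k \<psi> (interior (of_vec b) \<phi>))"
proof -
  have "interior v \<phi> = (\<lambda>xs. \<Sum>b\<in>Basis. cmetric (of_vec b) v * interior (of_vec b) \<phi> xs)"
    unfolding interior_def
    by (rule ext) (rule clinear_functional_expand[OF ext_forms_Cons_functional[OF assms]])
  then have "pair k \<psi> (interior v \<phi>) = (\<Sum>b\<in>Basis. pair k \<psi> (\<lambda>xs. cmetric (of_vec b) v * interior (of_vec b) \<phi> xs + 0 * \<phi> xs))"
    by (simp add: pair_sum_right)
  then show ?thesis unfolding pair_linear_right by simp
qed

text \<open>The factor is the number of positions at which \<open>v\<close> can be paired, since the
  lists are unordered. In the induction the term with \<open>v\<close> in front is separated from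
  those where it is paired further on.\<close>

lemma pair_ewedge:
  "\<phi> \<in> ext_forms \<Longrightarrow> pair (Suc k) (ewedge v \<psi>) \<phi> = of_nat (Suc k) * pair k \<psi> (interior v \<phi>)"
proof (induction k arbitrary: \<psi> \<phi>)
  case 0
  have "pair (Suc 0) (ewedge v \<psi>) \<phi> = (\<Sum>b\<in>Basis. cmetric (of_vec b) v * pair 0 \<psi> (interior (of_vec b) \<phi>))"
    by (simp add: interior_ewedge cmetric_sym[of v] mult.assoc)
  then show ?case using pair_interior_expand[OF 0, of 0 \<psi> v] by simp
next
  case (Suc k)
  let ?e = "of_vec :: 'a \<Rightarrow> _"
  have step: "pair (Suc k) (interior (?e b) (ewedge v \<psi>)) (interior (?e b) \<phi>) =
      cmetric (?e b) v * pair (Suc k) \<psi> (interior (?e b) \<phi>)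
      + of_nat (Suc k) * pair k (interior (?e b) \<psi>) (interior (?e b) (interior v \<phi>))" for b
  proof -
    have "interior (?e b) (ewedge v \<psi>) = (\<lambda>xs. cmetric (?e b) v * \<psi> xs + (-1) * ewedge v (interior (?e b) \<psi>) xs)"
      by (simp add: interior_ewedge cmetric_sym[of v])
    moreover have "interior v (interior (?e b) \<phi>) = (\<lambda>xs. - interior (?e b) (interior v \<phi>) xs)"
      unfolding interior_def by (rule ext) (rule ext_forms_swap[OF Suc.prems])
    ultimately show ?thesis
      by (simp only: pair_linear_left Suc.IH[OF interior_ext_forms[OF Suc.prems]] pair_uminus_right) simp
  qed
  have "pair (Suc (Suc k)) (ewedge v \<psi>) \<phi> = (\<Sum>b\<in>Basis. cmetric (?e b) v * pair (Suc k) \<psi> (interior (?e b) \<phi>))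
      + of_nat (Suc k) * pair (Suc k) \<psi> (interior v \<phi>)"
    by (simp only: pair.simps(2)[of "Suc k" "ewedge v \<psi>"] step sum.distrib sum_distrib_left[symmetric] pair.simps(2)[of k \<psi> "interior v \<phi>"])
  then show ?case unfolding pair_interior_expand[OF Suc.prems, symmetric] by (simp add: algebra_simps)
qed

text \<open>The weights are those of the inner product of forms for the metric \<open>g/2\<close>.\<close>

definition form_pairing :: "'v::euclidean_space form \<Rightarrow> 'v form \<Rightarrow> complex" where
  "form_pairing \<psi> \<phi> = (\<Sum>k\<le>DIM('v). 2 ^ k / fact k * pair k \<psi> \<phi>)"

lemma form_pairing_commute: "form_pairing \<psi> \<phi> = form_pairing \<phi> \<psi>"
  unfolding form_pairing_def by (simp add: pair_commute)

lemma form_pairing_linear_right: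
  "form_pairing \<psi> (\<lambda>xs. a * \<phi> xs + b * \<phi>' xs) = a * form_pairing \<psi> \<phi> + b * form_pairing \<psi> \<phi>'"
  unfolding form_pairing_def pair_linear_right
  by (simp add: sum_distrib_left sum.distrib[symmetric] algebra_simps)

lemma form_pairing_sum_right: "form_pairing \<psi> (\<lambda>xs. \<Sum>i\<in>I. \<phi> i xs) = (\<Sum>i\<in>I. form_pairing \<psi> (\<phi> i))"
  unfolding form_pairing_def pair_sum_right sum_distrib_left by (rule sum.swap)

text \<open>The weights satisfy \<open>c (Suc k) * of_nat (Suc k) = 2 * c k\<close>, which cancels
  the degree-dependent factor of \<open>pair_ewedge\<close> and leaves the constant 2.\<close>

lemma form_pairing_ewedge:
  fixes \<phi> :: "'v::euclidean_space form"
  assumes "\<phi> \<in> ext_forms"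
  shows "form_pairing (ewedge v \<psi>) \<phi> = 2 * form_pairing \<psi> (interior v \<phi>)"
proof -
  define c :: "nat \<Rightarrow> complex" where "c k = 2 ^ k / fact k" for k
  have c: "c (Suc k) * of_nat (Suc k) = 2 * c k" for k
    by (simp add: c_def field_simps del: of_nat_Suc)
  have "form_pairing (ewedge v \<psi>) \<phi> = (\<Sum>k\<in>{..<Suc DIM('v)}. c k * pair k (ewedge v \<psi>) \<phi>)"
    by (simp add: form_pairing_def c_def lessThan_Suc_atMost)
  also have "\<dots> = (\<Sum>k<DIM('v). c (Suc k) * pair (Suc k) (ewedge v \<psi>) \<phi>)"
    unfolding sum.lessThan_Suc_shift by simp
  also have "\<dots> = (\<Sum>k<DIM('v). 2 * (c k * pair k \<psi> (interior v \<phi>)))"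
    unfolding pair_ewedge[OF assms] mult.assoc[symmetric] c ..
  also have "\<dots> = 2 * (\<Sum>k<DIM('v). c k * pair k \<psi> (interior v \<phi>))"
    by (simp add: sum_distrib_left)
  \<comment> \<open>The shift of the index leaves a sum up to \<open>DIM('v) - 1\<close>. The
    missing term evaluates \<open>\<phi>\<close> on more vectors than the dimension, so it may be
    added.\<close>
  also have "pair DIM('v) \<psi> (interior v \<phi>) = 0"
    unfolding pair_eq_sum interior_def
    by (intro sum.neutral ballI) (simp add: ext_forms_above_top[OF assms])
  then have "(\<Sum>k<DIM('v). c k * pair k \<psi> (interior v \<phi>)) = form_pairing \<psi> (interior v \<phi>)"
    by (simp add: form_pairing_def c_def lessThan_Suc_atMost[symmetric])
  finally show ?thesis .
qed

text \<open>\<open>nabla v\<close> is contraction minus half of exterior multiplication, and these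
  two are transposes of each other, so the difference is skew.\<close>

lemma form_pairing_nabla:
  assumes \<psi>: "\<psi> \<in> ext_forms" and \<phi>: "\<phi> \<in> ext_forms"
  shows "form_pairing \<psi> (nabla v \<phi>) = - form_pairing (nabla v \<psi>) \<phi>"
proof -
  have n: "nabla v \<psi> = (\<lambda>xs. 1 * interior v \<psi> xs + (-1/2) * ewedge v \<psi> xs)" for \<psi> :: "'a form"
    by (simp add: nabla_def[abs_def])
  have "form_pairing \<psi> (nabla v \<phi>) = form_pairing \<psi> (interior v \<phi>) - form_pairing \<phi> (interior v \<psi>)"
    unfolding n form_pairing_linear_right form_pairing_commute[of \<psi> "ewedge v \<phi>"] form_pairing_ewedge[OF \<psi>] by simp
  moreover have "form_pairing \<phi> (nabla v \<psi>) = form_pairing \<phi> (interior v \<psi>) - form_pairing \<psi> (interior v \<phi>)"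
    unfolding n form_pairing_linear_right form_pairing_commute[of \<phi> "ewedge v \<psi>"] form_pairing_ewedge[OF \<phi>] by simp
  ultimately show ?thesis by (simp add: form_pairing_commute[of _ \<phi>])
qed

section \<open>Positivity of the pairing\<close>

primrec sqnorm :: "nat \<Rightarrow> 'v::euclidean_space form \<Rightarrow> real" where
  "sqnorm 0 \<psi> = (cmod (\<psi> []))\<^sup>2"
| "sqnorm (Suc k) \<psi> = (\<Sum>b\<in>Basis. sqnorm k (interior (of_vec b) \<psi>))"

lemma sqnorm_nonneg: "0 \<le> sqnorm k \<psi>"
  by (induction k arbitrary: \<psi>) (auto intro: sum_nonneg)

lemma pair_form_cnj: "pair k (form_cnj \<psi>) \<psi> = of_real (sqnorm k \<psi>)"
proof (induction k arbitrary: \<psi>)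
  case 0
  have "cnj (\<psi> []) * \<psi> [] = of_real ((cmod (\<psi> []))\<^sup>2)"
    by (metis complex_norm_square mult.commute)
  then show ?case by (simp add: form_cnj_def)
qed (simp add: interior_form_cnj)

lemma sqnorm_zero:
  "sqnorm k \<psi> = 0 \<Longrightarrow> length bs = k \<Longrightarrow> set bs \<subseteq> Basis \<Longrightarrow> \<psi> (map of_vec bs) = 0"
proof (induction k arbitrary: \<psi> bs)
  case (Suc k)
  then obtain b cs where bs: "bs = b # cs" "length cs = k" by (metis length_Suc_conv)
  have "sqnorm k (interior (of_vec b) \<psi>) = 0"
    using Suc.prems bs sum_nonneg_eq_0_iff[of Basis "\<lambda>b. sqnorm k (interior (of_vec b) \<psi>)"]
    by (auto simp: sqnorm_nonneg)
  then show ?case using Suc.IH[of "interior (of_vec b) \<psi>" cs] Suc.prems bs by (simp add: interior_def)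
qed simp

definition form_sqnorm :: "'v::euclidean_space form \<Rightarrow> real" where
  "form_sqnorm \<psi> = (\<Sum>k\<le>DIM('v). 2 ^ k / fact k * sqnorm k \<psi>)"

lemma form_sqnorm_nonneg: "0 \<le> form_sqnorm \<psi>"
  unfolding form_sqnorm_def by (intro sum_nonneg mult_nonneg_nonneg) (auto simp: sqnorm_nonneg)

lemma form_pairing_cnj: "form_pairing (form_cnj \<psi>) \<psi> = of_real (form_sqnorm \<psi>)"
  unfolding form_pairing_def form_sqnorm_def pair_form_cnj by simp

lemma form_sqnorm_zero:
  fixes \<psi> :: "'v::euclidean_space form"
  assumes "\<psi> \<in> ext_forms" "form_sqnorm \<psi> = 0"
  shows "\<psi> = (\<lambda>xs. 0)"
proof
  fix xs :: "'v cvec list"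
  show "\<psi> xs = 0"
  proof (cases "length xs \<le> DIM('v)")
    case True
    have "2 ^ length xs / fact (length xs) * sqnorm (length xs) \<psi> = 0"
      using assms(2) True unfolding form_sqnorm_def
      by (subst (asm) sum_nonneg_eq_0_iff) (auto simp: sqnorm_nonneg)
    then have z: "sqnorm (length xs) \<psi> = 0" by simp
    show ?thesis
      by (rule multilinear_eqI[where g = "\<lambda>xs. 0" and k = "length xs"])
        (use sqnorm_zero[OF z] assms in \<open>auto simp: ext_forms_iff multilinear_def\<close>)
  next
    case False
    then show ?thesis using ext_forms_above_top[OF assms(1)] by simp
  qed
qed

section \<open>The inner product of forms in components\<close>

lemma wedge_eq_sum_inversions:
  "wedge \<alpha> \<beta> xs = (\<Sum>S\<in>Pow {..<length xs}. (-1) ^ inversions (length xs) S * \<alpha> (nths xs S) * \<beta> (nths xs (- S)))"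
  by (simp add: wedge_def inversions_def)

text \<open>The sign in \<open>wedge\<close> is the sign of the permutation that sorts the arguments
  into the two blocks, so an alternating form absorbs it.\<close>

lemma ext_forms_unshuffle:
  "\<xi> \<in> ext_forms \<Longrightarrow> S \<subseteq> {..<length xs} \<Longrightarrow>
    (-1) ^ inversions (length xs) S * \<xi> (nths xs S @ nths xs (- S)) = \<xi> xs"
proof (induction xs arbitrary: \<xi> S)
  case Nil
  then show ?case by (simp add: inversions_def)
next
  case (Cons x xs)
  define T where "T = {j. Suc j \<in> S}"
  have T: "T \<subseteq> {..<length xs}" using Cons.prems by (auto simp: T_def)
  have len: "length (nths xs T) = card T"
    using T by (auto simp: length_nths intro!: arg_cong[of _ _ card])
  have IH: "(-1) ^ inversions (length xs) T * interior x \<xi> (nths xs T @ nths xs (- T)) = interior x \<xi> xs"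
    by (rule Cons.IH[OF interior_ext_forms[OF Cons.prems(1)] T])
  have co: "{j. Suc j \<notin> S} = - T" by (auto simp: T_def)
  show ?case
  proof (cases "0 \<in> S")
    case True
    then have S: "S = insert 0 (Suc ` T)"
      by (auto simp: T_def image_iff) (metis not0_implies_Suc)
    have "inversions (length (x # xs)) S = inversions (length xs) T"
      unfolding S by (simp add: inversions_insert_0)
    then show ?thesis using IH True by (simp add: nths_Cons T_def[symmetric] co) (simp add: interior_def)
  next
    case False
    then have S: "S = Suc ` T"
      by (auto simp: T_def image_iff) (metis not0_implies_Suc)
    have inv: "inversions (length (x # xs)) S = card T + inversions (length xs) T"
      unfolding S using T by (simp add: inversions_Suc_image)
    have mv: "\<xi> (nths xs T @ x # nths xs (- T)) = (-1) ^ card T * interior x \<xi> (nths xs T @ nths xs (- T))"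
      using ext_forms_move[OF Cons.prems(1), of "nths xs T" x] by (simp add: len interior_def)
    have sgn: "(-1) ^ (m + n) * ((-1) ^ m * a) = (-1) ^ n * a" for m n and a :: complex
      by (simp add: power_add mult_ac)
    have nths: "nths (x # xs) S = nths xs T" "nths (x # xs) (- S) = x # nths xs (- T)"
      using False by (simp_all add: nths_Cons T_def[symmetric] co)
    show ?thesis unfolding nths inv mv sgn IH by (simp add: interior_def)
  qed
qed

text \<open>The sign of the reordering is kept as an anonymous \<open>e\<close> with square 1 that
  is the same for all forms and all tails. It cancels wherever two forms are reordered together, so
  it is never computed.\<close>

lemma ext_forms_permute:
  "mset bs = mset cs \<Longrightarrow> \<exists>e::complex. e * e = 1 \<and> (\<forall>\<psi>\<in>ext_forms. \<forall>ds. \<psi> (bs @ ds) = e * \<psi> (cs @ ds))"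
proof (induction bs arbitrary: cs)
  case (Cons b bs)
  then have "b \<in> set cs" by (metis list.set_intros(1) set_mset_mset)
  then obtain us vs where cs: "cs = us @ b # vs" by (auto dest: split_list)
  with Cons.prems have "mset bs = mset (us @ vs)" by simp
  from Cons.IH[OF this] obtain e :: complex where e: "e * e = 1"
    "\<forall>\<psi>\<in>ext_forms. \<forall>ds. \<psi> (bs @ ds) = e * \<psi> ((us @ vs) @ ds)" by blast
  have "\<psi> ((b # bs) @ ds) = (e * (-1) ^ length us) * \<psi> (cs @ ds)" if \<psi>: "\<psi> \<in> ext_forms" for \<psi> ds
  proof -
    have "\<psi> ((b # bs) @ ds) = e * \<psi> (b # us @ vs @ ds)"
      using e(2)[rule_format, OF interior_ext_forms[OF \<psi>, of b], of ds] by (simp add: interior_def)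
    moreover have "\<psi> (cs @ ds) = (-1) ^ length us * \<psi> (b # us @ vs @ ds)"
      using ext_forms_move[OF \<psi>, of us b "vs @ ds"] by (simp add: cs)
    ultimately show ?thesis by (simp flip: power_mult_distrib)
  qed
  moreover have "(e * (-1) ^ length us) * (e * (-1) ^ length us) = 1"
    using e(1) by (simp add: mult_ac flip: power_mult_distrib)
  ultimately show ?case by blast
qed (auto intro!: exI[of _ 1])

text \<open>On real vectors a complex-linear functional is real-linear, so agreement on a real
  spanning set extends to the real space and from there to its complexification.\<close>

lemma spanning_functional_eq:
  fixes B :: "'v::euclidean_space set" and f g :: "'v cvec \<Rightarrow> complex"
  assumes sp: "span B = UNIV" and f: "clinear_functional f" and g: "clinear_functional g"
    and eq: "\<And>e. e \<in> of_vec ` B \<Longrightarrow> f e = g e"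
  shows "f z = g z"
proof -
  have lin: "linear (\<lambda>v. h (of_vec v))" if "clinear_functional h" for h :: "'v cvec \<Rightarrow> complex"
  proof
    fix v w :: 'v and r :: real
    have "(of_vec (v + w) :: 'v cvec) = cscale 1 (of_vec v) + of_vec w" by (simp add: of_vec_def cscale_def)
    then show "h (of_vec (v + w)) = h (of_vec v) + h (of_vec w)"
      using that unfolding clinear_functional_def by (metis mult_1)
    have "(of_vec (r *\<^sub>R v) :: 'v cvec) = cscale (of_real r) (of_vec v) + 0" by (simp add: of_vec_def cscale_def)
    then show "h (of_vec (r *\<^sub>R v)) = r *\<^sub>R h (of_vec v)"
      using that clinear_functional_zero[OF that] unfolding clinear_functional_def
      by (metis add.right_neutral scaleR_conv_of_real)
  qed
  have "f (of_vec v) = g (of_vec v)" for v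
    using linear_eq_on_span[OF lin[OF f] lin[OF g], of B] eq sp by auto
  then show ?thesis using clinear_functional_expand[OF f, of z] clinear_functional_expand[OF g, of z] by simp
qed

lemma independent_spanning:
  fixes B :: "'v::euclidean_space set"
  assumes "independent B" "card B = DIM('v)"
  shows "span B = UNIV"
  using card_ge_dim_independent[of B UNIV] assms by auto

lemma orthonormal_basis_span:
  fixes es :: "'v::euclidean_space list"
  assumes es: "orthonormal_basis es"
  shows "span (set es) = UNIV" "distinct es"
proof -
  have len: "length es = DIM('v)"
    and on: "\<And>i j. i < length es \<Longrightarrow> j < length es \<Longrightarrow> es ! i \<bullet> es ! j = (if i = j then 1 else 0)"
    using es by (auto simp: orthonormal_basis_def)
  show dist: "distinct es"
    unfolding distinct_conv_nth using on by (metis zero_neq_one)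
  have "pairwise orthogonal (set es)"
    unfolding pairwise_def orthogonal_def using on by (metis in_set_conv_nth)
  moreover have "0 \<notin> set es" using on by (metis in_set_conv_nth inner_zero_left zero_neq_one)
  ultimately have ind: "independent (set es)" by (rule pairwise_orthogonal_independent)
  then show "span (set es) = UNIV"
    using dist len by (intro independent_spanning) (auto simp: distinct_card)
qed

lemma nths_complement_disjoint:
  assumes "distinct xs" "S \<subseteq> {..<length xs}" "set bs \<subseteq> set xs" "set bs \<inter> set (nths xs (- S)) = {}"
  shows "{i. i < length xs \<and> xs ! i \<in> set bs} \<subseteq> S"
  using assms by (auto simp: set_nths)

text \<open>Both sides are multilinear in \<open>xs\<close>; on basis vectors only one shuffle survives.\<close>

lemma shuffle_sum:
  fixes es :: "'v::euclidean_space list"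
  assumes es: "orthonormal_basis es" and \<psi>: "\<psi> \<in> ext_forms" and \<xi>: "\<xi> \<in> ext_forms"
    and len: "length xs = k"
  defines "E \<equiv> map of_vec es"
  shows "(\<Sum>S | S \<subseteq> {..<DIM('v)} \<and> card S = k. (-1) ^ inversions DIM('v) S * \<psi> (nths E S) * \<xi> (xs @ nths E (- S)))
    = \<psi> xs * \<xi> E"
proof -
  let ?N = "DIM('v)"
  let ?P = "{S. S \<subseteq> {..<?N} \<and> card S = k}"
  let ?f = "\<lambda>xs. \<Sum>S\<in>?P. (-1) ^ inversions ?N S * \<psi> (nths E S) * \<xi> (xs @ nths E (- S))"
  have lenE: "length E = ?N" using es by (simp add: E_def orthonormal_basis_def)
  have "distinct es" by (rule orthonormal_basis_span[OF es])
  then have dist: "distinct E" by (simp add: E_def distinct_map inj_on_def of_vec_def)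
  have finP: "finite ?P" by (rule finite_subset[of _ "Pow {..<?N}"]) auto
  have m\<xi>: "multilinear \<xi>" and m\<psi>: "multilinear \<psi>" using \<xi> \<psi> by (auto simp: ext_forms_iff)
  show ?thesis
  proof (rule multilinear_eqI_spanning[where E = "set E" and k = k and f = ?f and g = "\<lambda>xs. \<psi> xs * \<xi> E"])
    show "f z = g z" if "clinear_functional f" "clinear_functional g" "\<And>e. e \<in> set E \<Longrightarrow> f e = g e" for f g and z :: "'v cvec"
      by (rule spanning_functional_eq[OF orthonormal_basis_span(1)[OF es] that(1,2)]) (use that(3) in \<open>auto simp: E_def\<close>)
    show "multilinear (\<lambda>xs. \<psi> xs * \<xi> E)"
      using m\<psi> unfolding multilinear_def by (simp add: algebra_simps del: split_paired_All)
    have "multilinear (\<lambda>xs. \<xi> (xs @ r))" for r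
      unfolding multilinear_def
    proof (intro allI impI)
      fix xs :: "'v cvec list" and i c x y assume "i < length xs"
      then show "\<xi> (xs[i := cscale c x + y] @ r) = c * \<xi> (xs[i := x] @ r) + \<xi> (xs[i := y] @ r)"
        using m\<xi>[unfolded multilinear_def, rule_format, of i "xs @ r" c x y] by (simp add: list_update_append1)
    qed
    then show "multilinear ?f"
      unfolding multilinear_def by (simp add: sum_distrib_left sum.distrib[symmetric] algebra_simps del: split_paired_All)
    fix bs assume bs: "length bs = k" "set bs \<subseteq> set E"
    show "?f bs = \<psi> bs * \<xi> E"
    proof (cases "distinct bs")
      case False
      then have "\<xi> (bs @ r) = 0" "\<psi> bs = 0" for r using \<xi> \<psi> by (auto simp: ext_forms_iff)
      then show ?thesis by simp
    next
      case True
      \<comment> \<open>The positions in \<open>E\<close> of the vectors in \<open>bs\<close>. For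
        any other block of this size the complement repeats one of these vectors, and
        \<open>\<xi>\<close> vanishes.\<close>
      define S0 where "S0 = {i. i < ?N \<and> E ! i \<in> set bs}"
      have S0: "S0 \<subseteq> {..<?N}" by (auto simp: S0_def)
      have setS0: "set (nths E S0) = set bs"
        using bs(2) by (force simp: set_nths S0_def lenE in_set_conv_nth)
      have "card S0 = length (nths E S0)"
        using S0 by (auto simp: length_nths lenE intro!: arg_cong[of _ _ card])
      also have "\<dots> = card (set bs)"
        using distinct_card[OF distinct_nthsI[OF dist]] setS0 by metis
      also have "\<dots> = k" using True bs(1) distinct_card by metis
      finally have cS0: "card S0 = k" .
      have zero: "\<xi> (bs @ nths E (- S)) = 0" if S: "S \<in> ?P - {S0}" for S
      proof -
        have "set bs \<inter> set (nths E (- S)) \<noteq> {}"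
        proof
          assume "set bs \<inter> set (nths E (- S)) = {}"
          then have "S0 \<subseteq> S"
            using nths_complement_disjoint[OF dist _ bs(2)] S by (auto simp: lenE S0_def)
          moreover have "finite S" using S finite_subset[of S "{..<?N}"] by auto
          ultimately have "S0 = S" using S cS0 by (intro card_subset_eq) auto
          then show False using S by simp
        qed
        then have "\<not> distinct (bs @ nths E (- S))" by auto
        then show ?thesis using \<xi> by (auto simp: ext_forms_iff)
      qed
      have "?f bs = (\<Sum>S\<in>{S0}. (-1) ^ inversions ?N S * \<psi> (nths E S) * \<xi> (bs @ nths E (- S)))"
        by (rule sum.mono_neutral_right[OF finP]) (use S0 cS0 zero in auto)
      also have "\<dots> = (-1) ^ inversions ?N S0 * \<psi> (nths E S0) * \<xi> (bs @ nths E (- S0))" by simp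
      also have "\<dots> = \<psi> bs * ((-1) ^ inversions ?N S0 * \<xi> (nths E S0 @ nths E (- S0)))"
      proof -
        \<comment> \<open>Putting \<open>bs\<close> into the order of \<open>E\<close> changes
          \<open>\<psi>\<close> and \<open>\<xi>\<close> by the same sign, so the product is
          unchanged.\<close>
        have "mset bs = mset (nths E S0)"
          using True setS0 distinct_nthsI[OF dist] set_eq_iff_mset_eq_distinct by metis
        from ext_forms_permute[OF this] obtain e :: complex where e: "e * e = 1"
          "\<forall>\<psi>\<in>ext_forms. \<forall>ds. \<psi> (bs @ ds) = e * \<psi> (nths E S0 @ ds)" by blast
        have "\<psi> bs = e * \<psi> (nths E S0)" using e(2)[rule_format, OF \<psi>, of "[]"] by simp
        then show ?thesis using e(2)[rule_format, OF \<xi>, of "nths E (- S0)"] by (simp add: mult_ac)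
      qed
      also have "\<dots> = \<psi> bs * \<xi> E" using ext_forms_unshuffle[OF \<xi>, of S0 E] S0 by (simp add: lenE)
      finally show ?thesis .
    qed
  qed (fact len)
qed

lemma ext_forms_scale_all:
  "\<psi> \<in> ext_forms \<Longrightarrow> \<psi> (map (\<lambda>b. of_vec (r *\<^sub>R b)) bs @ ys) = of_real r ^ length bs * \<psi> (map of_vec bs @ ys)"
proof (induction bs arbitrary: \<psi>)
  case (Cons b bs)
  have "(of_vec (r *\<^sub>R b) :: 'a cvec) = cscale (of_real r) (of_vec b)"
    by (simp add: of_vec_def cscale_def)
  then show ?case
    using Cons.IH[OF interior_ext_forms[OF Cons.prems, of "of_vec b"]]
    by (simp add: ext_forms_Cons(3)[OF Cons.prems]) (simp add: interior_def)
qed simp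

text \<open>If the volume form is -1 on the standard basis, reversing the first vector makes it 1.
  This existence gives meaning to the choice in \<open>form_inner\<close>.\<close>

lemma volume_form_positive_basis:
  fixes vol :: "'v::euclidean_space form"
  assumes "volume_form vol"
  shows "\<exists>es. orthonormal_basis es \<and> vol (map of_vec es) = 1"
proof -
  obtain bs :: "'v list" where bs: "set bs = Basis" "distinct bs" using finite_distinct_list[OF finite_Basis] by auto
  have ob: "orthonormal_basis bs"
    unfolding orthonormal_basis_def
    using bs distinct_card[OF bs(2)] by (auto simp: nth_eq_iff_index_eq inner_not_same_Basis inner_same_Basis
        dest: nth_mem intro!: inner_Basis[THEN trans])
  then have v: "vol (map of_vec bs) \<in> {1, -1}" and ext: "vol \<in> ext_forms"
    using assms by (auto simp: volume_form_def)
  obtain b cs where b: "bs = b # cs" using bs(1) nonempty_Basis by (metis list.exhaust list.set(1))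
  have "orthonormal_basis ((- b) # cs)"
    unfolding orthonormal_basis_def
  proof (intro conjI allI impI)
    have sg: "((- b) # cs) ! i = (if i = 0 then -1 else 1) *\<^sub>R (b # cs) ! i" for i
      by (cases i) auto
    fix i j assume "i < length ((- b) # cs)" "j < length ((- b) # cs)"
    then have "(b # cs) ! i \<bullet> (b # cs) ! j = (if i = j then 1 else 0)"
      using ob by (simp add: b orthonormal_basis_def)
    then show "((- b) # cs) ! i \<bullet> ((- b) # cs) ! j = (if i = j then 1 else 0)"
      unfolding sg inner_scaleR_left inner_scaleR_right by simp
  qed (use ob in \<open>simp add: b orthonormal_basis_def\<close>)
  moreover have "(of_vec (- b) :: 'v cvec) = cscale (-1) (of_vec b)" by (simp add: of_vec_def cscale_def)
  then have "vol (map of_vec ((- b) # cs)) = - vol (map of_vec bs)"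
    using ext_forms_Cons(3)[OF ext, of "-1" "of_vec b"] by (simp add: b del: cscale_simps)
  ultimately show ?thesis using v ob by (metis empty_iff insert_iff minus_minus)
qed

text \<open>Vectors orthonormal for \<open>g/2\<close> are longer by \<open>sqrt 2\<close>. In
  degree \<open>k\<close> this factor occurs \<open>k\<close> times in \<open>\<phi>\<close> and
  \<open>k\<close> times in the volume form, which gives \<open>2 ^ k\<close>; passing to the volume
  form of \<open>g/2\<close> costs \<open>sqrt (1/2) ^ DIM('v)\<close>, a factor common to all
  degrees. The shuffles are removed by \<open>shuffle_sum\<close>.\<close>

lemma form_inner_eq:
  fixes vol :: "'v::euclidean_space form"
  assumes vol: "volume_form vol" and \<psi>: "\<psi> \<in> ext_forms" and \<phi>: "\<phi> \<in> ext_forms"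
  shows "form_inner vol \<psi> \<phi> = of_real (sqrt (1/2) ^ DIM('v)) * form_pairing (form_cnj \<psi>) \<phi>"
proof -
  let ?N = "DIM('v)"
  define es where "es = (SOME es. orthonormal_basis es \<and> vol (map of_vec es) = 1)"
  have es: "orthonormal_basis es" "vol (map of_vec es) = 1"
    using someI_ex[OF volume_form_positive_basis[OF vol]] by (auto simp: es_def)
  define E where "E = map of_vec es"
  have lenE: "length E = ?N" using es by (simp add: E_def orthonormal_basis_def)
  have ext: "vol \<in> ext_forms" using vol by (simp add: volume_form_def)
  define q :: complex where "q = of_real (sqrt (1/2) ^ ?N)"
  define L where "L k = {bs. set bs \<subseteq> (Basis::'v set) \<and> length bs = k}" for k
  have finL: "finite (L k)" for k unfolding L_def by (rule finite_lists_length_eq) simp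
  have hodge: "hodge (1/2) vol \<phi> (nths E (- S)) =
      q * (2 ^ card S / fact (card S)) * (\<Sum>bs\<in>L (card S). \<phi> (map of_vec bs) * vol (map of_vec bs @ nths E (- S)))"
    if S: "S \<subseteq> {..<?N}" for S
  proof -
    have "length (nths E (- S)) = card ({..<?N} - S)"
      by (auto simp: length_nths lenE intro!: arg_cong[of _ _ card])
    also have "\<dots> = ?N - card S" using S by (simp add: card_Diff_subset finite_subset)
    finally have k: "?N - length (nths E (- S)) = card S"
      using S card_mono[OF _ S] by simp
    let ?r = "inverse (sqrt (1/2))"
    have r2: "(of_real ?r :: complex) ^ m * of_real ?r ^ m = 2 ^ m" for m
    proof -
      have "?r * ?r = 2" by (simp add: real_sqrt_divide)
      then have "(of_real ?r :: complex) * of_real ?r = 2" by (metis of_real_mult of_real_numeral)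
      then show ?thesis by (metis power_mult_distrib)
    qed
    have "hodge (1/2) vol \<phi> (nths E (- S)) = (\<Sum>bs\<in>L (card S).
        \<phi> (map (\<lambda>b. of_vec (?r *\<^sub>R b)) bs) * (q * vol (map (\<lambda>b. of_vec (?r *\<^sub>R b)) bs @ nths E (- S)))) / fact (card S)"
      unfolding hodge_def Let_def k L_def q_def ..
    also have "(\<Sum>bs\<in>L (card S).
        \<phi> (map (\<lambda>b. of_vec (?r *\<^sub>R b)) bs) * (q * vol (map (\<lambda>b. of_vec (?r *\<^sub>R b)) bs @ nths E (- S))))
      = (\<Sum>bs\<in>L (card S). q * 2 ^ card S * (\<phi> (map of_vec bs) * vol (map of_vec bs @ nths E (- S))))"
    proof (rule sum.cong[OF refl])
      fix bs assume "bs \<in> L (card S)"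
      then have l: "length bs = card S" by (simp add: L_def)
      show "\<phi> (map (\<lambda>b. of_vec (?r *\<^sub>R b)) bs) * (q * vol (map (\<lambda>b. of_vec (?r *\<^sub>R b)) bs @ nths E (- S)))
         = q * 2 ^ card S * (\<phi> (map of_vec bs) * vol (map of_vec bs @ nths E (- S)))"
        using ext_forms_scale_all[OF \<phi>, of ?r bs "[]"] ext_forms_scale_all[OF ext, of ?r bs "nths E (- S)"] l
        unfolding r2[symmetric] by (simp add: mult_ac)
    qed
    finally show ?thesis by (simp add: sum_distrib_left[symmetric])
  qed
  define h where "h S = (-1) ^ inversions ?N S * form_cnj \<psi> (nths E S) * hodge (1/2) vol \<phi> (nths E (- S))" for S
  have "form_inner vol \<psi> \<phi> = (\<Sum>S\<in>Pow {..<?N}. h S)"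
    unfolding form_inner_def es_def[symmetric] E_def[symmetric] wedge_eq_sum_inversions lenE h_def ..
  \<comment> \<open>Grouping by the size of the block given to the first factor, which is the degree
    in which the forms are paired.\<close>
  also have "\<dots> = (\<Sum>k\<le>?N. \<Sum>S\<in>{S \<in> Pow {..<?N}. card S = k}. h S)"
    using card_mono[of "{..<?N}"] by (intro sum.group[symmetric]) auto
  also have "\<dots> = (\<Sum>k\<le>?N. q * (2 ^ k / fact k * pair k (form_cnj \<psi>) \<phi>))"
  proof (rule sum.cong[OF refl])
    fix k
    let ?P = "{S. S \<subseteq> {..<?N} \<and> card S = k}"
    let ?t = "\<lambda>S bs. (-1) ^ inversions ?N S * form_cnj \<psi> (nths E S) * vol (map of_vec bs @ nths E (- S))"
    have "(\<Sum>S\<in>{S \<in> Pow {..<?N}. card S = k}. h S) =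
      (\<Sum>S\<in>?P. \<Sum>bs\<in>L k. q * (2 ^ k / fact k) * \<phi> (map of_vec bs) * ?t S bs)"
      by (rule sum.cong) (auto simp: h_def hodge sum_distrib_left mult_ac)
    also have "\<dots> = (\<Sum>bs\<in>L k. \<Sum>S\<in>?P. q * (2 ^ k / fact k) * \<phi> (map of_vec bs) * ?t S bs)"
      by (rule sum.swap)
    also have "\<dots> = (\<Sum>bs\<in>L k. q * (2 ^ k / fact k) * \<phi> (map of_vec bs) * form_cnj \<psi> (map of_vec bs))"
    proof (rule sum.cong[OF refl])
      fix bs assume "bs \<in> L k"
      then have "length (map of_vec bs :: 'v cvec list) = k" by (simp add: L_def)
      from shuffle_sum[OF es(1) form_cnj_ext_forms[OF \<psi>] ext this]
      have "(\<Sum>S\<in>?P. ?t S bs) = form_cnj \<psi> (map of_vec bs)" by (simp add: E_def es)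
      then show "(\<Sum>S\<in>?P. q * (2 ^ k / fact k) * \<phi> (map of_vec bs) * ?t S bs)
        = q * (2 ^ k / fact k) * \<phi> (map of_vec bs) * form_cnj \<psi> (map of_vec bs)"
        by (simp only: sum_distrib_left[symmetric])
    qed
    also have "\<dots> = q * (2 ^ k / fact k * pair k (form_cnj \<psi>) \<phi>)"
      unfolding pair_eq_sum L_def[symmetric] by (simp add: sum_distrib_left mult_ac)
    finally show "(\<Sum>S\<in>{S \<in> Pow {..<?N}. card S = k}. h S) = q * (2 ^ k / fact k * pair k (form_cnj \<psi>) \<phi>)" .
  qed
  also have "\<dots> = q * form_pairing (form_cnj \<psi>) \<phi>" by (simp add: form_pairing_def sum_distrib_left)
  finally show ?thesis by (simp add: q_def)
qed

section \<open>Tangent vectors of the space of complex structures\<close>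

text \<open>The form and its conjugate agree on lists of standard basis vectors, where the values
  are 1, -1 or 0. The orientation condition on complex structures concerns a real part, and with
  this a nonzero value has a nonzero real part.\<close>

lemma volume_form_real:
  fixes vol :: "'v::euclidean_space form"
  assumes vol: "volume_form vol"
  shows "Im (vol (map of_vec vs)) = 0"
proof -
  have ext: "vol \<in> ext_forms" and deg: "\<And>xs. length xs \<noteq> DIM('v) \<Longrightarrow> vol xs = 0"
    using vol by (auto simp: volume_form_def)
  have "form_cnj vol (map of_vec vs) = vol (map of_vec vs)"
  proof (rule multilinear_eqI)
    fix bs :: "'v list" assume bs: "length bs = length vs" "set bs \<subseteq> Basis"
    have "cnj (vol (map of_vec bs)) = vol (map of_vec bs)"
    proof (cases "distinct bs \<and> length bs = DIM('v)")
      case True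
      then have "orthonormal_basis bs"
        using bs(2) unfolding orthonormal_basis_def
        by (auto simp: nth_eq_iff_index_eq inner_not_same_Basis subset_iff)
      then have "vol (map of_vec bs) \<in> {1, -1}" using vol by (auto simp: volume_form_def)
      then show ?thesis by auto
    next
      case False
      then have "vol (map of_vec bs) = 0"
        using deg[of "map of_vec bs"] ext by (auto simp: ext_forms_iff distinct_map)
      then show ?thesis by simp
    qed
    then show "form_cnj vol (map of_vec bs) = vol (map of_vec bs)" by (simp add: form_cnj_def comp_def)
  qed (use ext form_cnj_ext_forms[OF ext] in \<open>auto simp: ext_forms_iff\<close>)
  then have "cnj (vol (map of_vec vs)) = vol (map of_vec vs)" by (simp add: form_cnj_def comp_def)
  then show ?thesis by (metis Reals_cnj_iff complex_is_Real_iff)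
qed

text \<open>Vanishing on one basis would imply vanishing on all lists of that length, by expansion
  in this basis, against the value 1 on a positive orthonormal basis.\<close>

lemma volume_form_nonzero:
  fixes vol :: "'v::euclidean_space form"
  assumes vol: "volume_form vol" and vs: "distinct vs" "independent (set vs)" "length vs = DIM('v)"
  shows "vol (map of_vec vs) \<noteq> 0"
proof
  assume z: "vol (map of_vec vs) = 0"
  have ext: "vol \<in> ext_forms" using vol by (auto simp: volume_form_def)
  have sp: "span (set vs) = UNIV"
    using vs by (intro independent_spanning) (auto simp: distinct_card)
  obtain es where es: "orthonormal_basis es" "vol (map of_vec es) = 1"
    using volume_form_positive_basis[OF vol] by blast
  have dist: "distinct (map of_vec vs :: 'v cvec list)"
    using vs(1) by (simp add: distinct_map inj_on_def of_vec_def)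
  have "vol (map of_vec es) = 0"
  proof (rule multilinear_eqI_spanning[where E = "of_vec ` set vs" and k = "DIM('v)" and g = "\<lambda>xs. 0"])
    fix bs :: "'v cvec list" assume bs: "length bs = DIM('v)" "set bs \<subseteq> of_vec ` set vs"
    show "vol bs = 0"
    proof (cases "distinct bs")
      case True
      have "set bs = set (map of_vec vs)"
        using bs True distinct_card[OF dist] distinct_card[OF True] vs(3) by (intro card_subset_eq) auto
      then have "mset bs = mset (map of_vec vs)"
        using True dist set_eq_iff_mset_eq_distinct by blast
      from ext_forms_permute[OF this] obtain e :: complex where
        "\<forall>\<psi>\<in>ext_forms. \<forall>ds. \<psi> (bs @ ds) = e * \<psi> (map of_vec vs @ ds)" by blast
      from this[rule_format, OF ext, of "[]"] show ?thesis using z by simp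
    qed (use ext in \<open>simp add: ext_forms_iff\<close>)
  qed (use ext es spanning_functional_eq[OF sp] in \<open>auto simp: ext_forms_iff multilinear_def orthonormal_basis_def\<close>)
  then show False using es by simp
qed

lemma complex_structure_square: "J \<in> complex_structures vol \<Longrightarrow> blinfun_apply J (blinfun_apply J x) = - x"
  and complex_structure_isometry:
    "J \<in> complex_structures vol \<Longrightarrow> blinfun_apply J x \<bullet> blinfun_apply J y = x \<bullet> y"
  by (auto simp: complex_structures_def)

lemma complex_structure_skew:
  "J \<in> complex_structures vol \<Longrightarrow> blinfun_apply J x \<bullet> y = - (x \<bullet> blinfun_apply J y)"
  by (metis complex_structure_square complex_structure_isometry inner_minus_right minus_minus)

text \<open>The equations for an orthogonal complex structure, linearised at \<open>J\<close>. The
  orientation is locally constant and contributes no equation.\<close>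

definition skew_anticommuting :: "('v::euclidean_space \<Rightarrow>\<^sub>L 'v) \<Rightarrow> ('v \<Rightarrow>\<^sub>L 'v) \<Rightarrow> bool" where
  "skew_anticommuting J A \<longleftrightarrow>
     (\<forall>x. blinfun_apply A (blinfun_apply J x) = - blinfun_apply J (blinfun_apply A x)) \<and>
     (\<forall>x y. blinfun_apply A x \<bullet> y = - (x \<bullet> blinfun_apply A y))"

lemma tangent_skew_anticommuting:
  assumes "A \<in> tangent (complex_structures vol) J"
  shows "skew_anticommuting J A"
proof -
  obtain \<gamma> :: "real \<Rightarrow> _" where g: "\<And>t. \<gamma> t \<in> complex_structures vol" "\<gamma> 0 = J"
    "(\<gamma> has_vector_derivative A) (at 0)"
    using assms by (auto simp: tangent_def)
  have d: "((\<lambda>t. blinfun_apply (\<gamma> t) x) has_vector_derivative blinfun_apply A x) (at 0)" for x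
    using bounded_linear.has_vector_derivative[OF blinfun.bounded_linear_left g(3)] .
  have J: "blinfun_apply J (blinfun_apply J x) = - x" "blinfun_apply J x \<bullet> blinfun_apply J y = x \<bullet> y" for x y
    using g(1)[of 0] g(2) by (auto simp: complex_structures_def)
  have 1: "blinfun_apply A (blinfun_apply J x) = - blinfun_apply J (blinfun_apply A x)" for x
  proof -
    have "((\<lambda>t. blinfun_apply (\<gamma> t) (blinfun_apply (\<gamma> t) x)) has_vector_derivative
        blinfun_apply (\<gamma> 0) (blinfun_apply A x) + blinfun_apply A (blinfun_apply (\<gamma> 0) x)) (at 0)"
      by (rule bounded_bilinear.has_vector_derivative[OF bounded_bilinear_blinfun_apply g(3) d])
    moreover have "(\<lambda>t. blinfun_apply (\<gamma> t) (blinfun_apply (\<gamma> t) x)) = (\<lambda>t. - x)"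
      using g(1) by (simp add: complex_structures_def)
    ultimately have "blinfun_apply J (blinfun_apply A x) + blinfun_apply A (blinfun_apply J x) = 0"
      using g(2) has_vector_derivative_const vector_derivative_unique_at by metis
    then show ?thesis by (simp add: eq_neg_iff_add_eq_0 add.commute)
  qed
  have 2: "blinfun_apply A x \<bullet> y = - (x \<bullet> blinfun_apply A y)" for x y
  proof -
    have "((\<lambda>t. blinfun_apply (\<gamma> t) x \<bullet> blinfun_apply (\<gamma> t) w) has_vector_derivative
        blinfun_apply (\<gamma> 0) x \<bullet> blinfun_apply A w + blinfun_apply A x \<bullet> blinfun_apply (\<gamma> 0) w) (at 0)" for w
      by (rule bounded_bilinear.has_vector_derivative[OF bounded_bilinear_inner d d])
    moreover have "(\<lambda>t. blinfun_apply (\<gamma> t) x \<bullet> blinfun_apply (\<gamma> t) w) = (\<lambda>t. x \<bullet> w)" for w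
      using g(1) by (simp add: complex_structures_def)
    ultimately have *: "blinfun_apply J x \<bullet> blinfun_apply A w + blinfun_apply A x \<bullet> blinfun_apply J w = 0" for w
      using g(2) has_vector_derivative_const vector_derivative_unique_at by metis
    have "blinfun_apply J x \<bullet> blinfun_apply A (blinfun_apply J y) = - (x \<bullet> blinfun_apply A y)"
      by (simp add: 1 J)
    then show ?thesis using *[of "blinfun_apply J y"] by (simp add: J inner_minus_right)
  qed
  show ?thesis using 1 2 by (simp add: skew_anticommuting_def)
qed

text \<open>For \<open>G = - A J / 2\<close>, the curve \<open>(1 + t G) J (1 + t G)\<^sup>-\<^sup>1\<close> of complex structures has velocity \<open>A\<close>
  at \<open>0\<close>.\<close>

lemma skew_anticommuting_tangent:
  fixes vol :: "'v::euclidean_space form"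
  assumes vol: "volume_form vol" and J: "J \<in> complex_structures vol" and A: "skew_anticommuting J A"
  shows "A \<in> tangent (complex_structures vol) J"
proof -
  define j where "j = blinfun_apply J"
  define a where "a = blinfun_apply A"
  have lj: "linear j" and la: "linear a" unfolding j_def a_def by (rule bounded_linear.linear[OF blinfun.bounded_linear_right])+
  note lin = linear_add[OF lj] linear_add[OF la] linear_cmul[OF lj] linear_cmul[OF la] linear_neg[OF lj] linear_neg[OF la]
  have jj: "j (j x) = - x" and jiso: "j x \<bullet> j y = x \<bullet> y" for x y
    using J by (auto simp: j_def complex_structures_def)
  have aj: "a (j x) = - j (a x)" and ask: "a x \<bullet> y = - (x \<bullet> a y)" for x y
    using A by (auto simp: a_def j_def skew_anticommuting_def)
  have jsk: "j x \<bullet> y = - (x \<bullet> j y)" for x y by (metis jj jiso inner_minus_right minus_minus)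
  have or: "0 < Re (vol (map of_vec (concat (map (\<lambda>v. [v, blinfun_apply J v]) vs))))"
    if "2 * length vs = DIM('v)" "distinct (concat (map (\<lambda>v. [v, blinfun_apply J v]) vs))"
      "independent (set (concat (map (\<lambda>v. [v, blinfun_apply J v]) vs)))" for vs
    using J that unfolding complex_structures_def Let_def by blast
  \<comment> \<open>Chosen to be skew with commutator \<open>G J - J G = A\<close> (see
    \<open>comm\<close>), the velocity at 0 of conjugating \<open>J\<close> by
    \<open>1 + t G\<close>.\<close>
  define G where "G x = - (1/2) *\<^sub>R a (j x)" for x
  have lG: "linear G" unfolding G_def
    by (intro linear_compose_scale_right linear_compose[OF lj la, unfolded comp_def] linear_compose_neg)
  have Gsk: "G x \<bullet> y = - (x \<bullet> G y)" for x y
  proof -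
    have "a (j x) \<bullet> y = - (x \<bullet> a (j y))"
      unfolding ask[of "j x" y] jsk[of x "a y"] aj[of y] inner_minus_right by simp
    then show ?thesis by (simp add: G_def)
  qed
  have "a (j (j x)) = - a x" for x by (simp only: jj linear_neg[OF la])
  then have G_j: "G (j x) = (1/2) *\<^sub>R a x" for x by (simp add: G_def)
  have "j (a (j x)) = a x" for x by (simp only: aj jj linear_neg[OF lj] minus_minus)
  then have j_G: "j (G x) = - (1/2) *\<^sub>R a x" for x by (simp add: G_def linear_cmul[OF lj] linear_neg[OF lj])
  have Gj: "G (j x) = - j (G x)" for x by (simp add: G_j j_G)
  have comm: "G (j x) - j (G x) = a x" for x
    by (simp add: G_j j_G flip: scaleR_add_left)
  define N where "N t x = x + t *\<^sub>R G x" for t x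
  have lN: "linear (N t)" for t unfolding N_def
    by (intro linear_compose_add linear_ident linear_compose_scale_right lG)
  \<comment> \<open>Skewness removes the terms linear in \<open>t\<close>, so \<open>N t\<close>
    never shortens vectors and is invertible for every real \<open>t\<close>, as needed for a curve
    defined on the whole line.\<close>
  have Nin: "N t x \<bullet> N t y = x \<bullet> y + t\<^sup>2 * (G x \<bullet> G y)" for t x y
    using Gsk[of x y] by (simp add: N_def inner_simps power2_eq_square algebra_simps)
  have Nnorm: "norm x \<le> norm (N t x)" for t x
    using Nin[of t x x] by (simp add: norm_eq_sqrt_inner)
  have "\<exists>R. linear R \<and> (\<forall>x. R (N t x) = x) \<and> (\<forall>x. N t (R x) = x)" for t
  proof -
    have "inj (N t)"
      unfolding linear_injective_0[OF lN] using Nnorm by (metis norm_le_zero_iff norm_zero)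
    then obtain R where R: "linear R" "R \<circ> N t = id"
      using linear_injective_left_inverse[OF lN] by blast
    then have "N t \<circ> R = id" using linear_inverse_left[OF lN R(1)] by simp
    then show ?thesis using R by (metis comp_apply id_apply)
  qed
  then obtain R where R: "\<And>t. linear (R t)" "\<And>t x. R t (N t x) = x" "\<And>t x. N t (R t x) = x" by metis
  have Rnorm: "norm (R t x) \<le> norm x" for t x using Nnorm[of "R t x" t] R(3) by simp
  define \<gamma> where "\<gamma> t = Blinfun (\<lambda>x. N t (j (R t x)))" for t
  have \<gamma>: "blinfun_apply (\<gamma> t) x = N t (j (R t x))" for t x
  proof -
    have "linear (\<lambda>x. N t (j (R t x)))"
      using linear_compose[OF linear_compose[OF R(1) lj] lN] by (simp add: comp_def)
    then show ?thesis by (simp add: \<gamma>_def bounded_linear_Blinfun_apply linear_conv_bounded_linear)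
  qed
  have \<gamma>0: "\<gamma> 0 = J"
  proof (rule blinfun_eqI)
    fix x show "blinfun_apply (\<gamma> 0) x = blinfun_apply J x"
      using R(3)[of 0 x] by (simp add: \<gamma> N_def j_def)
  qed
  have mem: "\<gamma> t \<in> complex_structures vol" for t
    unfolding complex_structures_def
  proof (intro CollectI conjI allI impI)
    fix x y
    show "blinfun_apply (\<gamma> t) (blinfun_apply (\<gamma> t) x) = - x"
      using R(3)[of t x] by (simp add: \<gamma> R(2) jj linear_neg[OF lN])
    \<comment> \<open>\<open>N t\<close> is not an isometry, but the metric it pulls back is
      invariant under \<open>J\<close>, because \<open>G\<close> anticommutes with \<open>J\<close>.
      Hence the conjugated structure is still orthogonal.\<close>
    have "blinfun_apply (\<gamma> t) x \<bullet> blinfun_apply (\<gamma> t) y = N t (R t x) \<bullet> N t (R t y)"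
      by (simp add: \<gamma> Nin Gj jiso)
    then show "blinfun_apply (\<gamma> t) x \<bullet> blinfun_apply (\<gamma> t) y = x \<bullet> y" by (simp add: R(3))
  next
    fix vs :: "'v list" assume len: "2 * length vs = DIM('v)"
    define bs where "bs = concat (map (\<lambda>v. [v, blinfun_apply (\<gamma> t) v]) vs)"
    define cs where "cs = concat (map (\<lambda>v. [v, blinfun_apply J v]) (map (R t) vs))"
    have bs_cs: "bs = map (N t) cs"
      unfolding bs_def cs_def by (induction vs) (auto simp: R(3) \<gamma> j_def)
    have cs_bs: "cs = map (R t) bs"
      unfolding bs_cs by (simp add: R(2) comp_def)
    have lenc: "length cs = DIM('v)" unfolding cs_def len[symmetric] by (induction vs) auto
    show "let bs = concat (map (\<lambda>v. [v, blinfun_apply (\<gamma> t) v]) vs)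
         in distinct bs \<and> independent (set bs) \<longrightarrow> 0 < Re (vol (map of_vec bs))"
      unfolding Let_def bs_def[symmetric]
    proof
      assume ind: "distinct bs \<and> independent (set bs)"
      have injR: "inj (R t)" using R(3) by (metis injI)
      have injN: "inj (N s)" for s using R(2) by (metis injI)
      have dc: "distinct cs" using ind inj_on_subset[OF injR subset_UNIV[of "set bs"]] by (simp add: cs_bs distinct_map)
      have ic: "independent (set cs)"
        using linear_independent_injective_image[OF R(1)[of t]]
          inj_on_subset[OF injR subset_UNIV[of "span (set bs)"]] ind by (simp add: cs_bs)
      \<comment> \<open>Orientation by continuity: \<open>N s\<close> joins the identity to
        \<open>N t\<close> through invertible maps, so the volume of the moved basis never vanishes
        and keeps the positive sign that it has at \<open>s = 0\<close>.\<close>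
      define f where "f s = Re (vol (map of_vec (map (N s) cs)))" for s
      have ext: "vol \<in> ext_forms" using vol by (simp add: volume_form_def)
      have contN: "\<psi> \<in> ext_forms \<Longrightarrow> continuous_on UNIV (\<lambda>s. \<psi> (map of_vec (map (N s) ws)))" for \<psi> and ws :: "'v list"
      proof (induction ws arbitrary: \<psi>)
        case (Cons w ws)
        have "(of_vec (N s w) :: 'v cvec) = cscale (of_real s) (of_vec (G w)) + of_vec w" for s
          by (simp add: of_vec_def cscale_def N_def)
        then have "\<psi> (map of_vec (map (N s) (w # ws))) =
            of_real s * interior (of_vec (G w)) \<psi> (map of_vec (map (N s) ws)) +
            interior (of_vec w) \<psi> (map of_vec (map (N s) ws))" for s
          using ext_forms_Cons(1)[OF Cons.prems] by (simp add: interior_def)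
        then show ?case
          by (simp only:) (intro continuous_intros Cons.IH interior_ext_forms Cons.prems)
      qed simp
      have cont: "continuous_on UNIV f" unfolding f_def by (rule continuous_on_Re[OF contN[OF ext]])
      have nz: "f s \<noteq> 0" for s
      proof -
        have "vol (map of_vec (map (N s) cs)) \<noteq> 0"
        proof (rule volume_form_nonzero[OF vol])
          show "distinct (map (N s) cs)" using dc inj_on_subset[OF injN[of s] subset_UNIV[of "set cs"]] by (simp add: distinct_map)
          show "independent (set (map (N s) cs))"
            using linear_independent_injective_image[OF lN[of s] ic]
              inj_on_subset[OF injN[of s] subset_UNIV[of "span (set cs)"]] by simp
        qed (simp add: lenc)
        then show ?thesis using volume_form_real[OF vol] unfolding f_def by (metis complex_eq_iff zero_complex.simps)
      qed
      have "N 0 = (\<lambda>x. x)" by (auto simp: N_def)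
      moreover have "0 < Re (vol (map of_vec cs))"
        using or[of "map (R t) vs", folded cs_def] len dc ic by simp
      ultimately have f0: "f 0 > 0" by (simp add: f_def)
      have "\<not> f t < 0"
      proof
        assume "f t < 0"
        have "connected (range f)" by (rule connected_continuous_image[OF cont connected_UNIV])
        then have "0 \<in> range f"
          by (rule connectedD_interval[of _ "f t" "f 0"]) (use \<open>f t < 0\<close> f0 in auto)
        then show False using nz by force
      qed
      then show "0 < Re (vol (map of_vec bs))" using nz[of t] by (simp add: f_def bs_cs)
    qed
  qed
  have "(\<gamma> has_vector_derivative A) (at 0)"
  proof -
    obtain C where C: "C > 0" "\<And>x. norm (a (G x)) \<le> norm x * C"
      using bounded_linear.pos_bounded[OF linear_conv_bounded_linear[THEN iffD1, OF linear_compose[OF lG la]]] by (auto simp: comp_def)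
    \<comment> \<open>Evaluating at \<open>x = N t y\<close> removes the inverse, and the error is
      exactly \<open>- (t\<^sup>2 *\<^sub>R a (G y))\<close>; the bound uses that \<open>R t\<close>
      does not increase norms.\<close>
    have est: "norm (\<gamma> t - \<gamma> 0 - t *\<^sub>R A) \<le> C * t\<^sup>2" for t
    proof (rule norm_blinfun_bound)
      fix x
      define y where "y = R t x"
      have x: "x = N t y" by (simp add: y_def R(3))
      have "blinfun_apply (\<gamma> t - \<gamma> 0 - t *\<^sub>R A) x = N t (j y) - j (N t y) - t *\<^sub>R a (N t y)"
        unfolding \<gamma>0 by (simp add: blinfun.diff_left blinfun.scaleR_left \<gamma> y_def[symmetric] j_def[symmetric] a_def[symmetric] x[symmetric])
      also have "\<dots> = t *\<^sub>R (G (j y) - j (G y)) - t *\<^sub>R a y - t\<^sup>2 *\<^sub>R a (G y)"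
        by (simp add: N_def lin algebra_simps power2_eq_square)
      also have "\<dots> = - (t\<^sup>2 *\<^sub>R a (G y))" by (simp add: comm)
      finally have "norm (blinfun_apply (\<gamma> t - \<gamma> 0 - t *\<^sub>R A) x) = t\<^sup>2 * norm (a (G y))" by simp
      also have "\<dots> \<le> t\<^sup>2 * (norm y * C)" by (intro mult_left_mono C) simp
      also have "\<dots> \<le> t\<^sup>2 * (norm x * C)" using Rnorm[of t x] C by (intro mult_left_mono mult_right_mono) (auto simp: y_def)
      finally show "norm (blinfun_apply (\<gamma> t - \<gamma> 0 - t *\<^sub>R A) x) \<le> C * t\<^sup>2 * norm x" by (simp add: mult_ac)
    qed (use C in auto)
    show ?thesis
      unfolding has_vector_derivative_def has_derivative_at_within
    proof (intro conjI)
      show "bounded_linear (\<lambda>h. h *\<^sub>R A)" by (rule bounded_linear_scaleR_left)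
      have "((\<lambda>t. C * \<bar>t\<bar>) \<longlongrightarrow> C * \<bar>0\<bar>) (at 0)" by (intro tendsto_intros)
      then have lim: "((\<lambda>t. C * \<bar>t\<bar>) \<longlongrightarrow> 0) (at 0)" by simp
      show "((\<lambda>y. (\<gamma> y - \<gamma> 0 - (y - 0) *\<^sub>R A) /\<^sub>R norm (y - 0)) \<longlongrightarrow> 0) (at 0)"
      proof (rule Lim_null_comparison[OF _ lim], rule always_eventually, rule allI)
        fix t :: real
        show "norm ((\<gamma> t - \<gamma> 0 - (t - 0) *\<^sub>R A) /\<^sub>R norm (t - 0)) \<le> C * \<bar>t\<bar>"
        proof (cases "t = 0")
          case False
          have "norm (\<gamma> t - \<gamma> 0 - t *\<^sub>R A) / \<bar>t\<bar> \<le> C * t\<^sup>2 / \<bar>t\<bar>" by (intro divide_right_mono est) simp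
          also have "\<dots> = C * \<bar>t\<bar>" using False by (simp add: field_simps power2_eq_square)
          finally show ?thesis by (simp add: divide_inverse mult.commute)
        qed simp
      qed
    qed
  qed
  then show ?thesis unfolding tangent_def using mem \<gamma>0 by blast
qed

lemma tangent_iff:
  assumes "volume_form vol" "J \<in> complex_structures vol"
  shows "A \<in> tangent (complex_structures vol) J \<longleftrightarrow> skew_anticommuting J A"
  using assms tangent_skew_anticommuting skew_anticommuting_tangent by blast

text \<open>Not visible from the definition by curves, but clear from the linear equations
  characterising tangent vectors.\<close>

lemma tangent_linear:
  assumes "volume_form vol" "J \<in> complex_structures vol"
    "A \<in> tangent (complex_structures vol) J" "B \<in> tangent (complex_structures vol) J"
  shows "a *\<^sub>R A + b *\<^sub>R B \<in> tangent (complex_structures vol) J"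
  using assms(3,4) unfolding tangent_iff[OF assms(1,2)] skew_anticommuting_def
  by (simp add: blinfun.add_left blinfun.scaleR_left blinfun.add_right blinfun.scaleR_right inner_simps)

text \<open>Differentiating the tangency equations of a field \<open>Z\<close> in direction
  \<open>B\<close> gives the same linear equations for the derivative of \<open>Z\<close>, except
  for the term \<open>Z B + B Z\<close>. It is symmetric in \<open>Z\<close> and \<open>B\<close>,
  so it cancels in the bracket.\<close>

lemma lie_bracket_tangent:
  fixes vol :: "'v::euclidean_space form"
  assumes vol: "volume_form vol" and U: "openin (top_of_set (complex_structures vol)) U" and J: "J \<in> U"
    and X: "vector_field (complex_structures vol) U X" and Y: "vector_field (complex_structures vol) U Y"
  shows "lie_bracket (complex_structures vol) X Y J \<in> tangent (complex_structures vol) J"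
proof -
  let ?M = "complex_structures vol"
  have JM: "J \<in> ?M" using U J openin_imp_subset by blast
  have eq: "blinfun_apply (deriv_along ?M Z J B) (blinfun_apply J v) + blinfun_apply J (blinfun_apply (deriv_along ?M Z J B) v)
      + blinfun_apply (Z J) (blinfun_apply B v) + blinfun_apply B (blinfun_apply (Z J) v) = 0"
    and sk: "blinfun_apply (deriv_along ?M Z J B) v \<bullet> w + v \<bullet> blinfun_apply (deriv_along ?M Z J B) w = 0"
    if Z: "vector_field ?M U Z" and B: "B \<in> tangent ?M J" for Z B v w
  proof -
    let ?Z' = "deriv_along ?M Z J"
    have "Z differentiable (at J within ?M)"
      using Z U J by (auto simp: vector_field_def intro: smooth_in_differentiable)
    then have dZ: "(Z has_derivative ?Z') (at J within ?M)" by (rule deriv_along_works)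
    have dZv: "((\<lambda>K. blinfun_apply (Z K) v) has_derivative (\<lambda>B. blinfun_apply (?Z' B) v)) (at J within ?M)" for v
      by (rule bounded_linear.has_derivative[OF blinfun.bounded_linear_left dZ])
    have did: "((\<lambda>K. blinfun_apply K v) has_derivative (\<lambda>B. blinfun_apply B v)) (at J within ?M)"
      by (rule bounded_linear.has_derivative[OF blinfun.bounded_linear_left has_derivative_ident])
    have sk: "skew_anticommuting K (Z K)" if "K \<in> U" for K
      using Z that tangent_skew_anticommuting by (auto simp: vector_field_def)
    have "deriv_along ?M (\<lambda>K. blinfun_apply (Z K) (blinfun_apply K v) + blinfun_apply K (blinfun_apply (Z K) v)) J B
      = (blinfun_apply (Z J) (blinfun_apply B v) + blinfun_apply (?Z' B) (blinfun_apply J v))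
        + (blinfun_apply J (blinfun_apply (?Z' B) v) + blinfun_apply B (blinfun_apply (Z J) v))"
      by (rule deriv_along_eq[OF has_derivative_add[OF
          bounded_bilinear.FDERIV[OF bounded_bilinear_blinfun_apply dZ did]
          bounded_bilinear.FDERIV[OF bounded_bilinear_blinfun_apply has_derivative_ident dZv]] B])
    moreover have "deriv_along ?M (\<lambda>K. blinfun_apply (Z K) (blinfun_apply K v) + blinfun_apply K (blinfun_apply (Z K) v)) J B
       = deriv_along ?M (\<lambda>K. 0) J B"
      by (rule deriv_along_cong[OF U J]) (use sk in \<open>simp add: skew_anticommuting_def\<close>)
    ultimately show "blinfun_apply (?Z' B) (blinfun_apply J v) + blinfun_apply J (blinfun_apply (?Z' B) v)
      + blinfun_apply (Z J) (blinfun_apply B v) + blinfun_apply B (blinfun_apply (Z J) v) = 0"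
      by (simp add: deriv_along_const[OF B] add_ac)
    have "deriv_along ?M (\<lambda>K. blinfun_apply (Z K) v \<bullet> w + v \<bullet> blinfun_apply (Z K) w) J B
      = blinfun_apply (?Z' B) v \<bullet> w + v \<bullet> blinfun_apply (?Z' B) w"
      by (rule deriv_along_eq[OF has_derivative_add[OF has_derivative_inner_left[OF dZv] has_derivative_inner_right[OF dZv]] B])
    moreover have "deriv_along ?M (\<lambda>K. blinfun_apply (Z K) v \<bullet> w + v \<bullet> blinfun_apply (Z K) w) J B
       = deriv_along ?M (\<lambda>K. 0) J B"
      by (rule deriv_along_cong[OF U J]) (use sk in \<open>simp add: skew_anticommuting_def\<close>)
    ultimately show "blinfun_apply (?Z' B) v \<bullet> w + v \<bullet> blinfun_apply (?Z' B) w = 0"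
      by (simp add: deriv_along_const[OF B])
  qed
  have aux: "a' - a = - (b' - b)" if "a + b + c + d = 0" "a' + b' + d + c = 0" for a a' b b' c d :: 'v
  proof -
    have "a' + b' + (c + d) = a + b + (c + d)" using that by (simp add: add_ac)
    then have "a' + b' = a + b" by (rule add_right_imp_eq)
    then show ?thesis by (simp add: algebra_simps)
  qed
  have XJ: "X J \<in> tangent ?M J" and YJ: "Y J \<in> tangent ?M J" using X Y J by (auto simp: vector_field_def)
  show ?thesis
    unfolding tangent_iff[OF vol JM] skew_anticommuting_def
  proof (intro conjI allI)
    fix x y
    show "blinfun_apply (lie_bracket ?M X Y J) (blinfun_apply J x) = - blinfun_apply J (blinfun_apply (lie_bracket ?M X Y J) x)"
      using aux[OF eq[OF X YJ, of x] eq[OF Y XJ, of x]]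
      by (simp add: lie_bracket_def blinfun.diff_left blinfun.diff_right)
    show "blinfun_apply (lie_bracket ?M X Y J) x \<bullet> y = - (x \<bullet> blinfun_apply (lie_bracket ?M X Y J) y)"
      using sk[OF X YJ, of x y] sk[OF Y XJ, of x y]
      by (simp add: lie_bracket_def blinfun.diff_left inner_simps)
  qed
qed

section \<open>Complexified operators and projections to the two types\<close>

lemma capply_simps [simp]:
  "capply T (x + y) = capply T x + capply T y" "capply T (cscale c x) = cscale c (capply T x)"
  "capply T (- x) = - capply T x" "capply T (x - y) = capply T x - capply T y" "capply T 0 = 0"
  "capply (T + S) x = capply T x + capply S x" "capply (T - S) x = capply T x - capply S x"
  by (auto simp: capply_def cscale_def blinfun.add_right blinfun.scaleR_right blinfun.minus_right blinfun.diff_right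
      blinfun.add_left blinfun.diff_left blinfun.zero_right zero_prod_def algebra_simps)

lemma capply_of_vec: "capply T (of_vec x) = of_vec (blinfun_apply T x)"
  by (simp add: capply_def of_vec_def)

lemma capply_cnj: "capply T (cvec_cnj z) = cvec_cnj (capply T z)"
  by (simp add: capply_def cvec_cnj_def blinfun.minus_right)

lemma cvec_cnj_cscale: "cvec_cnj (cscale c z) = cscale (cnj c) (cvec_cnj z)"
  by (simp add: cvec_cnj_def cscale_def)

lemma V01_cnj: "cvec_cnj z \<in> V01 J \<longleftrightarrow> z \<in> V10 J"
proof -
  have "cvec_cnj z \<in> V01 J \<longleftrightarrow> cvec_cnj (capply J z) = cvec_cnj (cscale \<i> z)"
    by (simp add: V01_def capply_cnj cvec_cnj_cscale del: cscale_simps)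
  also have "\<dots> \<longleftrightarrow> z \<in> V10 J"
    unfolding V10_def by (auto simp: cvec_cnj_def prod_eq_iff)
  finally show ?thesis .
qed

definition proj01 :: "('v::euclidean_space \<Rightarrow>\<^sub>L 'v) \<Rightarrow> 'v cvec \<Rightarrow> 'v cvec" where
  "proj01 J z = cscale (1/2) (z + cscale \<i> (capply J z))"

lemma proj_simps [simp]:
  "proj10 J (x + y) = proj10 J x + proj10 J y" "proj10 J (cscale c x) = cscale c (proj10 J x)"
  "proj10 J (- x) = - proj10 J x" "proj10 J (x - y) = proj10 J x - proj10 J y" "proj10 J 0 = 0"
  "proj01 J (x + y) = proj01 J x + proj01 J y" "proj01 J (cscale c x) = cscale c (proj01 J x)"
  "proj01 J (- x) = - proj01 J x" "proj01 J (x - y) = proj01 J x - proj01 J y" "proj01 J 0 = 0"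
  unfolding proj10_def proj01_def by (simp_all add: algebra_simps)

lemma proj_sum: "proj10 J z + proj01 J z = z"
proof -
  have "proj10 J z + proj01 J z = cscale (1/2) z + cscale (1/2) z" by (simp add: proj10_def proj01_def)
  also have "\<dots> = cscale (1/2 + 1/2) z" by (simp only: cscale_simps)
  also have "\<dots> = z" by simp
  finally show ?thesis .
qed

lemma capply_square: "J \<in> complex_structures vol \<Longrightarrow> capply J (capply J z) = - z"
  by (simp add: capply_def complex_structure_square prod_eq_iff)

lemma proj10_V10: "J \<in> complex_structures vol \<Longrightarrow> proj10 J z \<in> V10 J"
  and proj01_V01: "J \<in> complex_structures vol \<Longrightarrow> proj01 J z \<in> V01 J"
  by (auto simp: proj10_def proj01_def V10_def V01_def capply_square algebra_simps)

lemma proj10_ident: "z \<in> V10 J \<Longrightarrow> proj10 J z = z"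
  and proj01_ident: "z \<in> V01 J \<Longrightarrow> proj01 J z = z"
  and proj10_V01: "z \<in> V01 J \<Longrightarrow> proj10 J z = 0"
  and proj01_V10: "z \<in> V10 J \<Longrightarrow> proj01 J z = 0"
proof -
  have half: "cscale (1/2) (z + z) = z" for z :: "'a cvec"
    by (simp add: cscale_def prod_eq_iff del: cscale_simps)
  show "z \<in> V10 J \<Longrightarrow> proj10 J z = z" "z \<in> V01 J \<Longrightarrow> proj01 J z = z"
    "z \<in> V01 J \<Longrightarrow> proj10 J z = 0" "z \<in> V10 J \<Longrightarrow> proj01 J z = 0"
    using half[of z] by (auto simp: proj10_def proj01_def V10_def V01_def)
qed

lemma cmetric_capply_skew:
  "(\<And>x y. blinfun_apply T x \<bullet> y = - (x \<bullet> blinfun_apply T y)) \<Longrightarrow> cmetric (capply T z) w = - cmetric z (capply T w)"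
  by (simp add: cmetric_def capply_def complex_eq_iff)

text \<open>\<open>J\<close> is skew for the bilinear metric, so transposition replaces
  \<open>J\<close> by its negative and exchanges the two projections.\<close>

lemma cmetric_proj:
  assumes J: "J \<in> complex_structures vol"
  shows "cmetric (proj10 J z) w = cmetric z (proj01 J w)" "cmetric (proj01 J z) w = cmetric z (proj10 J w)"
  using cmetric_capply_skew[OF complex_structure_skew[OF J], of z w] by (simp_all add: proj10_def proj01_def)

lemma skew_anticommuting_cmetric:
  "skew_anticommuting J A \<Longrightarrow> cmetric (capply A z) w = - cmetric z (capply A w)"
  by (rule cmetric_capply_skew) (simp add: skew_anticommuting_def)

lemma skew_anticommuting_capply:
  "skew_anticommuting J A \<Longrightarrow> capply A (capply J z) = - capply J (capply A z)"
  by (simp add: capply_def skew_anticommuting_def)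

lemma skew_anticommuting_proj:
  assumes "skew_anticommuting J A"
  shows "capply A (proj10 J z) = proj01 J (capply A z)" "capply A (proj01 J z) = proj10 J (capply A z)"
  using skew_anticommuting_capply[OF assms, of z] by (simp_all add: proj10_def proj01_def)

lemma bounded_linear_cscale: "bounded_linear (cscale c :: 'v::euclidean_space cvec \<Rightarrow> _)"
proof (rule linear_conv_bounded_linear[THEN iffD1], rule linearI)
  fix x y :: "'v cvec" and r :: real
  show "cscale c (x + y) = cscale c x + cscale c y" by simp
  show "cscale c (r *\<^sub>R x) = r *\<^sub>R cscale c x" by (simp add: cscale_def algebra_simps)
qed

lemma bounded_linear_capply: "bounded_linear (\<lambda>T. capply T z)"
  unfolding capply_def by (intro bounded_linear_Pair blinfun.bounded_linear_left)

lemma proj10_has_derivative: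
  "((\<lambda>K. proj10 K z) has_derivative (\<lambda>B. cscale (- \<i>/2) (capply B z))) (at J within M)"
proof -
  have "((\<lambda>K. cscale (1/2) (z - cscale \<i> (capply K z))) has_derivative
      (\<lambda>B. cscale (1/2) (0 - cscale \<i> (capply B z)))) (at J within M)"
    by (intro bounded_linear.has_derivative[OF bounded_linear_cscale] has_derivative_diff has_derivative_const
        bounded_linear.has_derivative[OF bounded_linear_capply] has_derivative_ident)
  then show ?thesis by (simp add: proj10_def[abs_def])
qed

lemma dproj10_eq:
  "A \<in> tangent (complex_structures vol) J \<Longrightarrow> dproj10 vol J A z = cscale (- \<i>/2) (capply A z)"
  unfolding dproj10_def by (rule deriv_along_eq[OF proj10_has_derivative])

section \<open>The quantum connection and its curvature\<close>

lemma bounded_linear_cmetric: "bounded_linear (cmetric z :: 'v::euclidean_space cvec \<Rightarrow> _)"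
proof (rule linear_conv_bounded_linear[THEN iffD1], rule linearI)
  fix x y :: "'v cvec" and r :: real
  show "cmetric z (x + y) = cmetric z x + cmetric z y" by simp
  show "cmetric z (r *\<^sub>R x) = r *\<^sub>R cmetric z x"
    by (simp add: cmetric_def complex_eq_iff algebra_simps)
qed

lemma bounded_linear_of_vec: "bounded_linear of_vec"
  unfolding of_vec_def[abs_def] by (intro bounded_linear_Pair bounded_linear_ident bounded_linear_zero)

text \<open>The conditions defining \<open>ext_forms\<close> are linear and do not depend on the
  base point, so they pass to the derivative.\<close>

lemma trivial_connection_ext_forms:
  fixes s :: "'a::real_normed_vector \<Rightarrow> 'v::real_vector form"
  assumes U: "openin (top_of_set M) U" "x \<in> U" and ext: "\<And>y. y \<in> U \<Longrightarrow> s y \<in> ext_forms"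
    and sm: "\<And>i. smooth_in U (\<lambda>y. s y i)" and A: "A \<in> tangent M x"
  shows "trivial_connection M x A s \<in> ext_forms"
  unfolding ext_forms_iff multilinear_def
proof (intro conjI allI impI)
  have dif: "(\<lambda>y. s y i) differentiable (at x within M)" for i
    by (rule smooth_in_differentiable[OF U(1) sm U(2)])
  fix xs :: "'v cvec list" and i c u v assume i: "i < length xs"
  have "deriv_along M (\<lambda>y. s y (xs[i := cscale c u + v])) x A =
      deriv_along M (\<lambda>y. c * s y (xs[i := u]) + s y (xs[i := v])) x A"
    by (rule deriv_along_cong[OF U]) (use ext i in \<open>simp add: ext_forms_def del: split_paired_All\<close>)
  also have "\<dots> = c * deriv_along M (\<lambda>y. s y (xs[i := u])) x A + deriv_along M (\<lambda>y. s y (xs[i := v])) x A"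
    by (rule deriv_along_eq[OF has_derivative_add[OF has_derivative_mult_right] A]) (intro deriv_along_works dif)+
  finally show "trivial_connection M x A s (xs[i := cscale c u + v]) =
      c * trivial_connection M x A s (xs[i := u]) + trivial_connection M x A s (xs[i := v])"
    by (simp add: trivial_connection_def)
next
  fix xs :: "'v cvec list" assume "\<not> distinct xs"
  then have "deriv_along M (\<lambda>y. s y xs) x A = deriv_along M (\<lambda>y. 0) x A"
    by (intro deriv_along_cong[OF U]) (use ext in \<open>simp add: ext_forms_iff\<close>)
  then show "trivial_connection M x A s xs = 0"
    by (simp add: trivial_connection_def deriv_along_const[OF A])
qed

lemma nabla_has_derivative:
  assumes "\<And>i. ((\<lambda>y. s y i) has_derivative (\<lambda>B. s' B i)) F"
  shows "((\<lambda>y. nabla w (s y) xs) has_derivative (\<lambda>B. nabla w (s' B) xs)) F"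
  unfolding nabla_def interior_def wedge_def
  by (intro has_derivative_diff has_derivative_mult_right has_derivative_sum assms)

text \<open>Expanding the moving vector in the fixed basis leaves fixed operators with smooth
  coefficients. The product rule below comes from the same expansion.\<close>

lemma smooth_in_nabla:
  fixes s :: "'a::real_normed_vector \<Rightarrow> 'v::euclidean_space form"
  assumes ext: "\<And>y. y \<in> U \<Longrightarrow> s y \<in> ext_forms"
    and sm: "\<And>i. smooth_in U (\<lambda>y. s y i)" and v: "smooth_in U v"
  shows "smooth_in U (\<lambda>y. nabla (v y) (s y) xs)"
proof -
  have "smooth_in U (\<lambda>y. \<Sum>b\<in>Basis. cmetric (of_vec b) (v y) * nabla (of_vec b) (s y) xs)"
    unfolding nabla_def interior_def wedge_def
    by (intro smooth_in_sum smooth_in_mult smooth_in_diff smooth_in_const sm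
        smooth_in_linear[OF bounded_linear_cmetric v])
  then show ?thesis
    by (rule smooth_in_cong[THEN iffD1, rotated])
      (rule clinear_functional_expand[OF nabla_functional, symmetric], rule ext)
qed

lemma deriv_along_nabla:
  fixes s :: "'a::real_normed_vector \<Rightarrow> 'v::euclidean_space form"
  assumes U: "openin (top_of_set M) U" "x \<in> U" and ext: "\<And>y. y \<in> U \<Longrightarrow> s y \<in> ext_forms"
    and sm: "\<And>i. smooth_in U (\<lambda>y. s y i)" and v: "(v has_derivative v') (at x within M)"
    and A: "A \<in> tangent M x"
  shows "deriv_along M (\<lambda>y. nabla (v y) (s y) xs) x A =
    nabla (v' A) (s x) xs + nabla (v x) (trivial_connection M x A s) xs"
proof -
  let ?e = "of_vec :: 'v \<Rightarrow> _"
  have ds: "trivial_connection M x A s \<in> ext_forms" by (rule trivial_connection_ext_forms[OF U ext sm A])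
  have d: "((\<lambda>y. s y i) has_derivative (\<lambda>B. trivial_connection M x B s i)) (at x within M)" for i
    using deriv_along_works[OF smooth_in_differentiable[OF U(1) sm U(2)]] by (simp add: trivial_connection_def)
  have "deriv_along M (\<lambda>y. nabla (v y) (s y) xs) x A =
      deriv_along M (\<lambda>y. \<Sum>b\<in>Basis. cmetric (?e b) (v y) * nabla (?e b) (s y) xs) x A"
    by (rule deriv_along_cong[OF U]) (rule clinear_functional_expand[OF nabla_functional], rule ext)
  also have "\<dots> = (\<Sum>b\<in>Basis. cmetric (?e b) (v x) * nabla (?e b) (trivial_connection M x A s) xs
      + cmetric (?e b) (v' A) * nabla (?e b) (s x) xs)"
    by (rule deriv_along_eq[OF has_derivative_sum[OF bounded_bilinear.FDERIV[OF bounded_bilinear_mult]] A])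
      (intro bounded_linear.has_derivative[OF bounded_linear_cmetric v] nabla_has_derivative d)+
  also have "\<dots> = nabla (v x) (trivial_connection M x A s) xs + nabla (v' A) (s x) xs"
    unfolding sum.distrib
    by (simp only: clinear_functional_expand[OF nabla_functional[OF ds], of "v x" xs]
        clinear_functional_expand[OF nabla_functional[OF ext[OF U(2)]], of "v' A" xs])
  finally show ?thesis by simp
qed

section \<open>The fibre and its orthogonal complement\<close>

lemma quantum_bundle_ext: "\<psi> \<in> quantum_bundle J \<Longrightarrow> \<psi> \<in> ext_forms"
  by (simp add: quantum_bundle_def)

lemma quantum_bundle_nabla: "\<psi> \<in> quantum_bundle J \<Longrightarrow> z \<in> V01 J \<Longrightarrow> nabla z \<psi> = (\<lambda>xs. 0)"
  by (simp add: quantum_bundle_def)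

lemma quantum_bundle_linear_comb:
  "\<psi> \<in> quantum_bundle J \<Longrightarrow> \<phi> \<in> quantum_bundle J \<Longrightarrow> (\<lambda>xs. a * \<psi> xs + b * \<phi> xs) \<in> quantum_bundle J"
  by (auto simp: quantum_bundle_def nabla_linear fun_eq_iff intro: ext_forms_linear_comb)

text \<open>Equations are proved modulo this space, so only terms with a component in the fibre have
  to be followed.\<close>

definition quantum_perp :: "'v::euclidean_space form \<Rightarrow> ('v \<Rightarrow>\<^sub>L 'v) \<Rightarrow> 'v form set" where
  "quantum_perp vol J = {\<phi> \<in> ext_forms. \<forall>\<eta>\<in>quantum_bundle J. form_inner vol \<eta> \<phi> = 0}"

lemma quantum_perp_linear_comb:
  assumes "volume_form vol" "\<psi> \<in> quantum_perp vol J" "\<phi> \<in> quantum_perp vol J"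
  shows "(\<lambda>xs. a * \<psi> xs + b * \<phi> xs) \<in> quantum_perp vol J"
  using assms(2,3) unfolding quantum_perp_def
  by (auto simp: form_inner_eq[OF assms(1) quantum_bundle_ext] ext_forms_linear_comb form_pairing_linear_right)

lemma quantum_perp_scale:
  "volume_form vol \<Longrightarrow> \<psi> \<in> quantum_perp vol J \<Longrightarrow> (\<lambda>xs. a * \<psi> xs) \<in> quantum_perp vol J"
  using quantum_perp_linear_comb[of vol \<psi> J \<psi> a 0] by simp

lemma quantum_perp_sum:
  assumes "volume_form vol" "\<And>i. i \<in> I \<Longrightarrow> \<psi> i \<in> quantum_perp vol J"
  shows "(\<lambda>xs. \<Sum>i\<in>I. \<psi> i xs) \<in> quantum_perp vol J"
  unfolding quantum_perp_def
proof (intro CollectI conjI ballI)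
  have e: "\<psi> i \<in> ext_forms" if "i \<in> I" for i using assms(2)[OF that] by (simp add: quantum_perp_def)
  then show e': "(\<lambda>xs. \<Sum>i\<in>I. \<psi> i xs) \<in> ext_forms" by (rule ext_forms_sum)
  fix \<eta> assume \<eta>: "\<eta> \<in> quantum_bundle J"
  have "form_pairing (form_cnj \<eta>) (\<psi> i) = 0" if "i \<in> I" for i
  proof -
    have "form_inner vol \<eta> (\<psi> i) = 0" using assms(2)[OF that] \<eta> by (simp add: quantum_perp_def)
    then show ?thesis by (simp add: form_inner_eq[OF assms(1) quantum_bundle_ext[OF \<eta>] e[OF that]])
  qed
  then show "form_inner vol \<eta> (\<lambda>xs. \<Sum>i\<in>I. \<psi> i xs) = 0"
    by (simp add: form_inner_eq[OF assms(1) quantum_bundle_ext[OF \<eta>] e'] form_pairing_sum_right)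
qed

text \<open>The conjugate of \<open>v\<close> has type (0,1) and its operator kills the fibre;
  bilinear transposition followed by conjugation of \<open>\<eta>\<close> brings exactly this
  operator onto \<open>\<eta>\<close>.\<close>

lemma quantum_perp_nabla:
  assumes vol: "volume_form vol" and v: "v \<in> V10 J" and \<phi>: "\<phi> \<in> ext_forms"
  shows "nabla v \<phi> \<in> quantum_perp vol J"
  unfolding quantum_perp_def
proof (intro CollectI conjI ballI)
  show "nabla v \<phi> \<in> ext_forms" by (rule nabla_ext_forms[OF \<phi>])
  fix \<eta> assume \<eta>: "\<eta> \<in> quantum_bundle J"
  then have e: "\<eta> \<in> ext_forms" by (rule quantum_bundle_ext)
  have "nabla (cvec_cnj v) \<eta> = (\<lambda>xs. 0)" by (rule quantum_bundle_nabla[OF \<eta>]) (simp add: V01_cnj v)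
  then have "nabla v (form_cnj \<eta>) = form_cnj (\<lambda>xs. 0)" by (simp only: nabla_form_cnj)
  then have "nabla v (form_cnj \<eta>) = (\<lambda>xs. 0)" by (simp add: form_cnj_def[of "\<lambda>xs. 0"])
  then have "form_pairing (nabla v (form_cnj \<eta>)) \<phi> = 0"
    by (simp add: form_pairing_commute[of _ \<phi>]) (simp add: form_pairing_def pair_zero_right)
  then show "form_inner vol \<eta> (nabla v \<phi>) = 0"
    by (simp add: form_inner_eq[OF vol e nabla_ext_forms[OF \<phi>]] form_pairing_nabla[OF form_cnj_ext_forms[OF e] \<phi>])
qed

text \<open>Positivity of the norm. Thus an equation between elements of the fibre may be checked
  modulo the complement.\<close>

lemma quantum_perp_disjoint:
  assumes vol: "volume_form vol" and "\<phi> \<in> quantum_bundle J" "\<phi> \<in> quantum_perp vol J"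
  shows "\<phi> = (\<lambda>xs. 0)"
proof -
  have e: "\<phi> \<in> ext_forms" using assms(2) by (rule quantum_bundle_ext)
  have "form_inner vol \<phi> \<phi> = 0" using assms by (auto simp: quantum_perp_def)
  then have "form_sqnorm \<phi> = 0" by (simp add: form_inner_eq[OF vol e e] form_pairing_cnj)
  then show ?thesis by (rule form_sqnorm_zero[OF e])
qed

text \<open>No projection is constructed: an element of the fibre with orthogonal remainder is the
  unique value of the description.\<close>

lemma orthogonal_proj_eq:
  assumes vol: "volume_form vol" and \<phi>: "\<phi> \<in> quantum_bundle J" and d: "(\<lambda>xs. \<psi> xs - \<phi> xs) \<in> quantum_perp vol J"
  shows "orthogonal_proj vol (quantum_bundle J) \<psi> = \<phi>"
  unfolding orthogonal_proj_def
proof (rule the_equality)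
  show "\<phi> \<in> quantum_bundle J \<and> (\<forall>\<eta>\<in>quantum_bundle J. form_inner vol \<eta> (\<lambda>xs. \<psi> xs - \<phi> xs) = 0)"
    using \<phi> d by (auto simp: quantum_perp_def)
  fix \<phi>' assume \<phi>': "\<phi>' \<in> quantum_bundle J \<and> (\<forall>\<eta>\<in>quantum_bundle J. form_inner vol \<eta> (\<lambda>xs. \<psi> xs - \<phi>' xs) = 0)"
  have diff: "(\<lambda>xs. \<phi> xs - \<phi>' xs) \<in> quantum_bundle J"
    using quantum_bundle_linear_comb[OF \<phi>, of \<phi>' 1 "-1"] \<phi>' by simp
  \<comment> \<open>A competing value \<open>\<phi>'\<close> is not given together with the fact
    that its remainder is a form, which membership in \<open>quantum_perp\<close> requires; it is
    recovered from \<open>d\<close>.\<close>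
  have "(\<lambda>xs. \<psi> xs - \<phi> xs) \<in> ext_forms" using d by (simp add: quantum_perp_def)
  then have "(\<lambda>xs. (\<psi> xs - \<phi> xs) + (\<phi> xs - \<phi>' xs)) \<in> ext_forms"
    by (rule ext_forms_add) (rule quantum_bundle_ext[OF diff])
  then have d': "(\<lambda>xs. \<psi> xs - \<phi>' xs) \<in> quantum_perp vol J" using \<phi>' by (simp add: quantum_perp_def)
  have "(\<lambda>xs. 1 * (\<psi> xs - \<phi>' xs) + (-1) * (\<psi> xs - \<phi> xs)) \<in> quantum_perp vol J"
    by (rule quantum_perp_linear_comb[OF vol d' d])
  then have "(\<lambda>xs. \<phi> xs - \<phi>' xs) \<in> quantum_perp vol J" by (simp add: algebra_simps)
  then have "(\<lambda>xs. \<phi> xs - \<phi>' xs) = (\<lambda>xs. 0)" by (rule quantum_perp_disjoint[OF vol diff])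
  then show "\<phi>' = \<phi>" by (metis (no_types, lifting) ext eq_iff_diff_eq_0)
qed

text \<open>Up to the factor \<open>\<i>/4\<close> this is the difference of the connection and the trivial one.\<close>

definition second_fundamental :: "('v::euclidean_space \<Rightarrow>\<^sub>L 'v) \<Rightarrow> ('v \<Rightarrow>\<^sub>L 'v) \<Rightarrow> 'v form \<Rightarrow> 'v form" where
  "second_fundamental J A \<phi> = (\<lambda>xs. \<Sum>b\<in>Basis. nabla (proj10 J (capply A (of_vec b))) (nabla (of_vec b) \<phi>) xs)"

lemma second_fundamental_ext_forms: "\<phi> \<in> ext_forms \<Longrightarrow> second_fundamental J A \<phi> \<in> ext_forms"
  unfolding second_fundamental_def by (intro ext_forms_sum nabla_ext_forms)

lemma second_fundamental_perp:
  "volume_form vol \<Longrightarrow> J \<in> complex_structures vol \<Longrightarrow> \<phi> \<in> ext_forms \<Longrightarrow>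
    second_fundamental J A \<phi> \<in> quantum_perp vol J"
  unfolding second_fundamental_def
  by (intro quantum_perp_sum quantum_perp_nabla proj10_V10 nabla_ext_forms)

lemma second_fundamental_linear_comb:
  assumes "\<psi> \<in> ext_forms" "\<phi> \<in> ext_forms"
  shows "second_fundamental J A (\<lambda>xs. a * \<psi> xs + b * \<phi> xs) xs
    = a * second_fundamental J A \<psi> xs + b * second_fundamental J A \<phi> xs"
proof -
  have "nabla w (\<lambda>xs. a * \<psi> xs + b * \<phi> xs) = (\<lambda>xs. a * nabla w \<psi> xs + b * nabla w \<phi> xs)" for w
    by (rule ext) (rule nabla_linear)
  then show ?thesis
    by (simp add: second_fundamental_def nabla_linear sum.distrib sum_distrib_left)
qed

lemma second_fundamental_linear_tangent:
  assumes "\<phi> \<in> ext_forms"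
  shows "second_fundamental J (a *\<^sub>R A + b *\<^sub>R B) \<phi> xs
    = of_real a * second_fundamental J A \<phi> xs + of_real b * second_fundamental J B \<phi> xs"
proof -
  have "proj10 J (capply (a *\<^sub>R A + b *\<^sub>R B) z) =
      cscale (of_real a) (proj10 J (capply A z)) + (cscale (of_real b) (proj10 J (capply B z)) + 0)" for z
  proof -
    have "capply (r *\<^sub>R T) z = cscale (of_real r) (capply T z)" for r and T :: "'a \<Rightarrow>\<^sub>L 'a"
      by (simp add: capply_def cscale_def blinfun.scaleR_left)
    then show ?thesis by simp
  qed
  then show ?thesis
    using assms
    by (simp only: second_fundamental_def nabla_linear_vec[OF nabla_ext_forms] sum.distrib sum_distrib_left)
      (simp add: nabla_functional[THEN clinear_functional_zero, OF nabla_ext_forms])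
qed

text \<open>Since \<open>nabla z\<close> kills \<open>\<psi>\<close>, moving it through the two
  factors by the Clifford relation leaves one contraction for each factor. Summed over the basis,
  each of them gives \<open>nabla (capply A z) \<psi>\<close>, hence the factor 2.\<close>

lemma nabla_second_fundamental:
  assumes J: "J \<in> complex_structures vol" and A: "skew_anticommuting J A"
    and \<psi>: "\<psi> \<in> quantum_bundle J" and z: "z \<in> V01 J"
  shows "nabla z (second_fundamental J A \<psi>) xs = 2 * nabla (capply A z) \<psi> xs"
proof -
  let ?e = "of_vec :: 'a \<Rightarrow> _"
  let ?p = "\<lambda>b. proj10 J (capply A (?e b))"
  have ext: "\<psi> \<in> ext_forms" using \<psi> by (rule quantum_bundle_ext)
  have 1: "nabla z (nabla w \<psi>) = (\<lambda>xs. - cmetric z w * \<psi> xs)" for w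
    using nabla_anticommute[OF ext, of z w] quantum_bundle_nabla[OF \<psi> z] by (simp add: fun_eq_iff)
  have 2: "nabla z (nabla v (nabla w \<psi>)) xs = cmetric z w * nabla v \<psi> xs - cmetric z v * nabla w \<psi> xs" for v w
    using eq_diff_eq[THEN iffD2, OF nabla_anticommute[OF nabla_ext_forms[OF ext, of w], of z v xs]]
    unfolding 1 nabla_scale by simp
  have Az: "proj10 J (capply A z) = capply A z"
    using skew_anticommuting_proj(2)[OF A, of z] proj01_ident[OF z] by simp
  have f: "clinear_functional (\<lambda>v. nabla (proj10 J (capply A v)) \<psi> xs)"
    unfolding clinear_functional_def using nabla_linear_vec[OF ext] by simp
  have p: "cmetric z (?p b) = - cmetric (?e b) (capply A z)" for b
    using cmetric_proj(2)[OF J, of z "capply A (?e b)"] proj01_ident[OF z] skew_anticommuting_cmetric[OF A, of z "?e b"]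
    by (simp add: cmetric_sym[of "?e b"])
  have "nabla z (second_fundamental J A \<psi>) xs =
      (\<Sum>b\<in>Basis. cmetric (?e b) z * nabla (?p b) \<psi> xs) + (\<Sum>b\<in>Basis. cmetric (?e b) (capply A z) * nabla (?e b) \<psi> xs)"
    unfolding second_fundamental_def nabla_sum 2 p by (simp add: cmetric_sym[of z] sum.distrib)
  also have "\<dots> = nabla (proj10 J (capply A z)) \<psi> xs + nabla (capply A z) \<psi> xs"
    using clinear_functional_expand[OF f, of z]
      clinear_functional_expand[OF nabla_functional[OF ext], of "capply A z" xs] by simp
  finally show ?thesis by (simp add: Az)
qed

lemma local_section_quantum:
  assumes "local_section U quantum_bundle s"
  shows "y \<in> U \<Longrightarrow> s y \<in> quantum_bundle y" "y \<in> U \<Longrightarrow> s y \<in> ext_forms" "smooth_in U (\<lambda>y. s y i)"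
  using assms by (auto simp: local_section_def quantum_bundle_def)

text \<open>A vector of type (0,1) at \<open>J\<close> need not be so nearby; replacing it by
  \<open>proj01 K z\<close> gives an equation valid on all of \<open>U\<close>, which can be
  differentiated. The derivative of \<open>proj01\<close> is opposite to that of
  \<open>proj10\<close>.\<close>

lemma nabla_trivial_connection:
  assumes U: "openin (top_of_set (complex_structures vol)) U" "J \<in> U"
    and s: "local_section U quantum_bundle s" and A: "A \<in> tangent (complex_structures vol) J"
    and z: "z \<in> V01 J"
  shows "nabla z (trivial_connection (complex_structures vol) J A s) xs = - \<i>/2 * nabla (capply A z) (s J) xs"
proof -
  let ?M = "complex_structures vol"
  have UM: "U \<subseteq> ?M" using U openin_imp_subset by blast
  note s' = local_section_quantum[OF s]
  have "proj01 K z = z - proj10 K z" for K using proj_sum[of K z] by (simp add: algebra_simps)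
  then have d: "((\<lambda>K. proj01 K z) has_derivative (\<lambda>B. 0 - cscale (- \<i>/2) (capply B z))) (at J within ?M)"
    by (simp only:) (intro has_derivative_diff has_derivative_const proj10_has_derivative)
  let ?N = "nabla (0 - cscale (- \<i>/2) (capply A z)) (s J) xs" and ?T = "nabla z (trivial_connection ?M J A s) xs"
  have "?N + ?T = deriv_along ?M (\<lambda>K. nabla (proj01 K z) (s K) xs) J A"
    using deriv_along_nabla[OF U s'(2,3) d A, of xs] by (simp only: proj01_ident[OF z])
  also have "\<dots> = deriv_along ?M (\<lambda>K. 0) J A"
    by (rule deriv_along_cong[OF U])
      (use UM s'(1) in \<open>simp add: quantum_bundle_nabla[OF _ proj01_V01[of _ vol]] subset_iff\<close>)
  also have "\<dots> = 0" by (rule deriv_along_const[OF A])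
  finally have "?T = - ?N" by (simp only: add_eq_0_iff)
  also have "?N = \<i>/2 * nabla (capply A z) (s J) xs"
    using nabla_linear_vec[OF s'(2)[OF U(2)], of "\<i>/2" "capply A z" 0 xs]
      clinear_functional_zero[OF nabla_functional[OF s'(2)[OF U(2)]]] by simp
  finally show ?thesis by simp
qed

text \<open>The correction is orthogonal to the fibre, and \<open>\<i>/4\<close> is the coefficient
  for which its factor 2 under \<open>nabla z\<close> cancels the defect \<open>- \<i>/2\<close> of
  the plain derivative. So the sum lies in the fibre and is the projection.\<close>

lemma quantum_connection_eq:
  assumes vol: "volume_form vol" and U: "openin (top_of_set (complex_structures vol)) U" "J \<in> U"
    and s: "local_section U quantum_bundle s" and A: "A \<in> tangent (complex_structures vol) J"
  shows "quantum_connection vol J A s = (\<lambda>xs. trivial_connection (complex_structures vol) J A s xs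
      + \<i>/4 * second_fundamental J A (s J) xs)" (is "_ = ?\<phi>")
    and "quantum_connection vol J A s \<in> quantum_bundle J"
proof -
  let ?M = "complex_structures vol"
  note s' = local_section_quantum[OF s]
  have J: "J \<in> ?M" using U openin_imp_subset by blast
  have ds: "trivial_connection ?M J A s \<in> ext_forms" by (rule trivial_connection_ext_forms[OF U s'(2,3) A])
  have sa: "skew_anticommuting J A" by (rule tangent_skew_anticommuting[OF A])
  have \<phi>: "?\<phi> \<in> quantum_bundle J"
    unfolding quantum_bundle_def
  proof (intro CollectI conjI ballI ext)
    show "?\<phi> \<in> ext_forms"
      using ext_forms_linear_comb[OF ds second_fundamental_ext_forms[OF s'(2)[OF U(2)]], of 1 "\<i>/4" J A] by simp
    fix z xs assume z: "z \<in> V01 J"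
    show "nabla z ?\<phi> xs = 0"
      unfolding nabla_add nabla_scale nabla_trivial_connection[OF U s A z]
        nabla_second_fundamental[OF J sa s'(1)[OF U(2)] z] by simp
  qed
  have "(\<lambda>xs. trivial_connection ?M J A s xs - ?\<phi> xs) \<in> quantum_perp vol J"
    using quantum_perp_scale[OF vol second_fundamental_perp[OF vol J s'(2)[OF U(2)]], of "- \<i>/4" A] by simp
  with \<phi> show "quantum_connection vol J A s = ?\<phi>"
    unfolding quantum_connection_def by (rule orthogonal_proj_eq[OF vol])
  with \<phi> show "quantum_connection vol J A s \<in> quantum_bundle J" by simp
qed

section \<open>Differentiating the correction term\<close>

definition tangent_vec :: "('v::euclidean_space \<Rightarrow>\<^sub>L 'v) \<Rightarrow> ('v \<Rightarrow>\<^sub>L 'v) \<Rightarrow> 'v \<Rightarrow> 'v cvec" where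
  "tangent_vec J A b = proj10 J (capply A (of_vec b))"

lemma tangent_vec_eq:
  "tangent_vec J A b = cscale (1/2) (of_vec (blinfun_apply A b) - cscale \<i> (of_vec (blinfun_apply J (blinfun_apply A b))))"
  by (simp add: tangent_vec_def proj10_def capply_of_vec)

lemma smooth_in_tangent_vec:
  assumes "smooth_in U Y"
  shows "smooth_in U (\<lambda>K. tangent_vec K (Y K) b)"
  unfolding tangent_vec_eq
  by (intro smooth_in_linear[OF bounded_linear_cscale] smooth_in_diff smooth_in_linear[OF bounded_linear_of_vec]
      smooth_in_linear[OF blinfun.bounded_linear_left] smooth_in_bilinear[OF bounded_bilinear_blinfun_apply]
      smooth_in_ident assms)

lemma tangent_vec_has_derivative:
  assumes "(Y has_derivative Y') (at J within M)"
  shows "((\<lambda>K. tangent_vec K (Y K) b) has_derivative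
    (\<lambda>B. cscale (- \<i>/2) (capply B (capply (Y J) (of_vec b))) + tangent_vec J (Y' B) b)) (at J within M)"
proof -
  have dY: "((\<lambda>K. blinfun_apply (Y K) b) has_derivative (\<lambda>B. blinfun_apply (Y' B) b)) (at J within M)"
    by (rule bounded_linear.has_derivative[OF blinfun.bounded_linear_left assms])
  have "((\<lambda>K. tangent_vec K (Y K) b) has_derivative (\<lambda>B. cscale (1/2) (of_vec (blinfun_apply (Y' B) b)
      - cscale \<i> (of_vec (blinfun_apply J (blinfun_apply (Y' B) b) + blinfun_apply B (blinfun_apply (Y J) b)))))) (at J within M)"
    unfolding tangent_vec_eq
    by (intro bounded_linear.has_derivative[OF bounded_linear_cscale] has_derivative_diff
        bounded_linear.has_derivative[OF bounded_linear_of_vec] dY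
        bounded_bilinear.FDERIV[OF bounded_bilinear_blinfun_apply has_derivative_ident dY])
  moreover have "of_vec (x + y) = of_vec x + of_vec y" for x y :: 'a by (simp add: of_vec_def)
  ultimately show ?thesis
    by (simp add: tangent_vec_eq capply_of_vec algebra_simps)
qed

lemma quantum_connection_section:
  fixes vol :: "'v::euclidean_space form"
  assumes vol: "volume_form vol" and U: "openin (top_of_set (complex_structures vol)) U"
    and s: "local_section U quantum_bundle s" and Y: "vector_field (complex_structures vol) U Y"
  shows "local_section U quantum_bundle (\<lambda>K. quantum_connection vol K (Y K) s)"
  unfolding local_section_def
proof (intro conjI ballI allI)
  let ?M = "complex_structures vol"
  note s' = local_section_quantum[OF s]
  have Yt: "Y K \<in> tangent ?M K" if "K \<in> U" for K using Y that by (simp add: vector_field_def)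
  show "quantum_connection vol K (Y K) s \<in> quantum_bundle K" if "K \<in> U" for K
    by (rule quantum_connection_eq(2)[OF vol U that s Yt[OF that]])
  fix xs :: "'v cvec list"
  have "smooth_in U (\<lambda>K. deriv_along ?M (\<lambda>K. s K xs) K (Y K) + \<i>/4 * (\<Sum>b\<in>Basis. nabla (tangent_vec K (Y K) b) (nabla (of_vec b) (s K)) xs))"
    using Y unfolding vector_field_def
    by (intro smooth_in_add smooth_in_deriv_along[OF U s'(3) Y] smooth_in_mult smooth_in_const smooth_in_sum
        smooth_in_nabla nabla_ext_forms s'(2,3) smooth_in_tangent_vec) auto
  then show "smooth_in U (\<lambda>K. quantum_connection vol K (Y K) s xs)"
    by (rule smooth_in_cong[THEN iffD1, rotated])
      (simp add: quantum_connection_eq(1)[OF vol U _ s Yt] second_fundamental_def trivial_connection_def tangent_vec_def)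
qed

text \<open>Only the derivative of the projection inside the correction reaches the fibre. It
  contributes \<open>- \<i>/2\<close> times \<open>nabla (A Y b) (nabla b s)\<close>; the (0,1) part
  of \<open>A Y b\<close> kills \<open>s\<close>, so the Clifford relation turns that part into
  minus a metric coefficient times \<open>s\<close>. Every other term begins with
  \<open>nabla\<close> of a vector of type (1,0) and is orthogonal.\<close>

lemma deriv_along_second_fundamental:
  fixes vol :: "'v::euclidean_space form"
  assumes vol: "volume_form vol" and U: "openin (top_of_set (complex_structures vol)) U" "J \<in> U"
    and s: "local_section U quantum_bundle s" and Y: "vector_field (complex_structures vol) U Y"
    and A: "A \<in> tangent (complex_structures vol) J"
  shows "\<exists>\<phi>\<in>quantum_perp vol J. \<forall>xs. deriv_along (complex_structures vol) (\<lambda>K. second_fundamental K (Y K) (s K) xs) J A =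
    \<i>/2 * (\<Sum>b\<in>Basis. cmetric (of_vec b) (proj01 J (capply A (capply (Y J) (of_vec b))))) * s J xs + \<phi> xs"
proof -
  let ?M = "complex_structures vol"
  let ?e = "of_vec :: 'v \<Rightarrow> _"
  note s' = local_section_quantum[OF s]
  have J: "J \<in> ?M" using U openin_imp_subset by blast
  define Y' where "Y' = deriv_along ?M Y J"
  have dY: "(Y has_derivative Y') (at J within ?M)"
    using Y U unfolding Y'_def by (intro deriv_along_works smooth_in_differentiable[of _ U]) (auto simp: vector_field_def)
  define w where "w b = capply A (capply (Y J) (?e b))" for b
  define t where "t b = (\<lambda>K. nabla (?e b) (s K))" for b
  have te: "t b K \<in> ext_forms" if "K \<in> U" for b K
    using that by (simp add: t_def nabla_ext_forms s'(2))
  have ts: "smooth_in U (\<lambda>K. t b K xs)" for b xs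
    unfolding t_def by (rule smooth_in_nabla[OF s'(2,3) smooth_in_const])
  have dt: "trivial_connection ?M J A (t b) \<in> ext_forms" for b
    by (rule trivial_connection_ext_forms[OF U te ts A])
  have d1: "deriv_along ?M (\<lambda>K. second_fundamental K (Y K) (s K) xs) J A =
     (\<Sum>b\<in>Basis. nabla (cscale (- \<i>/2) (w b) + tangent_vec J (Y' A) b) (t b J) xs
        + nabla (tangent_vec J (Y J) b) (trivial_connection ?M J A (t b)) xs)" for xs
  proof -
    have "deriv_along ?M (\<lambda>K. second_fundamental K (Y K) (s K) xs) J A
       = deriv_along ?M (\<lambda>K. \<Sum>b\<in>Basis. nabla (tangent_vec K (Y K) b) (t b K) xs) J A"
      by (simp add: second_fundamental_def tangent_vec_def t_def)
    also have "\<dots> = (\<Sum>b\<in>Basis. deriv_along ?M (\<lambda>K. nabla (tangent_vec K (Y K) b) (t b K) xs) J A)"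
    proof (rule deriv_along_sum[OF _ A])
      fix b :: 'v
      show "(\<lambda>K. nabla (tangent_vec K (Y K) b) (t b K) xs) differentiable at J within ?M"
        using Y unfolding vector_field_def
        by (intro smooth_in_differentiable[OF U(1) _ U(2)] smooth_in_nabla te ts smooth_in_tangent_vec) auto
    qed
    also have "\<dots> = (\<Sum>b\<in>Basis. nabla (cscale (- \<i>/2) (w b) + tangent_vec J (Y' A) b) (t b J) xs
        + nabla (tangent_vec J (Y J) b) (trivial_connection ?M J A (t b)) xs)"
      unfolding w_def
      by (intro sum.cong refl deriv_along_nabla[OF U te ts tangent_vec_has_derivative[OF dY] A])
    finally show ?thesis .
  qed
  have key: "nabla (w b) (t b J) xs = - cmetric (?e b) (proj01 J (w b)) * s J xs + nabla (proj10 J (w b)) (t b J) xs" for b xs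
  proof -
    have "nabla (w b) (t b J) xs = nabla (cscale 1 (proj01 J (w b)) + proj10 J (w b)) (t b J) xs"
      using proj_sum[of J "w b"] by (simp add: add.commute)
    also have "\<dots> = nabla (proj01 J (w b)) (t b J) xs + nabla (proj10 J (w b)) (t b J) xs"
      by (simp only: nabla_linear_vec[OF te[OF U(2)]] mult_1)
    also have "nabla (proj01 J (w b)) (t b J) xs = - cmetric (?e b) (proj01 J (w b)) * s J xs"
      using nabla_anticommute[OF s'(2)[OF U(2)], of "proj01 J (w b)" "?e b" xs]
        quantum_bundle_nabla[OF s'(1)[OF U(2)] proj01_V01[OF J, of "w b"]]
      by (simp add: t_def cmetric_sym[of "?e b"])
    finally show ?thesis .
  qed
  \<comment> \<open>The terms whose outermost operator belongs to a vector of type (1,0).\<close>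
  define \<phi> where "\<phi> = (\<lambda>xs. \<Sum>b\<in>Basis. (- \<i>/2 * nabla (proj10 J (w b)) (t b J) xs + 1 * nabla (tangent_vec J (Y' A) b) (t b J) xs)
      + nabla (tangent_vec J (Y J) b) (trivial_connection ?M J A (t b)) xs)"
  have tv: "tangent_vec J B b \<in> V10 J" for B b unfolding tangent_vec_def by (rule proj10_V10[OF J])
  have "\<phi> \<in> quantum_perp vol J"
    unfolding \<phi>_def
  proof (rule quantum_perp_sum[OF vol])
    fix b :: 'v
    show "(\<lambda>xs. (- \<i>/2 * nabla (proj10 J (w b)) (t b J) xs + 1 * nabla (tangent_vec J (Y' A) b) (t b J) xs)
      + nabla (tangent_vec J (Y J) b) (trivial_connection ?M J A (t b)) xs) \<in> quantum_perp vol J"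
      using quantum_perp_linear_comb[OF vol quantum_perp_linear_comb[OF vol
          quantum_perp_nabla[OF vol proj10_V10[OF J, of "w b"] te[OF U(2), of b]]
          quantum_perp_nabla[OF vol tv[of "Y' A" b] te[OF U(2), of b]], of "- \<i>/2" 1]
          quantum_perp_nabla[OF vol tv[of "Y J" b] dt[of b]], of 1 1] by simp
  qed
  moreover have "deriv_along ?M (\<lambda>K. second_fundamental K (Y K) (s K) xs) J A =
      \<i>/2 * (\<Sum>b\<in>Basis. cmetric (?e b) (proj01 J (w b))) * s J xs + \<phi> xs" for xs
    unfolding d1 nabla_linear_vec[OF te[OF U(2)]] key \<phi>_def sum_distrib_left sum_distrib_right sum.distrib[symmetric]
    by (intro sum.cong refl) (simp add: algebra_simps)
  ultimately show ?thesis unfolding w_def by blast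
qed

text \<open>Each \<open>dproj10\<close> is \<open>- \<i>/2\<close> times an operator that exchanges
  the types, so a product of two commutes with \<open>proj10\<close> and the inner projection is
  absorbed. The constant is \<open>- \<i>\<close> times the square of
  \<open>- \<i>/2\<close>.\<close>

lemma sigma_form_eq:
  assumes vol: "volume_form vol" and J: "J \<in> complex_structures vol"
    and A: "A \<in> tangent (complex_structures vol) J" and B: "B \<in> tangent (complex_structures vol) J"
  shows "sigma_form vol J A B = \<i>/4 * (\<Sum>b\<in>Basis. cmetric (of_vec b) (proj10 J
     (capply A (capply B (of_vec b)) - capply B (capply A (of_vec b)))))"
proof -
  have sA: "skew_anticommuting J A" and sB: "skew_anticommuting J B"
    using A B tangent_skew_anticommuting by blast+
  have pp: "proj10 J (proj10 J z) = proj10 J z" for z by (rule proj10_ident[OF proj10_V10[OF J]])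
  have "capply A (capply B (proj10 J z)) = proj10 J (capply A (capply B z))"
    "capply B (capply A (proj10 J z)) = proj10 J (capply B (capply A z))" for z
    by (simp_all add: skew_anticommuting_proj[OF sA] skew_anticommuting_proj[OF sB])
  then have *: "proj10 J (dproj10 vol J A (dproj10 vol J B (proj10 J z))) - proj10 J (dproj10 vol J B (dproj10 vol J A (proj10 J z)))
     = cscale (- 1/4) (proj10 J (capply A (capply B z) - capply B (capply A z)))" for z
    by (simp add: dproj10_eq[OF A] dproj10_eq[OF B] pp)
  show ?thesis
    unfolding sigma_form_def ctrace_def * cmetric_simps(3) sum_distrib_left[symmetric] by simp
qed

text \<open>For skew operators the products in both orders have equal diagonal entries, so the
  commutator has zero diagonal and its traces on the two types are opposite. This passes from the
  (0,1) traces that the computations produce to the (1,0) trace in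
  \<open>sigma_form\<close>.\<close>

lemma trace_commutator:
  assumes J: "J \<in> complex_structures vol"
    and A: "skew_anticommuting J A" and B: "skew_anticommuting J B"
  shows "(\<Sum>b\<in>Basis. cmetric (of_vec b) (proj01 J (capply A (capply B (of_vec b)) - capply B (capply A (of_vec b))))) =
    - (\<Sum>b\<in>Basis. cmetric (of_vec b) (proj10 J (capply A (capply B (of_vec b)) - capply B (capply A (of_vec b)))))"
proof -
  let ?c = "\<lambda>b. capply A (capply B (of_vec b)) - capply B (capply A (of_vec b))"
  have "cmetric (of_vec b) (?c b) = 0" for b
  proof -
    have "cmetric (of_vec b) (capply A (capply B (of_vec b))) = cmetric (of_vec b) (capply B (capply A (of_vec b)))"
      using skew_anticommuting_cmetric[OF A, of "of_vec b" "capply B (of_vec b)"]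
        skew_anticommuting_cmetric[OF B, of "of_vec b" "capply A (of_vec b)"]
      by (simp add: cmetric_sym[of "capply B (of_vec b)" "capply A (of_vec b)"])
    then show ?thesis by simp
  qed
  moreover have "cmetric (of_vec b) (proj01 J (?c b)) + cmetric (of_vec b) (proj10 J (?c b)) = cmetric (of_vec b) (?c b)" for b
    using proj_sum[of J "?c b"] by (metis add.commute cmetric_simps(1))
  ultimately have "cmetric (of_vec b) (proj01 J (?c b)) = - cmetric (of_vec b) (proj10 J (?c b))" for b
    by (simp only: eq_neg_iff_add_eq_0)
  then show ?thesis by (simp only: sum_negf)
qed

lemma quantum_curvature:
  fixes vol :: "'v::euclidean_space form"
  assumes vol: "volume_form vol" and U: "openin (top_of_set (complex_structures vol)) U" "J \<in> U"
    and X: "vector_field (complex_structures vol) U X" and Y: "vector_field (complex_structures vol) U Y"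
    and s: "local_section U quantum_bundle s"
  shows "curvature (complex_structures vol) (quantum_connection vol) X Y s J =
    (\<lambda>i. sigma_form vol J (X J) (Y J) / (2 * \<i>) * s J i)"
proof -
  let ?M = "complex_structures vol"
  let ?D = "quantum_connection vol"
  let ?e = "of_vec :: 'v \<Rightarrow> _"
  note s' = local_section_quantum[OF s]
  have UM: "U \<subseteq> ?M" using openin_imp_subset[OF U(1)] .
  then have J: "J \<in> ?M" using U by auto
  have Xt: "X K \<in> tangent ?M K" and Yt: "Y K \<in> tangent ?M K" if "K \<in> U" for K
    using X Y that by (simp_all add: vector_field_def)
  have br: "lie_bracket ?M X Y J \<in> tangent ?M J" by (rule lie_bracket_tangent[OF vol U X Y])
  define q where "q A B = (\<Sum>b\<in>Basis. cmetric (?e b) (proj01 J (capply A (capply B (?e b)))))" for A B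
  \<comment> \<open>The correction of the outer derivative is orthogonal at once. The inner
    correction, differentiated, contributes \<open>\<i>/4\<close> times \<open>\<i>/2\<close>, which
    is \<open>- 1/8\<close>.\<close>
  have half: "\<exists>\<phi>\<in>quantum_perp vol J. \<forall>xs. ?D J (Z1 J) (\<lambda>K. ?D K (Z2 K) s) xs =
      deriv_along ?M (\<lambda>K. deriv_along ?M (\<lambda>K. s K xs) K (Z2 K)) J (Z1 J)
      - 1/8 * q (Z1 J) (Z2 J) * s J xs + \<phi> xs"
    if Z1: "vector_field ?M U Z1" and Z2: "vector_field ?M U Z2" for Z1 Z2
  proof -
    have t1: "Z1 J \<in> tangent ?M J" and t2: "K \<in> U \<Longrightarrow> Z2 K \<in> tangent ?M K" for K
      using Z1 Z2 U by (simp_all add: vector_field_def)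
    define r where "r K = ?D K (Z2 K) s" for K
    have r: "local_section U quantum_bundle r"
      unfolding r_def by (rule quantum_connection_section[OF vol U(1) s Z2])
    obtain \<phi> where \<phi>: "\<phi> \<in> quantum_perp vol J"
      "\<And>xs. deriv_along ?M (\<lambda>K. second_fundamental K (Z2 K) (s K) xs) J (Z1 J) = \<i>/2 * q (Z1 J) (Z2 J) * s J xs + \<phi> xs"
      using deriv_along_second_fundamental[OF vol U s Z2 t1] unfolding q_def by blast
    define \<phi>' where "\<phi>' = (\<lambda>xs. \<i>/4 * \<phi> xs + \<i>/4 * second_fundamental J (Z1 J) (r J) xs)"
    have "\<phi>' \<in> quantum_perp vol J"
      unfolding \<phi>'_def using local_section_quantum(2)[OF r U(2)]
      by (intro quantum_perp_linear_comb vol \<phi>(1) second_fundamental_perp J)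
    moreover have "?D J (Z1 J) r xs =
      deriv_along ?M (\<lambda>K. deriv_along ?M (\<lambda>K. s K xs) K (Z2 K)) J (Z1 J) - 1/8 * q (Z1 J) (Z2 J) * s J xs + \<phi>' xs" for xs
    proof -
      have sf: "smooth_in U (\<lambda>K. second_fundamental K (Z2 K) (s K) xs)"
        using Z2 unfolding vector_field_def second_fundamental_def tangent_vec_def[symmetric]
        by (intro smooth_in_sum smooth_in_nabla nabla_ext_forms s'(2,3) smooth_in_tangent_vec smooth_in_const) auto
      have "deriv_along ?M (\<lambda>K. r K xs) J (Z1 J) = deriv_along ?M (\<lambda>K. deriv_along ?M (\<lambda>K. s K xs) K (Z2 K)
          + \<i>/4 * second_fundamental K (Z2 K) (s K) xs) J (Z1 J)"
        by (rule deriv_along_cong[OF U]) (simp add: r_def quantum_connection_eq(1)[OF vol U(1) _ s t2] trivial_connection_def)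
      also have "\<dots> = deriv_along ?M (\<lambda>K. deriv_along ?M (\<lambda>K. s K xs) K (Z2 K)) J (Z1 J)
          + \<i>/4 * deriv_along ?M (\<lambda>K. second_fundamental K (Z2 K) (s K) xs) J (Z1 J)"
        by (rule deriv_along_eq[OF has_derivative_add[OF _ has_derivative_mult_right] t1])
          (intro deriv_along_works smooth_in_differentiable[OF U(1) _ U(2)] sf smooth_in_deriv_along[OF U(1) s'(3) Z2])+
      finally show ?thesis
        unfolding quantum_connection_eq(1)[OF vol U r t1] trivial_connection_def \<phi>(2) \<phi>'_def
        by (simp add: algebra_simps)
    qed
    ultimately show ?thesis unfolding r_def by blast
  qed
  obtain \<phi>1 where \<phi>1: "\<phi>1 \<in> quantum_perp vol J" "\<And>xs. ?D J (X J) (\<lambda>K. ?D K (Y K) s) xs =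
      deriv_along ?M (\<lambda>K. deriv_along ?M (\<lambda>K. s K xs) K (Y K)) J (X J) - 1/8 * q (X J) (Y J) * s J xs + \<phi>1 xs"
    using half[OF X Y] by blast
  obtain \<phi>2 where \<phi>2: "\<phi>2 \<in> quantum_perp vol J" "\<And>xs. ?D J (Y J) (\<lambda>K. ?D K (X K) s) xs =
      deriv_along ?M (\<lambda>K. deriv_along ?M (\<lambda>K. s K xs) K (X K)) J (Y J) - 1/8 * q (Y J) (X J) * s J xs + \<phi>2 xs"
    using half[OF Y X] by blast
  define F where "F = curvature ?M ?D X Y s J"
  define c where "c = sigma_form vol J (X J) (Y J) / (2 * \<i>)"
  let ?S = "\<Sum>b\<in>Basis. cmetric (?e b) (proj10 J (capply (X J) (capply (Y J) (?e b)) - capply (Y J) (capply (X J) (?e b))))"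
  have "q (X J) (Y J) - q (Y J) (X J) = - (\<Sum>b\<in>Basis. cmetric (?e b) (proj10 J (capply (X J) (capply (Y J) (?e b)) - capply (Y J) (capply (X J) (?e b)))))"
    using trace_commutator[OF J tangent_skew_anticommuting[OF Xt[OF U(2)]] tangent_skew_anticommuting[OF Yt[OF U(2)]]]
    unfolding q_def by (simp only: sum_subtractf[symmetric] cmetric_simps(7)[symmetric] proj_simps(9)[symmetric])
  then have S: "?S = - (q (X J) (Y J) - q (Y J) (X J))" by (simp only: minus_minus)
  have c: "c = - 1/8 * (q (X J) (Y J) - q (Y J) (X J))"
    unfolding c_def sigma_form_eq[OF vol J Xt[OF U(2)] Yt[OF U(2)]] S by (simp add: field_simps)
  define sf where "sf = second_fundamental J (lie_bracket ?M X Y J) (s J)"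
  have sfp: "sf \<in> quantum_perp vol J"
    unfolding sf_def by (rule second_fundamental_perp[OF vol J s'(2)[OF U(2)]])
  \<comment> \<open>The iterated plain derivatives combine to the plain derivative along the bracket
    and cancel that part of the bracket term; what is left of the latter is its orthogonal
    correction \<open>sf\<close>.\<close>
  have F: "F xs - c * s J xs = 1 * (1 * \<phi>1 xs + (-1) * \<phi>2 xs) + (- \<i>/4) * sf xs" for xs
  proof -
    have "deriv_along ?M (\<lambda>K. deriv_along ?M (\<lambda>K. s K xs) K (Y K)) J (X J) -
        deriv_along ?M (\<lambda>K. deriv_along ?M (\<lambda>K. s K xs) K (X K)) J (Y J) =
        deriv_along ?M (\<lambda>K. s K xs) J (lie_bracket ?M X Y J)"
      by (rule deriv_along_lie_bracket[OF U(1) s'(3) X Y U(2) br])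
    then show ?thesis
      unfolding F_def curvature_def \<phi>1(2) \<phi>2(2) quantum_connection_eq(1)[OF vol U s br] trivial_connection_def c sf_def
      by (simp add: algebra_simps)
  qed
  have "(\<lambda>xs. F xs - c * s J xs) \<in> quantum_perp vol J"
    unfolding F by (intro quantum_perp_linear_comb vol \<phi>1 \<phi>2 sfp)
  \<comment> \<open>The difference has just been placed in the complement. It also lies in the
    fibre, since the connection preserves the bundle, and therefore it vanishes.\<close>
  moreover have "(\<lambda>xs. F xs - c * s J xs) \<in> quantum_bundle J"
  proof -
    have 1: "?D J (X J) (\<lambda>K. ?D K (Y K) s) \<in> quantum_bundle J"
      by (rule quantum_connection_eq(2)[OF vol U quantum_connection_section[OF vol U(1) s Y] Xt[OF U(2)]])
    have 2: "?D J (Y J) (\<lambda>K. ?D K (X K) s) \<in> quantum_bundle J"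
      by (rule quantum_connection_eq(2)[OF vol U quantum_connection_section[OF vol U(1) s X] Yt[OF U(2)]])
    have 3: "?D J (lie_bracket ?M X Y J) s \<in> quantum_bundle J"
      by (rule quantum_connection_eq(2)[OF vol U s br])
    from quantum_bundle_linear_comb[OF quantum_bundle_linear_comb[OF 1 2, of 1 "-1"]
        quantum_bundle_linear_comb[OF 3 s'(1)[OF U(2)], of "-1" "-c"], of 1 1]
    show ?thesis unfolding F_def curvature_def by (simp add: algebra_simps)
  qed
  ultimately have "(\<lambda>xs. F xs - c * s J xs) = (\<lambda>xs. 0)" by (intro quantum_perp_disjoint[OF vol])
  then show ?thesis unfolding F_def c_def by (metis (no_types, lifting) ext eq_iff_diff_eq_0)
qed

section \<open>Tensor products with line bundles\<close>

lemma local_section_subset: "local_section U E s \<Longrightarrow> V \<subseteq> U \<Longrightarrow> local_section V E s"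
  by (auto simp: local_section_def intro: smooth_in_subset)

lemma vector_field_subset: "vector_field M U X \<Longrightarrow> V \<subseteq> U \<Longrightarrow> vector_field M V X"
  by (auto simp: vector_field_def intro: smooth_in_subset)

lemma local_section_cong:
  assumes s: "local_section U E s" and eq: "\<And>y. y \<in> U \<Longrightarrow> s y = t y"
  shows "local_section U E t"
  unfolding local_section_def
proof (intro conjI ballI allI)
  show "t y \<in> E y" if "y \<in> U" for y using s eq[OF that] that unfolding local_section_def by auto
  have "smooth_in U (\<lambda>y. s y i)" for i using s unfolding local_section_def by blast
  then show "smooth_in U (\<lambda>y. t y i)" for i
    by (rule smooth_in_cong[THEN iffD1, rotated]) (simp add: eq)
qed

text \<open>The fibrewise linear structure only; smoothness enters through
  \<open>local_section\<close>.\<close>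

definition subspace_bundle :: "'a set \<Rightarrow> ('a \<Rightarrow> ('i \<Rightarrow> complex) set) \<Rightarrow> bool" where
  "subspace_bundle M E \<longleftrightarrow> (\<forall>x\<in>M. (\<lambda>i. 0) \<in> E x \<and>
     (\<forall>u\<in>E x. \<forall>v\<in>E x. \<forall>a b. (\<lambda>i. a * u i + b * v i) \<in> E x))"

lemma subspace_bundle_linear_comb:
  "subspace_bundle M E \<Longrightarrow> x \<in> M \<Longrightarrow> u \<in> E x \<Longrightarrow> v \<in> E x \<Longrightarrow> (\<lambda>i. a * u i + b * v i) \<in> E x"
  by (simp add: subspace_bundle_def)

lemma subspace_bundle_zero: "subspace_bundle M E \<Longrightarrow> x \<in> M \<Longrightarrow> (\<lambda>i. 0) \<in> E x"
  by (simp add: subspace_bundle_def)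

lemma subspace_bundle_sum:
  assumes "subspace_bundle M E" "x \<in> M" "\<And>k. k \<in> I \<Longrightarrow> f k \<in> E x"
  shows "(\<lambda>i. \<Sum>k\<in>I. c k * f k i) \<in> E x"
  using assms(3)
proof (induction I rule: infinite_finite_induct)
  case (insert k I)
  then show ?case
    using subspace_bundle_linear_comb[OF assms(1,2), of "f k" "\<lambda>i. \<Sum>k\<in>I. c k * f k i" "c k" 1] by simp
qed (simp_all add: subspace_bundle_zero[OF assms(1,2)])

lemma local_section_linear_comb:
  assumes "subspace_bundle M E" "U \<subseteq> M" "local_section U E s" "local_section U E t" "smooth_in U f" "smooth_in U g"
  shows "local_section U E (\<lambda>y i. f y * s y i + g y * t y i)"
  unfolding local_section_def
proof (intro conjI ballI allI)
  fix y assume y: "y \<in> U"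
  have "s y \<in> E y" "t y \<in> E y" using assms(3,4) y by (simp_all add: local_section_def)
  then show "(\<lambda>i. f y * s y i + g y * t y i) \<in> E y"
    by (rule subspace_bundle_linear_comb[OF assms(1) subsetD[OF assms(2) y]])
next
  fix i
  have "smooth_in U (\<lambda>y. s y i)" "smooth_in U (\<lambda>y. t y i)" using assms(3,4) by (simp_all add: local_section_def)
  then show "smooth_in U (\<lambda>y. f y * s y i + g y * t y i)"
    by (intro smooth_in_add smooth_in_mult assms(5,6))
qed

lemma local_section_zero: "subspace_bundle M E \<Longrightarrow> U \<subseteq> M \<Longrightarrow> local_section U E (\<lambda>y i. 0)"
  unfolding local_section_def
proof (intro conjI ballI allI)
  fix y assume sub: "subspace_bundle M E" and "U \<subseteq> M" "y \<in> U"
  then have "y \<in> M" by blast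
  then show "(\<lambda>i. 0) \<in> E y" by (rule subspace_bundle_zero[OF sub])
qed (rule smooth_in_const)

lemma local_section_scale:
  assumes "subspace_bundle M E" "U \<subseteq> M" "local_section U E s" "smooth_in U f"
  shows "local_section U E (\<lambda>y i. f y * s y i)"
  using local_section_linear_comb[OF assms(1-3,3,4) smooth_in_const[of U 0]] by simp

lemma local_section_add:
  assumes "subspace_bundle M E" "U \<subseteq> M" "local_section U E s" "local_section U E t"
  shows "local_section U E (\<lambda>y i. s y i + t y i)"
  using local_section_linear_comb[OF assms smooth_in_const[of U 1] smooth_in_const[of U 1]] by simp

lemma
  assumes "connection M E D" "openin (top_of_set M) U" "local_section U E s" "x \<in> U" "A \<in> tangent M x"
  shows connection_in: "D x A s \<in> E x"
    and connection_germ: "local_section U E t \<Longrightarrow> (\<And>y. y \<in> U \<Longrightarrow> s y = t y) \<Longrightarrow> D x A s = D x A t"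
    and connection_linear: "B \<in> tangent M x \<Longrightarrow>
      D x (a *\<^sub>R A + b *\<^sub>R B) s = (\<lambda>i. of_real a * D x A s i + of_real b * D x B s i)"
    and connection_add: "local_section U E t \<Longrightarrow> D x A (\<lambda>y i. s y i + t y i) = (\<lambda>i. D x A s i + D x A t i)"
    and connection_leibniz: "smooth_in U f \<Longrightarrow>
      D x A (\<lambda>y i. f y * s y i) = (\<lambda>i. deriv_along M f x A * s x i + f x * D x A s i)"
proof -
  note c = mp[OF spec[OF spec[OF assms(1)[unfolded connection_def], of U], of s], OF conjI[OF assms(2,3)]]
  show "D x A s \<in> E x"
    using c[THEN conjunct1] assms(4,5) by blast
  show "local_section U E t \<Longrightarrow> (\<And>y. y \<in> U \<Longrightarrow> s y = t y) \<Longrightarrow> D x A s = D x A t"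
    using c[THEN conjunct2, THEN conjunct1] assms(4,5) by blast
  show "B \<in> tangent M x \<Longrightarrow> D x (a *\<^sub>R A + b *\<^sub>R B) s = (\<lambda>i. of_real a * D x A s i + of_real b * D x B s i)"
    using c[THEN conjunct2, THEN conjunct2, THEN conjunct2, THEN conjunct1] assms(4,5) by blast
  show "local_section U E t \<Longrightarrow> D x A (\<lambda>y i. s y i + t y i) = (\<lambda>i. D x A s i + D x A t i)"
    using c[THEN conjunct2, THEN conjunct2, THEN conjunct2, THEN conjunct2, THEN conjunct1] assms(4,5) by blast
  show "smooth_in U f \<Longrightarrow> D x A (\<lambda>y i. f y * s y i) = (\<lambda>i. deriv_along M f x A * s x i + f x * D x A s i)"
    using c[THEN conjunct2, THEN conjunct2, THEN conjunct2, THEN conjunct2, THEN conjunct2] assms(4,5) by blast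
qed

lemma connection_section:
  assumes "connection M E D" "openin (top_of_set M) U" "local_section U E s" "vector_field M U X"
  shows "local_section U E (\<lambda>x. D x (X x) s)"
proof -
  note c = mp[OF spec[OF spec[OF assms(1)[unfolded connection_def], of U], of s], OF conjI[OF assms(2,3)]]
  show ?thesis using c[THEN conjunct2, THEN conjunct2, THEN conjunct1] assms(4) by blast
qed

text \<open>That the combination is a section is proved along with the formula, because the sum rule
  in the next step asks for it.\<close>

lemma connection_combination:
  fixes N :: nat
  assumes D: "connection M E D" and sub: "subspace_bundle M E" and U: "openin (top_of_set M) U" "x \<in> U"
    and A: "A \<in> tangent M x"
  shows "(\<forall>k<N. local_section U E (s k) \<and> smooth_in U (g k)) \<Longrightarrow>
    local_section U E (\<lambda>y i. \<Sum>k<N. g k y * s k y i) \<and>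
    D x A (\<lambda>y i. \<Sum>k<N. g k y * s k y i) = (\<lambda>i. \<Sum>k<N. deriv_along M (g k) x A * s k x i + g k x * D x A (s k) i)"
proof (induction N)
  have UM: "U \<subseteq> M" by (rule openin_imp_subset[OF U(1)])
  case 0
  have z: "local_section U E (\<lambda>y i. 0)" by (rule local_section_zero[OF sub UM])
  \<comment> \<open>The zero section is 0 times itself, so the Leibniz rule gives it zero
    derivative.\<close>
  have "D x A (\<lambda>y i. 0 * 0) = (\<lambda>i. deriv_along M (\<lambda>y. 0) x A * 0 + 0 * D x A (\<lambda>y i. 0) i)"
    by (rule connection_leibniz[OF D U(1) z U(2) A smooth_in_const])
  then show ?case using z by simp
next
  have UM: "U \<subseteq> M" by (rule openin_imp_subset[OF U(1)])
  case (Suc N)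
  let ?r = "\<lambda>y i. \<Sum>k<N. g k y * s k y i"
  have IH: "local_section U E ?r" "D x A ?r = (\<lambda>i. \<Sum>k<N. deriv_along M (g k) x A * s k x i + g k x * D x A (s k) i)"
    using Suc by auto
  have sN: "local_section U E (s N)" "smooth_in U (g N)" using Suc.prems by auto
  have t: "local_section U E (\<lambda>y i. g N y * s N y i)" by (rule local_section_scale[OF sub UM sN])
  show ?case
    using local_section_add[OF sub UM IH(1) t] connection_add[OF D U(1) IH(1) U(2) A t]
      connection_leibniz[OF D U(1) sN(1) U(2) A sN(2)] IH(2) by simp
qed

lemma tensor_apply [simp]: "(u \<otimes>\<^sub>f v) (i, j) = u i * v j"
  by (simp add: tensor_def)

section \<open>Frames of line bundles and the connection on a tensor product\<close>

text \<open>\<open>l\<close> is a frame of \<open>L\<close> whose coordinate \<open>j\<close> does not vanish; this coordinate is used for division.\<close>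

definition line_frame ::
    "'a::real_normed_vector set \<Rightarrow> 'a set \<Rightarrow> ('a \<Rightarrow> ('i \<Rightarrow> complex) set) \<Rightarrow> ('a \<Rightarrow> 'i \<Rightarrow> complex) \<Rightarrow> 'i \<Rightarrow> bool" where
  "line_frame M U L l j \<longleftrightarrow> openin (top_of_set M) U \<and> local_section U L l \<and>
     (\<forall>y\<in>U. l y j \<noteq> 0 \<and> L y = {\<lambda>i. c * l y i | c. True})"

text \<open>A coordinate that is nonzero at \<open>x\<close> is chosen, and by continuity it stays
  nonzero on a smaller neighbourhood.\<close>

lemma line_bundle_frame:
  assumes L: "line_bundle M L" and U: "openin (top_of_set M) U" "x \<in> U"
  obtains V l j where "line_frame M V L l j" "x \<in> V" "V \<subseteq> U"
proof -
  have "x \<in> M" using openin_imp_subset[OF U(1)] U(2) by blast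
  from bspec[OF L[unfolded line_bundle_def] this]
  obtain W l where W: "openin (top_of_set M) W" "x \<in> W" "local_section W L l"
    "\<forall>y\<in>W. l y \<noteq> (\<lambda>i. 0) \<and> L y = {\<lambda>i. c * l y i | c. True}" by (elim exE conjE)
  have "l x \<noteq> (\<lambda>i. 0)" using bspec[OF W(4,2)] by (rule conjunct1)
  then obtain j where j: "l x j \<noteq> 0" by (auto simp: fun_eq_iff)
  have "smooth_in W (\<lambda>y. l y j)" using W(3) unfolding local_section_def by blast
  then have c: "continuous_on (U \<inter> W) (\<lambda>y. l y j)"
    using smooth_in_continuous_on[OF smooth_in_subset[OF _ Int_lower2]] by blast
  define V where "V = (U \<inter> W) \<inter> (\<lambda>y. l y j) -` (- {0})"
  have "openin (top_of_set (U \<inter> W)) V"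
  proof -
    have "open (- {0 :: complex})" by (rule open_Compl[OF closed_singleton])
    from continuous_openin_preimage_gen[OF c this] show ?thesis unfolding V_def .
  qed
  then have V: "openin (top_of_set M) V" by (rule openin_trans) (rule openin_Int[OF U(1) W(1)])
  have VW: "V \<subseteq> W" and VU: "V \<subseteq> U" and xV: "x \<in> V" using U(2) W(2) j by (auto simp: V_def)
  have "line_frame M V L l j"
    unfolding line_frame_def
  proof (intro conjI ballI V local_section_subset[OF W(3) VW])
    fix y assume y: "y \<in> V"
    then have "y \<in> W" using VW by blast
    from bspec[OF W(4) this] show "L y = {\<lambda>i. c * l y i | c. True}" by (rule conjunct2)
    show "l y j \<noteq> 0" using y by (simp add: V_def)
  qed
  then show ?thesis using xV VU by (rule that)
qed

lemma line_bundle_subspace: "line_bundle M L \<Longrightarrow> subspace_bundle M L"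
  unfolding line_bundle_def subspace_bundle_def
proof (intro ballI)
  fix x assume *: "\<forall>x\<in>M. \<exists>U l. openin (top_of_set M) U \<and> x \<in> U \<and> local_section U L l \<and>
     (\<forall>y\<in>U. l y \<noteq> (\<lambda>i. 0) \<and> L y = {\<lambda>i. c * l y i | c. True})" and "x \<in> M"
  from bspec[OF this] obtain U l where "x \<in> U" "\<forall>y\<in>U. l y \<noteq> (\<lambda>i. 0) \<and> L y = {\<lambda>i. c * l y i | c. True}"
    by (elim exE conjE)
  from bspec[OF this(2,1)] have l: "L x = {\<lambda>i. c * l x i | c. True}" by (rule conjunct2)
  show "(\<lambda>i. 0) \<in> L x \<and> (\<forall>u\<in>L x. \<forall>v\<in>L x. \<forall>a b. (\<lambda>i. a * u i + b * v i) \<in> L x)"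
  proof (intro conjI ballI allI)
    show "(\<lambda>i. 0) \<in> L x" unfolding l by (auto intro!: exI[of _ 0])
    fix u v a b assume "u \<in> L x" "v \<in> L x"
    then obtain c d where "u = (\<lambda>i. c * l x i)" "v = (\<lambda>i. d * l x i)" unfolding l by auto
    then show "(\<lambda>i. a * u i + b * v i) \<in> L x"
      unfolding l by (auto intro!: exI[of _ "a * c + b * d"] simp: algebra_simps)
  qed
qed

lemma line_frame_coordinate:
  assumes "line_frame M U L l j" "y \<in> U" "v \<in> L y"
  shows "v = (\<lambda>i. (v j / l y j) * l y i)"
proof -
  obtain c where "v = (\<lambda>i. c * l y i)" using assms unfolding line_frame_def by blast
  moreover have "l y j \<noteq> 0" using assms by (simp add: line_frame_def)
  ultimately show ?thesis by simp
qed

lemma line_frame_section: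
  assumes "line_frame M U L l j" "local_section V L t" "V \<subseteq> U"
  shows "smooth_in V (\<lambda>y. t y j / l y j)" "y \<in> V \<Longrightarrow> t y = (\<lambda>i. (t y j / l y j) * l y i)"
proof -
  have "smooth_in V (\<lambda>y. t y j * inverse (l y j))"
    using assms by (intro smooth_in_mult smooth_in_inverse)
      (auto simp: local_section_def line_frame_def intro: smooth_in_subset)
  then show "smooth_in V (\<lambda>y. t y j / l y j)" by (simp add: divide_inverse)
  show "t y = (\<lambda>i. (t y j / l y j) * l y i)" if "y \<in> V"
    using line_frame_coordinate[OF assms(1)] assms(2,3) that by (metis local_section_def subsetD)
qed

text \<open>The point is uniqueness. In any other local representation the second factors are smooth
  multiples \<open>g k\<close> of the frame, so \<open>u\<close> is the combination of the first
  factors with these coefficients. Differentiating both relations by the Leibniz rule shows that the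
  terms containing derivatives of \<open>g k\<close> are distributed differently over the two
  factors but have the same sum.\<close>

lemma tensor_connection_eq:
  fixes M :: "'a::real_normed_vector set" and E :: "'a \<Rightarrow> ('b \<Rightarrow> complex) set" and L :: "'a \<Rightarrow> ('c \<Rightarrow> complex) set"
  assumes DE: "connection M E DE" and subE: "subspace_bundle M E"
    and DL: "connection M L DL" and fr: "line_frame M U L l j"
    and x: "x \<in> U" and A: "A \<in> tangent M x"
    and u: "local_section U E u" and r: "\<And>y. y \<in> U \<Longrightarrow> r y = u y \<otimes>\<^sub>f l y"
  shows "tensor_connection M E DE L DL x A r = (\<lambda>p. (DE x A u \<otimes>\<^sub>f l x) p + (u x \<otimes>\<^sub>f DL x A l) p)"
proof -
  define P where "P w \<longleftrightarrow> (\<exists>U (N::nat) s t. openin (top_of_set M) U \<and> x \<in> U \<and>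
     (\<forall>k<N. local_section U E (s k) \<and> local_section U L (t k)) \<and>
     (\<forall>y\<in>U. r y = (\<lambda>p. \<Sum>k<N. (s k y \<otimes>\<^sub>f t k y) p)) \<and>
     w = (\<lambda>p. \<Sum>k<N. (DE x A (s k) \<otimes>\<^sub>f t k x) p + (s k x \<otimes>\<^sub>f DL x A (t k)) p))" for w
  have U: "openin (top_of_set M) U" and l: "local_section U L l" using fr by (simp_all add: line_frame_def)
  have ex: "P (\<lambda>p. (DE x A u \<otimes>\<^sub>f l x) p + (u x \<otimes>\<^sub>f DL x A l) p)"
    unfolding P_def using U x u l r
    by (intro exI[of _ U] exI[of _ 1] exI[of _ "\<lambda>_. u"] exI[of _ "\<lambda>_. l"]) simp
  have uniq: "w = (\<lambda>p. (DE x A u \<otimes>\<^sub>f l x) p + (u x \<otimes>\<^sub>f DL x A l) p)" if Pw: "P w" for w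
  proof -
    from Pw
    obtain U' and N :: nat and s t where U': "openin (top_of_set M) U'" "x \<in> U'"
      and st0: "\<forall>k<N. local_section U' E (s k) \<and> local_section U' L (t k)"
      and r0: "\<forall>y\<in>U'. r y = (\<lambda>p. \<Sum>k<N. (s k y \<otimes>\<^sub>f t k y) p)"
      and w: "w = (\<lambda>p. \<Sum>k<N. (DE x A (s k) \<otimes>\<^sub>f t k x) p + (s k x \<otimes>\<^sub>f DL x A (t k)) p)"
      unfolding P_def by (elim exE conjE)
    have st: "local_section U' E (s k)" "local_section U' L (t k)" if "k < N" for k using st0 that by simp_all
    have r': "r y = (\<lambda>p. \<Sum>k<N. (s k y \<otimes>\<^sub>f t k y) p)" if "y \<in> U'" for y using r0 that by simp
    define V where "V = U \<inter> U'"
    have V: "openin (top_of_set M) V" "x \<in> V" using U U' x by (auto simp: V_def openin_Int)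
    have VU: "V \<subseteq> U" "V \<subseteq> U'" by (auto simp: V_def)
    have sV: "local_section V E (s k)" and tV: "local_section V L (t k)" if "k < N" for k
      using st[OF that] VU(2) by (auto intro: local_section_subset)
    have uV: "local_section V E u" and lV: "local_section V L l" using u l VU by (auto intro: local_section_subset)
    define g where "g k y = t k y j / l y j" for k y
    have g: "smooth_in V (g k)" "y \<in> V \<Longrightarrow> t k y = (\<lambda>i. g k y * l y i)" if "k < N" for k y
      using line_frame_section[OF fr tV[OF that] VU(1)] by (simp_all add: g_def[abs_def])
    \<comment> \<open>Both representations are evaluated at \<open>(i, j)\<close>, and the nonzero
      coordinate \<open>l y j\<close> is cancelled.\<close>
    have uy: "u y = (\<lambda>i. \<Sum>k<N. g k y * s k y i)" if y: "y \<in> V" for y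
    proof
      fix i
      have "u y i * l y j = (\<Sum>k<N. s k y i * t k y j)"
      proof -
        have "y \<in> U" "y \<in> U'" using y VU by auto
        from fun_cong[OF r[OF this(1)], of "(i, j)"] fun_cong[OF r'[OF this(2)], of "(i, j)"] show ?thesis by simp
      qed
      also have "\<dots> = (\<Sum>k<N. g k y * s k y i) * l y j"
        unfolding sum_distrib_right by (rule sum.cong) (auto simp: g(2)[OF _ y])
      finally show "u y i = (\<Sum>k<N. g k y * s k y i)"
        using fr y VU by (auto simp: line_frame_def)
    qed
    have comb: "local_section V E (\<lambda>y i. \<Sum>k<N. g k y * s k y i) \<and>
      DE x A (\<lambda>y i. \<Sum>k<N. g k y * s k y i) = (\<lambda>i. \<Sum>k<N. deriv_along M (g k) x A * s k x i + g k x * DE x A (s k) i)"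
      by (rule connection_combination[OF DE subE V A]) (simp add: sV g)
    have DEu: "DE x A u = (\<lambda>i. \<Sum>k<N. deriv_along M (g k) x A * s k x i + g k x * DE x A (s k) i)"
      using connection_germ[OF DE V(1) uV V(2) A, of "\<lambda>y i. \<Sum>k<N. g k y * s k y i"] comb uy by simp
    have DLt: "DL x A (t k) = (\<lambda>i. deriv_along M (g k) x A * l x i + g k x * DL x A l i)" if k: "k < N" for k
    proof -
      have "local_section V L (\<lambda>y i. g k y * l y i)"
        by (rule local_section_cong[OF tV[OF k]]) (rule g(2)[OF k])
      then have "DL x A (t k) = DL x A (\<lambda>y i. g k y * l y i)"
        by (rule connection_germ[OF DL V(1) tV[OF k] V(2) A]) (rule g(2)[OF k])
      then show ?thesis by (simp add: connection_leibniz[OF DL V(1) lV V(2) A g(1)[OF k]])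
    qed
    show ?thesis
    proof
      fix p :: "'b \<times> 'c"
      obtain a b where p: "p = (a, b)" by (cases p)
      have "w p = (\<Sum>k<N. DE x A (s k) a * (g k x * l x b) + s k x a * (deriv_along M (g k) x A * l x b + g k x * DL x A l b))"
        unfolding w p by (rule sum.cong) (simp_all add: g(2)[OF _ V(2)] DLt)
      also have "\<dots> = (\<Sum>k<N. deriv_along M (g k) x A * s k x a + g k x * DE x A (s k) a) * l x b
         + (\<Sum>k<N. g k x * s k x a) * DL x A l b"
        unfolding sum_distrib_right sum.distrib[symmetric] by (rule sum.cong) (simp_all add: algebra_simps)
      finally show "w p = (DE x A u \<otimes>\<^sub>f l x) p + (u x \<otimes>\<^sub>f DL x A l) p"
        by (simp add: p DEu uy[OF V(2)])
    qed
  qed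
  have "tensor_connection M E DE L DL x A r = (THE w. P w)"
    unfolding tensor_connection_def P_def ..
  also have "\<dots> = (\<lambda>p. (DE x A u \<otimes>\<^sub>f l x) p + (u x \<otimes>\<^sub>f DL x A l) p)"
    by (rule the_equality[of P, OF ex uniq])
  finally show ?thesis .
qed

section \<open>Connection forms and the curvature of a tensor product\<close>

definition connection_form ::
    "('a \<Rightarrow> 'a \<Rightarrow> ('a \<Rightarrow> 'i \<Rightarrow> complex) \<Rightarrow> 'i \<Rightarrow> complex) \<Rightarrow> ('a \<Rightarrow> 'i \<Rightarrow> complex) \<Rightarrow> 'i \<Rightarrow> 'a \<Rightarrow> 'a \<Rightarrow> complex" where
  "connection_form D l j x A = D x A l j / l x j"

lemma connection_form_eq:
  assumes "connection M L D" "line_frame M U L l j" "x \<in> U" "A \<in> tangent M x"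
  shows "D x A l = (\<lambda>i. connection_form D l j x A * l x i)"
proof -
  have U: "openin (top_of_set M) U" and l: "local_section U L l" using assms(2) by (simp_all add: line_frame_def)
  show ?thesis
    unfolding connection_form_def
    by (rule line_frame_coordinate[OF assms(2,3) connection_in[OF assms(1) U l assms(3,4)]])
qed

lemma connection_form_smooth:
  assumes "connection M L D" "line_frame M U L l j" "vector_field M U X"
  shows "smooth_in U (\<lambda>x. connection_form D l j x (X x))"
proof -
  have "local_section U L (\<lambda>x. D x (X x) l)"
    using assms(2) by (intro connection_section[OF assms(1) _ _ assms(3)]) (simp_all add: line_frame_def)
  from line_frame_section(1)[OF assms(2) this] show ?thesis by (simp add: connection_form_def)
qed

text \<open>The invariant formula for the differential of a 1-form. For the connection form of a
  frame it gives the curvature of the line bundle.\<close>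

definition exterior_derivative ::
    "'a::real_normed_vector set \<Rightarrow> ('a \<Rightarrow> 'a \<Rightarrow> complex) \<Rightarrow> ('a \<Rightarrow> 'a) \<Rightarrow> ('a \<Rightarrow> 'a) \<Rightarrow> 'a \<Rightarrow> complex" where
  "exterior_derivative M \<theta> X Y x = deriv_along M (\<lambda>y. \<theta> y (Y y)) x (X x) - deriv_along M (\<lambda>y. \<theta> y (X y)) x (Y x)
     - \<theta> x (lie_bracket M X Y x)"

text \<open>In the frame \<open>l\<close> the tensor connection is \<open>DE\<close> shifted by the
  scalar form \<theta>. In the second derivatives the terms mixing \<theta> with \<open>DE\<close>
  and the products of two values of \<theta> are symmetric in the two fields and drop out, leaving
  the differential of \<theta>.\<close>

lemma tensor_curvature:
  fixes M :: "'a::real_normed_vector set"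
  assumes DE: "connection M E DE" and subE: "subspace_bundle M E"
    and DL: "connection M L DL" and fr: "line_frame M U L l j" and x: "x \<in> U"
    and X: "vector_field M U X" and Y: "vector_field M U Y" and br: "lie_bracket M X Y x \<in> tangent M x"
    and u: "local_section U E u" and r: "\<And>y. y \<in> U \<Longrightarrow> r y = u y \<otimes>\<^sub>f l y"
  shows "curvature M (tensor_connection M E DE L DL) X Y r x =
    (\<lambda>p. ((\<lambda>i. curvature M DE X Y u x i + exterior_derivative M (connection_form DL l j) X Y x * u x i) \<otimes>\<^sub>f l x) p)"
proof -
  let ?D = "tensor_connection M E DE L DL"
  let ?\<theta> = "connection_form DL l j"
  have U: "openin (top_of_set M) U" using fr by (simp add: line_frame_def)
  have UM: "U \<subseteq> M" by (rule openin_imp_subset[OF U])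
  have one: "?D y A t = (\<lambda>i. DE y A v i + ?\<theta> y A * v y i) \<otimes>\<^sub>f l y"
    if "y \<in> U" "A \<in> tangent M y" "local_section U E v" "\<And>y. y \<in> U \<Longrightarrow> t y = v y \<otimes>\<^sub>f l y" for y A v t
    using tensor_connection_eq[OF DE subE DL fr that] connection_form_eq[OF DL fr that(1,2)]
    by (auto simp: tensor_def fun_eq_iff algebra_simps)
  have two: "?D x (Z1 x) (\<lambda>y. ?D y (Z2 y) r) =
     (\<lambda>i. DE x (Z1 x) (\<lambda>y. DE y (Z2 y) u) i + deriv_along M (\<lambda>y. ?\<theta> y (Z2 y)) x (Z1 x) * u x i
       + ?\<theta> x (Z2 x) * DE x (Z1 x) u i + ?\<theta> x (Z1 x) * DE x (Z2 x) u i + ?\<theta> x (Z1 x) * ?\<theta> x (Z2 x) * u x i) \<otimes>\<^sub>f l x"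
    if Z1: "vector_field M U Z1" and Z2: "vector_field M U Z2" for Z1 Z2
  proof -
    have t1: "Z1 x \<in> tangent M x" and t2: "\<And>y. y \<in> U \<Longrightarrow> Z2 y \<in> tangent M y"
      using Z1 Z2 x by (auto simp: vector_field_def)
    have sm: "smooth_in U (\<lambda>y. ?\<theta> y (Z2 y))" by (rule connection_form_smooth[OF DL fr Z2])
    have s1: "local_section U E (\<lambda>y. DE y (Z2 y) u)" by (rule connection_section[OF DE U u Z2])
    have s2: "local_section U E (\<lambda>y i. ?\<theta> y (Z2 y) * u y i)" by (rule local_section_scale[OF subE UM u sm])
    let ?v = "\<lambda>y i. DE y (Z2 y) u i + ?\<theta> y (Z2 y) * u y i"
    have v: "local_section U E ?v" by (rule local_section_add[OF subE UM s1 s2])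
    have "DE x (Z1 x) ?v = (\<lambda>i. DE x (Z1 x) (\<lambda>y. DE y (Z2 y) u) i
       + (deriv_along M (\<lambda>y. ?\<theta> y (Z2 y)) x (Z1 x) * u x i + ?\<theta> x (Z2 x) * DE x (Z1 x) u i))"
      using connection_add[OF DE U s1 x t1 s2] connection_leibniz[OF DE U u x t1 sm] by simp
    then show ?thesis
      using one[OF x t1 v, of "\<lambda>y. ?D y (Z2 y) r"] one[OF _ t2 u r] by (simp add: algebra_simps)
  qed
  have three: "?D x (lie_bracket M X Y x) r =
      (\<lambda>i. DE x (lie_bracket M X Y x) u i + ?\<theta> x (lie_bracket M X Y x) * u x i) \<otimes>\<^sub>f l x"
    by (rule one[OF x br u]) (rule r)
  show ?thesis
    unfolding curvature_def two[OF X Y] two[OF Y X] three exterior_derivative_def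
    by (auto simp: fun_eq_iff tensor_def algebra_simps)
qed

text \<open>An element of the fibre is a finite sum of products whose second factors are multiples
  of \<open>l y\<close>, so it is a single product with \<open>l y\<close>; dividing the coordinate
  \<open>j\<close> by \<open>l y j\<close> recovers the first factor smoothly.\<close>

lemma tensor_section_factor:
  assumes sub: "subspace_bundle M E" and fr: "line_frame M U L l j" and r: "local_section U (tensor_bundle E L) r"
  defines "u \<equiv> \<lambda>y i. r y (i, j) / l y j"
  shows "local_section U E u" "y \<in> U \<Longrightarrow> r y = u y \<otimes>\<^sub>f l y"
proof -
  have "openin (top_of_set M) U" using fr by (simp add: line_frame_def)
  then have UM: "U \<subseteq> M" by (rule openin_imp_subset)
  have *: "u y \<in> E y \<and> r y = u y \<otimes>\<^sub>f l y" if y: "y \<in> U" for y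
  proof -
    have "r y \<in> cspan {u \<otimes>\<^sub>f v | u v. u \<in> E y \<and> v \<in> L y}"
      using r y by (simp add: local_section_def tensor_bundle_def)
    then obtain N :: nat and c f where N: "r y = (\<lambda>p. \<Sum>k<N. c k * f k p)"
      "\<forall>k<N. f k \<in> {u \<otimes>\<^sub>f v | u v. u \<in> E y \<and> v \<in> L y}"
      unfolding cspan_def by (elim CollectE exE conjE)
    have "\<exists>a b. f k = a \<otimes>\<^sub>f b \<and> a \<in> E y \<and> b \<in> L y" if "k < N" for k using N(2) that by blast
    then have "\<forall>k\<in>{..<N}. \<exists>a b. f k = a \<otimes>\<^sub>f b \<and> a \<in> E y \<and> b \<in> L y" by simp
    from bchoice[OF this] obtain a where "\<forall>k\<in>{..<N}. \<exists>b. f k = a k \<otimes>\<^sub>f b \<and> a k \<in> E y \<and> b \<in> L y" by (elim exE)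
    from bchoice[OF this] obtain b where "\<forall>k\<in>{..<N}. f k = a k \<otimes>\<^sub>f b k \<and> a k \<in> E y \<and> b k \<in> L y" by (elim exE)
    then have ab: "f k = a k \<otimes>\<^sub>f b k" "a k \<in> E y" "b k \<in> L y" if "k < N" for k using that by simp_all
    have bl: "b k = (\<lambda>i. (b k j / l y j) * l y i)" if "k < N" for k
      by (rule line_frame_coordinate[OF fr y ab(3)[OF that]])
    have ly: "l y j \<noteq> 0" using fr y by (simp add: line_frame_def)
    have rr: "r y (i, m) = (\<Sum>k<N. c k * (b k j / l y j) * a k i) * l y m" for i m
      unfolding N(1) sum_distrib_right
    proof (rule sum.cong[OF refl])
      fix k assume "k \<in> {..<N}"
      then have k: "k < N" by simp
      have "b k m = (b k j / l y j) * l y m" using fun_cong[OF bl[OF k], of m] .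
      then show "c k * f k (i, m) = c k * (b k j / l y j) * a k i * l y m" by (simp add: ab(1)[OF k])
    qed
    have uy: "u y = (\<lambda>i. \<Sum>k<N. c k * (b k j / l y j) * a k i)"
      unfolding u_def rr using ly by simp
    have "u y \<in> E y" unfolding uy by (rule subspace_bundle_sum[OF sub]) (use y UM ab in auto)
    moreover have "r y = u y \<otimes>\<^sub>f l y" by (rule ext) (auto simp: tensor_def uy rr)
    ultimately show ?thesis by blast
  qed
  show "r y = u y \<otimes>\<^sub>f l y" if "y \<in> U" using *[OF that] by simp
  have "smooth_in U (\<lambda>y. r y (i, j) * inverse (l y j))" for i
    using r fr by (intro smooth_in_mult smooth_in_inverse) (auto simp: local_section_def line_frame_def)
  then show "local_section U E u" unfolding local_section_def using * by (auto simp: u_def divide_inverse)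
qed

text \<open>Sections are locally of the form \<open>u \<otimes>\<^sub>f l\<close>, where the two
  scalar curvatures add. \<open>canc\<close> says that they are opposite in every frame.\<close>

lemma tensor_flat:
  fixes M :: "'a::real_normed_vector set"
  assumes DE: "connection M E DE" and subE: "subspace_bundle M E" and DL: "connection M L DL" and L: "line_bundle M L"
    and br: "\<And>U X Y x. openin (top_of_set M) U \<Longrightarrow> vector_field M U X \<Longrightarrow> vector_field M U Y \<Longrightarrow> x \<in> U \<Longrightarrow>
      lie_bracket M X Y x \<in> tangent M x"
    and \<omega>: "scalar_curvature M E DE \<omega>"
    and canc: "\<And>U l j X Y x. line_frame M U L l j \<Longrightarrow> vector_field M U X \<Longrightarrow> vector_field M U Y \<Longrightarrow> x \<in> U \<Longrightarrow>
      exterior_derivative M (connection_form DL l j) X Y x = - \<omega> x (X x) (Y x)"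
  shows "flat M (tensor_bundle E L) (tensor_connection M E DE L DL)"
  unfolding flat_def
proof (intro allI impI ballI, elim conjE)
  fix U X Y r x
  assume U: "openin (top_of_set M) U" and X: "vector_field M U X" and Y: "vector_field M U Y"
    and r: "local_section U (tensor_bundle E L) r" and x: "x \<in> U"
  obtain V l j where fr: "line_frame M V L l j" "x \<in> V" "V \<subseteq> U" by (rule line_bundle_frame[OF L U x])
  have X': "vector_field M V X" and Y': "vector_field M V Y" using X Y fr(3) by (auto intro: vector_field_subset)
  have V: "openin (top_of_set M) V" using fr by (simp add: line_frame_def)
  define u where "u = (\<lambda>y i. r y (i, j) / l y j)"
  have u: "local_section V E u" "\<And>y. y \<in> V \<Longrightarrow> r y = u y \<otimes>\<^sub>f l y"
    using tensor_section_factor[OF subE fr(1) local_section_subset[OF r fr(3)]] by (auto simp: u_def)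
  have "curvature M DE X Y u x = (\<lambda>i. \<omega> x (X x) (Y x) * u x i)"
    using \<omega> V X' Y' u(1) fr(2) unfolding scalar_curvature_def by blast
  moreover have "curvature M (tensor_connection M E DE L DL) X Y r x =
    (\<lambda>p. ((\<lambda>i. curvature M DE X Y u x i + exterior_derivative M (connection_form DL l j) X Y x * u x i) \<otimes>\<^sub>f l x) p)"
    by (rule tensor_curvature[OF DE subE DL fr(1,2) X' Y' br[OF V X' Y' fr(2)] u(1)]) (rule u(2))
  ultimately show "curvature M (tensor_connection M E DE L DL) X Y r x = (\<lambda>i. 0)"
    unfolding canc[OF fr(1) X' Y' fr(2)]
    by (simp add: tensor_def fun_eq_iff)
qed

section \<open>The connection axioms for the quantum connection\<close>

lemma quantum_subspace_bundle: "subspace_bundle M quantum_bundle"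
proof -
  have "(\<lambda>i. 0) \<in> quantum_bundle J" for J :: "'a \<Rightarrow>\<^sub>L 'a"
    by (simp add: quantum_bundle_def ext_forms_zero)
  then show ?thesis by (simp add: subspace_bundle_def quantum_bundle_linear_comb)
qed

lemma connection_quantum_connection:
  fixes vol :: "'v::euclidean_space form"
  assumes vol: "volume_form vol"
  shows "connection (complex_structures vol) quantum_bundle (quantum_connection vol)"
  unfolding connection_def
proof (intro allI impI conjI ballI)
  let ?M = "complex_structures vol"
  fix U s
  assume *: "openin (top_of_set ?M) U \<and> local_section U quantum_bundle s"
  then have U: "openin (top_of_set ?M) U" and s: "local_section U quantum_bundle s" by auto
  have UM: "U \<subseteq> ?M" by (rule openin_imp_subset[OF U])
  show "local_section U quantum_bundle (\<lambda>x. quantum_connection vol x (X x) s)" if "vector_field ?M U X" for X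
    by (rule quantum_connection_section[OF vol U s that])
  fix J A assume J: "J \<in> U" and A: "A \<in> tangent ?M J"
  note eq = quantum_connection_eq(1)[OF vol U J]
  have ext: "t J \<in> ext_forms" if "local_section U quantum_bundle t" for t
    by (rule local_section_quantum(2)[OF that J])
  have dif: "(\<lambda>K. t K i) differentiable (at J within ?M)" if "local_section U quantum_bundle t" for t i
    by (rule smooth_in_differentiable[OF U local_section_quantum(3)[OF that] J])
  show "quantum_connection vol J A s \<in> quantum_bundle J" by (rule quantum_connection_eq(2)[OF vol U J s A])
  show "quantum_connection vol J A s = quantum_connection vol J A t"
    if "local_section U quantum_bundle t \<and> (\<forall>y\<in>U. s y = t y)" for t
  proof -
    have t: "local_section U quantum_bundle t" and st: "\<And>y. y \<in> U \<Longrightarrow> s y = t y" using that by auto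
    have "trivial_connection ?M J A s = trivial_connection ?M J A t"
      unfolding trivial_connection_def by (rule HOL.ext, rule deriv_along_cong[OF U J]) (simp add: st)
    then show ?thesis by (simp add: eq[OF s A] eq[OF t A] st[OF J])
  qed
  show "quantum_connection vol J A (\<lambda>y i. s y i + t y i) = (\<lambda>i. quantum_connection vol J A s i + quantum_connection vol J A t i)"
    if t: "local_section U quantum_bundle t" for t
    unfolding eq[OF s A] eq[OF t A] eq[OF local_section_add[OF quantum_subspace_bundle UM s t] A] trivial_connection_def
    using second_fundamental_linear_comb[OF ext[OF s] ext[OF t], of J A 1 1]
    by (simp add: deriv_along_add[OF dif[OF s] dif[OF t] A] algebra_simps)
  show "quantum_connection vol J A (\<lambda>y i. f y * s y i) =
      (\<lambda>i. deriv_along ?M f J A * s J i + f J * quantum_connection vol J A s i)" if f: "smooth_in U f" for f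
    unfolding eq[OF s A] eq[OF local_section_scale[OF quantum_subspace_bundle UM s f] A] trivial_connection_def
    using second_fundamental_linear_comb[OF ext[OF s] ext[OF s], of J A "f J" 0]
    by (simp add: deriv_along_mult[OF smooth_in_differentiable[OF U f J] dif[OF s] A] algebra_simps)
  fix B a b assume B: "B \<in> tangent ?M J"
  have JM: "J \<in> ?M" using J UM by auto
  show "quantum_connection vol J (a *\<^sub>R A + b *\<^sub>R B) s =
      (\<lambda>i. of_real a * quantum_connection vol J A s i + of_real b * quantum_connection vol J B s i)"
    unfolding eq[OF s A] eq[OF s B] eq[OF s tangent_linear[OF vol JM A B]] trivial_connection_def
      second_fundamental_linear_tangent[OF ext[OF s]]
    by (simp add: deriv_along_linear[OF dif[OF s]] scaleR_conv_of_real algebra_simps)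
qed

section \<open>Derivations of forms and exterior products of vectors\<close>

definition derivation :: "('v::real_vector cvec \<Rightarrow> 'v cvec) \<Rightarrow> 'v form \<Rightarrow> 'v form" where
  "derivation T \<psi> xs = (\<Sum>i<length xs. \<psi> (xs[i := T (xs ! i)]))"

definition clinear_map :: "('v::real_vector cvec \<Rightarrow> 'v cvec) \<Rightarrow> bool" where
  "clinear_map T \<longleftrightarrow> (\<forall>c x y. T (cscale c x + y) = cscale c (T x) + T y)"

lemma derivation_Nil [simp]: "derivation T \<psi> [] = 0"
  by (simp add: derivation_def)

lemma derivation_Cons: "derivation T \<psi> (x # xs) = \<psi> (T x # xs) + derivation T (interior x \<psi>) xs"
  unfolding derivation_def length_Cons sum.lessThan_Suc_shift by (simp add: interior_def)

lemma derivation_linear_comb: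
  "derivation T (\<lambda>xs. a * \<psi> xs + b * \<phi> xs) xs = a * derivation T \<psi> xs + b * derivation T \<phi> xs"
  by (simp add: derivation_def sum.distrib sum_distrib_left)

lemma derivation_ident: "derivation (\<lambda>x. x) \<psi> xs = of_nat (length xs) * \<psi> xs"
  by (simp add: derivation_def)

lemma derivation_diff_map:
  assumes "\<psi> \<in> ext_forms"
  shows "derivation (\<lambda>x. T x - S x) \<psi> xs = derivation T \<psi> xs - derivation S \<psi> xs"
  using assms
proof (induction xs arbitrary: \<psi>)
  case (Cons x xs)
  have "\<psi> ((T x - S x) # xs) = \<psi> (T x # xs) - \<psi> (S x # xs)"
    using ext_forms_Cons(1)[OF Cons.prems, of "-1" "S x" "T x" xs] by simp
  then show ?case using Cons.IH[OF interior_ext_forms[OF Cons.prems]] by (simp add: derivation_Cons)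
qed simp

text \<open>Substitution into arguments is contravariant, so the commutator of the derivations
  belongs to the commutator of the maps in the opposite order.\<close>

lemma derivation_commutator:
  assumes "\<psi> \<in> ext_forms"
  shows "derivation S (derivation T \<psi>) xs - derivation T (derivation S \<psi>) xs = derivation (\<lambda>x. T (S x) - S (T x)) \<psi> xs"
  using assms
proof (induction xs arbitrary: \<psi>)
  case (Cons x xs)
  have step: "derivation S (derivation T \<psi>) (x # xs) = \<psi> (T (S x) # xs) + derivation T (interior (S x) \<psi>) xs
      + derivation S (interior (T x) \<psi>) xs + derivation S (derivation T (interior x \<psi>)) xs" for S T
  proof -
    have "interior x (derivation T \<psi>) = (\<lambda>ys. 1 * interior (T x) \<psi> ys + 1 * derivation T (interior x \<psi>) ys)"
      by (simp add: interior_def[of x "derivation T \<psi>"] derivation_Cons) (simp add: interior_def)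
    then show ?thesis by (simp only: derivation_Cons derivation_linear_comb) simp
  qed
  have "\<psi> ((T (S x) - S (T x)) # xs) = \<psi> (T (S x) # xs) - \<psi> (S (T x) # xs)"
    using ext_forms_Cons(1)[OF Cons.prems, of "-1" "S (T x)" "T (S x)" xs] by simp
  then show ?case
    using Cons.IH[OF interior_ext_forms[OF Cons.prems, of x]]
    unfolding step by (simp add: derivation_Cons algebra_simps)
qed simp

lemma clinear_functional_compose: "clinear_functional f \<Longrightarrow> clinear_map T \<Longrightarrow> clinear_functional (\<lambda>x. f (T x))"
  by (simp add: clinear_functional_def clinear_map_def del: split_paired_All)

lemma ewedge_functional: "clinear_functional (\<lambda>v. ewedge v \<psi> xs)"
  unfolding clinear_functional_def using ewedge_linear_vec by blast

text \<open>The fermionic second quantisation of \<open>T\<close>: annihilation by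
  \<open>T b\<close> followed by creation of \<open>b\<close>. Written so, the two steps can be
  interchanged at the cost of a trace.\<close>

lemma derivation_eq_sum:
  fixes \<psi> :: "'v::euclidean_space form"
  assumes "\<psi> \<in> ext_forms" and T: "clinear_map T"
  shows "derivation T \<psi> xs = (\<Sum>b\<in>Basis. ewedge (of_vec b) (interior (T (of_vec b)) \<psi>) xs)"
  using assms(1)
proof (induction xs arbitrary: \<psi>)
  case (Cons x xs)
  let ?e = "of_vec :: 'v \<Rightarrow> _"
  have f: "clinear_functional (\<lambda>x. \<psi> (T x # xs))"
    by (rule clinear_functional_compose[OF ext_forms_Cons_functional[OF Cons.prems] T])
  have sw: "ewedge v (interior x (interior y \<psi>)) xs = - ewedge v (interior y (interior x \<psi>)) xs" for v y
  proof -
    have "interior x (interior y \<psi>) = (\<lambda>ys. (-1) * interior y (interior x \<psi>) ys + 0 * \<psi> ys)"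
      unfolding interior_def using ext_forms_swap[OF Cons.prems, of y x] by simp
    then show ?thesis by (simp only: wedge_linear_right) simp
  qed
  have "(\<Sum>b\<in>Basis. ewedge (?e b) (interior (T (?e b)) \<psi>) (x # xs)) =
      (\<Sum>b\<in>Basis. cmetric (?e b) x * \<psi> (T (?e b) # xs)) + (\<Sum>b\<in>Basis. ewedge (?e b) (interior (T (?e b)) (interior x \<psi>)) xs)"
    unfolding ewedge_Cons sw sum.distrib[symmetric] by (simp add: interior_def[of _ \<psi>])
  also have "(\<Sum>b\<in>Basis. cmetric (?e b) x * \<psi> (T (?e b) # xs)) = \<psi> (T x # xs)"
    by (rule clinear_functional_expand[OF f, symmetric])
  finally show ?case using Cons.IH[OF interior_ext_forms[OF Cons.prems, of x]] by (simp add: derivation_Cons)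
qed simp

text \<open>Used to move a type projection from one slot of a contraction to the other, where it
  becomes the opposite projection.\<close>

lemma sum_basis_adjoint:
  fixes f :: "'v::euclidean_space cvec \<Rightarrow> 'v cvec \<Rightarrow> complex"
  assumes f1: "\<And>v. clinear_functional (\<lambda>u. f u v)" and f2: "\<And>u. clinear_functional (f u)"
    and adj: "\<And>x y. cmetric x (S y) = cmetric (S' x) y"
  shows "(\<Sum>b\<in>Basis. f (of_vec b) (S (of_vec b))) = (\<Sum>b\<in>Basis. f (S' (of_vec b)) (of_vec b))"
proof -
  let ?e = "of_vec :: 'v \<Rightarrow> _"
  have "(\<Sum>b\<in>Basis. f (?e b) (S (?e b))) = (\<Sum>b\<in>Basis. \<Sum>c\<in>Basis. cmetric (?e c) (S (?e b)) * f (?e b) (?e c))"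
    by (rule sum.cong[OF refl]) (rule clinear_functional_expand[OF f2])
  also have "\<dots> = (\<Sum>c\<in>Basis. \<Sum>b\<in>Basis. cmetric (?e c) (S (?e b)) * f (?e b) (?e c))" by (rule sum.swap)
  also have "\<dots> = (\<Sum>c\<in>Basis. \<Sum>b\<in>Basis. cmetric (?e b) (S' (?e c)) * f (?e b) (?e c))"
    unfolding adj by (simp only: cmetric_sym)
  also have "\<dots> = (\<Sum>c\<in>Basis. f (S' (?e c)) (?e c))"
    by (rule sum.cong[OF refl]) (rule clinear_functional_expand[OF f1, symmetric])
  finally show ?thesis .
qed

lemma cnj_proj01: "cvec_cnj (proj01 J (of_vec b)) = proj10 J (of_vec b)"
proof -
  have a: "cvec_cnj (x + y) = cvec_cnj x + cvec_cnj y" for x y :: "'a cvec"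
    by (simp add: cvec_cnj_def)
  show ?thesis
    by (simp add: proj01_def proj10_def a cvec_cnj_cscale capply_of_vec del: cscale_simps(4,6))
qed

text \<open>A form annihilated by \<open>V10 J\<close> is a form on the \<open>n\<close>-dimensional space \<open>V01 J\<close>. That an
  \<open>n\<close>-form has top degree there is shown by positivity: the number operator gives
  \<open>\<Sum>\<^sub>b \<iota>(Q b) (P b \<and> \<psi>) = 0\<close>, and its pairing with \<open>\<psi>\<close> is a sum of squares of norms.\<close>

locale top_form_data =
  fixes vol :: "'v::euclidean_space form" and n :: nat and J :: "'v \<Rightarrow>\<^sub>L 'v" and \<psi> :: "'v form"
  assumes dim: "DIM('v) = 2 * n" and J: "J \<in> complex_structures vol"
    and ext: "\<psi> \<in> ext_forms" and deg: "\<And>xs. length xs \<noteq> n \<Longrightarrow> \<psi> xs = 0"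
    and kill: "\<And>z xs. z \<in> V10 J \<Longrightarrow> \<psi> (z # xs) = 0"
begin

abbreviation e :: "'v \<Rightarrow> 'v cvec" where "e \<equiv> of_vec"

lemma interior_proj01: "interior z \<psi> = interior (proj01 J z) \<psi>"
proof
  fix xs
  have "\<psi> ((cscale 1 (proj01 J z) + proj10 J z) # xs) = 1 * \<psi> (proj01 J z # xs) + \<psi> (proj10 J z # xs)"
    by (rule ext_forms_Cons(1)[OF ext])
  then show "interior z \<psi> xs = interior (proj01 J z) \<psi> xs"
    using proj_sum[of J z] kill[OF proj10_V10[OF J]] by (simp add: interior_def add.commute)
qed

text \<open>Contraction of \<psi> sees only the (0,1) part, so \<open>proj01\<close> may be inserted
  there and transposed to \<open>proj10\<close> on the created vector. Interchanging creation and
  annihilation then yields a trace and a sum in the other order.\<close>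

lemma derivation_expand:
  assumes T: "clinear_map T" and comm: "\<And>z. T (proj01 J z) = proj01 J (T z)"
  shows "derivation T \<psi> xs = (\<Sum>b\<in>Basis. cmetric (proj10 J (e b)) (T (e b))) * \<psi> xs
    - (\<Sum>b\<in>Basis. interior (T (e b)) (ewedge (proj10 J (e b)) \<psi>) xs)"
proof -
  let ?f = "\<lambda>u v. ewedge u (interior (T v) \<psi>) xs"
  have f2: "clinear_functional (?f u)" for u
    unfolding clinear_functional_def
  proof (intro allI)
    fix c x y
    have "interior (T (cscale c x + y)) \<psi> = (\<lambda>ys. c * interior (T x) \<psi> ys + 1 * interior (T y) \<psi> ys)"
      using T ext_forms_Cons(1)[OF ext] by (simp add: clinear_map_def interior_def del: split_paired_All)
    then have "?f u (cscale c x + y) = ewedge u (\<lambda>ys. c * interior (T x) \<psi> ys + 1 * interior (T y) \<psi> ys) xs" by simp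
    also have "\<dots> = c * ?f u x + ?f u y" unfolding wedge_linear_right by simp
    finally show "?f u (cscale c x + y) = c * ?f u x + ?f u y" .
  qed
  have "derivation T \<psi> xs = (\<Sum>b\<in>Basis. ?f (e b) (e b))" by (rule derivation_eq_sum[OF ext T])
  also have "\<dots> = (\<Sum>b\<in>Basis. ?f (e b) (proj01 J (e b)))"
    by (rule sum.cong[OF refl]) (simp only: comm interior_proj01[symmetric])
  also have "\<dots> = (\<Sum>b\<in>Basis. ?f (proj10 J (e b)) (e b))"
    by (rule sum_basis_adjoint[OF ewedge_functional f2]) (rule cmetric_proj(1)[OF J, symmetric])
  also have "\<dots> = (\<Sum>b\<in>Basis. cmetric (proj10 J (e b)) (T (e b)) * \<psi> xs - interior (T (e b)) (ewedge (proj10 J (e b)) \<psi>) xs)"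
    by (simp add: interior_ewedge)
  finally show ?thesis by (simp add: sum_subtractf sum_distrib_right)
qed

text \<open>\<open>J b\<close> is orthogonal to \<open>b\<close>, so each of the
  \<open>2 * n\<close> unit vectors contributes one half.\<close>

lemma trace_proj10: "(\<Sum>b\<in>Basis. cmetric (proj10 J (e b)) (e b)) = of_nat n"
proof -
  have "cmetric (proj10 J (e b)) (e b) = 1/2" if "b \<in> Basis" for b
  proof -
    have "blinfun_apply J b \<bullet> b = 0" using complex_structure_skew[OF J, of b b] by (simp add: inner_commute)
    then show ?thesis
      using that by (simp add: proj10_def capply_of_vec cmetric_of_vec inner_same_Basis)
  qed
  then have "(\<Sum>b\<in>Basis. cmetric (proj10 J (e b)) (e b)) = (\<Sum>b\<in>(Basis :: 'v set). 1/2)"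
    by (rule sum.cong[OF refl])
  then show ?thesis by (simp add: dim)
qed

lemma ewedge_proj10_zero:
  assumes "b \<in> Basis"
  shows "ewedge (proj10 J (e b)) \<psi> = (\<lambda>xs. 0)"
proof -
  let ?w = "\<lambda>b. ewedge (proj10 J (e b)) \<psi>"
  have z: "(\<Sum>b\<in>Basis. interior (e b) (?w b) xs) = 0" for xs
  proof -
    have "clinear_map (\<lambda>x :: 'v cvec. x)" by (simp add: clinear_map_def)
    from derivation_expand[OF this, of xs]
    have "of_nat (length xs) * \<psi> xs = of_nat n * \<psi> xs - (\<Sum>b\<in>Basis. interior (e b) (?w b) xs)"
      by (simp only: derivation_ident trace_proj10)
    then show ?thesis using deg[of xs] by (cases "length xs = n") auto
  qed
  have wext: "?w b \<in> ext_forms" for b by (rule ewedge_ext_forms[OF ext])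
  let ?c = "form_cnj \<psi>"
  let ?f = "\<lambda>u v. form_pairing (ewedge u ?c) (ewedge (proj10 J v) \<psi>)"
  have lin: "(\<lambda>xs. ewedge (cscale c x + y) \<phi> xs) = (\<lambda>xs. c * ewedge x \<phi> xs + 1 * ewedge y \<phi> xs)" for c x y and \<phi> :: "'v form"
    by (simp add: ewedge_linear_vec)
  have f1: "clinear_functional (\<lambda>u. ?f u v)" for v
    unfolding clinear_functional_def form_pairing_commute[of _ "ewedge (proj10 J v) \<psi>"] lin form_pairing_linear_right by simp
  have f2: "clinear_functional (?f u)" for u
    unfolding clinear_functional_def proj_simps lin form_pairing_linear_right by simp
  have "0 = form_pairing ?c (\<lambda>xs. \<Sum>b\<in>Basis. interior (e b) (?w b) xs)"
    unfolding z by (simp add: form_pairing_def pair_zero_right)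
  also have "\<dots> = (\<Sum>b\<in>Basis. form_pairing ?c (interior (e b) (?w b)))" by (rule form_pairing_sum_right)
  also have "\<dots> = (\<Sum>b\<in>Basis. 1/2 * ?f (e b) (e b))"
    by (rule sum.cong[OF refl]) (simp add: form_pairing_ewedge[OF wext])
  \<comment> \<open>\<open>proj10\<close> is idempotent; one copy is split off in order to be moved,
    as \<open>proj01\<close>, to the conjugated factor, which becomes the conjugate of
    \<open>?w b\<close>.\<close>
  also have "\<dots> = 1/2 * (\<Sum>b\<in>Basis. ?f (e b) (proj10 J (e b)))"
    unfolding sum_distrib_left[symmetric] by (simp only: proj10_ident[OF proj10_V10[OF J]])
  also have "(\<Sum>b\<in>Basis. ?f (e b) (proj10 J (e b))) = (\<Sum>b\<in>Basis. ?f (proj01 J (e b)) (e b))"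
    by (rule sum_basis_adjoint[OF f1 f2]) (rule cmetric_proj(2)[OF J, symmetric])
  also have "\<dots> = (\<Sum>b\<in>Basis. of_real (form_sqnorm (?w b)))"
  proof (rule sum.cong[OF refl])
    fix b :: 'v
    have "ewedge (proj01 J (e b)) ?c = form_cnj (?w b)"
      by (rule HOL.ext) (simp add: ewedge_form_cnj cnj_proj01 form_cnj_def[of "ewedge _ _"])
    then show "?f (proj01 J (e b)) (e b) = of_real (form_sqnorm (?w b))" by (simp add: form_pairing_cnj)
  qed
  finally have "(\<Sum>b\<in>Basis. form_sqnorm (?w b)) = 0"
    by (simp flip: of_real_sum)
  then have "form_sqnorm (?w b) = 0"
    using assms sum_nonneg_eq_0_iff[of Basis "\<lambda>b. form_sqnorm (?w b)"] by (simp add: form_sqnorm_nonneg)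
  then show ?thesis by (rule form_sqnorm_zero[OF wext])
qed

text \<open>Exterior multiplication by a (1,0) vector leaves the top degree, so the reordered sum
  vanishes and only the trace remains.\<close>

lemma derivation_trace:
  assumes T: "clinear_map T" and comm: "\<And>z. T (proj01 J z) = proj01 J (T z)"
  shows "derivation T \<psi> xs = (\<Sum>b\<in>Basis. cmetric (e b) (proj01 J (T (e b)))) * \<psi> xs"
proof -
  have "(\<Sum>b\<in>Basis. interior (T (e b)) (ewedge (proj10 J (e b)) \<psi>) xs) = 0"
    by (rule sum.neutral) (simp add: ewedge_proj10_zero interior_def)
  then show ?thesis unfolding derivation_expand[OF T comm] by (simp add: cmetric_proj(1)[OF J])
qed

end

section \<open>Exterior products of vectors and the associated forms\<close>

lemma vec_wedge_eq:
  assumes "length \<alpha>s = length vs" "\<forall>\<alpha>\<in>set \<alpha>s. clinear_functional \<alpha>"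
  shows "vec_wedge vs \<alpha>s = (\<Sum>p | p permutes {..<length vs}. of_int (sign p) * (\<Prod>i<length vs. (\<alpha>s ! i) (vs ! p i)))"
  using assms by (simp add: vec_wedge_def)

lemma vec_wedge_eq_0:
  "\<not> (length \<alpha>s = length vs \<and> (\<forall>\<alpha>\<in>set \<alpha>s. clinear_functional \<alpha>)) \<Longrightarrow> vec_wedge vs \<alpha>s = 0"
  unfolding vec_wedge_def by (rule if_not_P)

text \<open>For each permutation the replaced slot is renamed \<open>i = p k\<close>, so that the
  sum runs over the functional that meets the replaced vector. The following identities are compared
  in this normal form.\<close>

lemma vec_wedge_replace_vector:
  fixes n :: nat
  assumes \<alpha>: "length \<alpha>s = n" "\<forall>\<alpha>\<in>set \<alpha>s. clinear_functional \<alpha>" and vs: "length vs = n" and ws: "length ws = n"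
  shows "(\<Sum>i<n. vec_wedge (vs[i := ws ! i]) \<alpha>s) = (\<Sum>p | p permutes {..<n}. of_int (sign p) *
     (\<Sum>k<n. (\<alpha>s ! k) (ws ! p k) * (\<Prod>j\<in>{..<n} - {k}. (\<alpha>s ! j) (vs ! p j))))"
proof -
  have "(\<Sum>i<n. vec_wedge (vs[i := ws ! i]) \<alpha>s) =
     (\<Sum>i<n. \<Sum>p | p permutes {..<n}. of_int (sign p) * (\<Prod>k<n. (\<alpha>s ! k) (vs[i := ws ! i] ! p k)))"
    using \<alpha> vs by (simp add: vec_wedge_eq)
  also have "\<dots> = (\<Sum>p | p permutes {..<n}. \<Sum>i<n. of_int (sign p) * (\<Prod>k<n. (\<alpha>s ! k) (vs[i := ws ! i] ! p k)))"
    by (rule sum.swap)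
  also have "\<dots> = (\<Sum>p | p permutes {..<n}. of_int (sign p) *
     (\<Sum>k<n. (\<alpha>s ! k) (ws ! p k) * (\<Prod>j\<in>{..<n} - {k}. (\<alpha>s ! j) (vs ! p j))))"
  proof (rule sum.cong[OF refl])
    fix p assume "p \<in> {p. p permutes {..<n}}"
    then have p: "p permutes {..<n}" by simp
    have "(\<Sum>i<n. \<Prod>k<n. (\<alpha>s ! k) (vs[i := ws ! i] ! p k)) = (\<Sum>a<n. \<Prod>k<n. (\<alpha>s ! k) (vs[p a := ws ! p a] ! p k))"
      using sum.permute[OF p, of "\<lambda>i. \<Prod>k<n. (\<alpha>s ! k) (vs[i := ws ! i] ! p k)"] by (simp add: comp_def)
    also have "\<dots> = (\<Sum>k<n. (\<alpha>s ! k) (ws ! p k) * (\<Prod>j\<in>{..<n} - {k}. (\<alpha>s ! j) (vs ! p j)))"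
    proof (rule sum.cong[OF refl])
      fix a assume a: "a \<in> {..<n}"
      have pa: "p a < n" using permutes_in_image[OF p, of a] a by simp
      have "(\<Prod>k<n. (\<alpha>s ! k) (vs[p a := ws ! p a] ! p k)) =
          (\<alpha>s ! a) (vs[p a := ws ! p a] ! p a) * (\<Prod>k\<in>{..<n} - {a}. (\<alpha>s ! k) (vs[p a := ws ! p a] ! p k))"
        by (rule prod.remove) (use a in auto)
      also have "(\<Prod>k\<in>{..<n} - {a}. (\<alpha>s ! k) (vs[p a := ws ! p a] ! p k)) = (\<Prod>k\<in>{..<n} - {a}. (\<alpha>s ! k) (vs ! p k))"
      proof (rule prod.cong[OF refl])
        fix k assume "k \<in> {..<n} - {a}"
        then have "p a \<noteq> p k" using permutes_inj[OF p] by (auto dest: injD)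
        then show "(\<alpha>s ! k) (vs[p a := ws ! p a] ! p k) = (\<alpha>s ! k) (vs ! p k)" by simp
      qed
      finally show "(\<Prod>k<n. (\<alpha>s ! k) (vs[p a := ws ! p a] ! p k)) =
          (\<alpha>s ! a) (ws ! p a) * (\<Prod>j\<in>{..<n} - {a}. (\<alpha>s ! j) (vs ! p j))" using pa vs by simp
    qed
    finally show "(\<Sum>i<n. of_int (sign p) * (\<Prod>k<n. (\<alpha>s ! k) (vs[i := ws ! i] ! p k))) =
      of_int (sign p) * (\<Sum>k<n. (\<alpha>s ! k) (ws ! p k) * (\<Prod>j\<in>{..<n} - {k}. (\<alpha>s ! j) (vs ! p j)))"
      by (simp only: sum_distrib_left[symmetric])
  qed
  finally show ?thesis .
qed

text \<open>Applying \<open>T\<close> to the functionals instead of the vectors lets the connection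
  term be written by means of the value in the exterior power, without its factors.\<close>

lemma vec_wedge_replace_functional:
  fixes n :: nat
  assumes \<alpha>: "length \<alpha>s = n" "\<forall>\<alpha>\<in>set \<alpha>s. clinear_functional \<alpha>" and vs: "length vs = n" and T: "clinear_map T"
  shows "(\<Sum>i<n. vec_wedge vs (\<alpha>s[i := \<lambda>v. (\<alpha>s ! i) (T v)])) = (\<Sum>i<n. vec_wedge (vs[i := T (vs ! i)]) \<alpha>s)"
proof -
  have lin: "\<forall>\<alpha>\<in>set (\<alpha>s[i := \<lambda>v. (\<alpha>s ! i) (T v)]). clinear_functional \<alpha>" if "i < n" for i
  proof
    fix \<alpha> assume "\<alpha> \<in> set (\<alpha>s[i := \<lambda>v. (\<alpha>s ! i) (T v)])"
    then have "\<alpha> \<in> insert (\<lambda>v. (\<alpha>s ! i) (T v)) (set \<alpha>s)" by (rule set_update_subset_insert[THEN subsetD])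
    moreover have "clinear_functional (\<lambda>v. (\<alpha>s ! i) (T v))"
      using \<alpha> that by (intro clinear_functional_compose[OF _ T]) simp
    ultimately show "clinear_functional \<alpha>" using \<alpha>(2) by auto
  qed
  have "(\<Sum>i<n. vec_wedge vs (\<alpha>s[i := \<lambda>v. (\<alpha>s ! i) (T v)])) =
     (\<Sum>i<n. \<Sum>p | p permutes {..<n}. of_int (sign p) * (\<Prod>k<n. (\<alpha>s[i := \<lambda>v. (\<alpha>s ! i) (T v)] ! k) (vs ! p k)))"
    by (rule sum.cong[OF refl]) (use \<alpha>(1) vs lin in \<open>simp add: vec_wedge_eq\<close>)
  also have "\<dots> = (\<Sum>p | p permutes {..<n}. \<Sum>i<n. of_int (sign p) * (\<Prod>k<n. (\<alpha>s[i := \<lambda>v. (\<alpha>s ! i) (T v)] ! k) (vs ! p k)))"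
    by (rule sum.swap)
  also have "\<dots> = (\<Sum>p | p permutes {..<n}. of_int (sign p) *
     (\<Sum>k<n. (\<alpha>s ! k) (map T vs ! p k) * (\<Prod>j\<in>{..<n} - {k}. (\<alpha>s ! j) (vs ! p j))))"
    unfolding sum_distrib_left
  proof (intro sum.cong refl)
    fix p i assume "p \<in> {p. p permutes {..<n}}" and i: "i \<in> {..<n}"
    then have p: "p permutes {..<n}" by simp
    have pi: "p i < n" using permutes_in_image[OF p, of i] i by simp
    have "(\<Prod>k<n. (\<alpha>s[i := \<lambda>v. (\<alpha>s ! i) (T v)] ! k) (vs ! p k)) =
       (\<alpha>s[i := \<lambda>v. (\<alpha>s ! i) (T v)] ! i) (vs ! p i) * (\<Prod>k\<in>{..<n} - {i}. (\<alpha>s[i := \<lambda>v. (\<alpha>s ! i) (T v)] ! k) (vs ! p k))"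
      by (rule prod.remove) (use i in auto)
    also have "\<dots> = (\<alpha>s ! i) (map T vs ! p i) * (\<Prod>j\<in>{..<n} - {i}. (\<alpha>s ! j) (vs ! p j))"
      using i pi \<alpha>(1) vs by (intro arg_cong2[where f = "(*)"] prod.cong) auto
    finally show "of_int (sign p) * (\<Prod>k<n. (\<alpha>s[i := \<lambda>v. (\<alpha>s ! i) (T v)] ! k) (vs ! p k)) =
      of_int (sign p) * ((\<alpha>s ! i) (map T vs ! p i) * (\<Prod>j\<in>{..<n} - {i}. (\<alpha>s ! j) (vs ! p j)))" by simp
  qed
  also have "\<dots> = (\<Sum>i<n. vec_wedge (vs[i := map T vs ! i]) \<alpha>s)"
    using vec_wedge_replace_vector[OF \<alpha> vs, of "map T vs"] vs by simp
  also have "\<dots> = (\<Sum>i<n. vec_wedge (vs[i := T (vs ! i)]) \<alpha>s)"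
    by (rule sum.cong) (use vs in auto)
  finally show ?thesis .
qed

text \<open>\<open>anticanonical_connection\<close> refers to sums of plain products, so a
  coefficient has to be absorbed into one of the vectors.\<close>

lemma vec_wedge_scale_head: "vec_wedge (cscale c v # vs) \<alpha>s = c * vec_wedge (v # vs) \<alpha>s"
proof (cases "length \<alpha>s = length (v # vs) \<and> (\<forall>\<alpha>\<in>set \<alpha>s. clinear_functional \<alpha>)")
  case True
  let ?n = "length (v # vs)"
  have "(\<Prod>i<?n. (\<alpha>s ! i) ((cscale c v # vs) ! p i)) = c * (\<Prod>i<?n. (\<alpha>s ! i) ((v # vs) ! p i))"
    if p: "p permutes {..<?n}" for p
  proof -
    define k where "k = inv p 0"
    have pk: "p k = 0" unfolding k_def using permutes_inverses(1)[OF p] by simp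
    have k: "k < ?n" using permutes_in_image[OF permutes_inv[OF p], of 0] by (simp add: k_def)
    have rest: "(\<alpha>s ! i) ((cscale c v # vs) ! p i) = (\<alpha>s ! i) ((v # vs) ! p i)" if "i \<in> {..<?n} - {k}" for i
    proof -
      have "p i \<noteq> 0" using that pk permutes_inj[OF p] by (metis DiffE injD singletonI)
      then show ?thesis by (cases "p i") auto
    qed
    have \<alpha>: "clinear_functional (\<alpha>s ! k)" using True k by (metis nth_mem)
    have "(\<alpha>s ! k) (cscale c v) = c * (\<alpha>s ! k) v"
      using \<alpha> clinear_functional_zero[OF \<alpha>] unfolding clinear_functional_def by (metis add.right_neutral)
    then have fk: "(\<alpha>s ! k) ((cscale c v # vs) ! p k) = c * (\<alpha>s ! k) ((v # vs) ! p k)" by (simp add: pk)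
    have rm: "(\<Prod>i<?n. f i) = f k * (\<Prod>i\<in>{..<?n} - {k}. f i)" for f :: "nat \<Rightarrow> complex"
      by (rule prod.remove) (use k in auto)
    have "(\<Prod>i<?n. (\<alpha>s ! i) ((cscale c v # vs) ! p i)) =
        c * (\<alpha>s ! k) ((v # vs) ! p k) * (\<Prod>i\<in>{..<?n} - {k}. (\<alpha>s ! i) ((v # vs) ! p i))"
      unfolding rm fk by (rule arg_cong2[where f = "(*)", OF refl prod.cong[OF refl rest]])
    also have "\<dots> = c * (\<Prod>i<?n. (\<alpha>s ! i) ((v # vs) ! p i))"
      unfolding rm by (simp only: mult.assoc)
    finally show ?thesis .
  qed
  then have "(\<Sum>p | p permutes {..<?n}. of_int (sign p) * (\<Prod>i<?n. (\<alpha>s ! i) ((cscale c v # vs) ! p i))) =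
      (\<Sum>p | p permutes {..<?n}. c * (of_int (sign p) * (\<Prod>i<?n. (\<alpha>s ! i) ((v # vs) ! p i))))"
    by (intro sum.cong) auto
  then show ?thesis using True by (simp only: vec_wedge_def) (simp add: sum_distrib_left)
next
  case False
  then have "vec_wedge (cscale c v # vs) \<alpha>s = 0" "vec_wedge (v # vs) \<alpha>s = 0"
    by (intro vec_wedge_eq_0; simp)+
  then show ?thesis by simp
qed

text \<open>The identification of vectors with covectors by the metric, on exterior powers. Nothing
  is lost, as every complex-linear functional is some \<open>cmetric z\<close>.\<close>

definition wedge_form :: "(('v::euclidean_space cvec \<Rightarrow> complex) list \<Rightarrow> complex) \<Rightarrow> 'v form" where
  "wedge_form \<kappa> xs = \<kappa> (map cmetric xs)"

lemma wedge_form_vec_wedge_ext: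
  fixes vs :: "'v::euclidean_space cvec list"
  shows "wedge_form (vec_wedge vs) \<in> ext_forms"
proof -
  let ?n = "length vs"
  have eq: "wedge_form (vec_wedge vs) xs = (\<Sum>p | p permutes {..<?n}. of_int (sign p) * (\<Prod>i<?n. cmetric (xs ! i) (vs ! p i)))"
    if "length xs = ?n" for xs
    using that by (simp add: wedge_form_def vec_wedge_eq clinear_functional_cmetric)
  have zero: "wedge_form (vec_wedge vs) xs = 0" if "length xs \<noteq> ?n" for xs
    using that by (simp add: wedge_form_def vec_wedge_def)
  show ?thesis
    unfolding ext_forms_iff multilinear_def
  proof (intro conjI allI impI)
    fix xs :: "'v cvec list" and i c x y assume i: "i < length xs"
    show "wedge_form (vec_wedge vs) (xs[i := cscale c x + y]) =
      c * wedge_form (vec_wedge vs) (xs[i := x]) + wedge_form (vec_wedge vs) (xs[i := y])"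
    proof (cases "length xs = ?n")
      case True
      have pr: "(\<Prod>k<?n. cmetric (xs[i := z] ! k) (vs ! p k)) =
          cmetric z (vs ! p i) * (\<Prod>k\<in>{..<?n} - {i}. cmetric (xs ! k) (vs ! p k))" for z p
      proof -
        have "(\<Prod>k<?n. cmetric (xs[i := z] ! k) (vs ! p k)) =
          cmetric (xs[i := z] ! i) (vs ! p i) * (\<Prod>k\<in>{..<?n} - {i}. cmetric (xs[i := z] ! k) (vs ! p k))"
          by (rule prod.remove) (use i True in auto)
        then show ?thesis using i by simp
      qed
      show ?thesis
        using True by (simp add: eq pr sum_distrib_left sum.distrib[symmetric] algebra_simps)
    qed (simp add: zero)
  next
    fix xs :: "'v cvec list" assume "\<not> distinct xs"
    then obtain a b where ab: "a < length xs" "b < length xs" "a \<noteq> b" "xs ! a = xs ! b"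
      by (auto simp: distinct_conv_nth)
    show "wedge_form (vec_wedge vs) xs = 0"
    proof (cases "length xs = ?n")
      case True
      \<comment> \<open>A determinant with two equal rows: composing with the transposition keeps
        each product and reverses each sign, so the sum equals its own negative.\<close>
      let ?t = "Transposition.transpose a b"
      let ?h = "\<lambda>p. of_int (sign p) * (\<Prod>i<?n. cmetric (xs ! i) (vs ! p i))"
      have t: "?t permutes {..<?n}" using ab True by (intro permutes_swap_id) auto
      have xst: "xs ! ?t i = xs ! i" for i using ab by (simp add: Transposition.transpose_def)
      have neg: "?h (p \<circ> ?t) = - ?h p" if p: "p permutes {..<?n}" for p
      proof -
        have "sign (p \<circ> ?t) = - sign p"
          using ab p t by (simp add: sign_compose permutation_permutes[THEN iffD2] sign_swap_id
              permutes_imp_permutation[of "{..<?n}"])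
        moreover have "(\<Prod>i<?n. cmetric (xs ! i) (vs ! (p \<circ> ?t) i)) = (\<Prod>i<?n. cmetric (xs ! i) (vs ! p i))"
          using prod.permute[OF t, of "\<lambda>i. cmetric (xs ! i) (vs ! p i)"] by (simp add: comp_def xst)
        ultimately show ?thesis by simp
      qed
      have selfneg: "x = - x \<Longrightarrow> x = 0" for x :: complex by (simp add: complex_eq_iff)
      from neg have "(\<Sum>p | p permutes {..<?n}. ?h p) = (\<Sum>p | p permutes {..<?n}. - ?h p)"
        by (subst sum_permutations_compose_right[OF t]) (rule sum.cong[OF refl], simp)
      then have "(\<Sum>p | p permutes {..<?n}. ?h p) = 0"
        unfolding sum_negf by (rule selfneg)
      then show ?thesis using eq[OF True] by simp
    qed (simp add: zero)
  qed
qed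

text \<open>Isotropy of the eigenspaces; through it, products of (1,0) vectors become forms killed
  by (1,0) vectors.\<close>

lemma cmetric_V10: "J \<in> complex_structures vol \<Longrightarrow> z \<in> V10 J \<Longrightarrow> w \<in> V10 J \<Longrightarrow> cmetric z w = 0"
  using cmetric_proj(1)[of J vol z w] proj10_ident[of z J] proj01_V10[of w J] by simp

lemma wedge_form_vec_wedge_kill:
  assumes J: "J \<in> complex_structures vol" and vs: "set vs \<subseteq> V10 J" and z: "z \<in> V10 J"
  shows "wedge_form (vec_wedge vs) (z # xs) = 0"
proof (cases "length (z # xs) = length vs")
  case True
  have "(\<Prod>i<length vs. cmetric ((z # xs) ! i) (vs ! p i)) = 0" if p: "p permutes {..<length vs}" for p
  proof -
    have "p 0 < length vs" using permutes_in_image[OF p, of 0] True by auto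
    then have "vs ! p 0 \<in> V10 J" using vs nth_mem by blast
    then have "cmetric ((z # xs) ! 0) (vs ! p 0) = 0" by (simp add: cmetric_V10[OF J z])
    moreover have "(0::nat) \<in> {..<length vs}" using True by auto
    ultimately have "\<exists>i\<in>{..<length vs}. cmetric ((z # xs) ! i) (vs ! p i) = 0" by (rule bexI)
    then show ?thesis by (intro prod_zero finite_lessThan)
  qed
  then show ?thesis
    using True by (simp add: wedge_form_def vec_wedge_eq clinear_functional_cmetric nth_map del: list.map)
      (auto simp: nth_map intro!: sum.neutral)
next
  case False
  then show ?thesis by (simp add: wedge_form_def vec_wedge_def)
qed

text \<open>The second conclusion guarantees that an element which is nonzero has a nonzero
  associated form.\<close>

lemma anticanonical_top_form:
  fixes vol :: "'v::euclidean_space form"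
  assumes dim: "DIM('v) = 2 * n" and J: "J \<in> complex_structures vol" and \<kappa>: "\<kappa> \<in> anticanonical_bundle n J"
  shows "top_form_data vol n J (wedge_form \<kappa>)"
    and "\<And>\<alpha>s. \<kappa> \<alpha>s \<noteq> 0 \<Longrightarrow> \<exists>xs. \<alpha>s = map cmetric xs \<and> length xs = n"
proof -
  obtain N :: nat and c f where \<kappa>eq: "\<kappa> = (\<lambda>\<alpha>s. \<Sum>k<N. c k * f k \<alpha>s)"
    and f: "\<forall>k<N. f k \<in> {vec_wedge vs | vs. length vs = n \<and> set vs \<subseteq> V10 J}"
    using \<kappa> unfolding anticanonical_bundle_def cspan_def by (elim CollectE exE conjE)
  have w: "wedge_form \<kappa> = (\<lambda>xs. \<Sum>k<N. c k * wedge_form (f k) xs)"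
    by (simp add: wedge_form_def[abs_def] \<kappa>eq)
  have vs: "\<exists>vs. f k = vec_wedge vs \<and> length vs = n \<and> set vs \<subseteq> V10 J" if "k < N" for k using f that by blast
  show "top_form_data vol n J (wedge_form \<kappa>)"
  proof
    show "wedge_form \<kappa> \<in> ext_forms"
      unfolding w
    proof (rule ext_forms_sum)
      fix k assume "k \<in> {..<N}"
      then show "(\<lambda>xs. c k * wedge_form (f k) xs) \<in> ext_forms"
        using vs[of k] wedge_form_vec_wedge_ext by (auto intro!: ext_forms_scale)
    qed
    show "wedge_form \<kappa> xs = 0" if "length xs \<noteq> n" for xs
      unfolding w
    proof (rule sum.neutral, rule ballI)
      fix k assume "k \<in> {..<N}"
      then show "c k * wedge_form (f k) xs = 0"
        using vs[of k] that by (auto simp: wedge_form_def vec_wedge_def)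
    qed
    show "wedge_form \<kappa> (z # xs) = 0" if "z \<in> V10 J" for z xs
      unfolding w
    proof (rule sum.neutral, rule ballI)
      fix k assume "k \<in> {..<N}"
      then show "c k * wedge_form (f k) (z # xs) = 0"
        using vs[of k] wedge_form_vec_wedge_kill[OF J _ that] by auto
    qed
  qed (fact dim, fact J)
  fix \<alpha>s assume "\<kappa> \<alpha>s \<noteq> 0"
  then obtain k where k: "k < N" "f k \<alpha>s \<noteq> 0"
    unfolding \<kappa>eq by (metis (no_types, lifting) lessThan_iff mult_zero_right sum.neutral)
  then have \<alpha>s: "length \<alpha>s = n" "\<forall>\<alpha>\<in>set \<alpha>s. clinear_functional \<alpha>"
    using vs[OF k(1)] by (auto simp: vec_wedge_def split: if_splits)
  have "\<forall>\<alpha>\<in>set \<alpha>s. \<exists>z. \<alpha> = cmetric z" using \<alpha>s(2) clinear_functional_eq_cmetric by metis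
  then have "\<exists>xs. \<alpha>s = map cmetric xs" by (auto simp: ex_map_conv)
  then show "\<exists>xs. \<alpha>s = map cmetric xs \<and> length xs = n" using \<alpha>s(1) by auto
qed

section \<open>Curvature of the anticanonical bundle\<close>

text \<open>Differentiating \<open>v = P v\<close> expresses the derivative of \<open>v\<close> as
  its projection plus \<open>- \<i>/2\<close> times \<open>A v\<close>; solving for the projection
  changes the sign.\<close>

lemma V10_connection_eq:
  fixes vol :: "'v::euclidean_space form"
  assumes U: "openin (top_of_set (complex_structures vol)) U" "J \<in> U" and v: "V10_section U v"
    and A: "A \<in> tangent (complex_structures vol) J"
  shows "V10_connection vol J A v = deriv_along (complex_structures vol) v J A + cscale (\<i>/2) (capply A (v J))"
proof -
  let ?M = "complex_structures vol"
  define v' where "v' = deriv_along ?M v J"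
  have d: "(v has_derivative v') (at J within ?M)"
    using v unfolding v'_def V10_section_def
    by (intro deriv_along_works smooth_in_differentiable[OF U(1) _ U(2)]) simp
  have c: "((\<lambda>K. capply K (v K)) has_derivative (\<lambda>B. capply J (v' B) + capply B (v J))) (at J within ?M)"
  proof -
    have "((\<lambda>K. (blinfun_apply K (fst (v K)), blinfun_apply K (snd (v K)))) has_derivative
      (\<lambda>B. (blinfun_apply J (fst (v' B)) + blinfun_apply B (fst (v J)),
            blinfun_apply J (snd (v' B)) + blinfun_apply B (snd (v J))))) (at J within ?M)"
      by (intro has_derivative_Pair bounded_bilinear.FDERIV[OF bounded_bilinear_blinfun_apply has_derivative_ident]
          bounded_linear.has_derivative[OF bounded_linear_fst d] bounded_linear.has_derivative[OF bounded_linear_snd d])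
    then show ?thesis by (simp add: capply_def)
  qed
  have "((\<lambda>K. proj10 K (v K)) has_derivative
      (\<lambda>B. cscale (1/2) (v' B - cscale \<i> (capply J (v' B) + capply B (v J))))) (at J within ?M)"
    unfolding proj10_def
    by (intro bounded_linear.has_derivative[OF bounded_linear_cscale] has_derivative_diff d c)
  from deriv_along_eq[OF this A]
  have "deriv_along ?M (\<lambda>K. proj10 K (v K)) J A = proj10 J (v' A) - cscale (\<i>/2) (capply A (v J))"
    by (simp add: proj10_def)
  moreover have "deriv_along ?M (\<lambda>K. proj10 K (v K)) J A = v' A"
    unfolding v'_def by (rule deriv_along_cong[OF U]) (use v in \<open>simp add: V10_section_def proj10_ident\<close>)
  ultimately show ?thesis by (simp add: V10_connection_def v'_def[symmetric] eq_diff_eq)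
qed

lemma clinear_functional_bounded:
  fixes \<alpha> :: "'v::euclidean_space cvec \<Rightarrow> complex"
  assumes "clinear_functional \<alpha>"
  shows "bounded_linear \<alpha>"
proof -
  obtain z where "\<alpha> = cmetric z" by (rule clinear_functional_eq_cmetric[OF assms])
  then show ?thesis by (simp add: bounded_linear_cmetric)
qed

lemma vec_wedge_has_derivative:
  fixes vs :: "('a::real_normed_vector \<Rightarrow> 'v::euclidean_space cvec) list" and n :: nat
  assumes \<alpha>: "length \<alpha>s = n" "\<forall>\<alpha>\<in>set \<alpha>s. clinear_functional \<alpha>" and vs: "length vs = n"
    and d: "\<And>i. i < n \<Longrightarrow> ((vs ! i) has_derivative d i) (at x within M)"
  shows "((\<lambda>y. vec_wedge (map (\<lambda>v. v y) vs) \<alpha>s) has_derivative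
    (\<lambda>B. \<Sum>i<n. vec_wedge ((map (\<lambda>v. v x) vs)[i := d i B]) \<alpha>s)) (at x within M)"
proof -
  have pn: "p k < n" if "p permutes {..<n}" "k < n" for p k
    using permutes_in_image[OF that(1), of k] that(2) by simp
  have e1: "(\<lambda>y. vec_wedge (map (\<lambda>v. v y) vs) \<alpha>s) =
      (\<lambda>y. \<Sum>p | p permutes {..<n}. of_int (sign p) * (\<Prod>i<n. (\<alpha>s ! i) ((vs ! p i) y)))"
    using \<alpha> vs pn by (intro ext) (simp add: vec_wedge_eq)
  have e2: "(\<Sum>i<n. vec_wedge ((map (\<lambda>v. v x) vs)[i := d i B]) \<alpha>s) =
      (\<Sum>p | p permutes {..<n}. of_int (sign p) *
        (\<Sum>k<n. (\<alpha>s ! k) (d (p k) B) * (\<Prod>j\<in>{..<n} - {k}. (\<alpha>s ! j) ((vs ! p j) x))))" for B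
  proof -
    have "(\<Sum>i<n. vec_wedge ((map (\<lambda>v. v x) vs)[i := d i B]) \<alpha>s) =
       (\<Sum>i<n. vec_wedge ((map (\<lambda>v. v x) vs)[i := map (\<lambda>i. d i B) [0..<n] ! i]) \<alpha>s)"
      by (rule sum.cong) auto
    also have "\<dots> = (\<Sum>p | p permutes {..<n}. of_int (sign p) * (\<Sum>k<n. (\<alpha>s ! k) (map (\<lambda>i. d i B) [0..<n] ! p k) *
        (\<Prod>j\<in>{..<n} - {k}. (\<alpha>s ! j) (map (\<lambda>v. v x) vs ! p j))))"
      by (rule vec_wedge_replace_vector[OF \<alpha>]) (use vs in auto)
    also have "\<dots> = (\<Sum>p | p permutes {..<n}. of_int (sign p) *
        (\<Sum>k<n. (\<alpha>s ! k) (d (p k) B) * (\<Prod>j\<in>{..<n} - {k}. (\<alpha>s ! j) ((vs ! p j) x))))"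
      using pn vs by (intro sum.cong arg_cong2[where f = "(*)"] prod.cong refl) auto
    finally show ?thesis .
  qed
  have f: "((\<lambda>y. (\<alpha>s ! i) ((vs ! p i) y)) has_derivative (\<lambda>B. (\<alpha>s ! i) (d (p i) B))) (at x within M)"
    if "p \<in> {p. p permutes {..<n}}" "i \<in> {..<n}" for p i
    using that \<alpha> pn by (intro bounded_linear.has_derivative[OF clinear_functional_bounded d]) auto
  show ?thesis
    unfolding e1 e2
    by (intro has_derivative_sum has_derivative_mult_right has_derivative_prod f)
qed

lemma vec_wedge_replace_linear_comb:
  fixes n :: nat
  assumes \<alpha>: "length \<alpha>s = n" "\<forall>\<alpha>\<in>set \<alpha>s. clinear_functional \<alpha>" and vs: "length vs = n"
  shows "(\<Sum>i<n. vec_wedge (vs[i := u i + cscale c (w i)]) \<alpha>s) =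
    (\<Sum>i<n. vec_wedge (vs[i := u i]) \<alpha>s) + c * (\<Sum>i<n. vec_wedge (vs[i := w i]) \<alpha>s)"
proof -
  have rep: "(\<Sum>i<n. vec_wedge (vs[i := u i]) \<alpha>s) = (\<Sum>p | p permutes {..<n}. of_int (sign p) *
     (\<Sum>k<n. (\<alpha>s ! k) (u (p k)) * (\<Prod>j\<in>{..<n} - {k}. (\<alpha>s ! j) (vs ! p j))))" for u
  proof -
    have "(\<Sum>i<n. vec_wedge (vs[i := u i]) \<alpha>s) = (\<Sum>i<n. vec_wedge (vs[i := map u [0..<n] ! i]) \<alpha>s)"
      by (rule sum.cong) auto
    also have "\<dots> = (\<Sum>p | p permutes {..<n}. of_int (sign p) *
     (\<Sum>k<n. (\<alpha>s ! k) (map u [0..<n] ! p k) * (\<Prod>j\<in>{..<n} - {k}. (\<alpha>s ! j) (vs ! p j))))"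
      by (rule vec_wedge_replace_vector[OF \<alpha> vs]) simp
    also have "\<dots> = (\<Sum>p | p permutes {..<n}. of_int (sign p) *
     (\<Sum>k<n. (\<alpha>s ! k) (u (p k)) * (\<Prod>j\<in>{..<n} - {k}. (\<alpha>s ! j) (vs ! p j))))"
    proof (intro sum.cong arg_cong2[where f = "(*)"] refl)
      fix p k assume "p \<in> {p. p permutes {..<n}}" "k \<in> {..<n}"
      then have "p k < n" using permutes_in_image[of p "{..<n}" k] by simp
      then show "(\<alpha>s ! k) (map u [0..<n] ! p k) = (\<alpha>s ! k) (u (p k))" by simp
    qed
    finally show ?thesis .
  qed
  have lin: "(\<alpha>s ! k) (x + cscale c y) = (\<alpha>s ! k) x + c * (\<alpha>s ! k) y" if "k < n" for k x y
  proof -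
    have "clinear_functional (\<alpha>s ! k)" using \<alpha> that by simp
    then have "(\<alpha>s ! k) (cscale c y + x) = c * (\<alpha>s ! k) y + (\<alpha>s ! k) x" unfolding clinear_functional_def by blast
    then show ?thesis by (simp add: add.commute)
  qed
  show ?thesis
    unfolding rep sum_distrib_left sum.distrib[symmetric]
    by (intro sum.cong refl) (simp add: lin algebra_simps)
qed

text \<open>The value is rewritten in terms of \<kappa> alone, which proves it independent of the
  decomposition and so evaluates the description. The default 0 is the value of
  \<open>vec_wedge\<close> on lists that do not consist of \<open>n\<close> complex-linear
  functionals.\<close>

lemma anticanonical_connection_eq:
  fixes vol :: "'v::euclidean_space form" and n N :: nat
  assumes U: "openin (top_of_set (complex_structures vol)) U" "J \<in> U"
    and A: "A \<in> tangent (complex_structures vol) J"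
    and vs: "\<forall>k<N. length (vs k) = n \<and> (\<forall>v\<in>set (vs k). V10_section U v)"
    and \<kappa>: "\<forall>K\<in>U. \<kappa> K = (\<lambda>\<alpha>s. \<Sum>k<N. vec_wedge (map (\<lambda>v. v K) (vs k)) \<alpha>s)"
  shows "anticanonical_connection vol n J A \<kappa> =
    (\<lambda>\<alpha>s. if length \<alpha>s = n \<and> (\<forall>\<alpha>\<in>set \<alpha>s. clinear_functional \<alpha>)
       then deriv_along (complex_structures vol) (\<lambda>K. \<kappa> K \<alpha>s) J A +
         \<i>/2 * (\<Sum>i<n. \<kappa> J (\<alpha>s[i := \<lambda>v. (\<alpha>s ! i) (capply A v)])) else 0)" (is "_ = ?W")
proof -
  let ?M = "complex_structures vol"
  define P where "P w \<longleftrightarrow> (\<exists>U (N::nat) vs.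
     openin (top_of_set (complex_structures vol)) U \<and> J \<in> U \<and>
     (\<forall>k<N. length (vs k) = n \<and> (\<forall>v\<in>set (vs k). V10_section U v)) \<and>
     (\<forall>J'\<in>U. \<kappa> J' = (\<lambda>\<alpha>s. \<Sum>k<N. vec_wedge (map (\<lambda>v. v J') (vs k)) \<alpha>s)) \<and>
     w = (\<lambda>\<alpha>s. \<Sum>k<N. \<Sum>i<n.
       vec_wedge ((map (\<lambda>v. v J) (vs k))[i := V10_connection vol J A (vs k ! i)]) \<alpha>s))" for w
  have key: "(\<lambda>\<alpha>s. \<Sum>k<N. \<Sum>i<n. vec_wedge ((map (\<lambda>v. v J) (vs k))[i := V10_connection vol J A (vs k ! i)]) \<alpha>s) = ?W"
    if U: "openin (top_of_set ?M) U" "J \<in> U"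
      and vs: "\<forall>k<N. length (vs k) = n \<and> (\<forall>v\<in>set (vs k). V10_section U v)"
      and \<kappa>: "\<forall>K\<in>U. \<kappa> K = (\<lambda>\<alpha>s. \<Sum>k<N. vec_wedge (map (\<lambda>v. v K) (vs k)) \<alpha>s)" for U and N :: nat and vs
  proof
    fix \<alpha>s
    have len: "length (vs k) = n" if "k < N" for k using vs that by simp
    have sec: "V10_section U (vs k ! i)" if "k < N" "i < n" for k i using vs that by simp
    show "(\<Sum>k<N. \<Sum>i<n. vec_wedge ((map (\<lambda>v. v J) (vs k))[i := V10_connection vol J A (vs k ! i)]) \<alpha>s) = ?W \<alpha>s"
    proof (cases "length \<alpha>s = n \<and> (\<forall>\<alpha>\<in>set \<alpha>s. clinear_functional \<alpha>)")
      case True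
      then have \<alpha>: "length \<alpha>s = n" "\<forall>\<alpha>\<in>set \<alpha>s. clinear_functional \<alpha>" by auto
      let ?ms = "\<lambda>k. map (\<lambda>v. v J) (vs k)"
      have dif: "((vs k ! i) has_derivative deriv_along ?M (vs k ! i) J) (at J within ?M)" if "k < N" "i < n" for k i
        using sec[OF that] unfolding V10_section_def
        by (intro deriv_along_works smooth_in_differentiable[OF U(1) _ U(2)]) simp
      have "deriv_along ?M (\<lambda>K. \<kappa> K \<alpha>s) J A = deriv_along ?M (\<lambda>K. \<Sum>k<N. vec_wedge (map (\<lambda>v. v K) (vs k)) \<alpha>s) J A"
        by (rule deriv_along_cong[OF U]) (simp add: \<kappa>)
      also have "\<dots> = (\<Sum>k<N. \<Sum>i<n. vec_wedge ((?ms k)[i := deriv_along ?M (vs k ! i) J A]) \<alpha>s)"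
        by (rule deriv_along_eq[OF has_derivative_sum[OF vec_wedge_has_derivative[OF \<alpha>]] A]) (simp_all add: len dif)
      finally have d: "deriv_along ?M (\<lambda>K. \<kappa> K \<alpha>s) J A = (\<Sum>k<N. \<Sum>i<n. vec_wedge ((?ms k)[i := deriv_along ?M (vs k ! i) J A]) \<alpha>s)" .
      have cm: "clinear_map (capply A)" by (simp add: clinear_map_def del: split_paired_All)
      have "(\<Sum>i<n. \<kappa> J (\<alpha>s[i := \<lambda>v. (\<alpha>s ! i) (capply A v)])) =
          (\<Sum>i<n. \<Sum>k<N. vec_wedge (?ms k) (\<alpha>s[i := \<lambda>v. (\<alpha>s ! i) (capply A v)]))"
        using \<kappa> U(2) by simp
      also have "\<dots> = (\<Sum>k<N. \<Sum>i<n. vec_wedge (?ms k) (\<alpha>s[i := \<lambda>v. (\<alpha>s ! i) (capply A v)]))" by (rule sum.swap)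
      also have "\<dots> = (\<Sum>k<N. \<Sum>i<n. vec_wedge ((?ms k)[i := capply A (?ms k ! i)]) \<alpha>s)"
        by (rule sum.cong[OF refl], rule vec_wedge_replace_functional[OF \<alpha> _ cm]) (simp add: len)
      finally have s: "(\<Sum>i<n. \<kappa> J (\<alpha>s[i := \<lambda>v. (\<alpha>s ! i) (capply A v)])) =
        (\<Sum>k<N. \<Sum>i<n. vec_wedge ((?ms k)[i := capply A (?ms k ! i)]) \<alpha>s)" .
      have "(\<Sum>i<n. vec_wedge ((?ms k)[i := V10_connection vol J A (vs k ! i)]) \<alpha>s) =
         (\<Sum>i<n. vec_wedge ((?ms k)[i := deriv_along ?M (vs k ! i) J A]) \<alpha>s) +
         \<i>/2 * (\<Sum>i<n. vec_wedge ((?ms k)[i := capply A (?ms k ! i)]) \<alpha>s)" if k: "k < N" for k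
      proof -
        have "(\<Sum>i<n. vec_wedge ((?ms k)[i := V10_connection vol J A (vs k ! i)]) \<alpha>s) =
          (\<Sum>i<n. vec_wedge ((?ms k)[i := deriv_along ?M (vs k ! i) J A + cscale (\<i>/2) (capply A (?ms k ! i))]) \<alpha>s)"
          by (rule sum.cong[OF refl]) (simp add: V10_connection_eq[OF U sec[OF k] A] len[OF k])
        also have "\<dots> = (\<Sum>i<n. vec_wedge ((?ms k)[i := deriv_along ?M (vs k ! i) J A]) \<alpha>s) +
         \<i>/2 * (\<Sum>i<n. vec_wedge ((?ms k)[i := capply A (?ms k ! i)]) \<alpha>s)"
          by (rule vec_wedge_replace_linear_comb[OF \<alpha>]) (simp add: len[OF k])
        finally show ?thesis .
      qed
      then have "(\<Sum>k<N. \<Sum>i<n. vec_wedge ((?ms k)[i := V10_connection vol J A (vs k ! i)]) \<alpha>s) =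
         (\<Sum>k<N. (\<Sum>i<n. vec_wedge ((?ms k)[i := deriv_along ?M (vs k ! i) J A]) \<alpha>s) +
         \<i>/2 * (\<Sum>i<n. vec_wedge ((?ms k)[i := capply A (?ms k ! i)]) \<alpha>s))"
        by (intro sum.cong) simp_all
      also have "\<dots> = deriv_along ?M (\<lambda>K. \<kappa> K \<alpha>s) J A + \<i>/2 * (\<Sum>i<n. \<kappa> J (\<alpha>s[i := \<lambda>v. (\<alpha>s ! i) (capply A v)]))"
        unfolding d s sum.distrib sum_distrib_left ..
      finally show ?thesis unfolding if_P[OF True] .
    next
      case False
      have "vec_wedge ((map (\<lambda>v. v J) (vs k))[i := V10_connection vol J A (vs k ! i)]) \<alpha>s = 0" if "k < N" for k i
        by (rule vec_wedge_eq_0) (simp only: length_list_update length_map len[OF that] False not_False_eq_True)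
      then have "(\<Sum>k<N. \<Sum>i<n. vec_wedge ((map (\<lambda>v. v J) (vs k))[i := V10_connection vol J A (vs k ! i)]) \<alpha>s) = 0"
        by (intro sum.neutral ballI) simp
      then show ?thesis unfolding if_not_P[OF False] .
    qed
  qed
  have ex: "P ?W"
    unfolding P_def key[OF U vs \<kappa>, symmetric] using U vs \<kappa>
    by (intro exI[of _ U] exI[of _ N] exI[of _ vs] conjI refl)
  have uniq: "w = ?W" if "P w" for w
  proof -
    from that obtain U' and N' :: nat and vs' where *: "openin (top_of_set ?M) U'" "J \<in> U'"
      "\<forall>k<N'. length (vs' k) = n \<and> (\<forall>v\<in>set (vs' k). V10_section U' v)"
      "\<forall>J'\<in>U'. \<kappa> J' = (\<lambda>\<alpha>s. \<Sum>k<N'. vec_wedge (map (\<lambda>v. v J') (vs' k)) \<alpha>s)"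
      and w: "w = (\<lambda>\<alpha>s. \<Sum>k<N'. \<Sum>i<n.
       vec_wedge ((map (\<lambda>v. v J) (vs' k))[i := V10_connection vol J A (vs' k ! i)]) \<alpha>s)"
      unfolding P_def by (elim exE conjE)
    show ?thesis unfolding w by (rule key[OF *])
  qed
  have "anticanonical_connection vol n J A \<kappa> = (THE w. P w)"
    unfolding anticanonical_connection_def P_def ..
  also have "\<dots> = ?W" by (rule the_equality[of P, OF ex uniq])
  finally show ?thesis .
qed

lemma smooth_in_proj10: "smooth_in U (\<lambda>K. proj10 K v)"
  unfolding proj10_def
  by (intro smooth_in_linear[OF bounded_linear_cscale] smooth_in_diff smooth_in_const
      smooth_in_linear[OF bounded_linear_capply] smooth_in_ident)

lemma smooth_in_cscale:
  fixes v :: "'a::real_normed_vector \<Rightarrow> 'v::euclidean_space cvec"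
  assumes "smooth_in U h" "smooth_in U v"
  shows "smooth_in U (\<lambda>K. cscale (h K) (v K))"
proof -
  have "smooth_in U (\<lambda>K. Re (h K) *\<^sub>R v K + Im (h K) *\<^sub>R cscale \<i> (v K))"
    by (intro smooth_in_add smooth_in_bilinear[OF bounded_bilinear_scaleR] smooth_in_linear[OF bounded_linear_Re]
        smooth_in_linear[OF bounded_linear_Im] smooth_in_linear[OF bounded_linear_cscale] assms)
  moreover have "Re c *\<^sub>R z + Im c *\<^sub>R cscale \<i> z = cscale c z" for c and z :: "'v cvec"
    by (simp add: cscale_def prod_eq_iff)
  ultimately show ?thesis by simp
qed

text \<open>The connection can be evaluated only on sections that are locally sums of products. Some
  product in the expansion at \<open>J\<close> is nonzero; projecting its vectors to nearby
  \<open>K\<close> gives a product \<open>W\<close> spanning the same line as the frame. The ratio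
  is smooth and is absorbed into the first vector, which exists because
  \<open>0 < n\<close>.\<close>

lemma anticanonical_decomposition:
  fixes vol :: "'v::euclidean_space form"
  assumes n: "0 < n" and U: "openin (top_of_set (complex_structures vol)) U" "J \<in> U"
    and \<kappa>: "local_section U (anticanonical_bundle n) \<kappa>"
    and span: "\<And>K. K \<in> U \<Longrightarrow> anticanonical_bundle n K = {\<lambda>i. c * \<kappa> K i | c. True}"
    and nz: "\<kappa> J \<noteq> (\<lambda>i. 0)"
  shows "\<exists>V vs. openin (top_of_set (complex_structures vol)) V \<and> J \<in> V \<and> V \<subseteq> U \<and> length vs = n \<and>
    (\<forall>v\<in>set vs. V10_section V v) \<and> (\<forall>K\<in>V. \<kappa> K = (\<lambda>\<alpha>s. vec_wedge (map (\<lambda>v. v K) vs) \<alpha>s))"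
proof -
  let ?M = "complex_structures vol"
  have UM: "U \<subseteq> ?M" by (rule openin_imp_subset[OF U(1)])
  have "\<kappa> J \<in> anticanonical_bundle n J" using \<kappa> U by (simp add: local_section_def)
  then obtain N :: nat and c f where eq: "\<kappa> J = (\<lambda>\<alpha>s. \<Sum>k<N. c k * f k \<alpha>s)"
    and f: "\<forall>k<N. f k \<in> {vec_wedge vs | vs. length vs = n \<and> set vs \<subseteq> V10 J}"
    unfolding anticanonical_bundle_def cspan_def by (elim CollectE exE conjE)
  obtain \<alpha>s where "\<kappa> J \<alpha>s \<noteq> 0" using nz by (auto simp: fun_eq_iff)
  then obtain k where k: "k < N" "f k \<alpha>s \<noteq> 0"
    unfolding eq by (metis (no_types, lifting) lessThan_iff mult_zero_right sum.neutral)
  obtain ws where ws: "f k = vec_wedge ws" "length ws = n" "set ws \<subseteq> V10 J" using f k(1) by blast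
  have \<alpha>: "length \<alpha>s = n" "\<forall>\<alpha>\<in>set \<alpha>s. clinear_functional \<alpha>"
    using k(2) ws(1,2) vec_wedge_eq_0[of \<alpha>s ws] by auto
  define W where "W K = vec_wedge (map (proj10 K) ws)" for K
  have "map (proj10 J) ws = ws" using ws(3) by (intro map_idI) (auto intro: proj10_ident)
  then have WJ: "W J \<alpha>s \<noteq> 0" using k(2) ws(1) by (simp add: W_def)
  have Weq: "W K \<alpha>s = (\<Sum>p | p permutes {..<n}. of_int (sign p) * (\<Prod>i<n. (\<alpha>s ! i) (proj10 K (ws ! p i))))" for K
  proof -
    have "W K \<alpha>s = (\<Sum>p | p permutes {..<n}. of_int (sign p) * (\<Prod>i<n. (\<alpha>s ! i) (map (proj10 K) ws ! p i)))"
      unfolding W_def using \<alpha> ws(2) by (simp add: vec_wedge_eq)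
    also have "\<dots> = (\<Sum>p | p permutes {..<n}. of_int (sign p) * (\<Prod>i<n. (\<alpha>s ! i) (proj10 K (ws ! p i))))"
    proof (intro sum.cong arg_cong2[where f = "(*)"] prod.cong refl)
      fix p i assume "p \<in> {p. p permutes {..<n}}" "i \<in> {..<n}"
      then have "p i < n" using permutes_in_image[of p "{..<n}" i] by simp
      then show "(\<alpha>s ! i) (map (proj10 K) ws ! p i) = (\<alpha>s ! i) (proj10 K (ws ! p i))" by (simp add: ws(2))
    qed
    finally show ?thesis .
  qed
  have Wsm: "smooth_in U (\<lambda>K. W K \<alpha>s)"
    unfolding Weq
  proof (intro smooth_in_sum smooth_in_mult smooth_in_const smooth_in_prod)
    fix p i assume "p \<in> {p. p permutes {..<n}}" "i \<in> {..<n}"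
    then have "clinear_functional (\<alpha>s ! i)" using \<alpha> by simp
    then show "smooth_in U (\<lambda>K. (\<alpha>s ! i) (proj10 K (ws ! p i)))"
      by (intro smooth_in_linear[OF clinear_functional_bounded] smooth_in_proj10)
  qed
  define V where "V = U \<inter> (\<lambda>K. W K \<alpha>s) -` (- {0})"
  have "openin (top_of_set U) V"
  proof -
    have "open (- {0 :: complex})" by (rule open_Compl[OF closed_singleton])
    from continuous_openin_preimage_gen[OF smooth_in_continuous_on[OF Wsm] this] show ?thesis unfolding V_def .
  qed
  then have V: "openin (top_of_set ?M) V" by (rule openin_trans[OF _ U(1)])
  have JV: "J \<in> V" and VU: "V \<subseteq> U" using U(2) WJ by (auto simp: V_def)
  \<comment> \<open>The ratio is read off at one list of functionals where \<open>W\<close> is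
    nonzero; since the fibre is a line, it is the ratio everywhere.\<close>
  define h where "h K = \<kappa> K \<alpha>s / W K \<alpha>s" for K
  have "smooth_in V (\<lambda>K. \<kappa> K \<alpha>s * inverse (W K \<alpha>s))"
  proof (intro smooth_in_mult smooth_in_inverse)
    have "smooth_in U (\<lambda>K. \<kappa> K \<alpha>s)" using \<kappa> unfolding local_section_def by blast
    then show "smooth_in V (\<lambda>K. \<kappa> K \<alpha>s)" using VU by (rule smooth_in_subset)
    show "smooth_in V (\<lambda>K. W K \<alpha>s)" using Wsm VU by (rule smooth_in_subset)
  qed (simp add: V_def)
  then have h: "smooth_in V h" by (simp add: h_def[abs_def] divide_inverse)
  obtain w0 wt where w0: "ws = w0 # wt" using ws(2) n by (cases ws) auto
  define vs where "vs = (\<lambda>K. cscale (h K) (proj10 K w0)) # map (\<lambda>w K. proj10 K w) wt"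
  have vsK: "map (\<lambda>v. v K) vs = cscale (h K) (proj10 K w0) # map (proj10 K) wt" for K
    by (simp add: vs_def comp_def)
  have sec0: "V10_section V (\<lambda>K. proj10 K w)" for w
    unfolding V10_section_def using UM VU by (intro conjI ballI smooth_in_proj10 proj10_V10[of _ vol]) auto
  have sec: "\<forall>v\<in>set vs. V10_section V v"
  proof
    fix v assume "v \<in> set vs"
    then consider "v = (\<lambda>K. cscale (h K) (proj10 K w0))" | w where "v = (\<lambda>K. proj10 K w)"
      by (auto simp: vs_def)
    then show "V10_section V v"
    proof cases
      case 1
      have "cscale (h K) (proj10 K w0) \<in> V10 K" if "K \<in> V" for K
      proof -
        have "proj10 K w0 \<in> V10 K" using sec0 that by (simp add: V10_section_def)
        then show ?thesis by (simp add: V10_def mult.commute)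
      qed
      then show ?thesis unfolding 1 V10_section_def by (simp add: smooth_in_cscale[OF h smooth_in_proj10])
    qed (simp add: sec0)
  qed
  have "\<kappa> K = (\<lambda>\<alpha>s. vec_wedge (map (\<lambda>v. v K) vs) \<alpha>s)" if K: "K \<in> V" for K
  proof -
    have KM: "K \<in> ?M" using K VU UM by auto
    have KU: "K \<in> U" using K VU by auto
    have WK: "W K \<alpha>s \<noteq> 0" using K by (simp add: V_def)
    have "W K \<in> anticanonical_bundle n K"
      unfolding anticanonical_bundle_def cspan_def
    proof (intro CollectI exI[of _ "1::nat"] exI[of _ "\<lambda>_. 1"] exI[of _ "\<lambda>_. W K"] conjI allI impI)
      show "W K = (\<lambda>i. \<Sum>k<(1::nat). 1 * W K i)" by simp
      show "\<exists>vs. W K = vec_wedge vs \<and> length vs = n \<and> set vs \<subseteq> V10 K"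
        unfolding W_def using ws(2) by (intro exI[of _ "map (proj10 K) ws"]) (auto intro: proj10_V10[OF KM])
    qed
    then obtain d where d: "W K = (\<lambda>i. d * \<kappa> K i)" unfolding span[OF KU] by blast
    have "d \<noteq> 0" using WK by (auto simp: d)
    then have "\<kappa> K i = h K * W K i" for i
      using WK by (simp add: h_def d)
    moreover have "vec_wedge (map (\<lambda>v. v K) vs) i = h K * W K i" for i
      unfolding vsK vec_wedge_scale_head W_def w0 by simp
    ultimately show ?thesis by auto
  qed
  then show ?thesis using V JV VU sec ws(2)
    by (intro exI[of _ V] exI[of _ vs]) (simp add: vs_def w0)
qed

section \<open>Differentiating derivations of forms\<close>

lemma ext_forms_slot_functional:
  "\<psi> \<in> ext_forms \<Longrightarrow> i < length xs \<Longrightarrow> clinear_functional (\<lambda>z. \<psi> (xs[i := z]))"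
  unfolding clinear_functional_def ext_forms_def by (simp del: split_paired_All)

lemma deriv_along_slot:
  fixes s :: "'a::real_normed_vector \<Rightarrow> 'v::euclidean_space form"
  assumes U: "openin (top_of_set M) U" "x \<in> U" and ext: "\<And>y. y \<in> U \<Longrightarrow> s y \<in> ext_forms"
    and sm: "\<And>i. smooth_in U (\<lambda>y. s y i)" and v: "(v has_derivative v') (at x within M)"
    and i: "i < length xs"
  shows "((\<lambda>y. s y (xs[i := v y])) has_derivative
    (\<lambda>A. \<Sum>b\<in>Basis. cmetric (of_vec b) (v x) * deriv_along M (\<lambda>y. s y (xs[i := of_vec b])) x A
      + cmetric (of_vec b) (v' A) * s x (xs[i := of_vec b]))) (at x within M)"
proof -
  let ?e = "of_vec :: 'v \<Rightarrow> _"
  have "((\<lambda>y. \<Sum>b\<in>Basis. cmetric (?e b) (v y) * s y (xs[i := ?e b])) has_derivative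
    (\<lambda>A. \<Sum>b\<in>Basis. cmetric (?e b) (v x) * deriv_along M (\<lambda>y. s y (xs[i := ?e b])) x A
      + cmetric (?e b) (v' A) * s x (xs[i := ?e b]))) (at x within M)"
    by (intro has_derivative_sum bounded_bilinear.FDERIV[OF bounded_bilinear_mult]
        bounded_linear.has_derivative[OF bounded_linear_cmetric v] deriv_along_works smooth_in_differentiable[OF U(1) sm U(2)])
  moreover have eq: "(\<Sum>b\<in>Basis. cmetric (?e b) (v y) * s y (xs[i := ?e b])) = s y (xs[i := v y])" if "y \<in> U" for y
    by (rule clinear_functional_expand[OF ext_forms_slot_functional[OF ext[OF that] i], symmetric])
  ultimately show ?thesis
  proof -
    assume d: "((\<lambda>y. \<Sum>b\<in>Basis. cmetric (?e b) (v y) * s y (xs[i := ?e b])) has_derivative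
      (\<lambda>A. \<Sum>b\<in>Basis. cmetric (?e b) (v x) * deriv_along M (\<lambda>y. s y (xs[i := ?e b])) x A
        + cmetric (?e b) (v' A) * s x (xs[i := ?e b]))) (at x within M)"
    obtain T where T: "open T" "U = M \<inter> T" using U(1) by (auto simp: openin_open)
    then obtain d' where d': "d' > 0" "ball x d' \<subseteq> T" using U(2) open_contains_ball by blast
    have xM: "x \<in> M" using U(2) T by blast
    show ?thesis
    proof (rule has_derivative_transform_within[OF d d'(1) xM])
      fix y assume "y \<in> M" "dist y x < d'"
      then have "y \<in> U" using d'(2) T by (auto simp: dist_commute subset_iff)
      then show "(\<Sum>b\<in>Basis. cmetric (?e b) (v y) * s y (xs[i := ?e b])) = s y (xs[i := v y])" by (rule eq)
    qed
  qed
qed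

lemma deriv_along_derivation:
  fixes s :: "('v::euclidean_space \<Rightarrow>\<^sub>L 'v) \<Rightarrow> 'v form"
  assumes U: "openin (top_of_set M) U" "x \<in> U" and ext: "\<And>y. y \<in> U \<Longrightarrow> s y \<in> ext_forms"
    and sm: "\<And>i. smooth_in U (\<lambda>y. s y i)" and Z: "(Z has_derivative Z') (at x within M)"
    and A: "A \<in> tangent M x"
  shows "(\<lambda>y. derivation (capply (Z y)) (s y) xs) differentiable (at x within M)"
    and "deriv_along M (\<lambda>y. derivation (capply (Z y)) (s y) xs) x A =
      derivation (capply (Z' A)) (s x) xs + derivation (capply (Z x)) (trivial_connection M x A s) xs"
proof -
  let ?e = "of_vec :: 'v \<Rightarrow> _"
  let ?d = "\<lambda>i B. \<Sum>b\<in>Basis. cmetric (?e b) (capply (Z x) (xs ! i)) * deriv_along M (\<lambda>y. s y (xs[i := ?e b])) x B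
      + cmetric (?e b) (capply (Z' B) (xs ! i)) * s x (xs[i := ?e b])"
  have Zv: "((\<lambda>y. capply (Z y) z) has_derivative (\<lambda>B. capply (Z' B) z)) (at x within M)" for z
    by (rule bounded_linear.has_derivative[OF bounded_linear_capply Z])
  have d: "((\<lambda>y. derivation (capply (Z y)) (s y) xs) has_derivative (\<lambda>B. \<Sum>i<length xs. ?d i B)) (at x within M)"
    unfolding derivation_def
  proof (rule has_derivative_sum)
    fix i assume "i \<in> {..<length xs}"
    then have i: "i < length xs" by simp
    show "((\<lambda>y. s y (xs[i := capply (Z y) (xs ! i)])) has_derivative ?d i) (at x within M)"
      by (rule deriv_along_slot[OF U ext sm Zv i])
  qed
  then show "(\<lambda>y. derivation (capply (Z y)) (s y) xs) differentiable (at x within M)"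
    by (auto simp: differentiable_def)
  have ds: "trivial_connection M x A s \<in> ext_forms" by (rule trivial_connection_ext_forms[OF U ext sm A])
  have "?d i A = trivial_connection M x A s (xs[i := capply (Z x) (xs ! i)]) + s x (xs[i := capply (Z' A) (xs ! i)])"
    if i: "i < length xs" for i
    using clinear_functional_expand[OF ext_forms_slot_functional[OF ds i], of "capply (Z x) (xs ! i)"]
      clinear_functional_expand[OF ext_forms_slot_functional[OF ext[OF U(2)] i], of "capply (Z' A) (xs ! i)"]
    by (simp add: trivial_connection_def sum.distrib)
  then show "deriv_along M (\<lambda>y. derivation (capply (Z y)) (s y) xs) x A =
      derivation (capply (Z' A)) (s x) xs + derivation (capply (Z x)) (trivial_connection M x A s) xs"
    unfolding deriv_along_eq[OF d A] by (simp add: derivation_def sum.distrib[symmetric] add.commute)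
qed

lemma anticanonical_curvature:
  fixes vol :: "'v::euclidean_space form"
  assumes dim: "DIM('v) = 2 * n" and vol: "volume_form vol"
    and U: "openin (top_of_set (complex_structures vol)) U" "x \<in> U"
    and \<kappa>: "local_section U (anticanonical_bundle n) \<kappa>"
    and span: "\<And>K. K \<in> U \<Longrightarrow> anticanonical_bundle n K = {\<lambda>i. c * \<kappa> K i | c. True}"
    and nz: "\<And>K. K \<in> U \<Longrightarrow> \<kappa> K \<noteq> (\<lambda>i. 0)"
    and \<tau>: "\<And>K A. K \<in> U \<Longrightarrow> A \<in> tangent (complex_structures vol) K \<Longrightarrow>
      anticanonical_connection vol n K A \<kappa> = (\<lambda>i. \<tau> K A * \<kappa> K i)"
    and \<tau>sm: "\<And>Z. vector_field (complex_structures vol) U Z \<Longrightarrow> smooth_in U (\<lambda>K. \<tau> K (Z K))"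
    and X: "vector_field (complex_structures vol) U X" and Y: "vector_field (complex_structures vol) U Y"
  shows "exterior_derivative (complex_structures vol) \<tau> X Y x = 1/4 * (\<Sum>b\<in>Basis. cmetric (of_vec b) (proj01 x
    (capply (X x) (capply (Y x) (of_vec b)) - capply (Y x) (capply (X x) (of_vec b)))))"
proof -
  let ?M = "complex_structures vol"
  have UM: "U \<subseteq> ?M" by (rule openin_imp_subset[OF U(1)])
  have n: "0 < n" using dim DIM_positive[where 'a = 'v] by simp
  define \<psi> where "\<psi> K = wedge_form (\<kappa> K)" for K
  have top: "top_form_data vol n K (\<psi> K)" if "K \<in> U" for K
    unfolding \<psi>_def using that UM \<kappa>
    by (intro anticanonical_top_form(1)[OF dim]) (auto simp: local_section_def)
  have ext: "\<psi> K \<in> ext_forms" if "K \<in> U" for K using top[OF that] by (simp add: top_form_data_def)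
  have sm: "smooth_in U (\<lambda>K. \<psi> K xs)" for xs
    using \<kappa> unfolding \<psi>_def wedge_form_def local_section_def by blast
  have deg: "\<psi> K xs = 0" if "K \<in> U" "length xs \<noteq> n" for K xs
    using top[OF that(1)] that(2) by (simp add: top_form_data_def)
  \<comment> \<open>The equation \<open>D \<psi> = \<tau> \<psi>\<close> solved for the plain
    derivative. Moving \<open>A\<close> from the functional \<open>cmetric z\<close> to the vector
    \<open>z\<close> costs a sign, as \<open>A\<close> is skew.\<close>
  have d\<psi>: "deriv_along ?M (\<lambda>K. \<psi> K xs) K A = \<tau> K A * \<psi> K xs + \<i>/2 * derivation (capply A) (\<psi> K) xs"
    if K: "K \<in> U" and A: "A \<in> tangent ?M K" for K A xs
  proof (cases "length xs = n")
    case True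
    have "\<exists>V vs. openin (top_of_set ?M) V \<and> K \<in> V \<and> V \<subseteq> U \<and> length vs = n \<and>
      (\<forall>v\<in>set vs. V10_section V v) \<and> (\<forall>K\<in>V. \<kappa> K = (\<lambda>\<alpha>s. vec_wedge (map (\<lambda>v. v K) vs) \<alpha>s))"
      by (rule anticanonical_decomposition[OF n U(1) K \<kappa> span nz[OF K]])
    then obtain V vs where V: "openin (top_of_set ?M) V" "K \<in> V" "V \<subseteq> U" "length vs = n"
      "\<forall>v\<in>set vs. V10_section V v" "\<forall>K\<in>V. \<kappa> K = (\<lambda>\<alpha>s. vec_wedge (map (\<lambda>v. v K) vs) \<alpha>s)"
      by (elim exE conjE)
    let ?\<alpha> = "map cmetric xs"
    have lin: "\<forall>\<alpha>\<in>set ?\<alpha>. clinear_functional \<alpha>" by (auto simp: clinear_functional_cmetric)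
    have "anticanonical_connection vol n K A \<kappa> =
      (\<lambda>\<alpha>s. if length \<alpha>s = n \<and> (\<forall>\<alpha>\<in>set \<alpha>s. clinear_functional \<alpha>)
       then deriv_along ?M (\<lambda>K. \<kappa> K \<alpha>s) K A + \<i>/2 * (\<Sum>i<n. \<kappa> K (\<alpha>s[i := \<lambda>v. (\<alpha>s ! i) (capply A v)])) else 0)"
      by (rule anticanonical_connection_eq[OF V(1,2) A, of 1 "\<lambda>_. vs"]) (use V(4,5,6) in simp_all)
    from fun_cong[OF this, of ?\<alpha>]
    have "\<tau> K A * \<psi> K xs = deriv_along ?M (\<lambda>K. \<psi> K xs) K A +
        \<i>/2 * (\<Sum>i<n. \<kappa> K (?\<alpha>[i := \<lambda>v. (?\<alpha> ! i) (capply A v)]))"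
      using True lin unfolding \<tau>[OF K A] \<psi>_def wedge_form_def by simp
    moreover have "\<kappa> K (?\<alpha>[i := \<lambda>v. (?\<alpha> ! i) (capply A v)]) = - \<psi> K (xs[i := capply A (xs ! i)])" if i: "i < n" for i
    proof -
      have "(\<lambda>v. (?\<alpha> ! i) (capply A v)) = cmetric (- capply A (xs ! i))"
        using i True skew_anticommuting_cmetric[OF tangent_skew_anticommuting[OF A], of "xs ! i"] by (simp add: fun_eq_iff)
      then have "\<kappa> K (?\<alpha>[i := \<lambda>v. (?\<alpha> ! i) (capply A v)]) = \<psi> K (xs[i := - capply A (xs ! i)])"
        by (simp add: \<psi>_def wedge_form_def map_update)
      also have "\<dots> = - \<psi> K (xs[i := capply A (xs ! i)])"
      proof -
        have f: "clinear_functional (\<lambda>z. \<psi> K (xs[i := z]))"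
          by (rule ext_forms_slot_functional[OF ext[OF K]]) (use i True in simp)
        have "\<psi> K (xs[i := cscale (-1) (capply A (xs ! i)) + 0]) = (-1) * \<psi> K (xs[i := capply A (xs ! i)]) + \<psi> K (xs[i := 0])"
          using f unfolding clinear_functional_def by blast
        then show ?thesis using clinear_functional_zero[OF f] by simp
      qed
      finally show ?thesis .
    qed
    ultimately show ?thesis by (simp add: derivation_def True sum_negf)
  next
    case False
    have "deriv_along ?M (\<lambda>K. \<psi> K xs) K A = deriv_along ?M (\<lambda>K. 0) K A"
      by (rule deriv_along_cong[OF U(1) K]) (simp add: deg False)
    then show ?thesis
      using False by (simp add: deriv_along_const[OF A] deg[OF K] derivation_def)
  qed
  have br: "lie_bracket ?M X Y x \<in> tangent ?M x" by (rule lie_bracket_tangent[OF vol U X Y])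
  let ?D = "\<lambda>Z1 Z2. deriv_along ?M Z2 x (Z1 x)"
  \<comment> \<open>\<open>d\<psi>\<close> is used twice. The products of a value of \<tau> with a
    derivation, and of two values of \<tau>, are symmetric in the two fields and will
    cancel.\<close>
  have second: "deriv_along ?M (\<lambda>K. deriv_along ?M (\<lambda>K. \<psi> K xs) K (Z2 K)) x (Z1 x) =
      deriv_along ?M (\<lambda>K. \<tau> K (Z2 K)) x (Z1 x) * \<psi> x xs
      + \<tau> x (Z2 x) * (\<tau> x (Z1 x) * \<psi> x xs + \<i>/2 * derivation (capply (Z1 x)) (\<psi> x) xs)
      + \<i>/2 * (derivation (capply (?D Z1 Z2)) (\<psi> x) xs
        + \<tau> x (Z1 x) * derivation (capply (Z2 x)) (\<psi> x) xs
        + \<i>/2 * derivation (capply (Z2 x)) (derivation (capply (Z1 x)) (\<psi> x)) xs)"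
    if Z1: "vector_field ?M U Z1" and Z2: "vector_field ?M U Z2" for Z1 Z2 xs
  proof -
    have t1: "Z1 x \<in> tangent ?M x" and t2: "\<And>K. K \<in> U \<Longrightarrow> Z2 K \<in> tangent ?M K"
      using Z1 Z2 U(2) by (simp_all add: vector_field_def)
    have "smooth_in U Z2" using Z2 by (simp add: vector_field_def)
    then have dZ: "(Z2 has_derivative deriv_along ?M Z2 x) (at x within ?M)"
      by (intro deriv_along_works smooth_in_differentiable[OF U(1) _ U(2)])
    have der: "(\<lambda>K. derivation (capply (Z2 K)) (\<psi> K) xs) differentiable (at x within ?M)"
      by (rule deriv_along_derivation(1)[OF U ext sm dZ t1])
    have der': "deriv_along ?M (\<lambda>K. derivation (capply (Z2 K)) (\<psi> K) xs) x (Z1 x) =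
      derivation (capply (?D Z1 Z2)) (\<psi> x) xs + derivation (capply (Z2 x)) (trivial_connection ?M x (Z1 x) \<psi>) xs"
      by (rule deriv_along_derivation(2)[OF U ext sm dZ t1])
    have dt: "trivial_connection ?M x (Z1 x) \<psi> = (\<lambda>xs. \<tau> x (Z1 x) * \<psi> x xs + \<i>/2 * derivation (capply (Z1 x)) (\<psi> x) xs)"
      unfolding trivial_connection_def by (rule HOL.ext) (rule d\<psi>[OF U(2) t1])
    have "deriv_along ?M (\<lambda>K. deriv_along ?M (\<lambda>K. \<psi> K xs) K (Z2 K)) x (Z1 x) =
      deriv_along ?M (\<lambda>K. \<tau> K (Z2 K) * \<psi> K xs + \<i>/2 * derivation (capply (Z2 K)) (\<psi> K) xs) x (Z1 x)"
      by (rule deriv_along_cong[OF U]) (simp add: d\<psi> t2)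
    also have "\<dots> = (\<tau> x (Z2 x) * deriv_along ?M (\<lambda>K. \<psi> K xs) x (Z1 x) + deriv_along ?M (\<lambda>K. \<tau> K (Z2 K)) x (Z1 x) * \<psi> x xs)
      + \<i>/2 * deriv_along ?M (\<lambda>K. derivation (capply (Z2 K)) (\<psi> K) xs) x (Z1 x)"
      by (rule deriv_along_eq[OF has_derivative_add[OF bounded_bilinear.FDERIV[OF bounded_bilinear_mult] has_derivative_mult_right] t1])
        (intro deriv_along_works smooth_in_differentiable[OF U(1) _ U(2)] sm \<tau>sm[OF Z2] der)+
    also have "deriv_along ?M (\<lambda>K. derivation (capply (Z2 K)) (\<psi> K) xs) x (Z1 x) =
      derivation (capply (?D Z1 Z2)) (\<psi> x) xs + (\<tau> x (Z1 x) * derivation (capply (Z2 x)) (\<psi> x) xs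
        + \<i>/2 * derivation (capply (Z2 x)) (derivation (capply (Z1 x)) (\<psi> x)) xs)"
      unfolding der' dt derivation_linear_comb ..
    finally show ?thesis unfolding d\<psi>[OF U(2) t1] by (simp add: algebra_simps)
  qed
  define a b where "a = capply (X x)" and "b = capply (Y x)"
  have XYt: "X x \<in> tangent ?M x" "Y x \<in> tangent ?M x" using X Y U(2) by (simp_all add: vector_field_def)
  note sX = tangent_skew_anticommuting[OF XYt(1)] and sY = tangent_skew_anticommuting[OF XYt(2)]
  let ?T = "\<lambda>z. a (b z) - b (a z)"
  let ?tr = "\<Sum>c\<in>Basis. cmetric (of_vec c) (proj01 x (?T (of_vec c)))"
  have main: "exterior_derivative ?M \<tau> X Y x * \<psi> x xs = 1/4 * ?tr * \<psi> x xs" for xs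
  proof -
    have lb: "derivation (capply (lie_bracket ?M X Y x)) (\<psi> x) xs =
        derivation (capply (?D X Y)) (\<psi> x) xs - derivation (capply (?D Y X)) (\<psi> x) xs"
    proof -
      have "capply (lie_bracket ?M X Y x) = (\<lambda>z. capply (?D X Y) z - capply (?D Y X) z)"
        unfolding lie_bracket_def by (rule HOL.ext) (rule capply_simps(7))
      then show ?thesis by (simp only: derivation_diff_map[OF ext[OF U(2)]])
    qed
    have comm: "derivation b (derivation a (\<psi> x)) xs - derivation a (derivation b (\<psi> x)) xs = derivation ?T (\<psi> x) xs"
      by (rule derivation_commutator[OF ext[OF U(2)]])
    have T: "derivation ?T (\<psi> x) xs = ?tr * \<psi> x xs"
    proof (rule top_form_data.derivation_trace[OF top[OF U(2)]])
      show "clinear_map ?T" by (simp add: clinear_map_def a_def b_def algebra_simps del: split_paired_All)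
      show "?T (proj01 x z) = proj01 x (?T z)" for z
        by (simp add: a_def b_def skew_anticommuting_proj[OF sX] skew_anticommuting_proj[OF sY])
    qed
    have "deriv_along ?M (\<lambda>K. deriv_along ?M (\<lambda>K. \<psi> K xs) K (Y K)) x (X x) -
      deriv_along ?M (\<lambda>K. deriv_along ?M (\<lambda>K. \<psi> K xs) K (X K)) x (Y x) =
      \<tau> x (lie_bracket ?M X Y x) * \<psi> x xs + \<i>/2 * derivation (capply (lie_bracket ?M X Y x)) (\<psi> x) xs"
      unfolding deriv_along_lie_bracket[OF U(1) sm X Y U(2) br] by (rule d\<psi>[OF U(2) br])
    \<comment> \<open>The derivatives of the fields account for the derivation by the bracket; the
      square of \<open>\<i>/2\<close> is \<open>- 1/4\<close>, which leaves a commutator of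
      derivations.\<close>
    then have "exterior_derivative ?M \<tau> X Y x * \<psi> x xs =
      1/4 * (derivation b (derivation a (\<psi> x)) xs - derivation a (derivation b (\<psi> x)) xs)"
      unfolding second[OF X Y] second[OF Y X] lb exterior_derivative_def a_def b_def
      by (simp add: algebra_simps)
    then show ?thesis unfolding comm T by simp
  qed
  \<comment> \<open>A nonzero value of the form, by which \<open>main\<close> is divided.\<close>
  obtain \<alpha>s where \<alpha>s: "\<kappa> x \<alpha>s \<noteq> 0" using nz[OF U(2)] by (auto simp: fun_eq_iff)
  have "\<kappa> x \<in> anticanonical_bundle n x" using \<kappa> U(2) by (simp add: local_section_def)
  from anticanonical_top_form(2)[OF dim _ this \<alpha>s] obtain xs where "\<alpha>s = map cmetric xs" using U(2) UM by blast
  then have "\<psi> x xs \<noteq> 0" using \<alpha>s by (simp add: \<psi>_def wedge_form_def)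
  with main[of xs] show ?thesis by (simp add: a_def b_def)
qed

text \<open>The isomorphism carries \<open>l \<otimes>\<^sub>f l\<close> to a frame \<kappa> of the
  anticanonical bundle. By the Leibniz rule its connection form is twice that of \<open>l\<close>,
  so the curvature of \<open>L\<close> is half of the anticanonical one.\<close>

lemma square_root_connection_form:
  fixes vol :: "'v::euclidean_space form" and L :: "('v \<Rightarrow>\<^sub>L 'v) \<Rightarrow> ('l \<Rightarrow> complex) set"
  assumes dim: "DIM('v) = 2 * n" and vol: "volume_form vol"
    and sq: "square_root_bundle (complex_structures vol) (anticanonical_bundle n) (anticanonical_connection vol n) L DL"
    and fr: "line_frame (complex_structures vol) U L l j"
    and X: "vector_field (complex_structures vol) U X" and Y: "vector_field (complex_structures vol) U Y" and x: "x \<in> U"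
  shows "exterior_derivative (complex_structures vol) (connection_form DL l j) X Y x = - (sigma_form vol x (X x) (Y x) / (2 * \<i>))"
proof -
  let ?M = "complex_structures vol" and ?K = "anticanonical_bundle n" and ?DK = "anticanonical_connection vol n"
  let ?LL = "tensor_bundle L L" and ?DLL = "tensor_connection ?M L DL L DL"
  obtain \<Phi> where L: "line_bundle ?M L" and DL: "connection ?M L DL" and \<Phi>: "connection_iso ?M ?LL ?DLL ?K ?DK \<Phi>"
    using sq unfolding square_root_bundle_def by (elim conjE exE)
  have sub: "subspace_bundle ?M L" by (rule line_bundle_subspace[OF L])
  have U: "openin (top_of_set ?M) U" and l: "local_section U L l" using fr by (simp_all add: line_frame_def)
  have UM: "U \<subseteq> ?M" by (rule openin_imp_subset[OF U])
  let ?\<theta> = "connection_form DL l j"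
  let ?t = "\<lambda>K. l K \<otimes>\<^sub>f l K"
  have lL: "l K \<in> L K" if "K \<in> U" for K using l that by (simp add: local_section_def)
  have LK: "L K = {\<lambda>i. c * l K i | c. True}" and lj: "l K j \<noteq> 0" if "K \<in> U" for K
    using fr that by (simp_all add: line_frame_def)
  have tLL: "(\<lambda>p. c * ?t K p) \<in> ?LL K" if "K \<in> U" for K c
    unfolding tensor_bundle_def cspan_def
  proof (intro CollectI exI[of _ "1::nat"] exI[of _ "\<lambda>_::nat. c"] exI[of _ "\<lambda>_::nat. ?t K"] conjI allI impI)
    show "(\<lambda>p. c * ?t K p) = (\<lambda>p. \<Sum>k<(1::nat). c * ?t K p)" by simp
    show "\<exists>u v. ?t K = u \<otimes>\<^sub>f v \<and> u \<in> L K \<and> v \<in> L K" using lL[OF that] by blast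
  qed
  have LLK: "r \<in> ?LL K \<Longrightarrow> \<exists>c. r = (\<lambda>p. c * ?t K p)" if K: "K \<in> U" for K r
  proof -
    assume "r \<in> ?LL K"
    then obtain N :: nat and c f where r: "r = (\<lambda>p. \<Sum>k<N. c k * f k p)"
      and f: "\<forall>k<N. f k \<in> {u \<otimes>\<^sub>f v | u v. u \<in> L K \<and> v \<in> L K}"
      unfolding tensor_bundle_def cspan_def by (elim CollectE exE conjE)
    have "\<exists>d. f k = (\<lambda>p. d * ?t K p)" if k: "k < N" for k
    proof -
      obtain u v where uv: "f k = u \<otimes>\<^sub>f v" "u \<in> L K" "v \<in> L K" using f k by blast
      obtain c d where cd: "u = (\<lambda>i. c * l K i)" "v = (\<lambda>i. d * l K i)" using uv(2,3) unfolding LK[OF K] by blast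
      show ?thesis unfolding uv(1) cd by (rule exI[of _ "c * d"]) (simp add: tensor_def fun_eq_iff)
    qed
    then have "\<forall>k\<in>{..<N}. \<exists>d. f k = (\<lambda>p. d * ?t K p)" by simp
    from bchoice[OF this] obtain d where d: "\<forall>k\<in>{..<N}. f k = (\<lambda>p. d k * ?t K p)" by (elim exE)
    have "r = (\<lambda>p. (\<Sum>k<N. c k * d k) * ?t K p)"
      unfolding r sum_distrib_right by (rule HOL.ext, rule sum.cong[OF refl]) (simp add: d)
    then show "\<exists>c. r = (\<lambda>p. c * ?t K p)" by blast
  qed
  have t: "local_section U ?LL ?t"
    unfolding local_section_def
  proof (intro conjI ballI allI)
    show "?t K \<in> ?LL K" if "K \<in> U" for K using tLL[OF that, of 1] by simp
    fix p :: "'l \<times> 'l"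
    show "smooth_in U (\<lambda>K. ?t K p)"
      using l unfolding local_section_def by (cases p) (simp add: smooth_in_mult)
  qed
  define \<kappa> where "\<kappa> K = \<Phi> K (?t K)" for K
  note iso = \<Phi>[unfolded connection_iso_def]
  have bij: "bij_betw (\<Phi> K) (?LL K) (?K K)" if "K \<in> U" for K
    using conjunct1[OF iso] that UM by blast
  have \<Phi>lin: "\<Phi> K (\<lambda>i. c * u i + v i) = (\<lambda>i. c * \<Phi> K u i + \<Phi> K v i)"
    if "K \<in> U" "u \<in> ?LL K" "v \<in> ?LL K" for K u v c
    using conjunct1[OF iso] that UM by blast
  have sec: "local_section U ?K \<kappa> \<and> (\<forall>x\<in>U. \<forall>A\<in>tangent ?M x. ?DK x A \<kappa> = \<Phi> x (?DLL x A ?t))"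
    using conjunct1[OF conjunct2[OF iso]] U t unfolding \<kappa>_def[abs_def] by blast
  have \<Phi>0: "\<Phi> K (\<lambda>i. 0) = (\<lambda>i. 0)" if K: "K \<in> U" for K
  proof -
    have z: "(\<lambda>i. 0) \<in> ?LL K" using tLL[OF K, of 0] by simp
    from \<Phi>lin[OF K z z, of 1] show ?thesis by (simp add: fun_eq_iff)
  qed
  have \<Phi>scale: "\<Phi> K (\<lambda>i. c * ?t K i) = (\<lambda>i. c * \<kappa> K i)" if K: "K \<in> U" for K c
    using \<Phi>lin[OF K _ _, of "?t K" "\<lambda>i. 0" c] tLL[OF K, of 1] tLL[OF K, of 0] \<Phi>0[OF K] by (simp add: \<kappa>_def)
  have span: "?K K = {\<lambda>i. c * \<kappa> K i | c. True}" if K: "K \<in> U" for K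
  proof -
    have "?LL K = {\<lambda>p. c * ?t K p | c. True}" using tLL[OF K] LLK[OF K] by blast
    then have "?K K = \<Phi> K ` {\<lambda>p. c * ?t K p | c. True}" using bij[OF K] by (simp add: bij_betw_def)
    then show ?thesis using \<Phi>scale[OF K] by (auto simp: image_iff) metis
  qed
  have nz: "\<kappa> K \<noteq> (\<lambda>i. 0)" if K: "K \<in> U" for K
  proof
    assume "\<kappa> K = (\<lambda>i. 0)"
    then have "\<Phi> K (?t K) = \<Phi> K (\<lambda>i. 0)" by (simp add: \<kappa>_def \<Phi>0[OF K])
    moreover have "?t K \<in> ?LL K" "(\<lambda>i. 0) \<in> ?LL K" using tLL[OF K, of 1] tLL[OF K, of 0] by simp_all
    ultimately have "?t K = (\<lambda>i. 0)" using bij[OF K] by (simp add: bij_betw_def inj_on_def)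
    from fun_cong[OF this, of "(j, j)"] show False using lj[OF K] by simp
  qed
  define \<tau> where "\<tau> K A = 2 * ?\<theta> K A" for K A
  have \<tau>: "?DK K A \<kappa> = (\<lambda>i. \<tau> K A * \<kappa> K i)" if K: "K \<in> U" and A: "A \<in> tangent ?M K" for K A
  proof -
    have "?DLL K A ?t = (\<lambda>p. (DL K A l \<otimes>\<^sub>f l K) p + (l K \<otimes>\<^sub>f DL K A l) p)"
      by (rule tensor_connection_eq[OF DL sub DL fr K A l]) simp
    also have "\<dots> = (\<lambda>p. \<tau> K A * ?t K p)"
      unfolding connection_form_eq[OF DL fr K A] \<tau>_def by (auto simp: tensor_def fun_eq_iff algebra_simps)
    finally show ?thesis using sec K A \<Phi>scale[OF K] by simp
  qed
  have \<tau>sm: "smooth_in U (\<lambda>K. \<tau> K (Z K))" if "vector_field ?M U Z" for Z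
    unfolding \<tau>_def by (intro smooth_in_mult smooth_in_const connection_form_smooth[OF DL fr that])
  have XYt: "X x \<in> tangent ?M x" "Y x \<in> tangent ?M x" using X Y x by (simp_all add: vector_field_def)
  have xM: "x \<in> ?M" using x UM by auto
  have "exterior_derivative ?M \<tau> X Y x = 2 * exterior_derivative ?M ?\<theta> X Y x"
  proof -
    have "deriv_along ?M (\<lambda>K. \<tau> K (Z2 K)) x (Z1 x) = 2 * deriv_along ?M (\<lambda>K. ?\<theta> K (Z2 K)) x (Z1 x)"
      if Z1: "vector_field ?M U Z1" and Z2: "vector_field ?M U Z2" for Z1 Z2
      unfolding \<tau>_def
    proof (rule deriv_along_bounded_linear[OF bounded_linear_mult_right])
      show "(\<lambda>K. ?\<theta> K (Z2 K)) differentiable at x within ?M"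
        by (rule smooth_in_differentiable[OF U connection_form_smooth[OF DL fr Z2] x])
      show "Z1 x \<in> tangent ?M x" using Z1 x by (simp add: vector_field_def)
    qed
    from this[OF X Y] this[OF Y X] show ?thesis
      unfolding exterior_derivative_def by (simp add: \<tau>_def[of x "lie_bracket ?M X Y x"] algebra_simps)
  qed
  moreover have "exterior_derivative ?M \<tau> X Y x = 1/4 * (\<Sum>b\<in>Basis. cmetric (of_vec b) (proj01 x
    (capply (X x) (capply (Y x) (of_vec b)) - capply (Y x) (capply (X x) (of_vec b)))))"
    by (rule anticanonical_curvature[OF dim vol U x conjunct1[OF sec] span nz \<tau> \<tau>sm X Y])
  \<comment> \<open>The (0,1) trace of the commutator is minus its (1,0) trace, so half of a quarter
    of it is \<open>- 1/8\<close> of the (1,0) trace, the opposite of the quantum curvature.\<close>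
  ultimately show ?thesis
    unfolding sigma_form_eq[OF vol xM XYt]
      trace_commutator[OF xM tangent_skew_anticommuting[OF XYt(1)] tangent_skew_anticommuting[OF XYt(2)]]
    by (simp add: field_simps)
qed

theorem theorem3p2:
  fixes vol :: "'v::euclidean_space form"
    and n :: nat
    and L :: "('v \<Rightarrow>\<^sub>L 'v) \<Rightarrow> ('l \<Rightarrow> complex) set"
    and D\<^sub>L :: "('v \<Rightarrow>\<^sub>L 'v) \<Rightarrow> ('v \<Rightarrow>\<^sub>L 'v) \<Rightarrow> (('v \<Rightarrow>\<^sub>L 'v) \<Rightarrow> 'l \<Rightarrow> complex) \<Rightarrow> 'l \<Rightarrow> complex"
  assumes dim: "DIM('v) = 2 * n"
    and vol: "volume_form vol"
  shows "projectively_flat (complex_structures vol) quantum_bundle (quantum_connection vol) \<and>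
    scalar_curvature (complex_structures vol) quantum_bundle (quantum_connection vol)
      (\<lambda>J A B. sigma_form vol J A B / (2 * \<i>)) \<and>
    (square_root_bundle (complex_structures vol)
        (anticanonical_bundle n) (anticanonical_connection vol n) L D\<^sub>L \<longrightarrow>
     flat (complex_structures vol) (tensor_bundle quantum_bundle L)
       (tensor_connection (complex_structures vol) quantum_bundle (quantum_connection vol) L D\<^sub>L))"
proof (intro conjI impI)
  let ?M = "complex_structures vol"
  show sc: "scalar_curvature ?M quantum_bundle (quantum_connection vol) (\<lambda>J A B. sigma_form vol J A B / (2 * \<i>))"
    unfolding scalar_curvature_def by (intro allI impI ballI, elim conjE) (rule quantum_curvature[OF vol])
  then show "projectively_flat ?M quantum_bundle (quantum_connection vol)"
    unfolding projectively_flat_def by (rule exI[of "scalar_curvature ?M quantum_bundle (quantum_connection vol)"])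
  assume sq: "square_root_bundle ?M (anticanonical_bundle n) (anticanonical_connection vol n) L D\<^sub>L"
  then have L: "line_bundle ?M L" and DL: "connection ?M L D\<^sub>L" by (simp_all add: square_root_bundle_def)
  show "flat ?M (tensor_bundle quantum_bundle L) (tensor_connection ?M quantum_bundle (quantum_connection vol) L D\<^sub>L)"
  proof (rule tensor_flat[OF connection_quantum_connection[OF vol] quantum_subspace_bundle DL L _ sc])
    show "lie_bracket ?M X Y x \<in> tangent ?M x"
      if "openin (top_of_set ?M) U" "vector_field ?M U X" "vector_field ?M U Y" "x \<in> U" for U X Y x
      by (rule lie_bracket_tangent[OF vol that(1,4,2,3)])
    show "exterior_derivative ?M (connection_form D\<^sub>L l j) X Y x = - (sigma_form vol x (X x) (Y x) / (2 * \<i>))"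
      if "line_frame ?M U L l j" "vector_field ?M U X" "vector_field ?M U Y" "x \<in> U" for U l j X Y x
      by (rule square_root_connection_form[OF dim vol sq that])
  qed
qed

end
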